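(* Let $X=Y\setminus Z\subset\mathbb P^n$ ($n\ge2$) be a (possibly singular) quasi-projective variety, $\mathcal S$ a Whitney stratification of $Y$ with $Z$ a union of strata, $\mathcal L$ a hyperplane transverse to $\mathcal S$, and $\mathcal P$ a pencil of hyperplanes having $\mathcal L$ as a member and whose axis $\mathcal M$ is transverse to $\mathcal S$. Assume $\mathcal M\cap X\ne\emptyset$ and let $*\in\mathcal M\cap X$. Fix an index $i$ of an exceptional hyperplane $\mathcal L_i$, let $h$ be a geometric monodromy of $\mathcal L\cap X$ relative to $\mathcal M\cap X$ above the loop $\omega_i$, and let $q\ge1$ be an integer. Then the correspondence $$\mathrm{VAR}_{i,q}\colon\pi_q(\mathcal L\cap X,\mathcal M\cap X,* )\to\pi_q(\mathcal L\cap X,* ),\qquad \langle f\rangle_{\mathcal L\cap X,\mathcal M\cap X,*}\mapsto\langle f\bot(h\circ f)\rangle_{\mathcal L\cap X,*}$$ gives a well-defined map which depends only on the homotopy class $\bar\omega_i$ of $\omega_i$ in $\mathbb P^1\setminus\bigcup_j\{\lambda_j\}$ (that is, another choice of $\omega_i$ in this class and another choice of geometric monodromy above it give the same map). If $q\ge2$, it is a homomorphism.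
   Context: $Y$ is a non-empty closed algebraic subset of $\mathbb P^n$ and $Z$ a proper closed algebraic subset of $Y$. All members of $\mathcal P$ are transverse to (all strata of) $\mathcal S$ except finitely many, called exceptional hyperplanes $(\mathcal L_i)_i$ (one may also count finitely many ordinary members different from $\mathcal L$ as exceptional). Parametrize $\mathcal P$ by $\mathbb P^1$ as usual: $\mathcal P(\mu)$ is the member with parameter $\mu$, $\mathcal L=\mathcal P(\lambda)$, $\mathcal L_i=\mathcal P(\lambda_i)$. For $G\subset\mathbb P^n$, $E\subset\mathbb P^1$, put $G_E=\bigcup_{\mu\in E}G\cap\mathcal P(\mu)$. Loops. For each $i$ let $D_i\subset\mathbb P^1$ be a small closed semi-analytic disk with centre $\lambda_i$, the $D_i$ mutually disjoint, $\gamma_i\in\partial D_i$, and $\Gamma_i$ the image of a simple real-analytic arc joining $\lambda$ to $\gamma_i$, with $\Gamma_i\cap D_i=\{\gamma_i\}$, and $\Gamma_i\cap\Gamma_{i'}=\{\lambda\}$, $\Gamma_i\cap D_{i'}=\emptyset$ for $i\neq i'$. Put $K_i=\Gamma_i\cup D_i$. Let $\omega_i$ be the loop in $\partial K_i$ starting at $\lambda$, running along $\Gamma_i$ to $\gamma_i$, once counter-clockwise around $\partial D_i$, and back along $\Gamma_i$ to $\lambda$. Monodromy. For each $i$ there is an isotopy $\Theta\colon(\mathcal L\cap X)\times[0,1]\to X_{\partial K_i}$ with $\Theta(x,0)=x$, $\Theta(x,t)\in X_{\omega_i(t)}$, $x\mapsto\Theta(x,t)$ a homeomorphism $\mathcal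 L\cap X\to X_{\omega_i(t)}$ for every $t$, and $\Theta(x,t)=x$ for $x\in\mathcal M\cap X$. For any such isotopy, the homeomorphism $h=\Theta(\cdot,1)$ of $\mathcal L\cap X$ is called a geometric monodromy of $\mathcal L\cap X$ relative to $\mathcal M\cap X$ above $\omega_i$; it fixes $\mathcal M\cap X$ pointwise. Homotopy cells. Let $I=[0,1]$. For a pointed pair $(A,B,* )$, $*\in B$, $F^q(A,B,* )$ is the set of maps $I^q\to A$ sending the face $x_q=0$ into $B$ and all other faces to $*$, and $F^q(A,* )$ the set of maps $I^q\to A$ sending $\partial I^q$ to $*$; $\langle f\rangle_{A,B,*}\in\pi_q(A,B,* )$ and $\langle f\rangle_{A,*}\in\pi_q(A,* )$ denote homotopy classes. For $f\in F^q(\mathcal L\cap X,\mathcal M\cap X,* )$, $f\bot(h\circ f)\in F^q(\mathcal L\cap X,* )$ is the map equal to $f(x_1,\dots,x_{q-1},1-2x_q)$ if $0\le x_q\le\frac12$ and to $h\circ f(x_1,\dots,x_{q-1},2x_q-1)$ if $\frac12\le x_q\le1$. *)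

theory Defs
  imports "HOL-Complex_Analysis.Complex_Analysis" "HOL-Library.Disjoint_Sets" "HOL-Algebra.Group"
begin

section \<open>Complex projective space\<close>

text \<open>Points are the complex lines through the origin of \<open>complex^'n\<close>, so that
  \<open>'n cproj\<close> is projective space of dimension \<open>CARD('n) - 1\<close>; \<open>2 cproj\<close> is the projective line.\<close>

typedef (overloaded) ('n::finite) cproj = "{l. \<exists>v::complex^'n. v \<noteq> 0 \<and> l = vec.span {v}}"
  morphisms line Line
proof -
  have "(1 :: complex^'n) \<noteq> 0"
    by (simp add: vec_eq_iff)
  then show ?thesis by blast
qed

text \<open>Only meaningful for \<open>v \<noteq> 0\<close>.\<close>

definition proj :: "complex^'n::finite \<Rightarrow> 'n cproj" where
  "proj v = Line (vec.span {v})"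

text \<open>The quotient topology.\<close>

instantiation cproj :: (finite) topological_space
begin

definition open_cproj :: "'a cproj set \<Rightarrow> bool" where
  "open_cproj U \<longleftrightarrow> open {v. v \<noteq> 0 \<and> proj v \<in> U}"

instance
proof
  show "open (UNIV :: 'a cproj set)"
    using open_Compl[OF closed_singleton, of 0] by (simp add: open_cproj_def Compl_eq)
next
  fix S T :: "'a cproj set" assume "open S" "open T"
  then have "open ({v. v \<noteq> 0 \<and> proj v \<in> S} \<inter> {v. v \<noteq> 0 \<and> proj v \<in> T})"
    unfolding open_cproj_def by (rule open_Int)
  also have "{v. v \<noteq> 0 \<and> proj v \<in> S} \<inter> {v. v \<noteq> 0 \<and> proj v \<in> T} = {v. v \<noteq> 0 \<and> proj v \<in> S \<inter> T}"
    by blast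
  finally show "open (S \<inter> T)"
    unfolding open_cproj_def .
next
  fix K :: "'a cproj set set" assume "\<forall>S\<in>K. open S"
  then have "open (\<Union>S\<in>K. {v. v \<noteq> 0 \<and> proj v \<in> S})"
    unfolding open_cproj_def by (intro open_UN)
  also have "(\<Union>S\<in>K. {v. v \<noteq> 0 \<and> proj v \<in> S}) = {v. v \<noteq> 0 \<and> proj v \<in> \<Union>K}"
    by blast
  finally show "open (\<Union>K)"
    unfolding open_cproj_def .
qed

end

definition homogeneous_form :: "nat \<Rightarrow> (complex^'n::finite \<Rightarrow> complex) \<Rightarrow> bool" where
  "homogeneous_form d f \<longleftrightarrow>
     (\<exists>(A :: ('n \<Rightarrow> nat) set) c. finite A \<and> (\<forall>\<alpha>\<in>A. (\<Sum>i\<in>UNIV. \<alpha> i) = d) \<and>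
        f = (\<lambda>v. \<Sum>\<alpha>\<in>A. c \<alpha> * (\<Prod>i\<in>UNIV. (v $ i) ^ \<alpha> i)))"

definition closed_algebraic :: "'n::finite cproj set \<Rightarrow> bool" where
  "closed_algebraic V \<longleftrightarrow>
     (\<exists>F. finite F \<and> (\<forall>f\<in>F. \<exists>d. homogeneous_form d f) \<and>
        V = {p. \<forall>f\<in>F. \<forall>v\<in>line p. f v = 0})"

text \<open>The part of \<open>A\<close> in the standard chart \<open>v$k \<noteq> 0\<close>, read in that chart. The chart
  \<open>v \<mapsto> v / v$k\<close> takes its values in the affine hyperplane \<open>w$k = 1\<close>, whose direction is \<open>w$k = 0\<close>.\<close>

definition affine_part :: "'n::finite \<Rightarrow> 'n cproj set \<Rightarrow> (complex^'n) set" where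
  "affine_part k A = {w. w $ k = 1 \<and> proj w \<in> A}"


section \<open>Complex submanifolds, Whitney stratifications, transversality\<close>

definition holomorphic_map_on :: "(complex^'n::finite) set \<Rightarrow> (complex^'n \<Rightarrow> complex^'n) \<Rightarrow> bool" where
  "holomorphic_map_on U f \<longleftrightarrow>
     (\<forall>x\<in>U. \<exists>f'. (f has_derivative f') (at x) \<and> Vector_Spaces.linear (*s) (*s) f')"

definition complex_submanifold :: "nat \<Rightarrow> (complex^'n::finite) set \<Rightarrow> bool" where
  "complex_submanifold d M \<longleftrightarrow>
     (\<forall>p\<in>M. \<exists>U V f g W. open U \<and> open V \<and> p \<in> U \<and> homeomorphism U V f g \<and>
        holomorphic_map_on U f \<and> holomorphic_map_on V g \<and>
        vec.subspace W \<and> vec.dim W = d \<and> f ` (M \<inter> U) = W \<inter> V)"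

definition tangent_space :: "(complex^'n::finite) set \<Rightarrow> complex^'n \<Rightarrow> (complex^'n) set" where
  "tangent_space M p =
     {v. \<exists>c :: real \<Rightarrow> complex^'n. c 0 = p \<and> (\<forall>t. c t \<in> M) \<and> (c has_vector_derivative v) (at 0)}"

text \<open>Convergence in the Grassmannian: a basis of the limit is the limit of bases of the \<open>T m\<close>.\<close>

definition grassmann_tendsto :: "(nat \<Rightarrow> (complex^'n::finite) set) \<Rightarrow> (complex^'n) set \<Rightarrow> bool" where
  "grassmann_tendsto T \<tau> \<longleftrightarrow>
     (\<forall>m. vec.subspace (T m) \<and> vec.dim (T m) = vec.dim \<tau>) \<and> vec.subspace \<tau> \<and>
     (\<forall>v\<in>\<tau>. \<exists>u. (\<forall>m. u m \<in> T m) \<and> u \<longlonglongrightarrow> v)"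

definition whitney_a :: "(complex^'n::finite) set \<Rightarrow> (complex^'n) set \<Rightarrow> bool" where
  "whitney_a R S \<longleftrightarrow>
     (\<forall>p x \<tau>. p \<in> S \<and> (\<forall>m. x m \<in> R) \<and> x \<longlonglongrightarrow> p \<and>
        grassmann_tendsto (\<lambda>m. tangent_space R (x m)) \<tau> \<longrightarrow> tangent_space S p \<subseteq> \<tau>)"

definition whitney_b :: "(complex^'n::finite) set \<Rightarrow> (complex^'n) set \<Rightarrow> bool" where
  "whitney_b R S \<longleftrightarrow>
     (\<forall>p x y \<tau> l. p \<in> S \<and> (\<forall>m. x m \<in> R \<and> y m \<in> S \<and> x m \<noteq> y m) \<and> x \<longlonglongrightarrow> p \<and> y \<longlonglongrightarrow> p \<and>
        grassmann_tendsto (\<lambda>m. tangent_space R (x m)) \<tau> \<and>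
        grassmann_tendsto (\<lambda>m. vec.span {x m - y m}) l \<longrightarrow> l \<subseteq> \<tau>)"

text \<open>Strata need not be connected. By Chow's theorem, asking that the closure and the boundary of
  each stratum be algebraic is the same as asking that they be analytic.\<close>

definition whitney_stratification :: "'n::finite cproj set \<Rightarrow> 'n cproj set set \<Rightarrow> bool" where
  "whitney_stratification Y \<S> \<longleftrightarrow>
     finite \<S> \<and> partition_on Y \<S> \<and>
     (\<forall>S\<in>\<S>. closed_algebraic (closure S) \<and> closed_algebraic (closure S - S) \<and>
        (\<exists>d. \<forall>k. complex_submanifold d (affine_part k S))) \<and>
     (\<forall>R\<in>\<S>. \<forall>S\<in>\<S>. S \<inter> closure R \<noteq> {} \<longrightarrow> S \<subseteq> closure R) \<and>
     (\<forall>R\<in>\<S>. \<forall>S\<in>\<S>. R \<noteq> S \<longrightarrow>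
        (\<forall>k. whitney_a (affine_part k R) (affine_part k S) \<and>
             whitney_b (affine_part k R) (affine_part k S)))"

definition transverse :: "'n::finite cproj set \<Rightarrow> 'n cproj set \<Rightarrow> bool" where
  "transverse A B \<longleftrightarrow>
     (\<forall>k. \<forall>w \<in> affine_part k A \<inter> affine_part k B.
        {u + v | u v. u \<in> tangent_space (affine_part k A) w \<and> v \<in> tangent_space (affine_part k B) w}
        = {u. u $ k = 0})"

definition transverse_to_strata :: "'n::finite cproj set \<Rightarrow> 'n cproj set set \<Rightarrow> bool" where
  "transverse_to_strata A \<S> \<longleftrightarrow> (\<forall>S\<in>\<S>. transverse A S)"


section \<open>Pencils of hyperplanes\<close>

definition hyperplane :: "complex^'n::finite \<Rightarrow> 'n cproj set" where
  "hyperplane a = {p. \<forall>v\<in>line p. (\<Sum>i\<in>UNIV. a $ i * v $ i) = 0}"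

text \<open>The member with parameter \<open>(s : t)\<close> of the pencil spanned by the hyperplanes of the
  (linearly independent) forms \<open>a\<close> and \<open>b\<close> is the hyperplane of the form \<open>s a + t b\<close>.\<close>

definition pencil :: "complex^'n::finite \<Rightarrow> complex^'n \<Rightarrow> 2 cproj \<Rightarrow> 'n cproj set" where
  "pencil a b \<mu> = {p. \<forall>s\<in>line \<mu>. p \<in> hyperplane (s $ 1 *s a + s $ 2 *s b)}"

definition pencil_axis :: "complex^'n::finite \<Rightarrow> complex^'n \<Rightarrow> 'n cproj set" where
  "pencil_axis a b = hyperplane a \<inter> hyperplane b"

definition over :: "complex^'n::finite \<Rightarrow> complex^'n \<Rightarrow> 'n cproj set \<Rightarrow> 2 cproj set \<Rightarrow> 'n cproj set" where
  "over a b G E = (\<Union>\<mu>\<in>E. G \<inter> pencil a b \<mu>)"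


section \<open>Loops around the exceptional parameters\<close>

text \<open>Affine coordinates on the projective line; \<open>proj v\<close> is the omitted point.\<close>

definition affine_coordinate :: "(complex \<Rightarrow> 2 cproj) \<Rightarrow> bool" where
  "affine_coordinate \<phi> \<longleftrightarrow>
     (\<exists>u v. u \<noteq> v \<and> vec.independent {u, v} \<and> \<phi> = (\<lambda>z. proj (u + z *s v)))"

definition real_analytic_on :: "complex set \<Rightarrow> (complex \<Rightarrow> real) \<Rightarrow> bool" where
  "real_analytic_on U f \<longleftrightarrow>
     (\<forall>z0\<in>U. \<exists>(c :: nat \<Rightarrow> nat \<Rightarrow> real) r. r > 0 \<and>
        (\<forall>z\<in>ball z0 r. ((\<lambda>(j, k). c j k * Re (z - z0) ^ j * Im (z - z0) ^ k) has_sum f z) UNIV))"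

definition semianalytic :: "2 cproj set \<Rightarrow> bool" where
  "semianalytic A \<longleftrightarrow>
     (\<forall>\<phi> z0. affine_coordinate \<phi> \<longrightarrow>
        (\<exists>r>0. \<exists>\<B>. finite \<B> \<and>
           (\<forall>(F, G)\<in>\<B>. finite F \<and> finite G \<and> (\<forall>f \<in> F \<union> G. real_analytic_on (ball z0 r) f)) \<and>
           \<phi> -` A \<inter> ball z0 r =
             (\<Union>(F, G)\<in>\<B>. {z \<in> ball z0 r. (\<forall>f\<in>F. f z = 0) \<and> (\<forall>g\<in>G. g z > 0)})))"

definition semianalytic_disk :: "2 cproj \<Rightarrow> 2 cproj set \<Rightarrow> bool" where
  "semianalytic_disk \<nu> D \<longleftrightarrow>
     semianalytic D \<and> (\<exists>f g. homeomorphism (cball (0::complex) 1) D f g \<and> f 0 = \<nu>)"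

definition real_analytic_path :: "(real \<Rightarrow> 2 cproj) \<Rightarrow> bool" where
  "real_analytic_path c \<longleftrightarrow>
     (\<forall>t\<in>{0..1}. \<exists>\<phi> (a :: nat \<Rightarrow> complex) r. affine_coordinate \<phi> \<and> r > 0 \<and>
        (\<forall>s\<in>{0..1}. \<bar>s - t\<bar> < r \<longrightarrow>
           (\<exists>z. (\<lambda>k. a k * of_real (s - t) ^ k) sums z \<and> c s = \<phi> z)))"

definition analytic_arc :: "2 cproj \<Rightarrow> 2 cproj \<Rightarrow> 2 cproj set \<Rightarrow> bool" where
  "analytic_arc x y \<Gamma> \<longleftrightarrow>
     (\<exists>c. arc c \<and> real_analytic_path c \<and> pathstart c = x \<and> pathfinish c = y \<and> path_image c = \<Gamma>)"

text \<open>The disks, base points on their boundaries, and arcs are indexed by the exceptional parameters.\<close>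

definition loop_system ::
  "2 cproj set \<Rightarrow> 2 cproj \<Rightarrow> (2 cproj \<Rightarrow> 2 cproj set) \<Rightarrow> (2 cproj \<Rightarrow> 2 cproj) \<Rightarrow> (2 cproj \<Rightarrow> 2 cproj set) \<Rightarrow> bool"
where
  "loop_system \<Lambda> \<mu>\<^sub>0 D \<gamma> \<Gamma> \<longleftrightarrow>
     (\<forall>i\<in>\<Lambda>. semianalytic_disk i (D i) \<and> \<gamma> i \<in> frontier (D i) \<and>
        analytic_arc \<mu>\<^sub>0 (\<gamma> i) (\<Gamma> i) \<and> \<Gamma> i \<inter> D i = {\<gamma> i}) \<and>
     (\<forall>i\<in>\<Lambda>. \<forall>j\<in>\<Lambda>. i \<noteq> j \<longrightarrow> D i \<inter> D j = {} \<and> \<Gamma> i \<inter> \<Gamma> j = {\<mu>\<^sub>0} \<and> \<Gamma> i \<inter> D j = {})"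

text \<open>On \<open>[s, t]\<close> the path \<open>\<omega>\<close> runs once counter-clockwise around the centre \<open>\<nu>\<close> of \<open>D\<close>: the
  winding number is computed in an affine coordinate centred at \<open>\<nu>\<close> and covering \<open>D\<close>.\<close>

definition counterclockwise :: "2 cproj \<Rightarrow> 2 cproj set \<Rightarrow> real \<Rightarrow> real \<Rightarrow> (real \<Rightarrow> 2 cproj) \<Rightarrow> bool" where
  "counterclockwise \<nu> D s t \<omega> \<longleftrightarrow>
     (\<exists>\<phi> p. affine_coordinate \<phi> \<and> \<phi> 0 = \<nu> \<and> D \<subseteq> range \<phi> \<and> path p \<and>
        (\<forall>r\<in>{0..1}. \<omega> (s + r * (t - s)) = \<phi> (p r)) \<and> winding_number p 0 = 1)"

text \<open>\<open>\<omega>\<close> runs along \<open>\<Gamma>\<close> from \<open>\<mu>\<^sub>0\<close> to \<open>\<gamma>\<close>, then once counter-clockwise around the boundary of the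
  disk \<open>D\<close> with centre \<open>\<nu>\<close>, then back along \<open>\<Gamma>\<close>; its parametrization is not prescribed.\<close>

definition loop_around ::
  "2 cproj \<Rightarrow> 2 cproj \<Rightarrow> 2 cproj set \<Rightarrow> 2 cproj \<Rightarrow> 2 cproj set \<Rightarrow> (real \<Rightarrow> 2 cproj) \<Rightarrow> bool"
where
  "loop_around \<mu>\<^sub>0 \<nu> D \<gamma> \<Gamma> \<omega> \<longleftrightarrow>
     path \<omega> \<and>
     (\<exists>s t. 0 < s \<and> s < t \<and> t < 1 \<and>
        \<omega> 0 = \<mu>\<^sub>0 \<and> \<omega> s = \<gamma> \<and> \<omega> t = \<gamma> \<and> \<omega> 1 = \<mu>\<^sub>0 \<and>
        inj_on \<omega> {0..s} \<and> \<omega> ` {0..s} = \<Gamma> \<and>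
        inj_on \<omega> {s..<t} \<and> \<omega> ` {s..t} = frontier D \<and> counterclockwise \<nu> D s t \<omega> \<and>
        inj_on \<omega> {t..1} \<and> \<omega> ` {t..1} = \<Gamma>)"


section \<open>Geometric monodromy\<close>

text \<open>Only the values of \<open>h\<close> on \<open>pencil a b (\<omega> 0) \<inter> X\<close> are specified; \<open>K\<close> is the union of the arc
  and of the disk.\<close>

definition geometric_monodromy ::
  "complex^'n::finite \<Rightarrow> complex^'n \<Rightarrow> 'n cproj set \<Rightarrow> 2 cproj set \<Rightarrow> (real \<Rightarrow> 2 cproj) \<Rightarrow>
   ('n cproj \<Rightarrow> 'n cproj) \<Rightarrow> bool"
where
  "geometric_monodromy a b X K \<omega> h \<longleftrightarrow>
     (let LX = pencil a b (\<omega> 0) \<inter> X; MX = pencil_axis a b \<inter> X in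
      \<exists>\<Theta> :: 'n cproj \<Rightarrow> real \<Rightarrow> 'n cproj.
        continuous_on (LX \<times> {0..1}) (\<lambda>(x, t). \<Theta> x t) \<and>
        (\<forall>x\<in>LX. \<forall>t\<in>{0..1}. \<Theta> x t \<in> over a b X (frontier K)) \<and>
        (\<forall>x\<in>LX. \<Theta> x 0 = x) \<and>
        (\<forall>t\<in>{0..1}. \<exists>g. homeomorphism LX (over a b X {\<omega> t}) (\<lambda>x. \<Theta> x t) g) \<and>
        (\<forall>x\<in>MX. \<forall>t\<in>{0..1}. \<Theta> x t = x) \<and>
        (\<forall>x\<in>LX. h x = \<Theta> x 1))"


section \<open>Homotopy groups\<close>

definition cube :: "nat \<Rightarrow> (nat \<Rightarrow> real) set" where
  "cube q = {x. (\<forall>i\<in>{1..q}. 0 \<le> x i \<and> x i \<le> 1) \<and> (\<forall>i. i \<notin> {1..q} \<longrightarrow> x i = 0)}"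

definition rel_cells :: "nat \<Rightarrow> 'a::topological_space set \<Rightarrow> 'a set \<Rightarrow> 'a \<Rightarrow> ((nat \<Rightarrow> real) \<Rightarrow> 'a) set" where
  "rel_cells q A B p =
     {f. continuous_on (cube q) f \<and> f ` cube q \<subseteq> A \<and>
         (\<forall>x\<in>cube q. x q = 0 \<longrightarrow> f x \<in> B) \<and>
         (\<forall>x\<in>cube q. x q = 1 \<or> (\<exists>i\<in>{1..<q}. x i = 0 \<or> x i = 1) \<longrightarrow> f x = p)}"

definition cells :: "nat \<Rightarrow> 'a::topological_space set \<Rightarrow> 'a \<Rightarrow> ((nat \<Rightarrow> real) \<Rightarrow> 'a) set" where
  "cells q A p =
     {f. continuous_on (cube q) f \<and> f ` cube q \<subseteq> A \<and>
         (\<forall>x\<in>cube q. (\<exists>i\<in>{1..q}. x i = 0 \<or> x i = 1) \<longrightarrow> f x = p)}"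

definition rel_class ::
  "nat \<Rightarrow> 'a::topological_space set \<Rightarrow> 'a set \<Rightarrow> 'a \<Rightarrow> ((nat \<Rightarrow> real) \<Rightarrow> 'a) \<Rightarrow> ((nat \<Rightarrow> real) \<Rightarrow> 'a) set"
where
  "rel_class q A B p f =
     {g. homotopic_with_canon (\<lambda>k. k \<in> rel_cells q A B p) (cube q) A f g}"

definition abs_class ::
  "nat \<Rightarrow> 'a::topological_space set \<Rightarrow> 'a \<Rightarrow> ((nat \<Rightarrow> real) \<Rightarrow> 'a) \<Rightarrow> ((nat \<Rightarrow> real) \<Rightarrow> 'a) set"
where
  "abs_class q A p f = {g. homotopic_with_canon (\<lambda>k. k \<in> cells q A p) (cube q) A f g}"

definition concat1 :: "((nat \<Rightarrow> real) \<Rightarrow> 'a) \<Rightarrow> ((nat \<Rightarrow> real) \<Rightarrow> 'a) \<Rightarrow> (nat \<Rightarrow> real) \<Rightarrow> 'a" where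
  "concat1 f g = (\<lambda>x. if x 1 \<le> 1/2 then f (x(1 := 2 * x 1)) else g (x(1 := 2 * x 1 - 1)))"

text \<open>For \<open>q = 1\<close> only the carrier of the relative record is meaningful.\<close>

definition rel_homotopy_group ::
  "nat \<Rightarrow> 'a::topological_space set \<Rightarrow> 'a set \<Rightarrow> 'a \<Rightarrow> ((nat \<Rightarrow> real) \<Rightarrow> 'a) set monoid"
where
  "rel_homotopy_group q A B p =
     \<lparr>carrier = rel_class q A B p ` rel_cells q A B p,
      mult = (\<lambda>\<alpha> \<beta>. \<Union>f\<in>\<alpha>. \<Union>g\<in>\<beta>. rel_class q A B p (concat1 f g)),
      one = rel_class q A B p (\<lambda>_. p)\<rparr>"

definition homotopy_group ::
  "nat \<Rightarrow> 'a::topological_space set \<Rightarrow> 'a \<Rightarrow> ((nat \<Rightarrow> real) \<Rightarrow> 'a) set monoid"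
where
  "homotopy_group q A p =
     \<lparr>carrier = abs_class q A p ` cells q A p,
      mult = (\<lambda>\<alpha> \<beta>. \<Union>f\<in>\<alpha>. \<Union>g\<in>\<beta>. abs_class q A p (concat1 f g)),
      one = abs_class q A p (\<lambda>_. p)\<rparr>"


section \<open>Variation\<close>

definition perp :: "nat \<Rightarrow> ((nat \<Rightarrow> real) \<Rightarrow> 'a) \<Rightarrow> ((nat \<Rightarrow> real) \<Rightarrow> 'a) \<Rightarrow> (nat \<Rightarrow> real) \<Rightarrow> 'a" where
  "perp q f g = (\<lambda>x. if x q \<le> 1/2 then f (x(q := 1 - 2 * x q)) else g (x(q := 2 * x q - 1)))"

text \<open>\<open>V\<close> is a map realizing the correspondence \<open>\<langle>f\<rangle> \<mapsto> \<langle>f \<bottom> (h \<circ> f)\<rangle>\<close>.\<close>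

definition is_variation ::
  "nat \<Rightarrow> 'a::topological_space set \<Rightarrow> 'a set \<Rightarrow> 'a \<Rightarrow> ('a \<Rightarrow> 'a) \<Rightarrow>
   (((nat \<Rightarrow> real) \<Rightarrow> 'a) set \<Rightarrow> ((nat \<Rightarrow> real) \<Rightarrow> 'a) set) \<Rightarrow> bool"
where
  "is_variation q A B p h V \<longleftrightarrow>
     V \<in> carrier (rel_homotopy_group q A B p) \<rightarrow>\<^sub>E carrier (homotopy_group q A p) \<and>
     (\<forall>f \<in> rel_cells q A B p.
        perp q f (h \<circ> f) \<in> cells q A p \<and>
        V (rel_class q A B p f) = abs_class q A p (perp q f (h \<circ> f)))"

end

theory Submission
  imports Defs
begin

text \<open>Outside the exceptional parameters, the part of the pencil over a small disk of parameters is
  trivialized by a flow on the cone over \<open>Y\<close> that preserves the strata and fixes the axis. By Whitney's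
  condition (b), a transverse vector field can be lifted to a continuous field, locally Lipschitz on each stratum, whose
  component normal to a stratum is quadratically small in the distance to it; this replaces Thom's isotopy theorem
  and needs no tubular neighbourhoods. Transport along paths then yields a homotopy from \<open>h \<circ> f\<close> to \<open>h' \<circ> f\<close> which is
  constant where \<open>f\<close> takes values in the axis. Points are transported in the cone, where
  normal directions and distances are those of a Hermitian vector space, rather than in projective space.\<close>

text \<open>The two monodromies to be compared come with arbitrary isotopies, tied to no common
  connection, so both are compared with a third transport that depends on neither. For homotopy
  classes of cells a homotopy of maps from a cube is enough: transport maps have to be continuous,
  but neither injective nor compatible under composition, and compactness of the cube stands in for
  compactness of X, which may fail. Everything can then be made local in the parameter.
  Singularities of Y are met by working on a closed set with a field that is only continuous there.
  Existence of solutions then rests on tangency alone, while uniqueness and invariance of strata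
  come from control. Since Z is a union of strata, a flow on the closed cone over Y that preserves
  each stratum also preserves the cone over X, and no boundary behaviour at Z has to be studied.
  Well-definedness and additivity use of \<open>h\<close> only that it is a continuous self-map of
  \<open>L \<inter> X\<close> fixing \<open>M \<inter> X\<close> pointwise.\<close>

no_notation fps_nth (infixl "$" 75)

section \<open>Differential inequalities\<close>

text \<open>The hypothesis is a one-sided estimate because the lemma is meant for squared distances
  to a set, which need not be differentiable. For every e > 0 the function stays below an
  exponential that starts at e, and e is arbitrary.\<close>

lemma dini_gronwall_zero:
  fixes f :: "real \<Rightarrow> real"
  assumes cont: "continuous_on {a..b} f" and fa: "f a = 0" and f0: "\<And>t. t \<in> {a..b} \<Longrightarrow> f t \<ge> 0"
    and dini: "\<And>t e. t \<in> {a..<b} \<Longrightarrow> e > 0 \<Longrightarrow>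
      \<exists>d>0. \<forall>h. 0 < h \<and> h < d \<and> t + h \<le> b \<longrightarrow> f (t + h) \<le> f t + (C * f t + e) * h"
    and t: "t \<in> {a..b}"
  shows "f t = 0"
proof -
  define D where "D = \<bar>C\<bar> + 1"
  have D: "D \<ge> C + 1" "D > 0" by (auto simp: D_def)
  have le: "f t \<le> e * exp (D * (t - a))" if e: "e > 0" for e
  proof -
    define g where "g = (\<lambda>t. e * exp (D * (t - a)))"
    have gpos: "g t > 0" for t using e by (simp add: g_def)
    have contg: "continuous_on {a..b} g" unfolding g_def by (intro continuous_intros)
    define A where "A = {s \<in> {a..b}. \<forall>r\<in>{a..s}. f r \<le> g r}"
    have aA: "a \<in> A" using t fa gpos[of a] by (auto simp: A_def)
    have bdd: "bdd_above A" by (rule bdd_aboveI[of _ b]) (auto simp: A_def)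
    define s where "s = Sup A"
    have "s \<le> b" unfolding s_def by (rule cSup_least) (use aA in \<open>auto simp: A_def\<close>)
    moreover have "a \<le> s" unfolding s_def by (rule cSup_upper[OF aA bdd])
    ultimately have sab: "a \<le> s" "s \<le> b" by auto
    have below: "f r \<le> g r" if r: "a \<le> r" "r < s" for r
    proof -
      obtain x where "x \<in> A" "r < x" using less_cSup_iff[of A r] aA bdd r by (auto simp: s_def)
      then show ?thesis using r by (auto simp: A_def)
    qed
    have fs: "f s \<le> g s"
    proof (cases "s = a")
      case True then show ?thesis using aA by (auto simp: A_def)
    next
      case False
      then have as: "a < s" using sab by simp
      have "continuous_on {a..s} (\<lambda>r. g r - f r)"
        using sab by (intro continuous_intros continuous_on_subset[OF cont] continuous_on_subset[OF contg]) auto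
      then have "((\<lambda>r. g r - f r) \<longlongrightarrow> g s - f s) (at s within {a..s})"
        using sab by (auto simp: continuous_on)
      moreover have "eventually (\<lambda>r. 0 \<le> g r - f r) (at s within {a..s})"
        unfolding eventually_at_filter using below by (auto intro!: always_eventually)
      moreover have "at s within {a..s} \<noteq> bot"
        using as by (simp add: at_within_Icc_at_left trivial_limit_at_left_real)
      ultimately have "0 \<le> g s - f s" by (intro tendsto_lowerbound)
      then show ?thesis by simp
    qed
    have "s = b"
    proof (rule ccontr)
      assume "s \<noteq> b"
      then have sb: "s < b" using sab by simp
      \<comment> \<open>The admissible error is taken to be \<open>g s\<close>, which is positive; C
        * f s + g s \<le> D * g s is what the summand 1 in D is for. Then 1 + D * h \<le> exp (D *
        h) carries the bound past s, against the choice of s as a supremum.\<close>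
      obtain d where d: "d > 0" "\<And>h. 0 < h \<Longrightarrow> h < d \<Longrightarrow> s + h \<le> b \<Longrightarrow> f (s + h) \<le> f s + (C * f s + g s) * h"
        using dini[of s "g s"] sab sb gpos by fastforce
      define r where "r = min (s + d/2) b"
      have r: "s < r" "r \<le> b" using sb d by (auto simp: r_def)
      have "f x \<le> g x" if x: "x \<in> {a..r}" for x
      proof (cases "x \<le> s")
        case True then show ?thesis using below[of x] fs x by (cases "x = s") auto
      next
        case False
        define h where "h = x - s"
        have h: "0 < h" "h < d" "s + h \<le> b" "x = s + h" using False x d r by (auto simp: h_def r_def)
        have "C * f s \<le> \<bar>C\<bar> * f s" using f0[of s] sab by (intro mult_right_mono) auto
        also have "\<dots> \<le> \<bar>C\<bar> * g s" using fs by (intro mult_left_mono) auto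
        finally have "C * f s + g s \<le> D * g s" by (simp add: D_def algebra_simps)
        then have "(C * f s + g s) * h \<le> D * g s * h" using h by (intro mult_right_mono) auto
        with d(2)[OF h(1-3)] fs h have "f x \<le> g s * (1 + D * h)" by (simp add: algebra_simps)
        also have "\<dots> \<le> g s * exp (D * h)" using gpos[of s] exp_ge_add_one_self[of "D*h"] by (intro mult_left_mono) auto
        also have "\<dots> = g x" by (simp add: g_def h(4) algebra_simps flip: exp_add)
        finally show ?thesis .
      qed
      then have "r \<in> A" using r sab by (auto simp: A_def)
      then have "r \<le> s" using cSup_upper[OF _ bdd] by (simp add: s_def)
      with r show False by simp
    qed
    then show ?thesis using below[of t] fs t by (cases "t = b") (auto simp: g_def)
  qed
  have "f t \<le> 0"
  proof (rule ccontr)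
    assume "\<not> f t \<le> 0"
    then have "f t > 0" by simp
    then have "f t \<le> f t / 2" using le[of "f t / (2 * exp (D * (t - a)))"] by simp
    with \<open>f t > 0\<close> show False by simp
  qed
  with f0[OF t] show ?thesis by simp
qed

text \<open>Backward in time the estimate has the same form, since it is stated with |s - t|; so the
  previous lemma is applied to f and to its reflection.\<close>

lemma dini_gronwall_vanish:
  fixes f :: "real \<Rightarrow> real"
  assumes cont: "continuous_on {a..b} f" and c: "c \<in> {a..b}" "f c = 0" and f0: "\<And>t. t \<in> {a..b} \<Longrightarrow> f t \<ge> 0"
    and dini: "\<And>t e. t \<in> {a..b} \<Longrightarrow> e > 0 \<Longrightarrow>
      \<exists>d>0. \<forall>s\<in>{a..b}. \<bar>s - t\<bar> < d \<longrightarrow> f s \<le> f t + (C * f t + e) * \<bar>s - t\<bar>"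
    and t: "t \<in> {a..b}"
  shows "f t = 0"
proof (cases "c \<le> t")
  case True
  show ?thesis
  proof (rule dini_gronwall_zero[of c b f C])
    show "continuous_on {c..b} f" using c by (intro continuous_on_subset[OF cont]) auto
    fix t e :: real assume te: "t \<in> {c..<b}" "e > 0"
    then obtain d where d: "d > 0" "\<forall>s\<in>{a..b}. \<bar>s - t\<bar> < d \<longrightarrow> f s \<le> f t + (C * f t + e) * \<bar>s - t\<bar>"
      using dini[of t e] c by auto
    have "f (t + h) \<le> f t + (C * f t + e) * h" if "0 < h" "h < d" "t + h \<le> b" for h
      using d(2)[rule_format, of "t + h"] that te c by auto
    with d(1) show "\<exists>d>0. \<forall>h. 0 < h \<and> h < d \<and> t + h \<le> b \<longrightarrow> f (t + h) \<le> f t + (C * f t + e) * h"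
      by blast
  qed (use c f0 t True in auto)
next
  case False
  have "(\<lambda>x. f (-x)) (- t) = 0"
  proof (rule dini_gronwall_zero[of "-c" "-a" "\<lambda>x. f (-x)" C "-t"])
    show "continuous_on {-c..-a} (\<lambda>x. f (- x))"
      using c by (intro continuous_on_compose2[OF cont] continuous_intros) auto
    fix t e :: real assume te: "t \<in> {-c..<-a}" "e > 0"
    then obtain d where d: "d > 0" "\<forall>s\<in>{a..b}. \<bar>s - -t\<bar> < d \<longrightarrow> f s \<le> f (-t) + (C * f (-t) + e) * \<bar>s - -t\<bar>"
      using dini[of "-t" e] c by auto
    have "f (- (t + h)) \<le> f (- t) + (C * f (- t) + e) * h" if "0 < h" "h < d" "t + h \<le> -a" for h
      using d(2)[rule_format, of "- (t + h)"] that te c by auto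
    with d(1) show "\<exists>d>0. \<forall>h. 0 < h \<and> h < d \<and> t + h \<le> -a \<longrightarrow> f (-(t + h)) \<le> f (-t) + (C * f (-t) + e) * h"
      by blast
  qed (use c f0 t False in auto)
  then show ?thesis by simp
qed

text \<open>The squared norm is differentiable and satisfies the inequality with constant 2 * C by
  Cauchy-Schwarz.\<close>

lemma gronwall_diff_vanish:
  fixes y :: "real \<Rightarrow> 'e::real_inner"
  assumes y: "\<And>t. t \<in> {a..b} \<Longrightarrow> (y has_vector_derivative y' t) (at t within {a..b})"
    and bd: "\<And>t. t \<in> {a..b} \<Longrightarrow> norm (y' t) \<le> C * norm (y t)"
    and c: "c \<in> {a..b}" "y c = 0" and t: "t \<in> {a..b}"
  shows "y t = 0"
proof -
  define f where "f = (\<lambda>t. (norm (y t))\<^sup>2)"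
  have "f t = 0"
  proof (rule dini_gronwall_vanish[of a b f c "2 * C"])
    have "continuous_on {a..b} y"
      using y by (intro continuous_on_vector_derivative) auto
    then show "continuous_on {a..b} f" unfolding f_def by (intro continuous_intros)
    fix t e :: real assume t: "t \<in> {a..b}" and e: "e > 0"
    have eq: "(\<lambda>t. (norm (y t))\<^sup>2) = (\<lambda>t. y t \<bullet> y t)" by (simp add: power2_norm_eq_inner)
    have "((\<lambda>t. (norm (y t))\<^sup>2) has_derivative (\<lambda>h. h * (2 * (y t \<bullet> y' t)))) (at t within {a..b})"
      unfolding eq using y[OF t] unfolding has_vector_derivative_def
      by (auto intro!: derivative_eq_intros simp: inner_commute algebra_simps)
    then obtain d where d: "d > 0" "\<And>s. s \<in> {a..b} \<Longrightarrow> \<bar>s - t\<bar> < d \<Longrightarrow>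
       \<bar>(norm (y s))\<^sup>2 - (norm (y t))\<^sup>2 - (s - t) * (2 * (y t \<bullet> y' t))\<bar> \<le> e * \<bar>s - t\<bar>"
      using e unfolding has_derivative_within_alt by (auto simp: real_norm_def dest!: spec[of _ e])
    have "\<bar>y t \<bullet> y' t\<bar> \<le> norm (y t) * norm (y' t)" by (rule Cauchy_Schwarz_ineq2)
    also have "\<dots> \<le> norm (y t) * (C * norm (y t))" using bd[OF t] by (intro mult_left_mono) auto
    finally have b: "\<bar>y t \<bullet> y' t\<bar> \<le> C * (norm (y t))\<^sup>2" by (simp add: power2_eq_square algebra_simps)
    show "\<exists>d>0. \<forall>s\<in>{a..b}. \<bar>s - t\<bar> < d \<longrightarrow> f s \<le> f t + (2 * C * f t + e) * \<bar>s - t\<bar>"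
    proof (intro exI[of _ d] conjI ballI impI d(1))
      fix s assume s: "s \<in> {a..b}" "\<bar>s - t\<bar> < d"
      have "(s - t) * (2 * (y t \<bullet> y' t)) \<le> \<bar>s - t\<bar> * (2 * \<bar>y t \<bullet> y' t\<bar>)"
        by (metis abs_ge_self abs_mult abs_numeral)
      also have "\<dots> \<le> \<bar>s - t\<bar> * (2 * (C * (norm (y t))\<^sup>2))" using b by (intro mult_left_mono) auto
      finally show "f s \<le> f t + (2 * C * f t + e) * \<bar>s - t\<bar>"
        using d(2)[OF s] by (simp add: f_def algebra_simps)
    qed
  qed (use c t in \<open>auto simp: f_def\<close>)
  then show ?thesis by (simp add: f_def)
qed

section \<open>Existence of solutions on closed sets\<close>

text \<open>The defect is bounded on every subinterval in proportion to its length, so it adds up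
  under concatenation and survives limits. With e = 0 this is the integral form of the differential
  equation.\<close>

definition approx_solution :: "('e::euclidean_space \<Rightarrow> 'e) \<Rightarrow> 'e \<Rightarrow> real \<Rightarrow> real \<Rightarrow> (real \<Rightarrow> 'e) \<Rightarrow> bool" where
  "approx_solution G x e \<tau> p \<longleftrightarrow> p 0 = x \<and> continuous_on {0..\<tau>} p \<and>
     (\<forall>s t. 0 \<le> s \<and> s \<le> t \<and> t \<le> \<tau> \<longrightarrow> norm (p t - p s - integral {s..t} (\<lambda>r. G (p r))) \<le> e * (t - s))"

lemma integrable_comp_field:
  fixes G :: "'e::euclidean_space \<Rightarrow> 'e" and p :: "real \<Rightarrow> 'e"
  assumes "continuous_on UNIV G" "continuous_on {a..b} p" "{s..t} \<subseteq> {a..b}"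
  shows "(\<lambda>r. G (p r)) integrable_on {s..t}"
  by (rule integrable_continuous_interval, rule continuous_on_compose2[OF assms(1)],
      rule continuous_on_subset[OF assms(2,3)]) auto

lemma norm_integral_field_le:
  fixes G :: "'e::euclidean_space \<Rightarrow> 'e" and p :: "real \<Rightarrow> 'e"
  assumes "continuous_on UNIV G" "\<And>x. norm (G x) \<le> M" "continuous_on {a..b} p" "{s..t} \<subseteq> {a..b}" "s \<le> t"
  shows "norm (integral {s..t} (\<lambda>r. G (p r))) \<le> M * (t - s)"
  by (rule integral_bound, fact, rule continuous_on_compose2[OF assms(1)],
      rule continuous_on_subset[OF assms(3,4)]) (use assms(2) in auto)

lemma approx_solution_lipschitz:
  assumes G: "continuous_on UNIV G" "\<And>x. norm (G x) \<le> M" and p: "approx_solution G x e \<tau> p"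
    and st: "0 \<le> s" "s \<le> t" "t \<le> \<tau>"
  shows "norm (p t - p s) \<le> (M + e) * (t - s)"
proof -
  have "norm (p t - p s) \<le> norm (p t - p s - integral {s..t} (\<lambda>r. G (p r))) + norm (integral {s..t} (\<lambda>r. G (p r)))"
    using norm_triangle_sub[of "p t - p s" "integral {s..t} (\<lambda>r. G (p r))"] by (simp add: add.commute)
  moreover have "norm (integral {s..t} (\<lambda>r. G (p r))) \<le> M * (t - s)"
    using p st by (intro norm_integral_field_le[OF G, where a=0 and b=\<tau>]) (auto simp: approx_solution_def)
  ultimately show ?thesis using p st unfolding approx_solution_def by (fastforce simp: algebra_simps)
qed

text \<open>A bounded field makes the approximate solutions uniformly Lipschitz, so Arzela-Ascoli
  applies, and dominated convergence passes to the limit in the integral equation. The lemma serves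
  twice: with e n tending to 0 for existence, and with e n = 0 for continuous dependence on the
  initial point.\<close>

lemma approx_solution_limit:
  fixes G :: "'e::euclidean_space \<Rightarrow> 'e"
  assumes G: "continuous_on UNIV G" "\<And>x. norm (G x) \<le> M"
    and p: "\<And>n. approx_solution G (x n) (e n) 1 (p n)"
    and x: "x \<longlonglongrightarrow> x0" and e: "e \<longlonglongrightarrow> 0"
  obtains \<phi> r where "strict_mono (r::nat \<Rightarrow> nat)" "\<phi> 0 = x0" "continuous_on {0..1} \<phi>"
    "\<And>t. t \<in> {0..1} \<Longrightarrow> (\<phi> has_vector_derivative G (\<phi> t)) (at t within {0..1})"
    "\<And>t. t \<in> {0..1} \<Longrightarrow> (\<lambda>n. p (r n) t) \<longlonglongrightarrow> \<phi> t"
proof -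
  obtain E where E: "\<And>n. norm (e n) \<le> E" using e convergent_imp_Bseq[of e] by (auto simp: convergent_def Bseq_def)
  obtain B where B: "\<And>n. norm (x n) \<le> B" using x convergent_imp_Bseq[of x] by (auto simp: convergent_def Bseq_def)
  have M0: "M \<ge> 0" using G(2)[of 0] norm_ge_zero order_trans by blast
  have E0: "E \<ge> 0" using E[of 0] norm_ge_zero order_trans by blast
  have lip: "norm (p n t - p n s) \<le> (M + E) * \<bar>t - s\<bar>" if "s \<in> {0..1}" "t \<in> {0..1}" for n s t
  proof -
    have *: "norm (p n t - p n s) \<le> (M + E) * (t - s)" if "0 \<le> s" "s \<le> t" "t \<le> 1" for s t
    proof -
      have "norm (p n t - p n s) \<le> (M + e n) * (t - s)"
        by (rule approx_solution_lipschitz[OF G p that])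
      also have "\<dots> \<le> (M + E) * (t - s)" using E[of n] that by (intro mult_right_mono) auto
      finally show ?thesis .
    qed
    show ?thesis using *[of s t] *[of t s] that by (cases "s \<le> t") (auto simp: norm_minus_commute)
  qed
  have p0: "p n 0 = x n" for n using p by (simp add: approx_solution_def)
  have bound: "norm (p n t) \<le> B + (M + E)" if "t \<in> {0..1}" for n t
  proof -
    have "norm (p n t) \<le> norm (p n 0) + norm (p n t - p n 0)" by (rule norm_triangle_sub)
    also have "norm (p n t - p n 0) \<le> (M + E) * \<bar>t - 0\<bar>" using that by (intro lip) auto
    also have "\<dots> \<le> (M + E) * 1" using that M0 E0 by (intro mult_left_mono) auto
    finally show ?thesis using p0 B[of n] by simp
  qed
  have "\<exists>d>0. \<forall>n y. y \<in> {0..1} \<and> norm (t - y) < d \<longrightarrow> norm (p n t - p n y) < c"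
    if "t \<in> {0..1}" "c > 0" for t c
  proof (intro exI conjI allI impI)
    show "0 < c / (M + E + 1)" using that M0 E0 by simp
    fix n y assume y: "y \<in> {0..1} \<and> norm (t - y) < c / (M + E + 1)"
    have "norm (p n t - p n y) \<le> (M + E) * \<bar>t - y\<bar>" using that y by (intro lip) auto
    also have "\<dots> \<le> (M + E) * (c / (M + E + 1))" using y M0 E0 by (intro mult_left_mono) auto
    also have "\<dots> < c" using that M0 E0 by (simp add: divide_simps algebra_simps)
    finally show "norm (p n t - p n y) < c" .
  qed
  then obtain \<phi> r where \<phi>: "continuous_on {0..1} \<phi>" "strict_mono (r::nat \<Rightarrow> nat)"
    "\<And>c. 0 < c \<Longrightarrow> \<exists>N. \<forall>n x. n \<ge> N \<and> x \<in> {0..1} \<longrightarrow> norm (p (r n) x - \<phi> x) < c"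
    by (rule Arzela_Ascoli[of "{0..1}" p "B + (M + E)", OF compact_Icc bound, rotated 1]) blast+
  have lim: "(\<lambda>n. p (r n) t) \<longlonglongrightarrow> \<phi> t" if "t \<in> {0..1}" for t
    unfolding lim_sequentially dist_norm using \<phi>(3) that by blast
  have xr: "(\<lambda>n. x (r n)) \<longlonglongrightarrow> x0" using LIMSEQ_subseq_LIMSEQ[OF x \<phi>(2)] by (simp add: o_def)
  have er: "(\<lambda>n. e (r n)) \<longlonglongrightarrow> 0" using LIMSEQ_subseq_LIMSEQ[OF e \<phi>(2)] by (simp add: o_def)
  have \<phi>0: "\<phi> 0 = x0" using LIMSEQ_unique[OF lim[of 0]] xr p0 by simp
  have int: "\<phi> t = x0 + integral {0..t} (\<lambda>r. G (\<phi> r))" if t: "t \<in> {0..1}" for t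
  proof -
    have "(\<lambda>n. integral {0..t} (\<lambda>s. G (p (r n) s))) \<longlonglongrightarrow> integral {0..t} (\<lambda>s. G (\<phi> s))"
    proof (rule dominated_convergence[where h="\<lambda>_. M"])
      show "(\<lambda>s. G (p (r k) s)) integrable_on {0..t}" for k
        using p[of "r k"] t by (intro integrable_comp_field[OF G(1), where a=0 and b=1]) (auto simp: approx_solution_def)
      show "(\<lambda>k. G (p (r k) s)) \<longlonglongrightarrow> G (\<phi> s)" if "s \<in> {0..t}" for s
        using lim[of s] that t G(1) by (intro isCont_tendsto_compose[of _ G])
          (auto simp: continuous_on_eq_continuous_at)
    qed (use G(2) in auto)
    then have "(\<lambda>n. p (r n) t - p (r n) 0 - integral {0..t} (\<lambda>s. G (p (r n) s))) \<longlonglongrightarrow> \<phi> t - x0 - integral {0..t} (\<lambda>s. G (\<phi> s))"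
      unfolding p0 using xr lim[OF t] by (intro tendsto_diff)
    moreover have "(\<lambda>n. p (r n) t - p (r n) 0 - integral {0..t} (\<lambda>s. G (p (r n) s))) \<longlonglongrightarrow> 0"
    proof (rule Lim_null_comparison)
      have "norm (p n t - p n 0 - integral {0..t} (\<lambda>s. G (p n s))) \<le> e n * (t - 0)" for n
        using p[of n] t unfolding approx_solution_def by (meson atLeastAtMost_iff order_refl)
      then show "\<forall>\<^sub>F n in sequentially. norm (p (r n) t - p (r n) 0 - integral {0..t} (\<lambda>s. G (p (r n) s))) \<le> e (r n) * (t - 0)"
        by simp
      show "(\<lambda>n. e (r n) * (t - 0)) \<longlonglongrightarrow> 0" using tendsto_mult_right[OF er, of "t-0"] by simp
    qed
    ultimately show ?thesis using LIMSEQ_unique by (fastforce simp: algebra_simps)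
  qed
  have der: "(\<phi> has_vector_derivative G (\<phi> t)) (at t within {0..1})" if t: "t \<in> {0..1}" for t
  proof -
    have "((\<lambda>t. x0 + integral {0..t} (\<lambda>r. G (\<phi> r))) has_vector_derivative 0 + G (\<phi> t)) (at t within {0..1})"
      by (intro has_vector_derivative_add has_vector_derivative_const integral_has_vector_derivative
          continuous_on_compose2[OF G(1) \<phi>(1)] t) auto
    then have "((\<lambda>t. x0 + integral {0..t} (\<lambda>r. G (\<phi> r))) has_vector_derivative G (\<phi> t)) (at t within {0..1})"
      by simp
    then show ?thesis
      by (rule has_vector_derivative_transform[rotated 2]) (use t int in auto)
  qed
  show thesis by (rule that[OF \<phi>(2) \<phi>0 \<phi>(1) der lim])
qed

text \<open>Nagumo's condition: \<open>G x\<close> lies in the contingent cone of F at x. It makes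
  sense for closed sets with singularities.\<close>

definition viable :: "'e::real_normed_vector set \<Rightarrow> ('e \<Rightarrow> 'e) \<Rightarrow> bool" where
  "viable F G \<longleftrightarrow> (\<forall>x\<in>F. \<forall>e>0. \<exists>h y. 0 < h \<and> h < e \<and> y \<in> F \<and> norm (y - x - h *\<^sub>R G x) \<le> e * h)"

text \<open>A lower bound for the steps is what lets finitely many of them reach time 1. The step
  found at one point also serves its neighbours, up to an error that is small compared with e * h,
  and compactness leaves finitely many step sizes.\<close>

lemma viable_uniform_step:
  fixes F :: "'e::euclidean_space set"
  assumes G: "continuous_on F G" and via: "viable F G" and K: "compact K" "K \<subseteq> F" and e: "e > 0" and k: "k > 0"
  obtains m where "m > 0" "\<And>x. x \<in> K \<Longrightarrow> \<exists>h y. m \<le> h \<and> h \<le> k \<and> y \<in> F \<and> norm (y - x - h *\<^sub>R G x) \<le> e * h"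
proof -
  have "\<exists>h d. 0 < h \<and> h \<le> k \<and> d > 0 \<and>
     (\<forall>x'\<in>F. dist x' x < d \<longrightarrow> (\<exists>y. y \<in> F \<and> norm (y - x' - h *\<^sub>R G x') \<le> e * h))" if x: "x \<in> F" for x
  proof -
    obtain h y where h: "0 < h" "h < min k (e/4)" "y \<in> F" "norm (y - x - h *\<^sub>R G x) \<le> min k (e/4) * h"
      using via x e k unfolding viable_def by (metis min_less_iff_conj zero_less_divide_iff zero_less_numeral)
    obtain d where d: "d > 0" "\<And>x'. x' \<in> F \<Longrightarrow> dist x' x < d \<Longrightarrow> dist (G x') (G x) < e/4"
      using G x e unfolding continuous_on_iff by (metis divide_pos_pos zero_less_numeral)
    show ?thesis
    proof (rule exI[of _ h], rule exI[of _ "min d (e * h/4)"], intro conjI ballI impI)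
      fix x' assume x': "x' \<in> F" "dist x' x < min d (e*h/4)"
      have "norm (y - x' - h *\<^sub>R G x') = norm ((y - x - h *\<^sub>R G x) + ((x - x') + h *\<^sub>R (G x - G x')))"
        by (simp add: algebra_simps)
      also have "\<dots> \<le> norm (y - x - h *\<^sub>R G x) + (norm (x - x') + norm (h *\<^sub>R (G x - G x')))"
        by (meson add_left_mono norm_triangle_ineq order_trans)
      also have "norm (y - x - h *\<^sub>R G x) \<le> e/4 * h" using h(4) h(1) by (smt (verit) mult_right_mono)
      also have "norm (x - x') \<le> e * h / 4" using x' by (simp add: dist_norm norm_minus_commute)
      also have "norm (h *\<^sub>R (G x - G x')) \<le> h * (e/4)"
        using d(2)[of x'] x' h(1) by (simp add: dist_norm norm_minus_commute)
      finally have "norm (y - x' - h *\<^sub>R G x') \<le> e * h"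
        using mult_pos_pos[OF e h(1)] by (simp add: mult.commute)
      then show "\<exists>y. y \<in> F \<and> norm (y - x' - h *\<^sub>R G x') \<le> e * h" using h by blast
    qed (use h e d in auto)
  qed
  then obtain h d where hd: "\<And>x. x \<in> F \<Longrightarrow> 0 < h x \<and> h x \<le> k \<and> d x > 0 \<and>
     (\<forall>x'\<in>F. dist x' x < d x \<longrightarrow> (\<exists>y. y \<in> F \<and> norm (y - x' - h x *\<^sub>R G x') \<le> e * h x))" by metis
  have "K \<subseteq> (\<Union>x\<in>K. ball x (d x))" using hd K by force
  then obtain C where C: "C \<subseteq> K" "finite C" "K \<subseteq> (\<Union>x\<in>C. ball x (d x))"
    using compactE_image[OF K(1), of K "\<lambda>x. ball x (d x)"] by auto
  define m where "m = Min (insert k (h ` C))"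
  show thesis
  proof
    show "m > 0" using C K hd k by (auto simp: m_def)
    fix x assume x: "x \<in> K"
    then obtain c where c: "c \<in> C" "dist x c < d c" using C by (auto simp: dist_commute)
    moreover have "m \<le> h c" using C c by (auto simp: m_def)
    ultimately show "\<exists>h y. m \<le> h \<and> h \<le> k \<and> y \<in> F \<and> norm (y - x - h *\<^sub>R G x) \<le> e * h"
      using hd[of c] C K x by (metis subsetD)
  qed
qed

text \<open>One half of the tolerance pays for the direction v, the other for the variation of G
  along the segment, whose length is at most (M + e) * h.\<close>

lemma approx_solution_segment:
  fixes G :: "'e::euclidean_space \<Rightarrow> 'e"
  assumes G: "continuous_on UNIV G" "\<And>x. norm (G x) \<le> M"
    and p: "approx_solution G x e \<tau> p" and \<tau>: "\<tau> \<ge> 0" and h: "h > 0" and e: "e > 0"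
    and v: "norm (v - G (p \<tau>)) \<le> e / 2"
    and near: "\<And>y. norm (y - p \<tau>) \<le> (M + e) * h \<Longrightarrow> norm (G y - G (p \<tau>)) \<le> e / 2"
  shows "approx_solution G x e (\<tau> + h) (\<lambda>t. if t \<le> \<tau> then p t else p \<tau> + (t - \<tau>) *\<^sub>R v)" (is "approx_solution _ _ _ _ ?q")
proof -
  have cp: "continuous_on {0..\<tau>} p" and p0: "p 0 = x" using p by (auto simp: approx_solution_def)
  have "continuous_on ({0..\<tau>} \<union> {\<tau>..\<tau>+h}) ?q"
    by (rule continuous_on_If) (auto intro!: continuous_intros cp)
  then have cq: "continuous_on {0..\<tau>+h} ?q" using \<tau> h by (simp add: ivl_disj_un_two_touch)
  have nv: "norm v \<le> M + e" using v G(2)[of "p \<tau>"] e norm_triangle_sub[of v "G (p \<tau>)"] by linarith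
  have first: "norm (?q t - ?q s - integral {s..t} (\<lambda>r. G (?q r))) \<le> e * (t - s)" if "0 \<le> s" "s \<le> t" "t \<le> \<tau>" for s t
  proof -
    have "integral {s..t} (\<lambda>r. G (?q r)) = integral {s..t} (\<lambda>r. G (p r))"
      using that by (intro integral_cong) auto
    then show ?thesis using p that by (simp add: approx_solution_def)
  qed
  have second: "norm (?q t - ?q s - integral {s..t} (\<lambda>r. G (?q r))) \<le> e * (t - s)" if st: "\<tau> \<le> s" "s \<le> t" "t \<le> \<tau> + h" for s t
  proof -
    have q: "?q r = p \<tau> + (r - \<tau>) *\<^sub>R v" if "r \<ge> \<tau>" for r using that by auto
    have int: "(\<lambda>r. G (?q r)) integrable_on {s..t}"
      by (rule integrable_comp_field[OF G(1) cq]) (use st \<tau> in auto)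
    have "integral {s..t} (\<lambda>r. v - G (?q r)) = integral {s..t} (\<lambda>r. v) - integral {s..t} (\<lambda>r. G (?q r))"
      by (rule integral_diff) (use int in auto)
    moreover have "?q t - ?q s = integral {s..t} (\<lambda>r. v)" using st q[of s] q[of t]
      by (simp add: algebra_simps)
    ultimately have eq: "?q t - ?q s - integral {s..t} (\<lambda>r. G (?q r)) = integral {s..t} (\<lambda>r. v - G (?q r))" by simp
    have "norm (integral {s..t} (\<lambda>r. v - G (?q r))) \<le> e * (t - s)"
    proof (rule integral_bound)
      show "continuous_on {s..t} (\<lambda>r. v - G (?q r))"
        by (intro continuous_intros continuous_on_compose2[OF G(1)] continuous_on_subset[OF cq]) (use st \<tau> in auto)
      fix r assume r: "r \<in> {s..t}"
      have "norm ((r - \<tau>) *\<^sub>R v) \<le> h * (M + e)" using r st nv h by (auto intro!: mult_mono)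
      then have "norm (G (?q r) - G (p \<tau>)) \<le> e/2" using r st by (intro near) (subst q, auto simp: mult.commute)
      with v show "norm (v - G (?q r)) \<le> e"
        using norm_triangle_ineq4[of "v - G (p \<tau>)" "G (?q r) - G (p \<tau>)"] by simp
    qed (use st in auto)
    then show ?thesis using eq by simp
  qed
  have "norm (?q t - ?q s - integral {s..t} (\<lambda>r. G (?q r))) \<le> e * (t - s)" if st: "0 \<le> s" "s \<le> t" "t \<le> \<tau> + h" for s t
  proof (cases "t \<le> \<tau> \<or> \<tau> \<le> s")
    case True then show ?thesis using first[of s t] second[of s t] st by auto
  next
    case False
    have "integral {s..\<tau>} (\<lambda>r. G (?q r)) + integral {\<tau>..t} (\<lambda>r. G (?q r)) = integral {s..t} (\<lambda>r. G (?q r))"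
      by (rule Henstock_Kurzweil_Integration.integral_combine, use False in simp, use False in simp)
        (rule integrable_comp_field[OF G(1) cq], use False st \<tau> in auto)
    then have "?q t - ?q s - integral {s..t} (\<lambda>r. G (?q r)) =
      (?q \<tau> - ?q s - integral {s..\<tau>} (\<lambda>r. G (?q r))) + (?q t - ?q \<tau> - integral {\<tau>..t} (\<lambda>r. G (?q r)))"
      by (simp add: algebra_simps)
    moreover have "norm (?q \<tau> - ?q s - integral {s..\<tau>} (\<lambda>r. G (?q r))) \<le> e * (\<tau> - s)"
      using False st by (intro first) auto
    moreover have "norm (?q t - ?q \<tau> - integral {\<tau>..t} (\<lambda>r. G (?q r))) \<le> e * (t - \<tau>)"
      using False st by (intro second) auto
    ultimately have "norm (?q t - ?q s - integral {s..t} (\<lambda>r. G (?q r))) \<le> e * (\<tau> - s) + e * (t - \<tau>)"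
      by (simp only: norm_triangle_mono)
    then show ?thesis by (simp add: algebra_simps)
  qed
  then show ?thesis using cq p0 \<tau> unfolding approx_solution_def by auto
qed

lemma approx_solution_exists:
  fixes F :: "'e::euclidean_space set"
  assumes F: "closed F" and G: "continuous_on UNIV G" "\<And>x. norm (G x) \<le> M" and via: "viable F G" and x: "x \<in> F"
    and e: "0 < e" "e \<le> 1"
  obtains p where "approx_solution G x e 1 p" "\<And>t. t \<in> {0..1} \<Longrightarrow> \<exists>y\<in>F. norm (p t - y) \<le> e"
proof -
  have M0: "M \<ge> 0" using G(2)[of 0] norm_ge_zero order_trans by blast
  \<comment> \<open>Up to time 1 a polygon moves by at most M + 1; the rest of R leaves room for one
    further segment.\<close>
  define R where "R = (M + 1) * 4"
  have "uniformly_continuous_on (cball x R) G"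
    by (intro compact_uniformly_continuous continuous_on_subset[OF G(1)]) auto
  then obtain d where d: "d > 0" "\<And>y z. y \<in> cball x R \<Longrightarrow> z \<in> cball x R \<Longrightarrow> dist y z < d \<Longrightarrow> dist (G y) (G z) < e/2"
    using e unfolding uniformly_continuous_on_def by (metis half_gt_zero)
  \<comment> \<open>A step of length at most k moves the polygon by less than d, so that the field
    varies by at most e / 2 on it, and by at most e, so that it remains within e of F.\<close>
  define k where "k = min 1 (min d e / (2 * (M + 1)))"
  have k: "k > 0" "k \<le> 1" "(M + e) * k < d" "(M + e) * k \<le> e"
  proof -
    show "k > 0" "k \<le> 1" using d e M0 by (auto simp: k_def)
    have "(M + e) * k \<le> (M + 1) * (min d e / (2 * (M + 1)))"
      using e M0 d by (intro mult_mono) (auto simp: k_def)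
    also have "\<dots> = min d e / 2"
    proof -
      have "M + 1 \<noteq> 0" using M0 by simp
      then show ?thesis by (simp only: times_divide_eq_right mult.commute[of 2]) (rule nonzero_mult_divide_mult_cancel_left)
    qed
    finally show "(M + e) * k < d" "(M + e) * k \<le> e" using d e by auto
  qed
  obtain m where m: "m > 0" "\<And>y. y \<in> F \<inter> cball x R \<Longrightarrow> \<exists>h z. m \<le> h \<and> h \<le> k \<and> z \<in> F \<and> norm (z - y - h *\<^sub>R G y) \<le> e/2 * h"
    by (rule viable_uniform_step[OF continuous_on_subset[OF G(1)] via, of "F \<inter> cball x R" "e/2" k])
      (use F e k in \<open>auto intro: closed_Int_compact\<close>)
  define P where "P = (\<lambda>\<tau> p. approx_solution G x e \<tau> p \<and> p \<tau> \<in> F \<and> (\<forall>t\<in>{0..\<tau>}. \<exists>y\<in>F. norm (p t - y) \<le> e))"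
  \<comment> \<open>After n steps the time is at least n * m unless it has passed 1. The last step
    may overshoot 1, and the polygon is cut back to [0, 1] at the end. Only its vertices lie in
    F.\<close>
  have iter: "\<exists>\<tau> p. 0 \<le> \<tau> \<and> min 1 (real n * m) \<le> \<tau> \<and> \<tau> \<le> 1 + k \<and> P \<tau> p" for n
  proof (induction n)
    case 0
    have "t = s" if "0 \<le> s" "s \<le> t" "t \<le> 0" for s t :: real using that by linarith
    then have "approx_solution G x e 0 (\<lambda>_. x)" unfolding approx_solution_def by fastforce
    then have "P 0 (\<lambda>_. x)" using x e by (auto simp: P_def intro!: bexI[of _ x])
    then show ?case using k by (intro exI[of _ 0]) auto
  next
    case (Suc n)
    then obtain \<tau> p where \<tau>: "0 \<le> \<tau>" "min 1 (real n * m) \<le> \<tau>" "\<tau> \<le> 1 + k" "P \<tau> p" by auto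
    show ?case
    proof (cases "\<tau> \<ge> 1")
      case True then show ?thesis using \<tau> by (intro exI[of _ \<tau>] exI[of _ p]) auto
    next
      case False
      have p: "approx_solution G x e \<tau> p" "p \<tau> \<in> F" "\<And>t. t \<in> {0..\<tau>} \<Longrightarrow> \<exists>y\<in>F. norm (p t - y) \<le> e"
        using \<tau>(4) by (auto simp: P_def)
      have "norm (p \<tau> - p 0) \<le> (M + e) * (\<tau> - 0)"
        by (rule approx_solution_lipschitz[OF G p(1)]) (use \<tau> in auto)
      also have "\<dots> \<le> (M + 1) * 1" using \<tau> False e M0 by (intro mult_mono) auto
      finally have near: "norm (p \<tau> - x) \<le> M + 1" using p(1) by (simp add: approx_solution_def)
      then have "p \<tau> \<in> F \<inter> cball x R" using p(2) M0 by (auto simp: R_def dist_norm norm_minus_commute)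
      then obtain h z where h: "m \<le> h" "h \<le> k" "z \<in> F" "norm (z - p \<tau> - h *\<^sub>R G (p \<tau>)) \<le> e/2 * h"
        using m(2) by blast
      have h0: "h > 0" using h m by simp
      define v where "v = (1/h) *\<^sub>R (z - p \<tau>)"
      have z: "z = p \<tau> + h *\<^sub>R v" using h0 by (simp add: v_def)
      have "h * norm (v - G (p \<tau>)) = norm (z - p \<tau> - h *\<^sub>R G (p \<tau>))"
        using h0 by (simp add: z flip: scaleR_diff_right)
      then have "h * norm (v - G (p \<tau>)) \<le> h * (e/2)" using h(4) by (simp add: mult.commute)
      then have v: "norm (v - G (p \<tau>)) \<le> e/2" using h0 by simp
      have nv: "norm v \<le> M + e" using v G(2)[of "p \<tau>"] e norm_triangle_sub[of v "G (p \<tau>)"] by linarith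
      define q where "q = (\<lambda>t. if t \<le> \<tau> then p t else p \<tau> + (t - \<tau>) *\<^sub>R v)"
      have hk: "(M + e) * h \<le> (M + e) * k" using h M0 e by (intro mult_left_mono) auto
      have "approx_solution G x e (\<tau> + h) q" unfolding q_def
      proof (rule approx_solution_segment[OF G p(1) \<tau>(1) h0 e(1) v])
        fix y assume y: "norm (y - p \<tau>) \<le> (M + e) * h"
        have yd: "norm (y - p \<tau>) < d" using y hk k by linarith
        have "norm (y - x) \<le> norm (y - p \<tau>) + norm (p \<tau> - x)" by (metis norm_triangle_ineq diff_add_cancel add_diff_eq)
        also have "\<dots> \<le> e + (M + 1)" using y hk k near by linarith
        also have "\<dots> \<le> R" using e M0 by (simp add: R_def)
        finally have "y \<in> cball x R" by (simp add: dist_norm norm_minus_commute)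
        moreover have "p \<tau> \<in> cball x R" using near M0 by (auto simp: R_def dist_norm norm_minus_commute)
        ultimately show "norm (G y - G (p \<tau>)) \<le> e / 2" using d(2) yd by (force simp: dist_norm)
      qed
      moreover have "q (\<tau> + h) = z" using h0 z by (simp add: q_def)
      moreover have "\<exists>y\<in>F. norm (q t - y) \<le> e" if t: "t \<in> {0..\<tau>+h}" for t
      proof (cases "t \<le> \<tau>")
        case True then show ?thesis using p(3) t by (auto simp: q_def)
      next
        case False
        have "norm (q t - p \<tau>) = (t - \<tau>) * norm v" using False by (simp add: q_def)
        also have "\<dots> \<le> h * (M + e)" using False t nv h0 by (intro mult_mono) auto
        also have "\<dots> \<le> e" using hk k by (simp add: mult.commute)
        finally show ?thesis using p(2) by auto
      qed
      ultimately have "P (\<tau> + h) q" using h by (simp add: P_def)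
      moreover have "min 1 (real (Suc n) * m) \<le> \<tau> + h" using \<tau>(2) h False by (auto simp: min_def algebra_simps split: if_splits)
      ultimately show ?thesis using \<tau> h h0 False by (intro exI[of _ "\<tau> + h"] exI[of _ q]) auto
    qed
  qed
  obtain n :: nat where n: "1 < real n * m" using reals_Archimedean3 m(1) by blast
  then obtain \<tau> p where \<tau>: "1 \<le> \<tau>" "P \<tau> p" using iter[of n] by auto
  show thesis
  proof
    show "approx_solution G x e 1 p" using \<tau> by (auto simp: P_def approx_solution_def intro: continuous_on_subset)
    show "\<exists>y\<in>F. norm (p t - y) \<le> e" if "t \<in> {0..1}" for t using that \<tau> by (auto simp: P_def)
  qed
qed

text \<open>Nagumo's theorem: a limit of Euler polygons whose tolerance tends to 0. The polygons
  stay within that tolerance of F, so closedness puts the limit into F.\<close>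

lemma viable_solution_exists:
  fixes F :: "'e::euclidean_space set"
  assumes F: "closed F" and G: "continuous_on UNIV G" "\<And>x. norm (G x) \<le> M" and via: "viable F G" and x: "x \<in> F"
  obtains \<phi> where "\<phi> 0 = x" "\<And>t. t \<in> {0..1} \<Longrightarrow> \<phi> t \<in> F"
    "\<And>t. t \<in> {0..1} \<Longrightarrow> (\<phi> has_vector_derivative G (\<phi> t)) (at t within {0..1})"
proof -
  have "\<exists>p. approx_solution G x (inverse (real (Suc n))) 1 p \<and> (\<forall>t\<in>{0..1}. \<exists>y\<in>F. norm (p t - y) \<le> inverse (real (Suc n)))" for n
    by (rule approx_solution_exists[OF F G via x, of "inverse (real (Suc n))"]) (auto simp: inverse_le_1_iff)
  then obtain p where p: "\<And>n. approx_solution G x (inverse (real (Suc n))) 1 (p n)"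
    "\<And>n t. t \<in> {0..1} \<Longrightarrow> \<exists>y\<in>F. norm (p n t - y) \<le> inverse (real (Suc n))" by metis
  obtain \<phi> r where \<phi>: "strict_mono (r::nat \<Rightarrow> nat)" "\<phi> 0 = x" "continuous_on {0..1} \<phi>"
    "\<And>t. t \<in> {0..1} \<Longrightarrow> (\<phi> has_vector_derivative G (\<phi> t)) (at t within {0..1})"
    "\<And>t. t \<in> {0..1} \<Longrightarrow> (\<lambda>n. p (r n) t) \<longlonglongrightarrow> \<phi> t"
    by (rule approx_solution_limit[OF G p(1), where ?x0.0 = x]) (use LIMSEQ_inverse_real_of_nat in auto)
  have "\<phi> t \<in> F" if t: "t \<in> {0..1}" for t
  proof -
    obtain y where y: "\<And>n. y n \<in> F" "\<And>n. norm (p n t - y n) \<le> inverse (real (Suc n))" using p(2)[OF t] by metis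
    have inv: "(\<lambda>n. inverse (real (Suc (r n)))) \<longlonglongrightarrow> 0"
      using LIMSEQ_subseq_LIMSEQ[OF LIMSEQ_inverse_real_of_nat \<phi>(1)] by (simp add: o_def)
    have "(\<lambda>n. p (r n) t - y (r n)) \<longlonglongrightarrow> 0"
      by (rule Lim_null_comparison[OF _ inv]) (use y(2) in auto)
    then have "(\<lambda>n. p (r n) t - (p (r n) t - y (r n))) \<longlonglongrightarrow> \<phi> t - 0" by (intro tendsto_diff \<phi>(5) t)
    then have "(\<lambda>n. y (r n)) \<longlonglongrightarrow> \<phi> t" by simp
    then show ?thesis by (rule closed_sequentially[OF F y(1)])
  qed
  then show thesis using that \<phi> by blast
qed

section \<open>Flows on stratified sets\<close>

lemma connected_interval_induct:
  fixes A :: "real set"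
  assumes "A \<subseteq> {0..1}" "c \<in> A" "t \<in> {0..1}"
    and "\<And>t. t \<in> A \<Longrightarrow> \<exists>d>0. \<forall>s\<in>{0..1}. \<bar>s - t\<bar> < d \<longrightarrow> s \<in> A"
    and "\<And>t. t \<in> {0..1} - A \<Longrightarrow> \<exists>d>0. \<forall>s\<in>{0..1}. \<bar>s - t\<bar> < d \<longrightarrow> s \<notin> A"
  shows "t \<in> A"
proof -
  have "openin (top_of_set {0..1}) A"
    unfolding openin_euclidean_subtopology_iff dist_real_def using assms(1,4) by blast
  moreover have "openin (top_of_set {0..1}) ({0..1} - A)"
    unfolding openin_euclidean_subtopology_iff dist_real_def using assms(5) by blast
  then have "closedin (top_of_set {0..1}) A"
    using assms(1) by (auto simp: closedin_def)
  ultimately have "A = {} \<or> A = {0..1}" using connected_Icc[of 0 "1::real"] unfolding connected_clopen by blast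
  then show ?thesis using assms by auto
qed

text \<open>The estimate \<open>controlled\<close> bounds the derivative of the squared distance of a solution to a stratum by a
  multiple of that squared distance, so by Gronwall a solution neither enters nor leaves a stratum. Inside a
  stratum the field is locally Lipschitz, whence uniqueness, and uniqueness makes the flow continuous although
  the field is merely continuous.\<close>

locale stratified_field =
  fixes F :: "'e::euclidean_space set" and G :: "'e \<Rightarrow> 'e" and \<R> :: "'e set set" and M :: real
  assumes closed_F: "closed F" and cont_G: "continuous_on F G" and bounded_G: "\<And>x. x \<in> F \<Longrightarrow> norm (G x) \<le> M"
    and viable_F: "viable F G" and strata_cover: "\<Union>\<R> = F" and strata_disjoint: "disjoint \<R>"
    and controlled: "\<And>R x. R \<in> \<R> \<Longrightarrow> x \<in> R \<Longrightarrow> \<exists>d>0. \<exists>C. \<forall>y\<in>F \<inter> ball x d. \<exists>q\<in>R.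
      dist y q = infdist y R \<and> \<bar>inner (y - q) (G y)\<bar> \<le> C * (dist y q)\<^sup>2"
    and locally_lipschitz: "\<And>R x. R \<in> \<R> \<Longrightarrow> x \<in> R \<Longrightarrow> \<exists>d>0. \<exists>L. L-lipschitz_on (R \<inter> ball x d) G"
begin

definition solution :: "(real \<Rightarrow> 'e) \<Rightarrow> bool" where
  "solution \<phi> \<longleftrightarrow> (\<forall>t\<in>{0..1}. \<phi> t \<in> F \<and> (\<phi> has_vector_derivative G (\<phi> t)) (at t within {0..1}))"

lemma solution_continuous: "solution \<phi> \<Longrightarrow> continuous_on {0..1} \<phi>"
  by (rule continuous_on_vector_derivative) (auto simp: solution_def)

lemma solution_near:
  assumes "solution \<phi>" "t0 \<in> {0..1}" "d > 0"
  obtains c where "c > 0" "\<And>s. s \<in> {0..1} \<Longrightarrow> \<bar>s - t0\<bar> < c \<Longrightarrow> dist (\<phi> s) (\<phi> t0) < d"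
  using solution_continuous[OF assms(1)] assms(2,3) unfolding continuous_on_iff dist_real_def by blast

text \<open>Freezing a nearest point q of \<open>\<phi> t\<close> bounds the squared distance to R
  from above by the smooth function |\<phi> s - q|^2, with equality at s = t;
  \<open>controlled\<close> bounds the derivative of the latter. This is the one-sided estimate that
  Gronwall asks for. Distance 0 means membership because the distance is attained.\<close>

lemma solution_stays_near:
  assumes \<phi>: "solution \<phi>" and R: "R \<in> \<R>" and t0: "t0 \<in> {0..1}" "\<phi> t0 \<in> R"
  shows "\<exists>d>0. \<forall>s\<in>{0..1}. \<bar>s - t0\<bar> < d \<longrightarrow> \<phi> s \<in> R"
proof -
  obtain d C where d: "d > 0" "\<And>y. y \<in> F \<Longrightarrow> dist (\<phi> t0) y < d \<Longrightarrow> \<exists>q\<in>R.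
      dist y q = infdist y R \<and> \<bar>inner (y - q) (G y)\<bar> \<le> C * (dist y q)\<^sup>2"
    using controlled[OF R t0(2)] by (metis IntI mem_ball)
  obtain c where c: "c > 0" "\<And>s. s \<in> {0..1} \<Longrightarrow> \<bar>s - t0\<bar> < c \<Longrightarrow> dist (\<phi> s) (\<phi> t0) < d"
    using solution_near[OF \<phi> t0(1) d(1)] by metis
  define a where "a = max 0 (t0 - c/2)"
  define b where "b = min 1 (t0 + c/2)"
  have ab: "{a..b} \<subseteq> {0..1}" "t0 \<in> {a..b}" using t0 c by (auto simp: a_def b_def)
  have near: "\<exists>q\<in>R. dist (\<phi> s) q = infdist (\<phi> s) R \<and> \<bar>inner (\<phi> s - q) (G (\<phi> s))\<bar> \<le> C * (dist (\<phi> s) q)\<^sup>2"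
    if "s \<in> {a..b}" for s
  proof -
    have "\<bar>s - t0\<bar> < c" "s \<in> {0..1}" using that c(1) ab by (auto simp: a_def b_def)
    then show ?thesis using c(2)[of s] \<phi> by (intro d(2)) (auto simp: solution_def dist_commute)
  qed
  have zero: "(infdist (\<phi> s) R)\<^sup>2 = 0" if s: "s \<in> {a..b}" for s
  proof (rule dini_gronwall_vanish[of a b "\<lambda>s. (infdist (\<phi> s) R)\<^sup>2" t0 "2 * C" s])
    show "continuous_on {a..b} (\<lambda>s. (infdist (\<phi> s) R)\<^sup>2)"
      by (intro continuous_intros continuous_on_subset[OF solution_continuous[OF \<phi>] ab(1)])
    show "t0 \<in> {a..b}" by (fact ab(2))
    show "(infdist (\<phi> t0) R)\<^sup>2 = 0" using t0(2) by simp
    fix t e :: real assume t: "t \<in> {a..b}" and e: "e > 0"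
    obtain q where q: "q \<in> R" "dist (\<phi> t) q = infdist (\<phi> t) R" "\<bar>inner (\<phi> t - q) (G (\<phi> t))\<bar> \<le> C * (dist (\<phi> t) q)\<^sup>2"
      using near[OF t] by blast
    have "(\<phi> has_vector_derivative G (\<phi> t)) (at t within {0..1})" using \<phi> t ab by (auto simp: solution_def)
    then have "((\<lambda>s. inner (\<phi> s - q) (\<phi> s - q)) has_derivative (\<lambda>h. h * (2 * inner (\<phi> t - q) (G (\<phi> t))))) (at t within {0..1})"
      unfolding has_vector_derivative_def
      by (auto intro!: derivative_eq_intros simp: inner_commute algebra_simps)
    then obtain d' where d': "d' > 0" "\<And>s. s \<in> {0..1} \<Longrightarrow> \<bar>s - t\<bar> < d' \<Longrightarrow>
       \<bar>inner (\<phi> s - q) (\<phi> s - q) - inner (\<phi> t - q) (\<phi> t - q) - (s - t) * (2 * inner (\<phi> t - q) (G (\<phi> t)))\<bar> \<le> e * \<bar>s - t\<bar>"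
      using e unfolding has_derivative_within_alt real_norm_def by metis
    show "\<exists>d>0. \<forall>s\<in>{a..b}. \<bar>s - t\<bar> < d \<longrightarrow> (infdist (\<phi> s) R)\<^sup>2 \<le> (infdist (\<phi> t) R)\<^sup>2 + (2 * C * (infdist (\<phi> t) R)\<^sup>2 + e) * \<bar>s - t\<bar>"
    proof (intro exI[of _ d'] conjI ballI impI d'(1))
      fix s assume s: "s \<in> {a..b}" "\<bar>s - t\<bar> < d'"
      have "(infdist (\<phi> s) R)\<^sup>2 \<le> (dist (\<phi> s) q)\<^sup>2"
        using infdist_le[OF q(1)] by (intro power_mono) (auto simp: infdist_nonneg)
      also have "\<dots> = inner (\<phi> s - q) (\<phi> s - q)" by (simp add: dist_norm power2_norm_eq_inner)
      also have "\<dots> \<le> inner (\<phi> t - q) (\<phi> t - q) + (s - t) * (2 * inner (\<phi> t - q) (G (\<phi> t))) + e * \<bar>s - t\<bar>"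
        using d'(2)[of s] s ab by (auto simp: abs_le_iff)
      also have "(s - t) * (2 * inner (\<phi> t - q) (G (\<phi> t))) \<le> \<bar>s - t\<bar> * (2 * (C * (dist (\<phi> t) q)\<^sup>2))"
      proof -
        have "(s - t) * (2 * inner (\<phi> t - q) (G (\<phi> t))) \<le> \<bar>s - t\<bar> * \<bar>2 * inner (\<phi> t - q) (G (\<phi> t))\<bar>"
          by (metis abs_ge_self abs_mult)
        also have "\<dots> \<le> \<bar>s - t\<bar> * (2 * (C * (dist (\<phi> t) q)\<^sup>2))" using q(3) by (intro mult_left_mono) auto
        finally show ?thesis .
      qed
      also have "inner (\<phi> t - q) (\<phi> t - q) = (infdist (\<phi> t) R)\<^sup>2" using q(2) by (simp add: dist_norm flip: power2_norm_eq_inner)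
      finally show "(infdist (\<phi> s) R)\<^sup>2 \<le> (infdist (\<phi> t) R)\<^sup>2 + (2 * C * (infdist (\<phi> t) R)\<^sup>2 + e) * \<bar>s - t\<bar>"
        using q(2) by (simp add: algebra_simps)
    qed
  qed (use s in auto)
  show ?thesis
  proof (intro exI[of _ "c/2"] conjI ballI impI)
    fix s assume "s \<in> {0..1}" "\<bar>s - t0\<bar> < c/2"
    then have s: "s \<in> {a..b}" by (auto simp: a_def b_def abs_if split: if_splits)
    obtain q where "q \<in> R" "dist (\<phi> s) q = infdist (\<phi> s) R" using near[OF s] by blast
    with zero[OF s] show "\<phi> s \<in> R" by simp
  qed (use c in auto)
qed

text \<open>Leaving R is excluded by the estimate at R, entering R by the estimate at the stratum
  one would come from; so the set of times spent in R is open and closed.\<close>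

lemma solution_in_stratum:
  assumes \<phi>: "solution \<phi>" and R: "R \<in> \<R>" and c: "c \<in> {0..1}" "\<phi> c \<in> R" and t: "t \<in> {0..1}"
  shows "\<phi> t \<in> R"
proof -
  have "t \<in> {t \<in> {0..1}. \<phi> t \<in> R}"
  proof (rule connected_interval_induct[of _ c])
    fix s assume "s \<in> {t \<in> {0..1}. \<phi> t \<in> R}"
    then show "\<exists>d>0. \<forall>u\<in>{0..1}. \<bar>u - s\<bar> < d \<longrightarrow> u \<in> {t \<in> {0..1}. \<phi> t \<in> R}"
      using solution_stays_near[OF \<phi> R, of s] by auto
  next
    fix s :: real assume s: "s \<in> {0..1} - {t \<in> {0..1}. \<phi> t \<in> R}"
    then have "\<phi> s \<in> F" using \<phi> by (auto simp: solution_def)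
    then obtain R' where R': "R' \<in> \<R>" "\<phi> s \<in> R'" using strata_cover by auto
    then have "R' \<inter> R = {}" using strata_disjoint R s by (auto simp: pairwise_def disjnt_def disjoint_def)
    with solution_stays_near[OF \<phi> R'(1) _ R'(2)] s
    show "\<exists>d>0. \<forall>u\<in>{0..1}. \<bar>u - s\<bar> < d \<longrightarrow> u \<notin> {t \<in> {0..1}. \<phi> t \<in> R}" by auto
  qed (use c t in auto)
  then show ?thesis by simp
qed

text \<open>The field may fail to be Lipschitz across strata, but both solutions remain in the
  stratum of their common initial point, where it is locally Lipschitz. Agreement therefore spreads
  along the interval.\<close>

lemma solution_unique:
  assumes \<phi>: "solution \<phi>" and \<psi>: "solution \<psi>" and eq: "\<phi> 0 = \<psi> 0" and t: "t \<in> {0..1}"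
  shows "\<phi> t = \<psi> t"
proof -
  have "\<phi> 0 \<in> F" using \<phi> by (auto simp: solution_def)
  then obtain R where R: "R \<in> \<R>" "\<phi> 0 \<in> R" using strata_cover by auto
  have inR: "\<phi> s \<in> R" "\<psi> s \<in> R" if "s \<in> {0..1}" for s
    using solution_in_stratum[OF \<phi> R(1) _ R(2) that] solution_in_stratum[OF \<psi> R(1) _ _ that, of 0] R eq by auto
  have "t \<in> {t \<in> {0..1}. \<phi> t = \<psi> t}"
  proof (rule connected_interval_induct[of _ 0])
    fix s assume "s \<in> {t \<in> {0..1}. \<phi> t = \<psi> t}"
    then have s: "s \<in> {0..1}" "\<phi> s = \<psi> s" by auto
    obtain d L where d: "d > 0" "L-lipschitz_on (R \<inter> ball (\<phi> s) d) G"
      using locally_lipschitz[OF R(1) inR(1)[OF s(1)]] by blast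
    obtain c1 where c1: "c1 > 0" "\<And>u. u \<in> {0..1} \<Longrightarrow> \<bar>u - s\<bar> < c1 \<Longrightarrow> dist (\<phi> u) (\<phi> s) < d"
      using solution_near[OF \<phi> s(1) d(1)] by metis
    obtain c2 where c2: "c2 > 0" "\<And>u. u \<in> {0..1} \<Longrightarrow> \<bar>u - s\<bar> < c2 \<Longrightarrow> dist (\<psi> u) (\<psi> s) < d"
      using solution_near[OF \<psi> s(1) d(1)] by metis
    define c where "c = min c1 c2"
    define a where "a = max 0 (s - c/2)"
    define b where "b = min 1 (s + c/2)"
    have c0: "c > 0" using c1 c2 by (simp add: c_def)
    have ab: "{a..b} \<subseteq> {0..1}" "s \<in> {a..b}" using s c0 by (auto simp: a_def b_def)
    have "\<phi> u - \<psi> u = 0" if u: "u \<in> {a..b}" for u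
    proof (rule gronwall_diff_vanish[of a b "\<lambda>u. \<phi> u - \<psi> u" "\<lambda>u. G (\<phi> u) - G (\<psi> u)" L s])
      fix v assume v: "v \<in> {a..b}"
      then have v1: "v \<in> {0..1}" using ab by auto
      show "((\<lambda>u. \<phi> u - \<psi> u) has_vector_derivative G (\<phi> v) - G (\<psi> v)) (at v within {a..b})"
        using \<phi> \<psi> v1 ab(1) by (intro has_vector_derivative_diff has_vector_derivative_within_subset[OF _ ab(1)])
          (auto simp: solution_def)
      have "\<bar>v - s\<bar> < c" using v c0 by (auto simp: a_def b_def)
      then have "\<phi> v \<in> R \<inter> ball (\<phi> s) d" "\<psi> v \<in> R \<inter> ball (\<phi> s) d"
        using c1(2)[OF v1] c2(2)[OF v1] inR[OF v1] s(2) by (auto simp: c_def dist_commute)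
      then show "norm (G (\<phi> v) - G (\<psi> v)) \<le> L * norm (\<phi> v - \<psi> v)"
        using lipschitz_onD[OF d(2)] by (simp add: dist_norm)
    qed (use ab s u in auto)
    moreover have "u \<in> {a..b}" if "u \<in> {0..1}" "\<bar>u - s\<bar> < c/2" for u
      using that by (auto simp: a_def b_def abs_if split: if_splits)
    ultimately show "\<exists>d>0. \<forall>u\<in>{0..1}. \<bar>u - s\<bar> < d \<longrightarrow> u \<in> {t \<in> {0..1}. \<phi> t = \<psi> t}"
      using c0 by (intro exI[of _ "c/2"]) auto
  next
    fix s :: real assume s: "s \<in> {0..1} - {t \<in> {0..1}. \<phi> t = \<psi> t}"
    define d where "d = dist (\<phi> s) (\<psi> s)"
    have d: "d > 0" using s by (simp add: d_def)
    obtain c1 where c1: "c1 > 0" "\<And>u. u \<in> {0..1} \<Longrightarrow> \<bar>u - s\<bar> < c1 \<Longrightarrow> dist (\<phi> u) (\<phi> s) < d/2"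
      using solution_near[OF \<phi>, of s "d/2"] s d by (metis DiffD1 half_gt_zero)
    obtain c2 where c2: "c2 > 0" "\<And>u. u \<in> {0..1} \<Longrightarrow> \<bar>u - s\<bar> < c2 \<Longrightarrow> dist (\<psi> u) (\<psi> s) < d/2"
      using solution_near[OF \<psi>, of s "d/2"] s d by (metis DiffD1 half_gt_zero)
    have "\<phi> u \<noteq> \<psi> u" if "u \<in> {0..1}" "\<bar>u - s\<bar> < min c1 c2" for u
    proof
      assume "\<phi> u = \<psi> u"
      then have "d \<le> dist (\<phi> u) (\<phi> s) + dist (\<psi> u) (\<psi> s)"
        unfolding d_def by (metis dist_commute dist_triangle)
      with c1(2)[of u] c2(2)[of u] that show False by simp
    qed
    then show "\<exists>d>0. \<forall>u\<in>{0..1}. \<bar>u - s\<bar> < d \<longrightarrow> u \<notin> {t \<in> {0..1}. \<phi> t = \<psi> t}"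
      using c1 c2 by (intro exI[of _ "min c1 c2"]) auto
  qed (use eq t in auto)
  then show ?thesis by simp
qed

lemma flow_exists:
  obtains \<Phi> where "\<And>x. x \<in> F \<Longrightarrow> solution (\<Phi> x)" "\<And>x. x \<in> F \<Longrightarrow> \<Phi> x 0 = x"
    "\<And>t. t \<in> {0..1} \<Longrightarrow> continuous_on F (\<lambda>x. \<Phi> x t)"
proof (cases "F = {}")
  case True
  then show thesis using that by auto
next
  case False
  then obtain x0 where "x0 \<in> F" by auto
  then have M: "M \<ge> 0" using bounded_G norm_ge_zero order_trans by blast
  \<comment> \<open>Approximate solutions leave F, so the field is extended to the whole space;
    Dugundji's theorem keeps its values in the ball of radius M.\<close>
  obtain H where H: "continuous_on UNIV H" "range H \<subseteq> cball 0 M" "\<And>x. x \<in> F \<Longrightarrow> H x = G x"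
  proof (rule Dugundji[of "cball 0 M" UNIV F G])
    show "closedin (top_of_set UNIV) F" using closed_F by simp
    show "G ` F \<subseteq> cball 0 M" using bounded_G by auto
  qed (use M cont_G in auto)
  have HM: "norm (H x) \<le> M" for x using H(2) by (auto simp: image_subset_iff)
  have "viable F H" using viable_F H(3) by (simp add: viable_def)
  then have "\<exists>\<phi>. solution \<phi> \<and> \<phi> 0 = x" if "x \<in> F" for x
    using viable_solution_exists[OF closed_F H(1) HM _ that] H(3) unfolding solution_def by metis
  then obtain \<Phi> where \<Phi>: "\<And>x. x \<in> F \<Longrightarrow> solution (\<Phi> x)" "\<And>x. x \<in> F \<Longrightarrow> \<Phi> x 0 = x" by metis
  have app: "approx_solution H x 0 1 \<phi>" if "solution \<phi>" "\<phi> 0 = x" for \<phi> x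
  proof -
    have "((\<lambda>r. H (\<phi> r)) has_integral (\<phi> t - \<phi> s)) {s..t}" if "0 \<le> s" "s \<le> t" "t \<le> 1" for s t
    proof (rule fundamental_theorem_of_calculus[OF \<open>s \<le> t\<close>])
      fix r assume r: "r \<in> {s..t}"
      then have "r \<in> {0..1}" using that by auto
      then have "\<phi> r \<in> F" "(\<phi> has_vector_derivative G (\<phi> r)) (at r within {0..1})"
        using \<open>solution \<phi>\<close> unfolding solution_def by blast+
      then show "(\<phi> has_vector_derivative H (\<phi> r)) (at r within {s..t})"
        using that r by (auto simp: H(3) intro: has_vector_derivative_within_subset)
    qed
    then have "\<phi> t - \<phi> s = integral {s..t} (\<lambda>r. H (\<phi> r))" if "0 \<le> s" "s \<le> t" "t \<le> 1" for s t
      using that integral_unique by metis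
    then show ?thesis using that solution_continuous[OF that(1)]
      unfolding approx_solution_def by auto
  qed
  have cont: "continuous_on F (\<lambda>x. \<Phi> x t)" if t: "t \<in> {0..1}" for t
    unfolding continuous_on_sequentially
  proof (intro allI ballI impI, elim conjE)
    fix x a assume a: "a \<in> F" and x: "\<forall>n. x n \<in> F" "x \<longlonglongrightarrow> a"
    show "((\<lambda>x. \<Phi> x t) \<circ> x) \<longlonglongrightarrow> \<Phi> a t"
    proof (rule ccontr)
      assume "\<not> ((\<lambda>x. \<Phi> x t) \<circ> x) \<longlonglongrightarrow> \<Phi> a t"
      then obtain e where e: "e > 0" "\<not> (\<exists>N. \<forall>n\<ge>N. dist (\<Phi> (x n) t) (\<Phi> a t) < e)"
        unfolding lim_sequentially by auto
      then have "\<exists>\<^sub>\<infinity>n. dist (\<Phi> (x n) t) (\<Phi> a t) \<ge> e"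
        unfolding INFM_nat_le by (meson not_less)
      then have inf: "infinite {n. dist (\<Phi> (x n) t) (\<Phi> a t) \<ge> e}" by (simp add: frequently_cofinite)
      define u where "u = enumerate {n. dist (\<Phi> (x n) t) (\<Phi> a t) \<ge> e}"
      have u: "strict_mono u" "\<And>n. dist (\<Phi> (x (u n)) t) (\<Phi> a t) \<ge> e"
        using strict_mono_enumerate[OF inf] enumerate_in_set[OF inf] by (auto simp: u_def)
      have xu: "(\<lambda>n. x (u n)) \<longlonglongrightarrow> a" using LIMSEQ_subseq_LIMSEQ[OF x(2) u(1)] by (simp add: o_def)
      \<comment> \<open>Exact solutions are approximate ones with defect 0, so the compactness lemma
        applies to the offending subsequence. Its limit is a solution starting at a, hence equal to
        \<open>\<Phi> a\<close> by uniqueness, which contradicts the distance e.\<close>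
      have ap: "approx_solution H (x (u n)) ((\<lambda>_. 0) n) 1 (\<Phi> (x (u n)))" for n
        using app \<Phi> x(1) by simp
      obtain \<psi> r where \<psi>: "strict_mono (r::nat \<Rightarrow> nat)" "\<psi> 0 = a" "continuous_on {0..1} \<psi>"
        "\<And>t. t \<in> {0..1} \<Longrightarrow> (\<psi> has_vector_derivative H (\<psi> t)) (at t within {0..1})"
        "\<And>t. t \<in> {0..1} \<Longrightarrow> (\<lambda>n. \<Phi> (x (u (r n))) t) \<longlonglongrightarrow> \<psi> t"
        by (rule approx_solution_limit[OF H(1) HM ap xu]) auto
      have "\<psi> s \<in> F" if s: "s \<in> {0..1}" for s
      proof (rule closed_sequentially[OF closed_F _ \<psi>(5)[OF s]])
        show "\<Phi> (x (u (r n))) s \<in> F" for n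
          using \<Phi>(1)[of "x (u (r n))"] x(1) s unfolding solution_def by blast
      qed
      then have "solution \<psi>" using \<psi>(4) H(3) by (auto simp: solution_def)
      then have "\<psi> t = \<Phi> a t" using solution_unique[of \<psi> "\<Phi> a" t] \<Phi> a \<psi>(2) t by auto
      with \<psi>(5)[OF t] have "(\<lambda>n. \<Phi> (x (u (r n))) t) \<longlonglongrightarrow> \<Phi> a t" by simp
      then obtain N where "\<forall>n\<ge>N. dist (\<Phi> (x (u (r n))) t) (\<Phi> a t) < e"
        using e(1) unfolding lim_sequentially by blast
      then have "dist (\<Phi> (x (u (r N))) t) (\<Phi> a t) < e" by simp
      with u(2)[of "r N"] show False by simp
    qed
  qed
  show thesis by (rule that[OF \<Phi> cont])
qed

end

section \<open>Gluing locally Lipschitz maps\<close>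

text \<open>The cover need not be locally finite: a countable subcover with rapidly decreasing weights is enough, because
  the values of infinite convex combinations stay in closed convex sets.\<close>

lemma locally_finite_free_gluing:
  fixes \<sigma> :: "'a::euclidean_space \<Rightarrow> 'a \<Rightarrow> 'b::euclidean_space"
  assumes r: "\<And>x. x \<in> S \<Longrightarrow> r x > 0"
    and lip: "\<And>x. x \<in> S \<Longrightarrow> \<exists>L. L-lipschitz_on (S \<inter> ball x (r x)) (\<sigma> x)"
  obtains \<eta> where "\<And>x. x \<in> S \<Longrightarrow> \<exists>d>0. \<exists>L. L-lipschitz_on (S \<inter> ball x d) \<eta>"
    "\<And>x C. x \<in> S \<Longrightarrow> closed C \<Longrightarrow> convex C \<Longrightarrow>
       (\<And>z. z \<in> S \<Longrightarrow> x \<in> ball z (r z) \<Longrightarrow> \<sigma> z x \<in> C) \<Longrightarrow> \<eta> x \<in> C"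
proof (cases "S = {}")
  case True then show thesis using that by blast
next
  case False
  have "\<exists>X\<subseteq>S. countable X \<and> S \<subseteq> (\<Union>x\<in>X. ball x (r x))"
  proof -
    obtain F where F: "F \<subseteq> (\<lambda>x. ball x (r x)) ` S" "countable F" "\<Union>F = \<Union>((\<lambda>x. ball x (r x)) ` S)"
      using Lindelof[of "(\<lambda>x. ball x (r x)) ` S"] by auto
    then obtain X where "X \<subseteq> S" "countable X" "F = (\<lambda>x. ball x (r x)) ` X"
      using countable_subset_image[of F "\<lambda>x. ball x (r x)" S] by auto
    moreover have "S \<subseteq> (\<Union>x\<in>S. ball x (r x))" using r by force
    ultimately show ?thesis using F(3) by (intro exI[of _ X]) simp
  qed
  then obtain X where X: "X \<subseteq> S" "countable X" "S \<subseteq> (\<Union>x\<in>X. ball x (r x))" by blast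
  have Xne: "X \<noteq> {}" using X(3) False by auto
  define z where "z = from_nat_into X"
  have zS: "z n \<in> S" for n using from_nat_into[OF Xne] X by (auto simp: z_def)
  have zcov: "\<exists>n. x \<in> ball (z n) (r (z n))" if "x \<in> S" for x
    using X that from_nat_into_surj[OF X(2)] unfolding z_def by (metis UN_E subsetD)
  define \<rho> where "\<rho> n = r (z n)" for n
  have \<rho>: "\<rho> n > 0" for n using r zS by (simp add: \<rho>_def)
  have "\<exists>L M. 0 \<le> L \<and> 0 \<le> M \<and> L-lipschitz_on (S \<inter> ball (z n) (\<rho> n)) (\<sigma> (z n)) \<and>
     (\<forall>x\<in>S \<inter> ball (z n) (\<rho> n). norm (\<sigma> (z n) x) \<le> M)" for n
  proof -
    obtain L where L: "L-lipschitz_on (S \<inter> ball (z n) (\<rho> n)) (\<sigma> (z n))" using lip[OF zS] by (auto simp: \<rho>_def)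
    have "norm (\<sigma> (z n) x) \<le> norm (\<sigma> (z n) (z n)) + L * \<rho> n" if x: "x \<in> S \<inter> ball (z n) (\<rho> n)" for x
    proof -
      have "dist (\<sigma> (z n) x) (\<sigma> (z n) (z n)) \<le> L * dist x (z n)"
        using x zS \<rho> by (intro lipschitz_onD[OF L]) auto
      also have "\<dots> \<le> L * \<rho> n" using x lipschitz_on_nonneg[OF L] by (intro mult_left_mono) (auto simp: dist_commute)
      finally show ?thesis by (simp add: dist_norm norm_diff_triangle_le) (smt (verit) norm_triangle_sub)
    qed
    then show ?thesis using L lipschitz_on_nonneg[OF L] \<rho>[of n]
      by (intro exI[of _ L] exI[of _ "norm (\<sigma> (z n) (z n)) + L * \<rho> n"]) (auto intro!: add_nonneg_nonneg)
  qed
  then obtain L M where LM: "\<And>n. 0 \<le> L n" "\<And>n. 0 \<le> M n"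
    "\<And>n. (L n)-lipschitz_on (S \<inter> ball (z n) (\<rho> n)) (\<sigma> (z n))"
    "\<And>n x. x \<in> S \<inter> ball (z n) (\<rho> n) \<Longrightarrow> norm (\<sigma> (z n) x) \<le> M n" by metis
  \<comment> \<open>With this weight the n-th bump and the n-th weighted section, together with
    their Lipschitz constants, are at most (1/2)^n, so the two series converge and have Lipschitz
    constant 2.\<close>
  define w where "w n = (1/2)^n / ((1 + \<rho> n) * (1 + M n + L n))" for n
  have w0: "w n > 0" for n using \<rho>[of n] LM(1,2)[of n] by (simp add: w_def)
  have wle: "w n * c \<le> (1/2)^n" if "c \<le> (1 + \<rho> n) * (1 + M n + L n)" for n c
  proof -
    have p: "(1 + \<rho> n) * (1 + M n + L n) > 0" using \<rho>[of n] LM(1,2)[of n] by (intro mult_pos_pos) auto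
    have "w n * c \<le> w n * ((1 + \<rho> n) * (1 + M n + L n))" using that w0[of n] by (intro mult_left_mono) auto
    moreover have "w n * ((1 + \<rho> n) * (1 + M n + L n)) = (1/2)^n"
      unfolding w_def using p by (metis nonzero_eq_divide_eq less_irrefl)
    ultimately show ?thesis by simp
  qed
  define b where "b n x = max 0 (\<rho> n - dist x (z n))" for n x
  have b0: "b n x \<ge> 0" "b n x \<le> \<rho> n" for n x using \<rho>[of n] by (auto simp: b_def)
  have bpos: "b n x > 0 \<longleftrightarrow> x \<in> ball (z n) (\<rho> n)" for n x by (auto simp: b_def dist_commute)
  have blip: "\<bar>b n x - b n y\<bar> \<le> dist x y" for n x y
    using dist_triangle[of x "z n" y] dist_triangle[of y "z n" x] by (auto simp: b_def max_def dist_commute)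
  define f where "f n x = (w n * b n x) *\<^sub>R \<sigma> (z n) x" for n x
  define N where "N x = (\<Sum>n. f n x)" for x
  define D where "D x = (\<Sum>n. w n * b n x)" for x
  have sum2: "summable (\<lambda>n. (1/2)^n :: real)" "(\<Sum>n. (1/2)^n) = (2::real)"
    by (auto simp: suminf_geometric)
  have wb: "w n * b n x \<le> (1/2)^n" for n x
  proof (rule wle)
    have "b n x \<le> 1 + \<rho> n" using b0[where n=n and x=x] by linarith
    also have "\<dots> = (1 + \<rho> n) * 1" by simp
    also have "\<dots> \<le> (1 + \<rho> n) * (1 + M n + L n)" using \<rho>[of n] LM(1,2)[of n] by (intro mult_left_mono) auto
    finally show "b n x \<le> (1 + \<rho> n) * (1 + M n + L n)" .
  qed
  have sD: "summable (\<lambda>n. w n * b n x)" for x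
    by (rule summable_comparison_test'[OF sum2(1)]) (use wb w0 b0 in \<open>auto simp: less_imp_le\<close>)
  have nf: "norm (f n x) \<le> (1/2)^n" if "x \<in> S" for n x
  proof (cases "b n x > 0")
    case True
    then have "norm (\<sigma> (z n) x) \<le> M n" using that LM(4) bpos by auto
    then have "b n x * norm (\<sigma> (z n) x) \<le> \<rho> n * M n" using b0[where n=n and x=x] LM(2)[of n] by (intro mult_mono) auto
    also have "\<dots> \<le> (1 + \<rho> n) * (1 + M n + L n)" using \<rho>[of n] LM(1,2)[of n] by (intro mult_mono) auto
    finally have "w n * (b n x * norm (\<sigma> (z n) x)) \<le> (1/2)^n" by (rule wle)
    then show ?thesis using w0[of n] b0[where n=n and x=x] by (simp add: f_def mult.assoc)
  next
    case False
    then have "b n x = 0" using b0(1)[where n=n and x=x] by linarith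
    then show ?thesis by (simp add: f_def)
  qed
  have sN: "summable (\<lambda>n. norm (f n x))" if "x \<in> S" for x
    by (rule summable_comparison_test'[OF sum2(1)]) (use nf[OF that] in auto)
  have Dpos: "D x > 0" if xS: "x \<in> S" for x
  proof -
    obtain n where "x \<in> ball (z n) (\<rho> n)" using zcov[OF xS] by (auto simp: \<rho>_def)
    then have "w n * b n x > 0" using w0 bpos by auto
    then show ?thesis unfolding D_def using w0 b0 by (intro suminf_pos2[OF sD]) (auto simp: less_imp_le)
  qed
  have Dlip: "\<bar>D x - D y\<bar> \<le> 2 * dist x y" for x y
  proof -
    have "D x - D y = (\<Sum>n. w n * b n x - w n * b n y)" unfolding D_def by (intro suminf_diff sD)
    also have "norm \<dots> \<le> (\<Sum>n. (1/2)^n * dist x y)"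
    proof (rule norm_suminf_le)
      fix n
      have "norm (w n * b n x - w n * b n y) = w n * \<bar>b n x - b n y\<bar>"
        using w0[of n] by (simp add: abs_mult flip: right_diff_distrib)
      also have "\<dots> \<le> w n * dist x y" using w0[of n] blip by (intro mult_left_mono) (auto simp: less_imp_le)
      also have "\<dots> \<le> (1/2)^n * dist x y"
      proof (rule mult_right_mono)
        have "1 * 1 \<le> (1 + \<rho> n) * (1 + M n + L n)" using \<rho>[of n] LM(1,2)[of n] by (intro mult_mono) auto
        then show "w n \<le> (1/2)^n" using wle[of 1 n] by simp
      qed simp
      finally show "norm (w n * b n x - w n * b n y) \<le> (1/2)^n * dist x y" .
    qed (intro summable_mult2 sum2)
    also have "\<dots> = 2 * dist x y" using suminf_mult2[OF sum2(1)] sum2(2) by metis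
    finally show ?thesis by simp
  qed
  have flip: "norm (f n x - f n y) \<le> (1/2)^n * dist x y" if xy: "x \<in> S" "y \<in> S" for n x y
  proof -
    have main: "norm (b n x *\<^sub>R \<sigma> (z n) x - b n y *\<^sub>R \<sigma> (z n) y) \<le> (M n + \<rho> n * L n) * dist x y"
      if xy: "x \<in> S" "y \<in> S" "b n x > 0" for x y
    proof (cases "b n y > 0")
      case True
      have mem: "x \<in> S \<inter> ball (z n) (\<rho> n)" "y \<in> S \<inter> ball (z n) (\<rho> n)" using True xy bpos by auto
      have "b n x *\<^sub>R \<sigma> (z n) x - b n y *\<^sub>R \<sigma> (z n) y = (b n x - b n y) *\<^sub>R \<sigma> (z n) x + b n y *\<^sub>R (\<sigma> (z n) x - \<sigma> (z n) y)"
        by (simp add: algebra_simps)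
      also have "norm \<dots> \<le> norm ((b n x - b n y) *\<^sub>R \<sigma> (z n) x) + norm (b n y *\<^sub>R (\<sigma> (z n) x - \<sigma> (z n) y))" by (rule norm_triangle_ineq)
      also have "norm ((b n x - b n y) *\<^sub>R \<sigma> (z n) x) \<le> dist x y * M n"
        using blip[of n x y] LM(4)[OF mem(1)] by (auto intro!: mult_mono)
      also have "norm (b n y *\<^sub>R (\<sigma> (z n) x - \<sigma> (z n) y)) \<le> \<rho> n * (L n * dist x y)"
        using b0[of n y] lipschitz_onD[OF LM(3) mem] \<rho>[of n] by (auto intro!: mult_mono simp: dist_norm)
      finally show ?thesis by (simp add: algebra_simps)
    next
      case False
      \<comment> \<open>Outside the ball nothing is known of \<open>\<sigma> (z n) y\<close>, but
        its coefficient vanishes, and b n x = b n x - b n y is at most the distance of x and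
        y.\<close>
      then have by0: "b n y = 0" using b0(1)[of n y] by linarith
      have "norm (b n x *\<^sub>R \<sigma> (z n) x) \<le> dist x y * M n"
        using blip[of n x y] by0 LM(4)[of x n] xy bpos[of n x] by (simp add: mult_mono)
      also have "\<dots> \<le> (M n + \<rho> n * L n) * dist x y" using \<rho>[of n] LM(1)[of n] by (simp add: algebra_simps)
      finally show ?thesis by (simp add: by0)
    qed
    have "norm (b n x *\<^sub>R \<sigma> (z n) x - b n y *\<^sub>R \<sigma> (z n) y) \<le> (M n + \<rho> n * L n) * dist x y"
    proof (cases "b n x > 0 \<or> b n y > 0")
      case True then show ?thesis using main[of x y] main[of y x] xy by (auto simp: norm_minus_commute dist_commute)
    next
      case False
      then have "b n x = 0" "b n y = 0" using b0(1)[where n=n and x=x] b0(1)[of n y] by linarith+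
      then show ?thesis using LM(1,2)[of n] \<rho>[of n] by simp
    qed
    then have "w n * norm (b n x *\<^sub>R \<sigma> (z n) x - b n y *\<^sub>R \<sigma> (z n) y) \<le> w n * ((M n + \<rho> n * L n) * dist x y)"
      using w0[of n] by (intro mult_left_mono) auto
    moreover have "f n x - f n y = w n *\<^sub>R (b n x *\<^sub>R \<sigma> (z n) x - b n y *\<^sub>R \<sigma> (z n) y)"
      by (simp add: f_def algebra_simps)
    ultimately have "norm (f n x - f n y) \<le> (w n * (M n + \<rho> n * L n)) * dist x y" using w0[of n] by (simp add: mult.assoc)
    also have "\<dots> \<le> (1/2)^n * dist x y"
    proof (rule mult_right_mono)
      show "w n * (M n + \<rho> n * L n) \<le> (1/2)^n"
        by (rule wle) (use \<rho>[of n] LM(1,2)[of n] in \<open>auto simp: algebra_simps\<close>)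
    qed simp
    finally show ?thesis .
  qed
  have Nlip: "norm (N x - N y) \<le> 2 * dist x y" if "x \<in> S" "y \<in> S" for x y
  proof -
    have "N x - N y = (\<Sum>n. f n x - f n y)"
      unfolding N_def by (intro suminf_diff summable_norm_cancel[OF sN] that)
    also have "norm \<dots> \<le> (\<Sum>n. (1/2)^n * dist x y)"
      by (rule norm_suminf_le) (use flip that in \<open>auto intro!: summable_mult2 sum2\<close>)
    also have "\<dots> = 2 * dist x y" using suminf_mult2[OF sum2(1)] sum2(2) by metis
    finally show ?thesis .
  qed
  have Nbd: "norm (N x) \<le> 2" if "x \<in> S" for x
    unfolding N_def using norm_suminf_le[OF nf[OF that] sum2(1)] sum2(2) by simp
  define \<eta> where "\<eta> x = (1 / D x) *\<^sub>R N x" for x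
  show thesis
  proof (rule that)
    fix x assume x: "x \<in> S"
    \<comment> \<open>D has Lipschitz constant 2, so on this ball it stays above D x / 2 and the
      quotient is Lipschitz.\<close>
    define d where "d = D x / 4"
    have d0: "d > 0" using Dpos[OF x] by (simp add: d_def)
    have Dge: "D y \<ge> D x / 2" if "y \<in> ball x d" for y
      using Dlip[of x y] that by (auto simp: d_def abs_le_iff)
    have "(4 / D x + 16 / (D x)\<^sup>2)-lipschitz_on (S \<inter> ball x d) \<eta>"
    proof (rule lipschitz_onI)
      fix y y' assume y: "y \<in> S \<inter> ball x d" and y': "y' \<in> S \<inter> ball x d"
      have Dy: "D y \<ge> D x / 2" "D y' \<ge> D x / 2" "D y > 0" "D y' > 0" "D x > 0" using Dge y y' Dpos x by auto
      have "\<eta> y - \<eta> y' = (1 / D y) *\<^sub>R (N y - N y') + (1 / D y - 1 / D y') *\<^sub>R N y'"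
        by (simp add: \<eta>_def algebra_simps)
      also have "norm \<dots> \<le> norm ((1 / D y) *\<^sub>R (N y - N y')) + norm ((1 / D y - 1 / D y') *\<^sub>R N y')" by (rule norm_triangle_ineq)
      also have "norm ((1 / D y) *\<^sub>R (N y - N y')) \<le> (2 / D x) * (2 * dist y y')"
      proof -
        have "1 / D y \<le> 2 / D x" using Dy by (simp add: field_simps)
        moreover have "norm (N y - N y') \<le> 2 * dist y y'" using Nlip y y' by auto
        ultimately have "1 / D y * norm (N y - N y') \<le> (2 / D x) * (2 * dist y y')"
          using Dy by (intro mult_mono) auto
        then show ?thesis using Dy by simp
      qed
      also have "norm ((1 / D y - 1 / D y') *\<^sub>R N y') \<le> (8 / (D x)\<^sup>2 * dist y y') * 2"
      proof -
        have "\<bar>1 / D y - 1 / D y'\<bar> = \<bar>D y' - D y\<bar> * (1 / (D y * D y'))" using Dy by (simp add: field_simps abs_mult)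
        also have "\<dots> \<le> (2 * dist y y') * (1 / ((D x / 2) * (D x / 2)))"
          using Dlip[of y' y] Dy by (intro mult_mono divide_left_mono) (auto simp: dist_commute)
        also have "\<dots> = 8 / (D x)\<^sup>2 * dist y y'" by (simp add: power2_eq_square)
        finally have "\<bar>1 / D y - 1 / D y'\<bar> * norm (N y') \<le> (8 / (D x)\<^sup>2 * dist y y') * 2"
          using Nbd[of y'] y' by (intro mult_mono) auto
        then show ?thesis by simp
      qed
      finally show "dist (\<eta> y) (\<eta> y') \<le> (4 / D x + 16 / (D x)\<^sup>2) * dist y y'" by (simp add: dist_norm algebra_simps)
    qed (use Dpos[OF x] in auto)
    then show "\<exists>d>0. \<exists>L. L-lipschitz_on (S \<inter> ball x d) \<eta>" using d0 by blast
  next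
    fix x C assume x: "x \<in> S" and C: "closed C" "convex C"
      and mem: "\<And>z. z \<in> S \<Longrightarrow> x \<in> ball z (r z) \<Longrightarrow> \<sigma> z x \<in> C"
    \<comment> \<open>Renormalized partial sums are genuine finite convex combinations of values in
      C; their limit stays in C because C is closed.\<close>
    define DK where "DK K = (\<Sum>n<K. w n * b n x)" for K
    define NK where "NK K = (\<Sum>n<K. f n x)" for K
    have lD: "DK \<longlonglongrightarrow> D x" unfolding DK_def D_def using sD[of x] by (rule summable_LIMSEQ)
    have lN: "NK \<longlonglongrightarrow> N x" unfolding NK_def N_def using summable_norm_cancel[OF sN[OF x]] by (rule summable_LIMSEQ)
    have ev: "eventually (\<lambda>K. DK K > 0) sequentially" using lD Dpos[OF x] by (rule order_tendstoD(1))
    have lq: "(\<lambda>K. (1 / DK K) *\<^sub>R NK K) \<longlonglongrightarrow> \<eta> x" unfolding \<eta>_def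
      using Dpos[OF x] by (intro tendsto_intros lD lN) auto
    have "eventually (\<lambda>K. (1 / DK K) *\<^sub>R NK K \<in> C) sequentially"
    proof (rule eventually_mono[OF ev])
      fix K assume K: "DK K > 0"
      define I where "I = {n \<in> {..<K}. b n x > 0}"
      have z0: "b n x = 0" if "n \<in> {..<K} - I" for n
        using that b0(1)[where n=n and x=x] by (auto simp: I_def not_less)
      have DI: "DK K = (\<Sum>n\<in>I. w n * b n x)" unfolding DK_def
        by (rule sum.mono_neutral_right) (use z0 in \<open>auto simp: I_def\<close>)
      have NI: "NK K = (\<Sum>n\<in>I. f n x)" unfolding NK_def
        by (rule sum.mono_neutral_right) (use z0 in \<open>auto simp: I_def f_def\<close>)
      have "(\<Sum>n\<in>I. (w n * b n x / DK K) *\<^sub>R \<sigma> (z n) x) \<in> C"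
      proof (rule convex_sum[OF _ C(2)])
        show "(\<Sum>n\<in>I. w n * b n x / DK K) = 1" using K DI by (simp flip: sum_divide_distrib)
        show "0 \<le> w n * b n x / DK K" for n using K w0[of n] b0(1)[where n=n and x=x] by (auto simp: less_imp_le)
        show "\<sigma> (z n) x \<in> C" if "n \<in> I" for n
          using that bpos zS by (intro mem) (auto simp: I_def \<rho>_def)
      qed (auto simp: I_def)
      also have "(\<Sum>n\<in>I. (w n * b n x / DK K) *\<^sub>R \<sigma> (z n) x) = (1 / DK K) *\<^sub>R NK K"
        by (simp add: NI f_def scaleR_sum_right)
      finally show "(1 / DK K) *\<^sub>R NK K \<in> C" .
    qed
    then show "\<eta> x \<in> C" by (rule Lim_in_closed_set[OF C(1) _ sequentially_bot lq])
  qed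
qed

section \<open>Strata in Hermitian space\<close>

text \<open>Antilinear in the second argument. Its real part is the Euclidean inner product, which
  links it to nearest points and distances.\<close>

definition cdot :: "complex^'n::finite \<Rightarrow> complex^'n \<Rightarrow> complex" where
  "cdot x y = (\<Sum>i\<in>UNIV. x $ i * cnj (y $ i))"

definition lform :: "complex^'n::finite \<Rightarrow> complex^'n \<Rightarrow> complex" where
  "lform a x = (\<Sum>i\<in>UNIV. a $ i * x $ i)"

lemma cdot_add_left: "cdot (x + y) z = cdot x z + cdot y z"
  by (simp add: cdot_def algebra_simps sum.distrib)

lemma cdot_add_right: "cdot z (x + y) = cdot z x + cdot z y"
  by (simp add: cdot_def algebra_simps sum.distrib)

lemma cdot_diff_left: "cdot (x - y) z = cdot x z - cdot y z"
  by (simp add: cdot_def algebra_simps sum_subtractf)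

lemma cdot_diff_right: "cdot z (x - y) = cdot z x - cdot z y"
  by (simp add: cdot_def algebra_simps sum_subtractf)

lemma cdot_scale_left: "cdot (c *s x) z = c * cdot x z"
  by (simp add: cdot_def sum_distrib_left mult.assoc)

lemma cdot_scale_right: "cdot z (c *s x) = cnj c * cdot z x"
  by (simp add: cdot_def sum_distrib_left mult_ac)

lemma cdot_zero [simp]: "cdot 0 z = 0" "cdot z 0 = 0"
  by (simp_all add: cdot_def)

lemma cdot_commute: "cdot y x = cnj (cdot x y)"
  by (simp add: cdot_def mult.commute)

lemma scaleR_vec_eq: "r *\<^sub>R (x :: complex^'n::finite) = of_real r *s x"
  by (simp add: vec_eq_iff scaleR_conv_of_real[where 'a=complex])

lemma cdot_scaleR_left: "cdot (r *\<^sub>R x) z = of_real r * cdot x z"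
  by (simp add: scaleR_vec_eq cdot_scale_left)

lemma cdot_scaleR_right: "cdot z (r *\<^sub>R x) = of_real r * cdot z x"
  by (simp add: scaleR_vec_eq cdot_scale_right)

lemma Re_cdot: "Re (cdot x y) = inner x y"
  by (simp add: cdot_def inner_vec_def inner_complex_def)

lemma cdot_self: "cdot x x = of_real ((norm x)\<^sup>2)"
proof -
  have "Im (cdot x x) = 0" by (simp add: cdot_def)
  moreover have "Re (cdot x x) = (norm x)\<^sup>2" by (simp add: Re_cdot power2_norm_eq_inner)
  ultimately show ?thesis by (simp add: complex_eq_iff)
qed

lemma norm_vec_scale: "norm (c *s (x :: complex^'n::finite)) = cmod c * norm x"
proof -
  have "(norm (c *s x))\<^sup>2 = (cmod c * norm x)\<^sup>2"
  proof -
    have "complex_of_real ((norm (c *s x))\<^sup>2) = of_real ((cmod c)\<^sup>2) * of_real ((norm x)\<^sup>2)"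
      unfolding cdot_self[symmetric]
      by (simp add: cdot_scale_left cdot_scale_right mult.commute) (metis complex_norm_square of_real_power)
    then show ?thesis by (metis of_real_eq_iff of_real_mult power_mult_distrib)
  qed
  then show ?thesis by (simp add: power2_eq_iff_nonneg)
qed

lemma norm_cdot_le: "cmod (cdot x y) \<le> norm x * norm y"
proof (cases "cdot x y = 0")
  case False
  define c where "c = cnj (cdot x y) / of_real (cmod (cdot x y))"
  have c: "cmod c = 1" using False by (simp add: c_def norm_divide)
  have "cdot (c *s x) y = of_real (cmod (cdot x y))"
    using False by (simp add: cdot_scale_left c_def mult.commute complex_norm_square[symmetric] power2_eq_square)

  then have "cmod (cdot x y) = inner (c *s x) y" by (metis Re_cdot Re_complex_of_real)
  also have "\<dots> \<le> norm (c *s x) * norm y" by (rule norm_cauchy_schwarz)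
  finally show ?thesis by (simp add: norm_vec_scale c)
qed simp

lemma abs_inner_le_cdot: "\<bar>inner x y\<bar> \<le> cmod (cdot x y)"
  by (metis Re_cdot abs_Re_le_cmod)

lemma lform_cdot: "lform a x = cdot x (\<chi> i. cnj (a $ i))"
  by (simp add: lform_def cdot_def mult.commute)

lemma norm_lform_le: "cmod (lform a x) \<le> norm a * norm x"
proof -
  have "norm (\<chi> i. cnj (a $ i)) = norm a" by (simp add: norm_vec_def)
  then show ?thesis using norm_cdot_le[of x "\<chi> i. cnj (a $ i)"] by (simp add: lform_cdot mult.commute)
qed

lemma lform_add: "lform a (x + y) = lform a x + lform a y"
  by (simp add: lform_cdot cdot_add_left)
lemma lform_diff: "lform a (x - y) = lform a x - lform a y"
  by (simp add: lform_cdot cdot_diff_left)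
lemma lform_scale: "lform a (c *s x) = c * lform a x"
  by (simp add: lform_cdot cdot_scale_left)
lemma lform_scaleR: "lform a (r *\<^sub>R x) = of_real r * lform a x"
  by (simp add: lform_cdot cdot_scaleR_left)

lemma bounded_linear_lform: "bounded_linear (lform a)"
  by (rule bounded_linear_intro[where K="norm a"])
    (auto simp: lform_add lform_scaleR scaleR_conv_of_real[where 'a=complex] norm_lform_le mult.commute[of _ "norm a"])

lemma bounded_bilinear_cdot: "bounded_bilinear (cdot :: complex^'n::finite \<Rightarrow> _)"
  by (standard, auto simp: cdot_add_left cdot_add_right cdot_scaleR_left cdot_scaleR_right scaleR_conv_of_real[where 'a=complex]
      intro!: exI[of _ 1] norm_cdot_le)

lemma bounded_bilinear_vec_scale: "bounded_bilinear ((*s) :: complex \<Rightarrow> complex^'n::finite \<Rightarrow> _)"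
  by (standard, auto simp: vec_eq_iff algebra_simps norm_vec_scale intro!: exI[of _ 1])

lemma vec_subspace_imp_subspace: "vec.subspace (T :: (complex^'n::finite) set) \<Longrightarrow> subspace T"
  unfolding subspace_def vec.subspace_def by (simp add: scaleR_vec_eq)

lemma closed_vec_subspace: "vec.subspace (T :: (complex^'n::finite) set) \<Longrightarrow> closed T"
  by (intro closed_subspace vec_subspace_imp_subspace)

definition normal_to :: "(complex^'n::finite) set \<Rightarrow> complex^'n \<Rightarrow> bool" where
  "normal_to T v \<longleftrightarrow> (\<forall>t\<in>T. cdot t v = 0)"

text \<open>What is kept of a complex submanifold with Lipschitz tangent spaces.
  \<open>reach\<close> is Federer's positive reach in local form: chords leave the tangent space
  only to second order. \<open>nearest_normal\<close> asks for Hermitian orthogonality, which is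
  stronger than real orthogonality and fits complex tangent spaces. The family T is left abstract so
  that one family can serve several strata.\<close>

locale stratum =
  fixes R :: "(complex^'n::finite) set" and T :: "complex^'n \<Rightarrow> (complex^'n) set"
  assumes subspace_T: "\<And>x. x \<in> R \<Longrightarrow> vec.subspace (T x)"
    and loc_closed: "\<And>x. x \<in> R \<Longrightarrow> \<exists>d>0. closed (R \<inter> cball x d)"
    and reach: "\<And>y. y \<in> R \<Longrightarrow> \<exists>d>0. \<exists>K\<ge>0. \<forall>x\<in>R \<inter> ball y d. \<forall>x'\<in>R \<inter> ball y d. \<forall>v.
       normal_to (T x) v \<longrightarrow> cmod (cdot (x' - x) v) \<le> K * norm v * (norm (x' - x))\<^sup>2"
    and nearest_normal: "\<And>x y d. y \<in> R \<Longrightarrow> d > 0 \<Longrightarrow> (\<And>q. q \<in> R \<inter> ball y d \<Longrightarrow> dist x y \<le> dist x q) \<Longrightarrow>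
       normal_to (T y) (x - y)"
    and sections: "\<And>x t. x \<in> R \<Longrightarrow> t \<in> T x \<Longrightarrow> \<exists>d>0. \<exists>L \<sigma>. L-lipschitz_on (R \<inter> ball x d) \<sigma> \<and> \<sigma> x = t \<and>
       (\<forall>x'\<in>R \<inter> ball x d. \<sigma> x' \<in> T x')"
begin

text \<open>Local closedness gives a nearest point among the points of R near y. As x is within a
  third of that radius from y, points of R farther away cannot be nearer to x, so the minimum is
  global.\<close>

lemma foot_exists:
  assumes y: "y \<in> R" and e: "e > 0"
  obtains d where "d > 0" "d \<le> e" "\<And>x. x \<in> ball y d \<Longrightarrow>
    \<exists>q\<in>R \<inter> ball y e. normal_to (T q) (x - q) \<and> dist x q = infdist x R"
proof -
  obtain d0 where d0: "d0 > 0" "closed (R \<inter> cball y d0)" using loc_closed[OF y] by blast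
  define d where "d = min d0 e / 3"
  have d: "d > 0" "3 * d \<le> d0" "3 * d \<le> e" using d0 e by (auto simp: d_def)
  have "\<exists>q\<in>R \<inter> ball y e. normal_to (T q) (x - q) \<and> dist x q = infdist x R" if x: "x \<in> ball y d" for x
  proof -
    have "compact (R \<inter> cball y d0)" using d0(2) by (metis bounded_Int bounded_cball compact_eq_bounded_closed)
    moreover have ne: "R \<inter> cball y d0 \<noteq> {}" using y d0(1) by auto
    ultimately obtain q where q: "q \<in> R \<inter> cball y d0" "\<And>z. z \<in> R \<inter> cball y d0 \<Longrightarrow> dist x q \<le> dist x z"
      using continuous_attains_inf[of "R \<inter> cball y d0" "dist x"] continuous_on_dist[OF continuous_on_const continuous_on_id]
      by metis
    have "dist x q \<le> dist x y" using q(2)[of y] y d0 by auto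
    then have xq: "dist x q < d" using x by (simp add: dist_commute)
    have yq: "dist y q < 2 * d" using xq x dist_triangle[of y q x] by (simp add: dist_commute)
    have glob: "dist x q \<le> dist x z" if z: "z \<in> R" for z
    proof (cases "z \<in> cball y d0")
      case True then show ?thesis using q(2) z by auto
    next
      case False
      then have "dist y z > d0" by simp
      then show ?thesis using dist_triangle[of y z x] x xq d by simp
    qed
    have "normal_to (T q) (x - q)" by (rule nearest_normal[of q 1 x]) (use q glob in auto)
    moreover have "dist x q = infdist x R"
    proof (rule antisym)
      have "R \<noteq> {}" using y by auto
      then show "dist x q \<le> infdist x R" using glob by (auto simp: infdist_notempty intro: cINF_greatest)
    qed (use q in \<open>auto intro: infdist_le\<close>)
    ultimately show ?thesis using q yq d by auto
  qed
  then show thesis using that[of d] d by auto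
qed

text \<open>|q' - q|^2 is the product of q' - q with x' - x and with the two normal vectors. On a
  ball of this radius \<open>reach\<close> makes each of the latter terms at most a quarter of |q' -
  q|^2, so half of the left side survives. With x = x' this is uniqueness of feet.\<close>

lemma foot_lipschitz:
  assumes y: "y \<in> R"
  obtains d where "d > 0" "\<And>x x' q q'. x \<in> ball y d \<Longrightarrow> x' \<in> ball y d \<Longrightarrow> q \<in> R \<inter> ball y d \<Longrightarrow> q' \<in> R \<inter> ball y d \<Longrightarrow>
    normal_to (T q) (x - q) \<Longrightarrow> normal_to (T q') (x' - q') \<Longrightarrow> dist q q' \<le> 2 * dist x x'"
proof -
  obtain d0 K where d0: "d0 > 0" "K \<ge> 0" "\<And>x x' v. x \<in> R \<inter> ball y d0 \<Longrightarrow> x' \<in> R \<inter> ball y d0 \<Longrightarrow>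
     normal_to (T x) v \<Longrightarrow> cmod (cdot (x' - x) v) \<le> K * norm v * (norm (x' - x))\<^sup>2"
    using reach[OF y] by metis
  define d where "d = min d0 (1 / (8 * (K + 1)))"
  have d: "d > 0" "d \<le> d0" "K * (2 * d) \<le> 1/4"
  proof -
    show "d > 0" "d \<le> d0" using d0 by (auto simp: d_def)
    have "K * (2 * d) \<le> (K + 1) * (2 * (1 / (8 * (K + 1))))"
      using d0(2) \<open>d > 0\<close> by (intro mult_mono) (auto simp: d_def)
    also have "\<dots> = 1/4" using d0(2) by (simp add: divide_simps)
    finally show "K * (2 * d) \<le> 1/4" .
  qed
  have "dist q q' \<le> 2 * dist x x'"
    if *: "x \<in> ball y d" "x' \<in> ball y d" "q \<in> R \<inter> ball y d" "q' \<in> R \<inter> ball y d"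
      "normal_to (T q) (x - q)" "normal_to (T q') (x' - q')" for x x' q q'
  proof -
    have est: "cmod (cdot (q' - q) (x - q)) \<le> 1/4 * (norm (q' - q))\<^sup>2"
      if *: "x \<in> ball y d" "q \<in> R \<inter> ball y d" "q' \<in> R \<inter> ball y d" "normal_to (T q) (x - q)" for x q q'
    proof -
      have "norm (x - q) \<le> 2 * d" using * dist_triangle[of x q y] by (auto simp: dist_norm norm_minus_commute)
      have "cmod (cdot (q' - q) (x - q)) \<le> K * norm (x - q) * (norm (q' - q))\<^sup>2" using * d by (intro d0(3)) auto
      also have "\<dots> \<le> K * (2 * d) * (norm (q' - q))\<^sup>2"
        using \<open>norm (x - q) \<le> 2 * d\<close> d0(2) by (intro mult_right_mono mult_left_mono) auto
      also have "\<dots> \<le> 1/4 * (norm (q' - q))\<^sup>2" using d(3) by (intro mult_right_mono) auto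
      finally show ?thesis .
    qed
    have a1: "cmod (cdot (q' - q) (x - q)) \<le> 1/4 * (norm (q' - q))\<^sup>2" using * by (intro est) auto
    have "cmod (cdot (q - q') (x' - q')) \<le> 1/4 * (norm (q - q'))\<^sup>2" using * by (intro est) auto
    moreover have "cdot (q' - q) (x' - q') = - cdot (q - q') (x' - q')" by (simp add: cdot_diff_left)
    ultimately have a2: "cmod (cdot (q' - q) (x' - q')) \<le> 1/4 * (norm (q' - q))\<^sup>2"
      by (simp add: norm_minus_commute)
    have a3: "cmod (cdot (q' - q) (x' - x)) \<le> norm (q' - q) * norm (x' - x)" by (rule norm_cdot_le)
    have "cdot (q' - q) (q' - q) = cdot (q' - q) (x' - x) + cdot (q' - q) (x - q) - cdot (q' - q) (x' - q')"
      by (simp add: cdot_diff_right)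
    then have "cmod (cdot (q' - q) (q' - q)) \<le> cmod (cdot (q' - q) (x' - x)) + cmod (cdot (q' - q) (x - q)) + cmod (cdot (q' - q) (x' - q'))"
      using norm_triangle_ineq4[of "cdot (q' - q) (x' - x) + cdot (q' - q) (x - q)" "cdot (q' - q) (x' - q')"]
        norm_triangle_ineq[of "cdot (q' - q) (x' - x)" "cdot (q' - q) (x - q)"] by simp
    then have "(norm (q' - q))\<^sup>2 \<le> norm (q' - q) * norm (x' - x) + 1/2 * (norm (q' - q))\<^sup>2"
      using a1 a2 a3 unfolding cdot_self norm_of_real abs_power2 by linarith
    then have "norm (q' - q) * norm (q' - q) \<le> norm (q' - q) * (2 * norm (x' - x))" by (simp add: power2_eq_square)
    then have "norm (q' - q) \<le> 2 * norm (x' - x)" by (cases "norm (q' - q) = 0") auto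
    then show ?thesis by (simp add: dist_norm norm_minus_commute)
  qed
  then show thesis using that d by blast
qed

end

text \<open>A tangent vector at \<open>x\<close> close to a given tangent vector at a nearby point of a lower stratum can be
  corrected along the radial direction \<open>x - y\<close>, which is almost tangent by condition (b).\<close>

lemma corrected_tangent_vector:
  fixes a x y t1 u1 w v :: "complex^'n::finite"
  assumes T: "vec.subspace T" and t1: "t1 \<in> T" "norm (t1 - w) \<le> e" and u1: "u1 \<in> T" "norm (u1 - (x - y)) \<le> e * norm (x - y)"
    and xy: "x \<noteq> y" and v: "cdot v (x - y) = 0" "norm (v - w) \<le> e" "lform a w = 1"
    and e: "0 < e" "e \<le> 1/2" "9 * norm a * e \<le> 1/2"
  obtains t where "t \<in> T" "lform a t = 1" "cdot t (x - y) = 0" "norm (t - v) \<le> (10 + 18 * norm a * (norm w + 9)) * e"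
proof -
  define N where "N = norm (x - y)"
  have N: "N > 0" using xy by (simp add: N_def)
  define s where "s = cdot t1 (x - y)"
  define p where "p = cdot u1 (x - y)"
  have "s = cdot (t1 - v) (x - y)" using v by (simp add: s_def cdot_diff_left)
  moreover have "norm (t1 - v) \<le> 2 * e" using t1 v(2) norm_triangle_ineq4[of "t1 - w" "v - w"] by simp
  ultimately have s: "cmod s \<le> 2 * e * N"
    using norm_cdot_le[of "t1 - v" "x - y"] N by (metis N_def mult_right_mono norm_ge_zero order_trans)
  have "cmod (p - of_real (N\<^sup>2)) = cmod (cdot (u1 - (x - y)) (x - y))" by (simp add: p_def N_def cdot_diff_left cdot_self)
  also have "\<dots> \<le> norm (u1 - (x - y)) * N" unfolding N_def by (rule norm_cdot_le)
  also have "\<dots> \<le> (e * N) * N" using u1 N by (intro mult_right_mono) (auto simp: N_def)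
  also have "\<dots> \<le> N\<^sup>2 / 2" using e N mult_right_mono[of e "1/2" "N * N"] by (simp add: power2_eq_square)
  finally have "cmod (p - of_real (N\<^sup>2)) \<le> N\<^sup>2 / 2" .
  then have p: "cmod p \<ge> N\<^sup>2 / 2"
    using norm_triangle_sub[of "complex_of_real (N\<^sup>2)" p] N by (simp add: norm_minus_commute norm_power)
  have p0: "p \<noteq> 0" using p N by auto
  have "norm u1 \<le> norm (u1 - (x - y)) + N" unfolding N_def by (metis norm_triangle_sub add.commute)
  then have nu1: "norm u1 \<le> 2 * N" using u1(2) e(2) N mult_right_mono[of e "1/2" N] unfolding N_def[symmetric] by linarith
  \<comment> \<open>Since u1 is almost x - y, its product p with x - y is at least half of |x -
    y|^2; subtracting a multiple of u1 makes t1 exactly orthogonal to x - y and moves it by at most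
    8 * e.\<close>
  define t2 where "t2 = t1 - (s / p) *s u1"
  have t2T: "t2 \<in> T" unfolding t2_def using T t1 u1 by (intro vec.subspace_diff vec.subspace_scale) auto
  have t2n: "cdot t2 (x - y) = 0" using p0 by (simp add: t2_def cdot_diff_left cdot_scale_left s_def p_def)
  have "norm (t2 - t1) = cmod s / cmod p * norm u1" by (simp add: t2_def norm_vec_scale norm_divide)
  also have "\<dots> \<le> (2 * e * N) / (N\<^sup>2 / 2) * (2 * N)"
    using s p nu1 N e by (intro mult_mono frac_le) auto
  also have "\<dots> = 8 * e" using N by (simp add: power2_eq_square field_simps)
  finally have t2w: "norm (t2 - w) \<le> 9 * e" using t1(2) norm_triangle_ineq[of "t2 - t1" "t1 - w"] by simp
  define l where "l = lform a t2"
  have "cmod (l - 1) = cmod (lform a (t2 - w))" using v(3) by (simp add: l_def lform_diff)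
  also have "\<dots> \<le> norm a * (9 * e)"
    by (rule order_trans[OF norm_lform_le mult_left_mono[OF t2w norm_ge_zero]])
  finally have l1: "cmod (l - 1) \<le> 9 * norm a * e" by simp
  then have l: "cmod l \<ge> 1/2" using e(3) norm_triangle_sub[of 1 l] by (simp add: norm_minus_commute)
  then have l0: "l \<noteq> 0" by auto
  \<comment> \<open>Rescaling restores the value 1 of the form and keeps orthogonality. Its cost is
    18 * norm a * e times a bound for t2; with the distances 9 * e and e of t2 and v from w this
    gives the constant of the statement.\<close>
  define t where "t = (1 / l) *s t2"
  have "norm (t - t2) = cmod (1 / l - 1) * norm t2"
    by (simp add: t_def flip: norm_vec_scale)
  also have "\<dots> \<le> (18 * norm a * e) * (norm w + 9)"
  proof (rule mult_mono)
    have "1 / l - 1 = (1 - l) / l" using l0 by (simp add: field_simps)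
    then have "cmod (1 / l - 1) = cmod (l - 1) / cmod l" by (simp add: norm_divide norm_minus_commute)
    also have "\<dots> \<le> (9 * norm a * e) / (1/2)" using l1 l e by (intro frac_le) auto
    finally show "cmod (1 / l - 1) \<le> 18 * norm a * e" by simp
    show "norm t2 \<le> norm w + 9" using t2w e norm_triangle_sub[of t2 w] by simp
  qed (use e in auto)
  finally have "norm (t - t2) \<le> (18 * norm a * e) * (norm w + 9)" .
  moreover have "norm (t - v) \<le> norm (t - t2) + (norm (t2 - w) + norm (v - w))"
    using norm_triangle_ineq[of "t - t2" "t2 - v"] norm_triangle_ineq4[of "t2 - w" "v - w"] by simp
  ultimately have "norm (t - v) \<le> (10 + 18 * norm a * (norm w + 9)) * e" using t2w v(2) by (simp add: algebra_simps)
  moreover have "t \<in> T" unfolding t_def using T t2T by (rule vec.subspace_scale)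
  moreover have "lform a t = 1" using l0 by (simp add: t_def lform_scale l_def)
  moreover have "cdot t (x - y) = 0" using t2n by (simp add: t_def cdot_scale_left)
  ultimately show thesis using that by blast
qed

section \<open>Controlled fields on Whitney stratified sets\<close>

text \<open>A Lipschitz section through t is divided by the value of the form on it, which is 1 at
  x.\<close>

lemma (in stratum) normalized_section:
  assumes x: "x \<in> R" and t: "t \<in> T x" "lform a t = 1" and e: "e > 0"
  obtains d L \<sigma> where "d > 0" "L-lipschitz_on (R \<inter> ball x d) \<sigma>" "\<And>x'. x' \<in> R \<inter> ball x d \<Longrightarrow> \<sigma> x' \<in> T x'"
    "\<And>x'. x' \<in> R \<inter> ball x d \<Longrightarrow> lform a (\<sigma> x') = 1" "\<And>x'. x' \<in> R \<inter> ball x d \<Longrightarrow> norm (\<sigma> x' - t) \<le> e"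
proof -
  obtain d0 L0 \<sigma>0 where s0: "d0 > 0" "L0-lipschitz_on (R \<inter> ball x d0) \<sigma>0" "\<sigma>0 x = t"
    "\<And>x'. x' \<in> R \<inter> ball x d0 \<Longrightarrow> \<sigma>0 x' \<in> T x'"
    using sections[OF x t(1)] by metis
  have L0: "L0 \<ge> 0" using lipschitz_on_nonneg[OF s0(2)] .
  define N where "N = norm a"
  \<comment> \<open>Within this radius the value of the form differs from 1 by at most 1/2, so
    dividing by it is safe.\<close>
  define d1 where "d1 = min d0 (1 / (2 * ((N + 1) * (L0 + 1))))"
  have d1: "d1 > 0" "d1 \<le> d0" using s0(1) L0 by (auto simp: d1_def N_def intro!: mult_pos_pos add_nonneg_pos)
  have Nd: "N * (L0 * d1) \<le> 1/2" "L0 * d1 \<le> 1/2"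
  proof -
    have N0: "N \<ge> 0" by (simp add: N_def)
    have pos: "(N + 1) * (L0 + 1) > 0" using N0 L0 by (intro mult_pos_pos) auto
    have "d1 * ((N + 1) * (L0 + 1)) \<le> (1 / (2 * ((N + 1) * (L0 + 1)))) * ((N + 1) * (L0 + 1))"
      using pos by (intro mult_right_mono) (auto simp: d1_def)
    also have "\<dots> = 1/2" using less_imp_neq[OF pos] by (simp only: times_divide_eq_left mult_1_left) (metis mult.commute nonzero_divide_mult_cancel_left)
    finally have h: "d1 * ((N + 1) * (L0 + 1)) \<le> 1/2" .
    have "N * (L0 * d1) \<le> d1 * ((N + 1) * (L0 + 1))" "L0 * d1 \<le> d1 * ((N + 1) * (L0 + 1))"
      using N0 L0 d1 by (auto simp: algebra_simps intro!: add_nonneg_nonneg)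
    with h show "N * (L0 * d1) \<le> 1/2" "L0 * d1 \<le> 1/2" by auto
  qed
  define l where "l x' = lform a (\<sigma>0 x')" for x'
  have s0d: "norm (\<sigma>0 y - \<sigma>0 y') \<le> L0 * dist y y'" if "y \<in> R \<inter> ball x d1" "y' \<in> R \<inter> ball x d1" for y y'
    using lipschitz_onD[OF s0(2), of y y'] that d1 by (auto simp: dist_norm)
  have xin: "x \<in> R \<inter> ball x d1" using x d1 by auto
  have s0t: "norm (\<sigma>0 y - t) \<le> L0 * d1" if "y \<in> R \<inter> ball x d1" for y
    using s0d[OF that xin] that s0(3) L0 mult_left_mono[of "dist y x" d1 L0] by (auto simp: dist_commute)
  have ldiff: "cmod (l y - l y') \<le> N * (L0 * dist y y')" if "y \<in> R \<inter> ball x d1" "y' \<in> R \<inter> ball x d1" for y y'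
  proof -
    have "cmod (l y - l y') \<le> N * norm (\<sigma>0 y - \<sigma>0 y')" using norm_lform_le[of a "\<sigma>0 y - \<sigma>0 y'"] by (simp add: l_def lform_diff N_def)
    also have "\<dots> \<le> N * (L0 * dist y y')" using s0d[OF that] by (intro mult_left_mono) (auto simp: N_def)
    finally show ?thesis .
  qed
  have lge: "cmod (l y) \<ge> 1/2" if "y \<in> R \<inter> ball x d1" for y
  proof -
    have "cmod (l y - 1) \<le> N * norm (\<sigma>0 y - t)" using norm_lform_le[of a "\<sigma>0 y - t"] t by (simp add: l_def lform_diff N_def)
    also have "\<dots> \<le> N * (L0 * d1)" using s0t[OF that] by (intro mult_left_mono) (auto simp: N_def)
    finally have "cmod (l y - 1) \<le> 1/2" using Nd by simp
    then show ?thesis using norm_triangle_sub[of 1 "l y"] by (simp add: norm_minus_commute)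
  qed
  define \<sigma> where "\<sigma> y = (1 / l y) *s \<sigma>0 y" for y
  define L where "L = 2 * L0 + (norm t + 1) * (4 * (N * L0))"
  have L: "L \<ge> 0" using L0 by (auto simp: L_def N_def intro!: add_nonneg_nonneg mult_nonneg_nonneg)
  have lip: "norm (\<sigma> y - \<sigma> y') \<le> L * dist y y'" if y: "y \<in> R \<inter> ball x d1" "y' \<in> R \<inter> ball x d1" for y y'
  proof -
    have l0: "l y \<noteq> 0" "l y' \<noteq> 0" using lge[OF y(1)] lge[OF y(2)] by auto
    have "\<sigma> y - \<sigma> y' = (1 / l y) *s (\<sigma>0 y - \<sigma>0 y') + ((l y' - l y) / (l y * l y')) *s \<sigma>0 y'"
      using l0 by (simp add: \<sigma>_def vec_eq_iff divide_simps) (simp add: algebra_simps)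
    then have "norm (\<sigma> y - \<sigma> y') \<le> norm ((1 / l y) *s (\<sigma>0 y - \<sigma>0 y')) + norm (((l y' - l y) / (l y * l y')) *s \<sigma>0 y')"
      by (metis norm_triangle_ineq)
    also have "norm ((1 / l y) *s (\<sigma>0 y - \<sigma>0 y')) \<le> 2 * (L0 * dist y y')"
    proof -
      have "cmod (1 / l y) \<le> 2" using lge[OF y(1)] by (simp add: norm_divide divide_le_eq)
      then show ?thesis unfolding norm_vec_scale using s0d[OF y] by (intro mult_mono) auto
    qed
    also have "norm (((l y' - l y) / (l y * l y')) *s \<sigma>0 y') \<le> (4 * (N * (L0 * dist y y'))) * (norm t + 1)"
    proof -
      have "cmod ((l y' - l y) / (l y * l y')) \<le> (N * (L0 * dist y y')) / ((1/2) * (1/2))"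
        unfolding norm_divide norm_mult
        by (intro frac_le mult_mono lge y) (use ldiff[OF y] in \<open>auto simp: norm_minus_commute N_def L0\<close>)
      moreover have "norm (\<sigma>0 y') \<le> norm t + 1" using s0t[OF y(2)] Nd norm_triangle_sub[of "\<sigma>0 y'" t] by simp
      ultimately show ?thesis unfolding norm_vec_scale by (intro mult_mono) (auto simp: N_def L0)
    qed
    finally show ?thesis by (simp add: L_def algebra_simps)
  qed
  define d where "d = min d1 (e / (L + 1))"
  have d: "d > 0" "d \<le> d1" using d1 e L by (auto simp: d_def)
  have \<sigma>x: "\<sigma> x = t" using t s0(3) by (simp add: \<sigma>_def l_def)
  show thesis
  proof
    show "d > 0" by fact
    show "L-lipschitz_on (R \<inter> ball x d) \<sigma>"
      by (rule lipschitz_onI) (use lip d L in \<open>auto simp: dist_norm\<close>)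
    fix y assume y: "y \<in> R \<inter> ball x d"
    then have y1: "y \<in> R \<inter> ball x d1" "y \<in> R \<inter> ball x d0" using d d1 by auto
    show "\<sigma> y \<in> T y" unfolding \<sigma>_def using y1 s0(4)[OF y1(2)] subspace_T by (intro vec.subspace_scale) auto
    show "lform a (\<sigma> y) = 1" using lge[OF y1(1)] by (auto simp: \<sigma>_def lform_scale l_def)
    have "norm (\<sigma> y - t) \<le> L * dist y x" using lip[OF y1(1) xin] \<sigma>x by simp
    also have "\<dots> \<le> L * (e / (L + 1))" using y L by (intro mult_left_mono) (auto simp: d_def dist_commute)
    also have "\<dots> \<le> e" using L e by (simp add: divide_simps mult_left_mono)
    finally show "norm (\<sigma> y - t) \<le> e" .
  qed
qed

text \<open>The numbering makes initial segments relatively closed, so the stratum of index k is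
  open in the union of those up to k, and a field can be extended one stratum at a time.
  \<open>transv\<close> is transversality to the hyperplane of the form, scaled to the value 1. Both
  Whitney conditions are in uniform, non-sequential form.\<close>

locale whitney_family =
  fixes \<Omega> :: "(complex^'n::finite) set" and T :: "complex^'n \<Rightarrow> (complex^'n) set" and a :: "complex^'n"
    and R :: "nat \<Rightarrow> (complex^'n) set" and m :: nat
  assumes open_\<Omega>: "open \<Omega>" and \<Omega>_ne: "\<Omega> \<noteq> UNIV"
    and stratum: "\<And>i. i < m \<Longrightarrow> stratum (R i) T" and R_sub: "\<And>i. i < m \<Longrightarrow> R i \<subseteq> \<Omega>"
    and R_disj: "\<And>i j. i < j \<Longrightarrow> j < m \<Longrightarrow> R i \<inter> R j = {}"
    and closed_lower: "\<And>k. k \<le> m \<Longrightarrow> closedin (top_of_set \<Omega>) (\<Union>i<k. R i)"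
    and transv: "\<And>i x. i < m \<Longrightarrow> x \<in> R i \<Longrightarrow> \<exists>t\<in>T x. lform a t = 1"
    and condition_a: "\<And>i j y w e. i < j \<Longrightarrow> j < m \<Longrightarrow> y \<in> R i \<Longrightarrow> w \<in> T y \<Longrightarrow> e > 0 \<Longrightarrow>
       \<exists>d>0. \<forall>x\<in>R j \<inter> ball y d. \<exists>t\<in>T x. norm (t - w) \<le> e"
    and condition_b: "\<And>i j y e. i < j \<Longrightarrow> j < m \<Longrightarrow> y \<in> R i \<Longrightarrow> e > 0 \<Longrightarrow>
       \<exists>d>0. \<forall>x\<in>R j \<inter> ball y d. \<forall>y'\<in>R i \<inter> ball y d. \<exists>t\<in>T x. norm (t - (x - y')) \<le> e * norm (x - y')"
begin

definition Y :: "nat \<Rightarrow> (complex^'n) set" where "Y k = (\<Union>i<k. R i)"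

text \<open>The last clause is the invariant carried by the induction: the component normal to each
  stratum is quadratically small. It is tested at every q near y with x - q normal at q, not only at
  nearest points, so that it can be moved from one foot to another.\<close>

definition good_field :: "nat \<Rightarrow> (complex^'n \<Rightarrow> complex^'n) \<Rightarrow> bool" where
  "good_field k \<eta> \<longleftrightarrow> (\<forall>i<k. \<forall>x\<in>R i. \<eta> x \<in> T x \<and> lform a (\<eta> x) = 1) \<and> continuous_on (Y k) \<eta> \<and>
     (\<forall>i<k. \<forall>x\<in>R i. \<exists>d>0. \<exists>L. L-lipschitz_on (R i \<inter> ball x d) \<eta>) \<and>
     (\<forall>i<k. \<forall>y\<in>R i. \<exists>d>0. \<exists>C\<ge>0. \<forall>x\<in>Y k \<inter> ball y d. \<forall>q\<in>R i \<inter> ball y d. normal_to (T q) (x - q) \<longrightarrow>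
        cmod (cdot (\<eta> x) (x - q)) \<le> C * (norm (x - q))\<^sup>2)"

text \<open>Adding the complement of \<Omega> makes the set closed in the whole space and never
  empty, so that \<open>infdist\<close> to it is positive off it.\<close>

definition low :: "nat \<Rightarrow> (complex^'n) set" where "low k = Y k \<union> - \<Omega>"

lemma Y_Suc: "Y (Suc k) = Y k \<union> R k"
  by (auto simp: Y_def less_Suc_eq)

lemma low_closed: "k \<le> m \<Longrightarrow> closed (low k)"
proof -
  assume "k \<le> m"
  then obtain C where C: "closed C" "Y k = \<Omega> \<inter> C" using closed_lower[of k] by (auto simp: Y_def closedin_closed)
  then have "low k = C \<union> - \<Omega>" by (auto simp: low_def)
  then show ?thesis using C open_\<Omega> by (simp add: closed_Un closed_Compl)
qed

lemma low_ne: "low k \<noteq> {}" using \<Omega>_ne by (auto simp: low_def)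

lemma R_not_low: "j < m \<Longrightarrow> k \<le> j \<Longrightarrow> x \<in> R j \<Longrightarrow> x \<notin> low k"
  using R_sub[of j] R_disj[of _ j] by (auto simp: low_def Y_def disjoint_iff) (meson order.strict_trans2)

lemma R_infdist_pos: "j < m \<Longrightarrow> k \<le> j \<Longrightarrow> x \<in> R j \<Longrightarrow> infdist x (low k) > 0"
  using R_not_low[of j k x] infdist_pos_not_in_closed[OF low_closed low_ne, of k x] by auto

definition \<delta> :: "nat \<Rightarrow> complex^'n \<Rightarrow> real" where "\<delta> j y = min 1 (infdist y (low j))"

lemma \<delta>_pos: "j < m \<Longrightarrow> y \<in> R j \<Longrightarrow> \<delta> j y > 0"
  using R_infdist_pos by (simp add: \<delta>_def)

lemma \<delta>_le: "\<delta> j y \<le> 1" "z \<in> low j \<Longrightarrow> \<delta> j y \<le> dist y z"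
  by (auto simp: \<delta>_def min_le_iff_disj infdist_le)

lemma \<delta>_lip: "\<delta> j y \<ge> \<delta> j z - dist y z"
proof -
  have "infdist z (low j) \<le> infdist y (low j) + dist y z"
    using infdist_triangle[of z "low j" y] by (auto simp: dist_commute)
  then have "infdist z (low j) - dist y z \<le> infdist y (low j)" "1 - dist y z \<le> 1" by auto
  then have "min 1 (infdist z (low j)) - dist y z \<le> min 1 (infdist y (low j))"
    by (intro min.boundedI) (metis diff_right_mono min.cobounded1 order_trans, metis diff_right_mono min.cobounded2 order_trans)
  then show ?thesis by (simp add: \<delta>_def)
qed

end

section \<open>Extension of a controlled field over one more stratum\<close>

locale whitney_step = whitney_family +
  fixes k :: nat and \<eta> :: "complex^'a::finite \<Rightarrow> complex^'a"
  assumes k: "k < m" and good: "good_field k \<eta>"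
begin

lemma \<eta>_T: "i < k \<Longrightarrow> x \<in> R i \<Longrightarrow> \<eta> x \<in> T x" "i < k \<Longrightarrow> x \<in> R i \<Longrightarrow> lform a (\<eta> x) = 1"
  using good by (auto simp: good_field_def)

lemma \<eta>_near:
  assumes "y \<in> Y k" "e > 0"
  obtains d where "d > 0" "\<And>x. x \<in> Y k \<Longrightarrow> dist x y < d \<Longrightarrow> norm (\<eta> x - \<eta> y) < e"
  using good assms unfolding good_field_def continuous_on_iff dist_norm by metis

text \<open>A candidate value \<open>t\<close> at \<open>x\<close> imitates \<open>\<eta>\<close> at a foot \<open>y\<close> in a lower stratum and is exactly orthogonal to
  \<open>x - y\<close>. Near the stratum \<open>j\<close>, a nearly cheapest candidate either has its foot in that stratum or is controlled
  through \<open>\<eta>\<close> itself, which is already controlled along the foot.\<close>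

definition valid :: "nat \<Rightarrow> complex^'a \<Rightarrow> complex^'a \<Rightarrow> complex^'a \<Rightarrow> bool" where
  "valid j x y t \<longleftrightarrow> y \<in> R j \<and> t \<in> T x \<and> lform a t = 1 \<and> normal_to (T y) (x - y) \<and> cdot t (x - y) = 0 \<and>
     norm (x - y) < (\<delta> j y)\<^sup>2 / 16 \<and> norm (t - \<eta> y) < \<delta> j y"

definition cost :: "complex^'a \<Rightarrow> complex^'a \<Rightarrow> complex^'a \<Rightarrow> real" where
  "cost x y t = norm (t - \<eta> y) + norm (x - y)"

text \<open>At the foot y of x, condition (a) gives a tangent vector near \<open>\<eta> y0\<close>
  and condition (b) one near x - y; \<open>corrected_tangent_vector\<close> combines them. The
  tolerance e0 is chosen so that its error K * e0 is at most a quarter of both e and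
  \<delta>0.\<close>

lemma valid_near:
  assumes j: "j < k" and y0: "y0 \<in> R j" and e: "e > 0"
  obtains d where "d > 0" "\<And>x. x \<in> R k \<inter> ball y0 d \<Longrightarrow> \<exists>y t. valid j x y t \<and> cost x y t < e"
proof -
  interpret Rj: stratum "R j" T using stratum j k by simp
  interpret Rk: stratum "R k" T using stratum k by simp
  define w where "w = \<eta> y0"
  define K where "K = 10 + 18 * norm a * (norm w + 9)"
  define \<delta>0 where "\<delta>0 = \<delta> j y0"
  have \<delta>0: "\<delta>0 > 0" "\<delta>0 \<le> 1" using \<delta>_pos[of j y0] j k y0 \<delta>_le by (auto simp: \<delta>0_def)
  have K: "K \<ge> 10" "K \<ge> 18 * norm a" by (auto simp: K_def algebra_simps)
  define c0 where "c0 = min e \<delta>0 / 4"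
  have c0: "c0 > 0" "c0 \<le> e/4" "c0 \<le> \<delta>0/4" using e \<delta>0 by (auto simp: c0_def)
  define e0 where "e0 = min (1/2) (c0 / K)"
  have "e0 \<le> 1/2" "e0 \<le> c0/K" unfolding e0_def by (rule min.cobounded1, rule min.cobounded2)
  then have e0: "e0 > 0" "e0 \<le> 1/2" "K * e0 \<le> c0"
    using c0 K mult_left_mono[of e0 "c0/K" K] by (auto simp: e0_def)
  have e09: "9 * norm a * e0 \<le> 1/2"
  proof -
    have "18 * norm a * e0 \<le> K * e0" using K e0 by (intro mult_right_mono) auto
    then show ?thesis using e0(3) c0(3) \<delta>0 by linarith
  qed
  have y0Y: "y0 \<in> Y k" using y0 j by (auto simp: Y_def)
  obtain d1 where d1: "d1 > 0" "\<And>x. x \<in> Y k \<Longrightarrow> dist x y0 < d1 \<Longrightarrow> norm (\<eta> x - \<eta> y0) < e0"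
    using \<eta>_near[OF y0Y e0(1)] by metis
  obtain d2 where d2: "d2 > 0" "\<And>x. x \<in> R k \<inter> ball y0 d2 \<Longrightarrow> \<exists>t\<in>T x. norm (t - w) \<le> e0"
    using condition_a[OF j k y0 _ e0(1), of w] \<eta>_T[OF j y0] unfolding w_def by metis
  obtain d3 where d3: "d3 > 0" "\<And>x y'. x \<in> R k \<inter> ball y0 d3 \<Longrightarrow> y' \<in> R j \<inter> ball y0 d3 \<Longrightarrow> \<exists>t\<in>T x. norm (t - (x - y')) \<le> e0 * norm (x - y')"
    using condition_b[OF j k y0 e0(1)] by metis
  define e5 where "e5 = Min {d1, d3, \<delta>0/2}"
  have e5: "e5 > 0" "e5 \<le> d1" "e5 \<le> d3" "e5 \<le> \<delta>0/2" using d1 d3 \<delta>0 by (auto simp: e5_def)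
  obtain d4 where d4: "d4 > 0" "d4 \<le> e5" "\<And>x. x \<in> ball y0 d4 \<Longrightarrow>
    \<exists>q\<in>R j \<inter> ball y0 e5. normal_to (T q) (x - q) \<and> dist x q = infdist x (R j)"
    using Rj.foot_exists[OF y0 e5(1)] by metis
  \<comment> \<open>Near y0 the scale \<open>\<delta> j y\<close> is at least \<delta>0 / 2, and
    (\<delta>0 / 2)^2 / 16 = \<delta>0^2 / 64 is the bound that validity asks of |x - y|.\<close>
  define d where "d = Min {d2, d3, d4, \<delta>0\<^sup>2/64, e/4}"
  have d: "d > 0" "d \<le> d2" "d \<le> d3" "d \<le> d4" "d \<le> \<delta>0\<^sup>2/64" "d \<le> e/4" using d2 d3 d4 \<delta>0 e by (auto simp: d_def)
  show thesis
  proof (rule that[OF d(1)])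
    fix x assume x: "x \<in> R k \<inter> ball y0 d"
    obtain y where y: "y \<in> R j" "y \<in> ball y0 e5" "normal_to (T y) (x - y)" "dist x y = infdist x (R j)"
      using d4(3)[of x] x d by auto
    have xy: "norm (x - y) < d" using y(4) infdist_le[OF y0, of x] x by (auto simp: dist_norm norm_minus_commute)
    have xney: "x \<noteq> y" using x y(1) R_disj[OF j k] by auto
    have yY: "y \<in> Y k" using y j by (auto simp: Y_def)
    have \<eta>y: "norm (\<eta> y - w) \<le> e0" using d1(2)[OF yY] y(2) e5 by (auto simp: w_def dist_commute)
    obtain t1 where t1: "t1 \<in> T x" "norm (t1 - w) \<le> e0" using d2(2)[of x] x d by auto
    obtain u1 where u1: "u1 \<in> T x" "norm (u1 - (x - y)) \<le> e0 * norm (x - y)" using d3(2)[of x y] x y d e5 by auto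
    have n: "cdot (\<eta> y) (x - y) = 0" using y(3) \<eta>_T(1)[OF j y(1)] by (auto simp: normal_to_def)
    obtain t where t: "t \<in> T x" "lform a t = 1" "cdot t (x - y) = 0" "norm (t - \<eta> y) \<le> (10 + 18 * norm a * (norm w + 9)) * e0"
      by (rule corrected_tangent_vector[OF Rk.subspace_T t1 u1 xney n \<eta>y _ e0(1,2) e09])
        (use x \<eta>_T[OF j y0] in \<open>auto simp: w_def\<close>)
    have t4: "norm (t - \<eta> y) \<le> c0" using t(4) e0(3) unfolding K_def by linarith
    have \<delta>y: "\<delta> j y \<ge> \<delta>0 / 2" using \<delta>_lip[of j y0 y] y(2) e5 by (auto simp: \<delta>0_def dist_commute)
    have "(\<delta> j y)\<^sup>2 \<ge> (\<delta>0/2)\<^sup>2" using \<delta>y \<delta>0 by (intro power_mono) auto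
    then have "norm (x - y) < (\<delta> j y)\<^sup>2 / 16" using xy d(5) by (simp add: power_divide)
    moreover have "norm (t - \<eta> y) < \<delta> j y" using t4 c0 \<delta>y \<delta>0 by linarith
    ultimately have "valid j x y t" using t y by (simp add: valid_def)
    moreover have "cost x y t < e" using t4 c0 xy d e by (simp add: cost_def)
    ultimately show "\<exists>y t. valid j x y t \<and> cost x y t < e" by blast
  qed
qed

text \<open>The infimum of the costs need not be attained, but it is positive: every foot lies in
  \<open>low k\<close>, which has positive distance to x. So some candidate costs less than twice
  the infimum.\<close>

lemma cheapest_valid:
  assumes j: "j < k" and x: "x \<in> R k" and ex: "valid j x y0 t0"
  obtains y t where "valid j x y t" "\<And>y' t'. valid j x y' t' \<Longrightarrow> cost x y t \<le> 2 * cost x y' t'"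
proof -
  define P where "P = {cost x y t | y t. valid j x y t}"
  have ne: "P \<noteq> {}" using ex by (auto simp: P_def)
  have lb: "infdist x (low k) \<le> c" if cP: "c \<in> P" for c
  proof -
    obtain y t where yt: "c = cost x y t" "valid j x y t" using cP unfolding P_def by blast
    then have "y \<in> low k" using j by (auto simp: valid_def low_def Y_def)
    then have "infdist x (low k) \<le> dist x y" by (rule infdist_le)
    then show ?thesis using yt norm_ge_zero[of "t - \<eta> y"] unfolding cost_def dist_norm by linarith
  qed
  have pos: "infdist x (low k) > 0" using R_infdist_pos[OF k _ x] by simp
  have bdd: "bdd_below P" using lb by (auto simp: bdd_below_def)
  have "Inf P \<ge> infdist x (low k)" using ne lb by (intro cInf_greatest) auto
  then have "Inf P < 2 * Inf P" using pos by simp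
  then obtain c where c: "c \<in> P" "c < 2 * Inf P" using ne bdd by (auto simp: cInf_less_iff)
  then obtain y t where yt: "c = cost x y t" "valid j x y t" by (auto simp: P_def)
  have "cost x y t \<le> 2 * cost x y' t'" if "valid j x y' t'" for y' t'
  proof -
    have "Inf P \<le> cost x y' t'" using that bdd by (intro cInf_lower) (auto simp: P_def)
    then show ?thesis using c yt by simp
  qed
  then show thesis using that yt by blast
qed

text \<open>A patch imitates one candidate t with foot y. Its section differs from t by at most |x -
  y| and its radius is at most |x - y|^2 / 16, so replacing x by a point of the patch produces
  errors that are quadratic in |x - y|. The index i may exceed j: a candidate of a higher stratum
  then serves the lower one too. The bound by half the distance to \<open>low k\<close> keeps the
  centre near a lower stratum whenever a point of the patch is.\<close>

definition patch :: "complex^'a \<Rightarrow> real \<Rightarrow> (complex^'a \<Rightarrow> complex^'a) \<Rightarrow> bool" where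
  "patch x r \<sigma> \<longleftrightarrow> r > 0 \<and> r \<le> infdist x (low k) / 2 \<and> (\<exists>L. L-lipschitz_on (R k \<inter> ball x r) \<sigma>) \<and>
     (\<forall>x'\<in>R k \<inter> ball x r. \<sigma> x' \<in> T x' \<and> lform a (\<sigma> x') = 1) \<and>
     (\<forall>j<k. (\<exists>y t. valid j x y t) \<longrightarrow> (\<exists>i y t. j \<le> i \<and> i < k \<and> valid i x y t \<and> r \<le> (norm (x - y))\<^sup>2 / 16 \<and>
        (\<forall>x'\<in>R k \<inter> ball x r. norm (\<sigma> x' - t) \<le> norm (x - y)) \<and>
        (i = j \<longrightarrow> (\<forall>y' t'. valid j x y' t' \<longrightarrow> cost x y t \<le> 2 * cost x y' t'))))"

text \<open>One candidate serves all j at once: the highest index that admits candidates is taken,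
  and there an almost cheapest one. Where no candidate exists, any normalized section will
  do.\<close>

lemma patch_exists:
  assumes x: "x \<in> R k"
  shows "\<exists>r \<sigma>. patch x r \<sigma>"
proof -
  interpret Rk: stratum "R k" T using stratum k by simp
  have pos: "infdist x (low k) > 0" using R_infdist_pos[OF k _ x] by simp
  show ?thesis
  proof (cases "\<exists>j<k. \<exists>y t. valid j x y t")
    case False
    obtain t where t: "t \<in> T x" "lform a t = 1" using transv[OF k x] by blast
    obtain d L \<sigma> where d: "d > 0" "L-lipschitz_on (R k \<inter> ball x d) \<sigma>" "\<And>x'. x' \<in> R k \<inter> ball x d \<Longrightarrow> \<sigma> x' \<in> T x'"
      "\<And>x'. x' \<in> R k \<inter> ball x d \<Longrightarrow> lform a (\<sigma> x') = 1" "\<And>x'. x' \<in> R k \<inter> ball x d \<Longrightarrow> norm (\<sigma> x' - t) \<le> 1"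
      using Rk.normalized_section[OF x t, of 1] by auto
    have "patch x (min d (infdist x (low k) / 2)) \<sigma>"
      unfolding patch_def using False d pos by (auto intro!: exI[of _ L] lipschitz_on_subset[OF d(2)])
    then show ?thesis by blast
  next
    case True
    define J where "J = {j. j < k \<and> (\<exists>y t. valid j x y t)}"
    define i where "i = Max J"
    have J: "finite J" "J \<noteq> {}" using True by (auto simp: J_def)
    then have iJ: "i \<in> J" and imax: "\<And>j. j \<in> J \<Longrightarrow> j \<le> i" by (auto simp: i_def)
    from iJ obtain y0 t0 where ik: "i < k" "valid i x y0 t0" by (auto simp: J_def)
    obtain y t where yt: "valid i x y t" "\<And>y' t'. valid i x y' t' \<Longrightarrow> cost x y t \<le> 2 * cost x y' t'"
      using cheapest_valid[OF ik(1) x ik(2)] by metis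
    have "y \<in> R i" using yt by (simp add: valid_def)
    then have xy: "norm (x - y) > 0" using R_disj[OF ik(1) k] x by auto
    have t: "t \<in> T x" "lform a t = 1" using yt by (auto simp: valid_def)
    obtain d L \<sigma> where d: "d > 0" "L-lipschitz_on (R k \<inter> ball x d) \<sigma>" "\<And>x'. x' \<in> R k \<inter> ball x d \<Longrightarrow> \<sigma> x' \<in> T x'"
      "\<And>x'. x' \<in> R k \<inter> ball x d \<Longrightarrow> lform a (\<sigma> x') = 1" "\<And>x'. x' \<in> R k \<inter> ball x d \<Longrightarrow> norm (\<sigma> x' - t) \<le> norm (x - y)"
      using Rk.normalized_section[OF x t xy] by metis
    define r where "r = Min {d, infdist x (low k) / 2, (norm (x - y))\<^sup>2 / 16}"
    have r: "r > 0" "r \<le> d" "r \<le> infdist x (low k) / 2" "r \<le> (norm (x - y))\<^sup>2 / 16"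
      using d pos xy by (auto simp: r_def)
    have sub: "R k \<inter> ball x r \<subseteq> R k \<inter> ball x d" using r by auto
    have "patch x r \<sigma>" unfolding patch_def
    proof (intro conjI allI impI)
      show "\<exists>L. L-lipschitz_on (R k \<inter> ball x r) \<sigma>" using lipschitz_on_subset[OF d(2) sub] by blast
      show "\<forall>x'\<in>R k \<inter> ball x r. \<sigma> x' \<in> T x' \<and> lform a (\<sigma> x') = 1" using d(3,4) sub by blast
      fix j assume "j < k" "\<exists>y t. valid j x y t"
      then have "j \<le> i" by (intro imax) (auto simp: J_def)
      then show "\<exists>i y t. j \<le> i \<and> i < k \<and> valid i x y t \<and> r \<le> (norm (x - y))\<^sup>2 / 16 \<and>
        (\<forall>x'\<in>R k \<inter> ball x r. norm (\<sigma> x' - t) \<le> norm (x - y)) \<and>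
        (i = j \<longrightarrow> (\<forall>y' t'. valid j x y' t' \<longrightarrow> cost x y t \<le> 2 * cost x y' t'))"
        using ik yt r d(5) sub by (intro exI[of _ i] exI[of _ y] exI[of _ t]) blast
    qed (use r in auto)
    then show ?thesis by blast
  qed
qed

text \<open>The foot and the value used by a patch covering x tend to y0 and
  \<open>\<eta> y0\<close>. If the foot is in the stratum j this is the comparison with the cheap
  candidates of \<open>valid_near\<close>; if it is in a higher one, validity itself forces
  it.\<close>

lemma patch_near:
  assumes j: "j < k" and y0: "y0 \<in> R j" and e: "e > 0"
  obtains d where "d > 0" "d \<le> e" "\<And>x x0 r \<sigma>. x \<in> R k \<inter> ball y0 d \<Longrightarrow> x0 \<in> R k \<Longrightarrow> patch x0 r \<sigma> \<Longrightarrow> x \<in> ball x0 r \<Longrightarrow>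
    \<exists>i y t. j \<le> i \<and> i < k \<and> valid i x0 y t \<and> r \<le> (norm (x0 - y))\<^sup>2 / 16 \<and> norm (\<sigma> x - t) \<le> norm (x0 - y) \<and>
      dist y y0 < e \<and> dist x0 y0 < e \<and> norm (x0 - y) < e \<and> norm (\<sigma> x - \<eta> y) < e"
proof -
  obtain d0 where d0: "d0 > 0" "\<And>x. x \<in> R k \<inter> ball y0 d0 \<Longrightarrow> \<exists>y t. valid j x y t \<and> cost x y t < e/16"
    using valid_near[OF j y0, of "e/16"] e by auto
  define d where "d = min d0 (e/16) / 2"
  have d: "d > 0" "2 * d \<le> d0" "d \<le> e/32" using d0 e by (auto simp: d_def)
  show thesis
  proof (rule that[of d])
    fix x x0 r \<sigma> assume x: "x \<in> R k \<inter> ball y0 d" and x0: "x0 \<in> R k" and p: "patch x0 r \<sigma>" and xr: "x \<in> ball x0 r"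
    have "y0 \<in> low k" using y0 j by (auto simp: low_def Y_def)
    then have "r \<le> dist x0 y0 / 2" using p infdist_le[of y0 "low k" x0] by (auto simp: patch_def)
    then have x0y0: "dist x0 y0 < 2 * d" using x xr dist_triangle[of x0 y0 x] by (auto simp: dist_commute)
    obtain y' t' where v': "valid j x0 y' t'" "cost x0 y' t' < e/16" using d0(2)[of x0] x0 x0y0 d by (auto simp: dist_commute)
    then obtain i y t where i: "j \<le> i" "i < k" "valid i x0 y t" "r \<le> (norm (x0 - y))\<^sup>2 / 16"
        "\<forall>x'\<in>R k \<inter> ball x0 r. norm (\<sigma> x' - t) \<le> norm (x0 - y)"
        "i = j \<longrightarrow> (\<forall>y' t'. valid j x0 y' t' \<longrightarrow> cost x0 y t \<le> 2 * cost x0 y' t')"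
      using p j unfolding patch_def by meson
    have \<sigma>: "norm (\<sigma> x - t) \<le> norm (x0 - y)" using i(5) x xr by blast
    have *: "norm (x0 - y) < e/8 \<and> norm (t - \<eta> y) \<le> e/8"
    proof (cases "i = j")
      case True
      then have "cost x0 y t < e/8" using i(6) v' by fastforce
      then show ?thesis unfolding cost_def using norm_ge_zero[of "t - \<eta> y"] norm_ge_zero[of "x0 - y"] by linarith
    next
      case False
      \<comment> \<open>For i > j the point y0 is a lower point, so \<open>\<delta> i y\<close> is
        at most the distance of y and y0, and both |x0 - y| and |t - \<eta> y| are bounded in terms
        of \<open>\<delta> i y\<close>. The first bound in turn keeps y near y0.\<close>
      then have "y0 \<in> low i" using i(1) y0 by (auto simp: low_def Y_def)
      then have \<delta>: "\<delta> i y \<le> dist y y0" "\<delta> i y \<le> 1" using \<delta>_le by auto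
      have \<delta>0: "\<delta> i y > 0" using \<delta>_pos[of i y] i k by (auto simp: valid_def)
      have "(\<delta> i y)\<^sup>2 \<le> \<delta> i y * 1" unfolding power2_eq_square using \<delta> \<delta>0 by (intro mult_left_mono) auto
      then have n: "norm (x0 - y) < \<delta> i y / 16" using i(3) by (auto simp: valid_def)
      then have "dist y y0 \<le> 2 * dist x0 y0"
        using \<delta> dist_triangle[of y y0 x0] norm_ge_zero[of "x0 - y0"] unfolding dist_norm norm_minus_commute[of y] by linarith
      then have "\<delta> i y < 4 * d" using \<delta> x0y0 by linarith
      then show ?thesis using n d i(3) \<delta>0 by (auto simp: valid_def)
    qed
    have "dist y y0 < e" using * x0y0 d dist_triangle[of y y0 x0] by (simp add: dist_norm norm_minus_commute)
    moreover have "norm (\<sigma> x - \<eta> y) < e" using * \<sigma> e norm_triangle_ineq[of "\<sigma> x - t" "t - \<eta> y"] by simp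
    moreover have "dist x0 y0 < e" using x0y0 d by simp
    moreover have "norm (x0 - y) < e" using * e by linarith
    ultimately show "\<exists>i y t. j \<le> i \<and> i < k \<and> valid i x0 y t \<and> r \<le> (norm (x0 - y))\<^sup>2 / 16 \<and> norm (\<sigma> x - t) \<le> norm (x0 - y) \<and>
      dist y y0 < e \<and> dist x0 y0 < e \<and> norm (x0 - y) < e \<and> norm (\<sigma> x - \<eta> y) < e"
      using i \<sigma> by blast
  qed (use d e in auto)
qed

text \<open>The constant must not depend on the patch, because the glued value at x is a limit of
  convex combinations over all patches that cover x.\<close>

lemma patch_control:
  assumes j: "j < k" and y0: "y0 \<in> R j"
  obtains d C where "d > 0" "C \<ge> 0" "\<And>x q x0 r \<sigma>. x \<in> R k \<inter> ball y0 d \<Longrightarrow> q \<in> R j \<inter> ball y0 d \<Longrightarrow> normal_to (T q) (x - q) \<Longrightarrow>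
    x0 \<in> R k \<Longrightarrow> patch x0 r \<sigma> \<Longrightarrow> x \<in> ball x0 r \<Longrightarrow> cmod (cdot (\<sigma> x) (x - q)) \<le> C * (norm (x - q))\<^sup>2"
proof -
  interpret Rj: stratum "R j" T using stratum j k by simp
  obtain dL where dL: "dL > 0" "\<And>x x' q q'. x \<in> ball y0 dL \<Longrightarrow> x' \<in> ball y0 dL \<Longrightarrow> q \<in> R j \<inter> ball y0 dL \<Longrightarrow> q' \<in> R j \<inter> ball y0 dL \<Longrightarrow>
    normal_to (T q) (x - q) \<Longrightarrow> normal_to (T q') (x' - q') \<Longrightarrow> dist q q' \<le> 2 * dist x x'"
    using Rj.foot_lipschitz[OF y0] by metis
  obtain d4 C4 where d4: "d4 > 0" "C4 \<ge> 0" "\<And>x q. x \<in> Y k \<inter> ball y0 d4 \<Longrightarrow> q \<in> R j \<inter> ball y0 d4 \<Longrightarrow> normal_to (T q) (x - q) \<Longrightarrow>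
        cmod (cdot (\<eta> x) (x - q)) \<le> C4 * (norm (x - q))\<^sup>2"
    using good j y0 unfolding good_field_def by meson
  have y0Y: "y0 \<in> Y k" using y0 j by (auto simp: Y_def)
  obtain dB where dB: "dB > 0" "\<And>x. x \<in> Y k \<Longrightarrow> dist x y0 < dB \<Longrightarrow> norm (\<eta> x - \<eta> y0) < 1"
    using \<eta>_near[OF y0Y, of 1] by auto
  define B where "B = norm (\<eta> y0) + 2"
  have B: "B \<ge> 2" by (simp add: B_def)
  define e1 where "e1 = min dL d4"
  have e1: "e1 > 0" using dL d4 by (simp add: e1_def)
  obtain dF where dF: "dF > 0" "dF \<le> e1" "\<And>x. x \<in> ball y0 dF \<Longrightarrow>
    \<exists>q\<in>R j \<inter> ball y0 e1. normal_to (T q) (x - q) \<and> dist x q = infdist x (R j)"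
    using Rj.foot_exists[OF y0 e1] by metis
  define e where "e = Min {dL, d4, dB, dF, 1}"
  have e: "e > 0" "e \<le> dL" "e \<le> d4" "e \<le> dB" "e \<le> dF" "e \<le> 1" using dL d4 dB dF by (auto simp: e_def)
  obtain d where d: "d > 0" "d \<le> e" "\<And>x x0 r \<sigma>. x \<in> R k \<inter> ball y0 d \<Longrightarrow> x0 \<in> R k \<Longrightarrow> patch x0 r \<sigma> \<Longrightarrow> x \<in> ball x0 r \<Longrightarrow>
    \<exists>i y t. j \<le> i \<and> i < k \<and> valid i x0 y t \<and> r \<le> (norm (x0 - y))\<^sup>2 / 16 \<and> norm (\<sigma> x - t) \<le> norm (x0 - y) \<and>
      dist y y0 < e \<and> dist x0 y0 < e \<and> norm (x0 - y) < e \<and> norm (\<sigma> x - \<eta> y) < e"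
    using patch_near[OF j y0 e(1)] by metis
  \<comment> \<open>Four times the three contributions of the case i > j, the factor coming from D
    \<le> 2 * z. The case i = j needs 4 * (B + 1).\<close>
  define C where "C = 4 * (C4 + B + 1)"
  have C0: "C \<ge> 0" using d4 B by (simp add: C_def)
  show thesis
  proof (rule that[OF d(1) C0])
    fix x q x0 r \<sigma>
    assume x: "x \<in> R k \<inter> ball y0 d" and q: "q \<in> R j \<inter> ball y0 d" and nq: "normal_to (T q) (x - q)"
      and x0: "x0 \<in> R k" and p: "patch x0 r \<sigma>" and xr: "x \<in> ball x0 r"
    obtain i y t where i: "j \<le> i" "i < k" "valid i x0 y t" "r \<le> (norm (x0 - y))\<^sup>2 / 16" "norm (\<sigma> x - t) \<le> norm (x0 - y)"
      "dist y y0 < e" "dist x0 y0 < e" "norm (x0 - y) < e" "norm (\<sigma> x - \<eta> y) < e"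
      using d(3)[OF x x0 p xr] by blast
    define n where "n = norm (x0 - y)"
    define z where "z = norm (x - q)"
    have yR: "y \<in> R i" and ny: "normal_to (T y) (x0 - y)" and tn: "cdot t (x0 - y) = 0"
      and n\<delta>: "n < (\<delta> i y)\<^sup>2 / 16" and t\<delta>: "norm (t - \<eta> y) < \<delta> i y"
      using i(3) by (auto simp: valid_def n_def)
    have yY: "y \<in> Y k" using yR i(2) by (auto simp: Y_def)
    have "norm (\<eta> y - \<eta> y0) < 1" using dB(2)[OF yY] i(6) e by auto
    then have \<eta>y: "norm (\<eta> y) \<le> B - 1" using norm_triangle_sub[of "\<eta> y" "\<eta> y0"] by (simp add: B_def)
    have \<sigma>x: "norm (\<sigma> x) \<le> B" using \<eta>y i(9) e norm_triangle_sub[of "\<sigma> x" "\<eta> y"] by simp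
    have n0: "n \<ge> 0" by (simp add: n_def)
    have \<delta>1: "\<delta> i y \<le> 1" "\<delta> i y > 0" using \<delta>_le \<delta>_pos[of i y] i k yR by auto
    have \<delta>sq: "(\<delta> i y)\<^sup>2 \<le> \<delta> i y" using \<delta>1 by (simp add: power2_eq_square mult_left_le)
    have n1: "n \<le> 1/16" using n\<delta> \<delta>sq \<delta>1 by linarith
    have nsq: "n\<^sup>2 \<le> n" using n0 n1 by (simp add: power2_eq_square mult_left_le)
    have r: "dist x x0 \<le> n\<^sup>2 / 16" using xr i(4) by (simp add: n_def dist_commute)
    have balls: "x \<in> ball y0 dL" "x0 \<in> ball y0 dL" "q \<in> R j \<inter> ball y0 dL" "y \<in> ball y0 dL"
      using x q i d e by (auto simp: dist_commute)
    show "cmod (cdot (\<sigma> x) (x - q)) \<le> C * (norm (x - q))\<^sup>2"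
    proof (cases "i = j")
      case True
      \<comment> \<open>Same stratum: t is exactly orthogonal to x0 - y, and passing to x - q
        changes this vector by at most 3 * n^2 / 16 since feet are Lipschitz. As n \<le> 2 * z,
        errors of order n^2 are of order z^2.\<close>
      have "dist q y \<le> 2 * dist x x0"
        by (rule dL(2)[OF balls(1,2,3) _ nq ny]) (use balls yR True in auto)
      then have diff: "norm ((x - q) - (x0 - y)) \<le> 3 * n\<^sup>2 / 16"
        using r norm_triangle_ineq4[of "x - x0" "q - y"] by (simp add: dist_norm algebra_simps)
      have "n \<le> z + norm ((x - q) - (x0 - y))"
        using norm_triangle_sub[of "x0 - y" "x - q"] by (simp add: n_def z_def norm_minus_commute)
      then have zn: "n \<le> 2 * z" using diff nsq n0 by linarith
      have "cdot (\<sigma> x) (x - q) = cdot (\<sigma> x) ((x - q) - (x0 - y)) + cdot (\<sigma> x - t) (x0 - y)"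
        using tn by (simp add: cdot_diff_left cdot_diff_right)
      then have "cmod (cdot (\<sigma> x) (x - q)) \<le> cmod (cdot (\<sigma> x) ((x - q) - (x0 - y))) + cmod (cdot (\<sigma> x - t) (x0 - y))"
        by (metis norm_triangle_ineq)
      also have "\<dots> \<le> B * (3 * n\<^sup>2 / 16) + n * n"
      proof (rule add_mono)
        show "cmod (cdot (\<sigma> x) ((x - q) - (x0 - y))) \<le> B * (3 * n\<^sup>2 / 16)"
          using \<sigma>x diff B by (intro order_trans[OF norm_cdot_le] mult_mono) auto
        show "cmod (cdot (\<sigma> x - t) (x0 - y)) \<le> n * n"
          using i(5) by (intro order_trans[OF norm_cdot_le] mult_mono) (auto simp: n_def)
      qed
      also have "\<dots> \<le> (B + 1) * n\<^sup>2" using B by (simp add: power2_eq_square algebra_simps)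
      also have "\<dots> \<le> (B + 1) * (2 * z)\<^sup>2" using zn n0 B by (intro mult_left_mono power_mono) auto
      also have "\<dots> \<le> C * z\<^sup>2" using d4(2) by (simp add: C_def power_mult_distrib algebra_simps)
      finally show ?thesis by (simp add: z_def)
    next
      case False
      \<comment> \<open>Higher stratum: \<eta> is already controlled at y along the stratum j, with
        foot q0 of y. Passing from y - q0 to x - q costs a multiple of a^2, and
        \<open>\<sigma> x\<close> differs from \<open>\<eta> y\<close> by at most 2 * a. Since q0 is
        a lower point, a is at most |y - q0|, which is at most 2 * z.\<close>
      then have ij: "j < i" using i(1) by simp
      have yb: "y \<in> ball y0 dF" using i(6) e by (simp add: dist_commute)
      obtain q0 where q0: "q0 \<in> R j \<inter> ball y0 e1" "normal_to (T q0) (y - q0)" using dF(3)[OF yb] by blast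
      define a where "a = \<delta> i y"
      have a: "0 < a" "a \<le> 1" "a\<^sup>2 \<le> a" using \<delta>1 \<delta>sq by (auto simp: a_def)
      have na: "n < a\<^sup>2 / 16" using n\<delta> by (simp add: a_def)
      have xy: "norm (x - y) \<le> a\<^sup>2 / 8"
        using norm_triangle_ineq[of "x - x0" "x0 - y"] r nsq n0 na unfolding n_def[symmetric] dist_norm by simp
      have "dist q q0 \<le> 2 * dist x y"
        by (rule dL(2)[OF balls(1,4,3) _ nq q0(2)]) (use q0(1) in \<open>auto simp: e1_def\<close>)
      then have diff: "norm ((x - q) - (y - q0)) \<le> 3 * a\<^sup>2 / 8"
        using xy norm_triangle_ineq4[of "x - y" "q - q0"] by (simp add: dist_norm algebra_simps)
      define D where "D = norm (y - q0)"
      have "q0 \<in> low i" using q0 ij by (auto simp: low_def Y_def)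
      then have aD: "a \<le> D" using \<delta>_le(2)[of q0 i y] by (simp add: a_def D_def dist_norm)
      have a2: "a\<^sup>2 \<le> D\<^sup>2" using aD a by (intro power_mono) auto
      have D2: "D \<le> 2 * z"
        using norm_triangle_sub[of "y - q0" "x - q"] diff a aD by (simp add: D_def z_def norm_minus_commute)
      have D0: "D \<ge> 0" by (simp add: D_def)
      have IH: "cmod (cdot (\<eta> y) (y - q0)) \<le> C4 * D\<^sup>2"
        unfolding D_def by (rule d4(3)) (use yY i(6) e q0 in \<open>auto simp: dist_commute e1_def\<close>)
      have s\<eta>: "norm (\<sigma> x - \<eta> y) \<le> 2 * a"
        using i(5) t\<delta> na a norm_triangle_ineq[of "\<sigma> x - t" "t - \<eta> y"] by (simp add: n_def a_def)
      have "cdot (\<sigma> x) (x - q) = cdot (\<eta> y) (y - q0) + cdot (\<eta> y) ((x - q) - (y - q0)) + cdot (\<sigma> x - \<eta> y) (x - q)"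
        by (simp add: cdot_diff_left cdot_diff_right)
      then have "cmod (cdot (\<sigma> x) (x - q)) \<le> cmod (cdot (\<eta> y) (y - q0)) + cmod (cdot (\<eta> y) ((x - q) - (y - q0))) + cmod (cdot (\<sigma> x - \<eta> y) (x - q))"
        using norm_triangle_ineq[of "cdot (\<eta> y) (y - q0) + cdot (\<eta> y) ((x - q) - (y - q0))" "cdot (\<sigma> x - \<eta> y) (x - q)"]
          norm_triangle_ineq[of "cdot (\<eta> y) (y - q0)" "cdot (\<eta> y) ((x - q) - (y - q0))"] by simp
      also have "\<dots> \<le> C4 * D\<^sup>2 + B * (3 * a\<^sup>2 / 8) + (2 * a) * z"
      proof (intro add_mono IH)
        show "cmod (cdot (\<eta> y) ((x - q) - (y - q0))) \<le> B * (3 * a\<^sup>2 / 8)"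
          using \<eta>y diff B by (intro order_trans[OF norm_cdot_le] mult_mono) auto
        show "cmod (cdot (\<sigma> x - \<eta> y) (x - q)) \<le> (2 * a) * z"
          using s\<eta> a by (intro order_trans[OF norm_cdot_le] mult_mono) (auto simp: z_def)
      qed
      also have "\<dots> \<le> C4 * (2 * z)\<^sup>2 + B * (2 * z)\<^sup>2 + (2 * (2 * z)) * z"
      proof (intro add_mono mult_left_mono)
        show "D\<^sup>2 \<le> (2 * z)\<^sup>2" using D2 D0 by (intro power_mono) auto
        then show "3 * a\<^sup>2 / 8 \<le> (2 * z)\<^sup>2" using a2 zero_le_power2[of a] by linarith
        show "2 * a * z \<le> 2 * (2 * z) * z" using aD D2 by (intro mult_right_mono) (auto simp: z_def)
      qed (use d4 B in auto)
      also have "\<dots> = C * z\<^sup>2" by (simp add: C_def power2_eq_square algebra_simps)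
      finally show ?thesis by (simp add: z_def)
    qed
  qed
qed

text \<open>Tangency, the value 1 of the form, nearness to a given value and the control estimate
  are each a closed convex condition on the value at x. Every patch covering x satisfies them, so
  the glued field does; nearness yields continuity at the lower strata.\<close>

lemma extension:
  obtains \<eta>' where "good_field (Suc k) \<eta>'"
proof -
  interpret Rk: stratum "R k" T using stratum k by simp
  obtain r \<sigma> where p: "\<And>x. x \<in> R k \<Longrightarrow> patch x (r x) (\<sigma> x)" using patch_exists by metis
  have "\<And>x. x \<in> R k \<Longrightarrow> r x > 0" "\<And>x. x \<in> R k \<Longrightarrow> \<exists>L. L-lipschitz_on (R k \<inter> ball x (r x)) (\<sigma> x)"
    using p by (auto simp: patch_def)
  moreover have pT: "\<sigma> z x \<in> T x \<and> lform a (\<sigma> z x) = 1" if "z \<in> R k" "x \<in> ball z (r z)" "x \<in> R k" for z x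
    using p[OF that(1)] that(2,3) unfolding patch_def by blast
  ultimately obtain \<zeta> where \<zeta>: "\<And>x. x \<in> R k \<Longrightarrow> \<exists>d>0. \<exists>L. L-lipschitz_on (R k \<inter> ball x d) \<zeta>"
    "\<And>x C. x \<in> R k \<Longrightarrow> closed C \<Longrightarrow> convex C \<Longrightarrow>
       (\<And>z. z \<in> R k \<Longrightarrow> x \<in> ball z (r z) \<Longrightarrow> \<sigma> z x \<in> C) \<Longrightarrow> \<zeta> x \<in> C"
    using locally_finite_free_gluing[of "R k" r \<sigma>] by metis
  define \<eta>' where "\<eta>' x = (if x \<in> R k then \<zeta> x else \<eta> x)" for x
  have YR: "Y k \<inter> R k = {}" using R_disj[OF _ k] by (auto simp: Y_def)
  have \<eta>'Y: "\<eta>' x = \<eta> x" if "x \<in> Y k" for x using that YR by (auto simp: \<eta>'_def)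
  have \<eta>'R: "\<eta>' x = \<zeta> x" if "x \<in> R k" for x using that by (simp add: \<eta>'_def)
  have RY: "R i \<subseteq> Y k" if "i < k" for i using that by (auto simp: Y_def)
  have sep: "\<exists>d>0. Y (Suc k) \<inter> ball y d \<subseteq> R k" if y: "y \<in> R k" for y
  proof (intro exI conjI)
    show "infdist y (low k) > 0" using R_infdist_pos[OF k _ y] by simp
    show "Y (Suc k) \<inter> ball y (infdist y (low k)) \<subseteq> R k"
    proof
      fix x assume x: "x \<in> Y (Suc k) \<inter> ball y (infdist y (low k))"
      show "x \<in> R k"
      proof (rule ccontr)
        assume "x \<notin> R k"
        then have "x \<in> low k" using x by (auto simp: Y_Suc low_def)
        then show False using infdist_le[of x "low k" y] x by simp
      qed
    qed
  qed
  have g1: "\<eta>' x \<in> T x \<and> lform a (\<eta>' x) = 1" if i: "i < Suc k" and x: "x \<in> R i" for i x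
  proof (cases "i = k")
    case False
    then show ?thesis using i x \<eta>_T[of i x] \<eta>'Y RY[of i] by auto
  next
    case True
    then have xk: "x \<in> R k" using x by simp
    have "closed {t. lform a t = 1}"
      by (intro closed_Collect_eq continuous_intros linear_continuous_on bounded_linear_lform)
    moreover have "convex {t. lform a t = 1}"
      unfolding convex_def by (auto simp: lform_add lform_scaleR simp flip: of_real_add)
    moreover have "convex (T x)" using Rk.subspace_T[OF xk] by (intro subspace_imp_convex vec_subspace_imp_subspace)
    ultimately have "\<zeta> x \<in> T x \<inter> {t. lform a t = 1}"
      using pT[OF _ _ xk] by (intro \<zeta>(2)[OF xk] closed_Int convex_Int closed_vec_subspace[OF Rk.subspace_T[OF xk]]) auto
    then show ?thesis using \<eta>'R xk by simp
  qed
  have g3: "\<exists>d>0. \<exists>L. L-lipschitz_on (R i \<inter> ball x d) \<eta>'" if i: "i < Suc k" and x: "x \<in> R i" for i x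
  proof (cases "i = k")
    case True
    then obtain d L where d: "d > 0" "L-lipschitz_on (R i \<inter> ball x d) \<zeta>" using \<zeta>(1) x by metis
    then have "L-lipschitz_on (R i \<inter> ball x d) \<eta>'" using True \<eta>'R by (auto simp: lipschitz_on_def)
    then show ?thesis using d by blast
  next
    case False
    then have ik: "i < k" using i by simp
    then obtain d L where d: "d > 0" "L-lipschitz_on (R i \<inter> ball x d) \<eta>" using good x unfolding good_field_def by meson
    then have "L-lipschitz_on (R i \<inter> ball x d) \<eta>'" using \<eta>'Y RY[OF ik] by (auto simp: lipschitz_on_def subset_iff)
    then show ?thesis using d by blast
  qed
  have g2: "continuous_on (Y (Suc k)) \<eta>'"
    unfolding continuous_on_iff
  proof (intro ballI allI impI)
    fix y e assume y: "y \<in> Y (Suc k)" and e: "(0::real) < e"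
    show "\<exists>d>0. \<forall>x'\<in>Y (Suc k). dist x' y < d \<longrightarrow> dist (\<eta>' x') (\<eta>' y) < e"
    proof (cases "y \<in> R k")
      case True
      obtain d1 where d1: "d1 > 0" "Y (Suc k) \<inter> ball y d1 \<subseteq> R k" using sep[OF True] by blast
      obtain d2 L where d2: "d2 > 0" "L-lipschitz_on (R k \<inter> ball y d2) \<eta>'" using g3[of k y] True by auto
      have "continuous_on (R k \<inter> ball y d2) \<eta>'" by (rule lipschitz_on_continuous_on[OF d2(2)])
      moreover have "y \<in> R k \<inter> ball y d2" using True d2 by auto
      ultimately obtain d3 where "d3 > 0" "\<forall>x'\<in>R k \<inter> ball y d2. dist x' y < d3 \<longrightarrow> dist (\<eta>' x') (\<eta>' y) < e"
        using e unfolding continuous_on_iff by blast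
      then show ?thesis using d1 d2 by (intro exI[of _ "Min {d1, d2, d3}"]) (auto simp: dist_commute subset_iff)
    next
      case False
      then have yY: "y \<in> Y k" using y by (auto simp: Y_Suc)
      then obtain j where j: "j < k" "y \<in> R j" by (auto simp: Y_def)
      obtain d1 where d1: "d1 > 0" "\<And>x. x \<in> Y k \<Longrightarrow> dist x y < d1 \<Longrightarrow> norm (\<eta> x - \<eta> y) < e/4"
        using \<eta>_near[OF yY, of "e/4"] e by auto
      have e2: "min d1 (e/4) > 0" using d1 e by simp
      obtain d where d: "d > 0" "\<And>x x0 r \<sigma>. x \<in> R k \<inter> ball y d \<Longrightarrow> x0 \<in> R k \<Longrightarrow> patch x0 r \<sigma> \<Longrightarrow> x \<in> ball x0 r \<Longrightarrow>
        \<exists>i z t. j \<le> i \<and> i < k \<and> valid i x0 z t \<and> r \<le> (norm (x0 - z))\<^sup>2 / 16 \<and> norm (\<sigma> x - t) \<le> norm (x0 - z) \<and>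
          dist z y < min d1 (e/4) \<and> dist x0 y < min d1 (e/4) \<and> norm (x0 - z) < min d1 (e/4) \<and> norm (\<sigma> x - \<eta> z) < min d1 (e/4)"
        using patch_near[OF j e2] by metis
      have "dist (\<eta>' x) (\<eta>' y) < e" if x: "x \<in> Y (Suc k)" "dist x y < min d d1" for x
      proof (cases "x \<in> R k")
        case True
        have "\<zeta> x \<in> cball (\<eta> y) (e/2)"
        proof (rule \<zeta>(2)[OF True closed_cball convex_cball])
          fix x0 assume x0: "x0 \<in> R k" "x \<in> ball x0 (r x0)"
          have xb: "x \<in> R k \<inter> ball y d" using True x by (auto simp: dist_commute)
          obtain i z t where z: "i < k" "valid i x0 z t" "dist z y < d1" "norm (\<sigma> x0 x - \<eta> z) < e/4"
            using d(2)[OF xb x0(1) p[OF x0(1)] x0(2)] by auto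
          have "z \<in> Y k" using z by (auto simp: valid_def Y_def)
          then have "norm (\<eta> z - \<eta> y) < e/4" using d1 z by auto
          then show "\<sigma> x0 x \<in> cball (\<eta> y) (e/2)"
            using z(4) norm_triangle_ineq[of "\<sigma> x0 x - \<eta> z" "\<eta> z - \<eta> y"] by (simp add: dist_norm norm_minus_commute)
        qed
        then show ?thesis using \<eta>'R[OF True] \<eta>'Y[OF yY] e by (simp add: dist_commute)
      next
        case False
        then have "x \<in> Y k" using x by (auto simp: Y_Suc)
        then show ?thesis using d1(2)[of x] x \<eta>'Y yY e by (simp add: dist_norm)
      qed
      then show ?thesis using d d1 by (intro exI[of _ "min d d1"]) auto
    qed
  qed
  have g4: "\<exists>d>0. \<exists>C\<ge>0. \<forall>x\<in>Y (Suc k) \<inter> ball y d. \<forall>q\<in>R i \<inter> ball y d. normal_to (T q) (x - q) \<longrightarrow>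
        cmod (cdot (\<eta>' x) (x - q)) \<le> C * (norm (x - q))\<^sup>2" if i: "i < Suc k" and y: "y \<in> R i" for i y
  proof (cases "i = k")
    case True
    have yk: "y \<in> R k" using y True by simp
    obtain d1 where d1: "d1 > 0" "Y (Suc k) \<inter> ball y d1 \<subseteq> R k" using sep[OF yk] by blast
    obtain dL where dL: "dL > 0" "\<And>x x' q q'. x \<in> ball y dL \<Longrightarrow> x' \<in> ball y dL \<Longrightarrow> q \<in> R k \<inter> ball y dL \<Longrightarrow> q' \<in> R k \<inter> ball y dL \<Longrightarrow>
      normal_to (T q) (x - q) \<Longrightarrow> normal_to (T q') (x' - q') \<Longrightarrow> dist q q' \<le> 2 * dist x x'"
      using Rk.foot_lipschitz[OF yk] by metis
    \<comment> \<open>Along the new stratum itself control is vacuous: nearby points lie in it, and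
      such a point has itself as a foot, so uniqueness of feet leaves only q = x.\<close>
    have "x = q" if "x \<in> Y (Suc k) \<inter> ball y (min d1 dL)" "q \<in> R k \<inter> ball y (min d1 dL)" "normal_to (T q) (x - q)" for x q
      using dL(2)[of x x q x] that d1 by (auto simp: normal_to_def)
    then show ?thesis using True d1 dL by (intro exI[of _ "min d1 dL"] conjI exI[of _ 0] ballI impI) (simp, simp, metis cdot_zero(2) diff_self mult_zero_left norm_zero order_refl)
  next
    case False
    then have ik: "i < k" using i by simp
    obtain d1 C1 where d1: "d1 > 0" "C1 \<ge> 0" "\<And>x q. x \<in> Y k \<inter> ball y d1 \<Longrightarrow> q \<in> R i \<inter> ball y d1 \<Longrightarrow> normal_to (T q) (x - q) \<Longrightarrow>
        cmod (cdot (\<eta> x) (x - q)) \<le> C1 * (norm (x - q))\<^sup>2"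
      using good ik y unfolding good_field_def by meson
    obtain d2 C2 where d2: "d2 > 0" "C2 \<ge> 0" "\<And>x q x0 r \<sigma>. x \<in> R k \<inter> ball y d2 \<Longrightarrow> q \<in> R i \<inter> ball y d2 \<Longrightarrow> normal_to (T q) (x - q) \<Longrightarrow>
      x0 \<in> R k \<Longrightarrow> patch x0 r \<sigma> \<Longrightarrow> x \<in> ball x0 r \<Longrightarrow> cmod (cdot (\<sigma> x) (x - q)) \<le> C2 * (norm (x - q))\<^sup>2"
      using patch_control[OF ik y] by metis
    have "cmod (cdot (\<eta>' x) (x - q)) \<le> max C1 C2 * (norm (x - q))\<^sup>2"
      if x: "x \<in> Y (Suc k) \<inter> ball y (min d1 d2)" and q: "q \<in> R i \<inter> ball y (min d1 d2)" and nq: "normal_to (T q) (x - q)" for x q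
    proof (cases "x \<in> R k")
      case True
      define P where "P = {t. cmod (cdot t (x - q)) \<le> C2 * (norm (x - q))\<^sup>2}"
      have "bounded_linear (\<lambda>t. cdot t (x - q))" by (rule bounded_bilinear.bounded_linear_left[OF bounded_bilinear_cdot])
      then have lin: "linear (\<lambda>t. cdot t (x - q))" and cont: "continuous_on UNIV (\<lambda>t. cdot t (x - q))"
        by (auto intro: linear_continuous_on bounded_linear.linear)
      have P: "P = (\<lambda>t. cdot t (x - q)) -` cball 0 (C2 * (norm (x - q))\<^sup>2)" by (auto simp: P_def)
      have "closed P" unfolding P using cont by (intro closed_vimage) auto
      moreover have "convex P" unfolding P using lin by (intro convex_linear_vimage) auto
      ultimately have "\<zeta> x \<in> P" using d2(3)[of x q] True x q nq p by (intro \<zeta>(2)[OF True]) (auto simp: P_def)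
      then have "cmod (cdot (\<eta>' x) (x - q)) \<le> C2 * (norm (x - q))\<^sup>2" using \<eta>'R[OF True] by (simp add: P_def)
      also have "\<dots> \<le> max C1 C2 * (norm (x - q))\<^sup>2" by (intro mult_right_mono) auto
      finally show ?thesis .
    next
      case False
      then have xY: "x \<in> Y k" using x by (auto simp: Y_Suc)
      then have "cmod (cdot (\<eta>' x) (x - q)) \<le> C1 * (norm (x - q))\<^sup>2" using d1(3)[of x q] x q nq \<eta>'Y by auto
      also have "\<dots> \<le> max C1 C2 * (norm (x - q))\<^sup>2" by (intro mult_right_mono) auto
      finally show ?thesis .
    qed
    then show ?thesis using d1 d2 by (intro exI[of _ "min d1 d2"] exI[of _ "max C1 C2"] conjI ballI impI) auto
  qed
  show thesis by (rule that) (use g1 g2 g3 g4 in \<open>auto simp: good_field_def\<close>)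
qed

end

lemma (in whitney_family) controlled_field_exists: "k \<le> m \<Longrightarrow> \<exists>\<eta>. good_field k \<eta>"
proof (induction k)
  case 0
  show ?case by (intro exI[of _ "\<lambda>_. 0"]) (auto simp: good_field_def Y_def)
next
  case (Suc k)
  then obtain \<eta> where "good_field k \<eta>" by auto
  then interpret whitney_step \<Omega> T a R m k \<eta> by unfold_locales (use Suc in auto)
  show ?case using extension by blast
qed

section \<open>Holomorphic charts as strata\<close>

lemma norm_vec_le_sum: "norm (x :: complex^'n::finite) \<le> (\<Sum>i\<in>UNIV. cmod (x $ i))"
  unfolding norm_vec_def by (rule L2_set_le_sum) auto

lemma clinearD:
  assumes "Vector_Spaces.linear (*s) (*s) (D :: complex^'n::finite \<Rightarrow> complex^'n)"
  shows "D (x + y) = D x + D y" "D (c *s x) = c *s D x" "D (x - y) = D x - D y" "D 0 = 0"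
proof -
  have *: "D (x + y) = D x + D y" "D (c *s x) = c *s D x" for x y c
    using assms unfolding Vector_Spaces.linear_iff by auto
  show "D (x + y) = D x + D y" "D (c *s x) = c *s D x" by (rule *)+
  show "D 0 = 0" using *(2)[of 0 0] by simp
  have "D ((x - y) + y) = D (x - y) + D y" by (rule *)
  then show "D (x - y) = D x - D y" by (simp add: algebra_simps)
qed

text \<open>On the complex line u + z h each component is a function of one variable, bounded on a
  disc of radius \<rho> \<ge> 2. Cauchy's inequality on discs of radius \<rho> / 4 about points of
  the unit disc bounds its second derivative, and Taylor's formula at z = 1 gives the remainder. The
  factor CARD('n) comes from summing components.\<close>

lemma holomorphic_quadratic_bound:
  fixes f :: "complex^'n::finite \<Rightarrow> complex^'n"
  assumes der: "\<And>x. x \<in> ball p (4 * r) \<Longrightarrow> (f has_derivative D x) (at x) \<and> Vector_Spaces.linear (*s) (*s) (D x)"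
    and M: "\<And>x. x \<in> ball p (4 * r) \<Longrightarrow> norm (f x) \<le> M" and r: "r > 0"
    and u: "u \<in> ball p r" and h: "norm h \<le> r"
  shows "norm (f (u + h) - f u - D u h) \<le> real CARD('n) * (8 * M / r\<^sup>2) * (norm h)\<^sup>2"
proof (cases "h = 0")
  case True
  have "Vector_Spaces.linear (*s) (*s) (D u)" using der[of u] u r by auto
  then show ?thesis using True clinearD(4) by force
next
  case False
  then have h0: "norm h > 0" by simp
  have M0: "M \<ge> 0" using M[of p] r by (auto intro: order_trans[OF norm_ge_zero[of "f p"]])
  define \<rho> where "\<rho> = 2 * r / norm h"
  have \<rho>: "\<rho> \<ge> 2" using h h0 by (simp add: \<rho>_def field_simps)
  have inb: "u + z *s h \<in> ball p (4 * r)" if "z \<in> ball 0 \<rho>" for z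
  proof -
    have "norm (z *s h) < 2 * r" using that h0 by (simp add: norm_vec_scale \<rho>_def field_simps)
    then show ?thesis using u norm_triangle_ineq4[of "p - u" "z *s h"] r by (simp add: dist_norm diff_diff_eq)
  qed
  have comp: "cmod ((f (u + h) - f u - D u h) $ i) \<le> 8 * M / r\<^sup>2 * (norm h)\<^sup>2" for i
  proof -
    define g where "g z = f (u + z *s h) $ i" for z
    have dg: "(g has_field_derivative (D (u + z *s h) h) $ i) (at z)" if z: "z \<in> ball 0 \<rho>" for z
    proof -
      have lin: "Vector_Spaces.linear (*s) (*s) (D (u + z *s h))" and df: "(f has_derivative D (u + z *s h)) (at (u + z *s h))"
        using der[OF inb[OF z]] by auto
      have bl: "bounded_linear (\<lambda>c. c *s h)" by (rule bounded_bilinear.bounded_linear_left[OF bounded_bilinear_vec_scale])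
      have "((\<lambda>z. u + z *s h) has_derivative (\<lambda>c. c *s h)) (at z)"
        using bounded_linear_imp_has_derivative[OF bl] by (auto intro!: derivative_eq_intros)
      then have "((\<lambda>z. f (u + z *s h)) has_derivative (\<lambda>c. D (u + z *s h) (c *s h))) (at z)"
        using df by (rule has_derivative_compose)
      then have "(g has_derivative (\<lambda>c. D (u + z *s h) (c *s h) $ i)) (at z)" unfolding g_def
        by (rule bounded_linear.has_derivative[OF bounded_linear_vec_nth])
      moreover have "(\<lambda>c. D (u + z *s h) (c *s h) $ i) = (*) ((D (u + z *s h) h) $ i)"
        by (auto simp: fun_eq_iff clinearD(2)[OF lin])
      ultimately show ?thesis unfolding has_field_derivative_def by (simp only:)
    qed
    have hol: "g holomorphic_on ball 0 \<rho>" using dg by (subst holomorphic_on_open) blast+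
    have gM: "cmod (g z) \<le> M" if "z \<in> ball 0 \<rho>" for z
      using M[OF inb[OF that]] Finite_Cartesian_Product.norm_nth_le[of "f (u + z *s h)" i] by (simp add: g_def)
    have d2: "cmod ((deriv ^^ 2) g z) \<le> fact 2 * M / (\<rho>/4)^2" if z: "z \<in> cball 0 1" for z
    proof (rule Cauchy_inequality)
      have sub: "cball z (\<rho>/4) \<subseteq> ball 0 \<rho>"
      proof
        fix w assume "w \<in> cball z (\<rho>/4)"
        then have "cmod w \<le> 1 + \<rho>/4" using z norm_triangle_sub[of w z] by (simp add: dist_norm norm_minus_commute)
        then show "w \<in> ball 0 \<rho>" using \<rho> by simp
      qed
      show "g holomorphic_on ball z (\<rho>/4)" using hol sub by (meson ball_subset_cball holomorphic_on_subset order_trans)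
      show "continuous_on (cball z (\<rho>/4)) g" using hol sub by (meson continuous_on_subset holomorphic_on_imp_continuous_on)
      show "cmod (g x) \<le> M" if "cmod (z - x) = \<rho>/4" for x using that sub by (intro gM) (auto simp: dist_norm subset_iff)
    qed (use \<rho> in auto)
    have "cmod ((\<lambda>i. (deriv ^^ i) g) 0 1 - (\<Sum>i\<le>1. (\<lambda>i. (deriv ^^ i) g) i 0 * (1 - 0) ^ i / fact i)) \<le> (fact 2 * M / (\<rho>/4)^2) * cmod (1 - 0) ^ Suc 1 / fact 1"
    proof (rule complex_Taylor[of "cball 0 1"])
      fix i x assume "x \<in> cball (0::complex) 1"
      then have "x \<in> ball 0 \<rho>" using \<rho> by auto
      then show "((deriv ^^ i) g has_field_derivative (deriv ^^ Suc i) g x) (at x within cball 0 1)"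
        using holomorphic_derivI[OF holomorphic_higher_deriv[OF hol, of i]] by auto
    next
      fix x assume "x \<in> cball (0::complex) 1"
      then show "cmod ((deriv ^^ Suc 1) g x) \<le> fact 2 * M / (\<rho>/4)^2" using d2 by (simp only: Suc_1)
    qed auto
    moreover have "deriv g 0 = (D u h) $ i" using dg[of 0] \<rho> by (auto intro!: DERIV_imp_deriv)
    ultimately have "cmod (g 1 - (g 0 + (D u h) $ i)) \<le> 2 * M / (\<rho>/4)^2" by simp
    moreover have "g 1 - (g 0 + (D u h) $ i) = (f (u + h) - f u - D u h) $ i" by (simp add: g_def)
    moreover have "2 * M / (\<rho>/4)^2 = 8 * M / r\<^sup>2 * (norm h)\<^sup>2" using h0 r by (simp add: \<rho>_def power_divide power_mult_distrib field_simps)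
    ultimately show ?thesis by simp
  qed
  have "norm (f (u + h) - f u - D u h) \<le> (\<Sum>i\<in>UNIV. cmod ((f (u + h) - f u - D u h) $ i))" by (rule norm_vec_le_sum)
  also have "\<dots> \<le> (\<Sum>i\<in>(UNIV::'n set). 8 * M / r\<^sup>2 * (norm h)\<^sup>2)" by (intro sum_mono comp)
  finally show ?thesis by (simp add: mult.assoc)
qed

text \<open>Complex differentiability at each point is all that is given; continuity of the
  derivative is a consequence. The quadratic remainder bounds the derivative by difference quotients
  and yields its Lipschitz dependence on the point.\<close>

lemma holomorphic_map_c11:
  fixes f :: "complex^'n::finite \<Rightarrow> complex^'n"
  assumes U: "open U" "p \<in> U" and f: "holomorphic_map_on U f"
  obtains r K D where "r > 0" "K \<ge> 0" "ball p r \<subseteq> U"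
    "\<And>u. u \<in> ball p r \<Longrightarrow> (f has_derivative D u) (at u)" "\<And>u. u \<in> ball p r \<Longrightarrow> Vector_Spaces.linear (*s) (*s) (D u)"
    "\<And>u u'. u \<in> ball p r \<Longrightarrow> u' \<in> ball p r \<Longrightarrow> norm (f u' - f u - D u (u' - u)) \<le> K * (norm (u' - u))\<^sup>2"
    "\<And>u u' h. u \<in> ball p r \<Longrightarrow> u' \<in> ball p r \<Longrightarrow> norm (D u' h - D u h) \<le> K * norm (u' - u) * norm h"
    "\<And>u h. u \<in> ball p r \<Longrightarrow> norm (D u h) \<le> K * norm h"
    "\<And>u u'. u \<in> ball p r \<Longrightarrow> u' \<in> ball p r \<Longrightarrow> norm (f u' - f u) \<le> K * norm (u' - u)"
proof -
  obtain D where D: "\<And>x. x \<in> U \<Longrightarrow> (f has_derivative D x) (at x) \<and> Vector_Spaces.linear (*s) (*s) (D x)"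
    using f unfolding holomorphic_map_on_def by metis
  have "continuous_on U f" using D by (meson continuous_at_imp_continuous_on has_derivative_continuous)
  obtain R where R: "R > 0" "cball p R \<subseteq> U" using U open_contains_cball by blast
  have "compact (f ` cball p R)" using R \<open>continuous_on U f\<close> by (intro compact_continuous_image) (auto intro: continuous_on_subset)
  then obtain M where M: "\<And>x. x \<in> cball p R \<Longrightarrow> norm (f x) \<le> M" "M > 0"
    using compact_imp_bounded[of "f ` cball p R"] unfolding bounded_pos by (metis imageI)
  define s where "s = R / 4"
  have s: "s > 0" using R by (simp add: s_def)
  have sub: "ball p (4 * s) \<subseteq> cball p R" by (auto simp: s_def)
  define C where "C = real CARD('n) * (8 * M / s\<^sup>2)"
  have C0: "C \<ge> 0" using M s by (simp add: C_def)
  have Q: "norm (f (u + h) - f u - D u h) \<le> C * (norm h)\<^sup>2" if "u \<in> ball p s" "norm h \<le> s" for u h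
    unfolding C_def by (rule holomorphic_quadratic_bound[OF _ _ s that]) (use D M R sub in blast)+
  have lin: "Vector_Spaces.linear (*s) (*s) (D u)" if "u \<in> ball p s" for u
    using D[of u] R that s sub by (auto simp: s_def subset_iff)
  have scale: "D u (t *\<^sub>R h) = t *\<^sub>R D u h" if "u \<in> ball p s" for u t h
    using clinearD(2)[OF lin[OF that]] by (simp add: scaleR_vec_eq)
  define B where "B = (2 * M + C * s\<^sup>2) / s"
  have B0: "B \<ge> 0" using M s C0 by (simp add: B_def)
  have bd: "norm (D u h) \<le> B * norm h" if u: "u \<in> ball p s" for u h
  proof (cases "h = 0")
    case True then show ?thesis using clinearD(4)[OF lin[OF u]] by simp
  next
    case False
    define k where "k = (s / norm h) *\<^sub>R h"
    have nk: "norm k = s" using False s by (simp add: k_def)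
    have "u + k \<in> cball p R" using u nk norm_triangle_ineq4[of "p - u" k] R by (simp add: dist_norm diff_diff_eq s_def)
    moreover have "u \<in> cball p R" using u s by (simp add: s_def)
    ultimately have ff: "norm (f (u + k) - f u) \<le> 2 * M"
      using M(1)[of "u + k"] M(1)[of u] norm_triangle_ineq4[of "f (u + k)" "f u"] by simp
    have "norm (D u k) \<le> norm (f (u + k) - f u) + norm (f (u + k) - f u - D u k)"
      by (metis add.commute norm_minus_commute norm_triangle_sub)
    also have "\<dots> \<le> 2 * M + C * s\<^sup>2" using ff Q[OF u, of k] nk by simp
    finally have "s * norm (D u h) \<le> (2 * M + C * s\<^sup>2) * norm h" using False s by (simp add: k_def scale[OF u] field_simps)
    then show ?thesis using s by (simp add: B_def field_simps)
  qed
  define r where "r = s / 8"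
  have r: "r > 0" "r \<le> s" using s by (auto simp: r_def)
  have d: "norm (u' - u) \<le> s / 4" if "u \<in> ball p r" "u' \<in> ball p r" for u u'
    using that norm_triangle_ineq4[of "p - u" "p - u'"] by (simp add: r_def dist_norm)
  define K where "K = B + 6 * C + C * s"
  have K: "K \<ge> 0" "K \<ge> 6 * C" "K \<ge> B" "K \<ge> B + C * s" "K \<ge> C" using B0 C0 s by (auto simp: K_def)
  show thesis
  proof (rule that[of r K D])
    show "ball p r \<subseteq> U" using R r sub by (auto simp: s_def)
    fix u assume u: "u \<in> ball p r"
    then have us: "u \<in> ball p s" using r by auto
    show "(f has_derivative D u) (at u)" using D[of u] us R sub s by (auto simp: s_def subset_iff)
    show "Vector_Spaces.linear (*s) (*s) (D u)" by (rule lin[OF us])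
    show "norm (D u h) \<le> K * norm h" for h using bd[OF us, of h] K by (meson mult_right_mono norm_ge_zero order_trans)
    fix u' assume u': "u' \<in> ball p r"
    then have us': "u' \<in> ball p s" using r by auto
    have q: "norm (f u' - f u - D u (u' - u)) \<le> C * (norm (u' - u))\<^sup>2" using Q[OF us, of "u' - u"] d[OF u u'] s by simp
    also have "\<dots> \<le> K * (norm (u' - u))\<^sup>2" using K by (intro mult_right_mono) auto
    finally show "norm (f u' - f u - D u (u' - u)) \<le> K * (norm (u' - u))\<^sup>2" .
    have "norm (f u' - f u) \<le> norm (D u (u' - u)) + norm (f u' - f u - D u (u' - u))" by (rule norm_triangle_sub)
    also have "\<dots> \<le> B * norm (u' - u) + C * (norm (u' - u))\<^sup>2" using bd[OF us] q by (intro add_mono) auto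
    also have "\<dots> \<le> B * norm (u' - u) + C * (norm (u' - u) * s)"
      using d[OF u u'] s C0 by (intro add_left_mono mult_left_mono) (auto simp: power2_eq_square intro!: mult_left_mono)
    also have "\<dots> = (B + C * s) * norm (u' - u)" by (simp add: algebra_simps)
    also have "\<dots> \<le> K * norm (u' - u)" using K by (intro mult_right_mono) auto
    finally show "norm (f u' - f u) \<le> K * norm (u' - u)" .
    show "norm (D u' h - D u h) \<le> K * norm (u' - u) * norm h" for h
    proof (cases "h = 0 \<or> u' = u")
      case True then show ?thesis using clinearD(4)[OF lin[OF us]] clinearD(4)[OF lin[OF us']] by auto
    next
      case False
      define t where "t = norm (u' - u)"
      have t: "t > 0" "t \<le> s / 4" using False d[OF u u'] by (auto simp: t_def)
      define k where "k = (t / norm h) *\<^sub>R h"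
      have nk: "norm k = t" using False t by (simp add: k_def)
      have q1: "norm (f (u' + k) - f u' - D u' k) \<le> C * t\<^sup>2" using Q[OF us', of k] nk t s by simp
      have n2: "norm ((u' - u) + k) \<le> 2 * t" using norm_triangle_ineq[of "u' - u" k] nk by (simp add: t_def)
      have "norm (f (u + ((u' - u) + k)) - f u - D u ((u' - u) + k)) \<le> C * (norm ((u' - u) + k))\<^sup>2"
        using n2 t s by (intro Q us) auto
      also have "\<dots> \<le> C * (2 * t)\<^sup>2" using n2 C0 by (intro mult_left_mono power_mono) auto
      finally have q2: "norm (f (u' + k) - f u - D u (u' - u) - D u k) \<le> C * (2 * t)\<^sup>2"
        unfolding clinearD(1)[OF lin[OF us]] by (simp add: diff_diff_eq add.assoc)
      have q3: "norm (f u' - f u - D u (u' - u)) \<le> C * t\<^sup>2" using q by (simp add: t_def)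
      \<comment> \<open>With k of length t = |u' - u|, the difference of derivatives is a
        combination of three Taylor remainders, at most (4 + 1 + 1) * C * t^2.\<close>
      have "D u' k - D u k = (f (u' + k) - f u - D u (u' - u) - D u k) - (f (u' + k) - f u' - D u' k) - (f u' - f u - D u (u' - u))"
        by simp
      then have "norm (D u' k - D u k) \<le> norm (f (u' + k) - f u - D u (u' - u) - D u k) + norm (f (u' + k) - f u' - D u' k) + norm (f u' - f u - D u (u' - u))"
        using norm_triangle_ineq4[of "(f (u' + k) - f u - D u (u' - u) - D u k) - (f (u' + k) - f u' - D u' k)" "f u' - f u - D u (u' - u)"]
          norm_triangle_ineq4[of "f (u' + k) - f u - D u (u' - u) - D u k" "f (u' + k) - f u' - D u' k"] by simp
      also have "\<dots> \<le> 6 * C * t\<^sup>2" using q1 q2 q3 by (simp add: power_mult_distrib)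
      finally have "norm (D u' k - D u k) \<le> 6 * C * t * t" by (simp add: power2_eq_square)
      moreover have "D u' k - D u k = (t / norm h) *\<^sub>R (D u' h - D u h)" unfolding k_def scale[OF us] scale[OF us'] by (simp add: scaleR_diff_right)
      ultimately have "t / norm h * norm (D u' h - D u h) \<le> 6 * C * t * t" using t by simp
      then have "norm (D u' h - D u h) \<le> 6 * C * t * norm h" using t False by (simp add: field_simps)
      also have "\<dots> \<le> K * t * norm h" using K t by (intro mult_right_mono) auto
      finally show ?thesis by (simp add: t_def)
    qed
  qed (use r K in auto)
qed

text \<open>\<open>f\<close> is a chart into \<open>W\<close>, and \<open>D x\<close> is the derivative at \<open>x\<close> of its inverse.\<close>

definition c11_chart :: "(complex^'n::finite) set \<Rightarrow> (complex^'n \<Rightarrow> (complex^'n) set) \<Rightarrow> complex^'n \<Rightarrow> real \<Rightarrow> real \<Rightarrow>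
  'h::real_normed_vector set \<Rightarrow> (complex^'n \<Rightarrow> 'h) \<Rightarrow> (complex^'n \<Rightarrow> 'h \<Rightarrow> complex^'n) \<Rightarrow> bool" where
  "c11_chart R T y d K W f D \<longleftrightarrow> d > 0 \<and> K \<ge> 0 \<and>
     (\<forall>x\<in>R \<inter> ball y d. T x = D x ` W \<and> (\<forall>h\<in>W. norm (D x h) \<le> K * norm h) \<and>
        (\<forall>x'\<in>R \<inter> ball y d. f x' - f x \<in> W \<and> norm (x' - x - D x (f x' - f x)) \<le> K * (norm (x' - x))\<^sup>2 \<and>
          (\<forall>h\<in>W. norm (D x' h - D x h) \<le> K * norm (x' - x) * norm h)))"

text \<open>Along a curve in R through y the squared distance to x has a local minimum, so its
  derivative vanishes; that is real orthogonality.\<close>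

lemma tangent_space_nearest_normal:
  fixes R :: "(complex^'n::finite) set"
  assumes sub: "vec.subspace (tangent_space R y)" and d: "d > 0"
    and near: "\<And>q. q \<in> R \<inter> ball y d \<Longrightarrow> dist x y \<le> dist x q"
  shows "normal_to (tangent_space R y) (x - y)"
proof -
  have real: "inner t (x - y) = 0" if t: "t \<in> tangent_space R y" for t
  proof -
    obtain c where c: "c 0 = y" "\<And>s. c s \<in> R" "(c has_vector_derivative t) (at 0)"
      using t by (auto simp: tangent_space_def)
    have "isCont c 0" using c(3) has_vector_derivative_continuous by blast
    then obtain e where e: "e > 0" "\<And>s. \<bar>s\<bar> < e \<Longrightarrow> dist (c s) y < d"
      using d c(1) unfolding continuous_at_eps_delta by (metis diff_zero dist_real_def)
    define g where "g s = inner (x - c s) (x - c s)" for s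
    have "(g has_derivative (\<lambda>h. h * (- 2 * inner t (x - y)))) (at 0)"
      unfolding g_def using c(3) unfolding has_vector_derivative_def
      by (auto intro!: derivative_eq_intros simp: c(1) inner_commute algebra_simps inner_diff)
    moreover have "(\<lambda>h. h * (- 2 * inner t (x - y))) = (*) (- 2 * inner t (x - y))" by (simp add: fun_eq_iff)
    ultimately have "(g has_real_derivative (- 2 * inner t (x - y))) (at 0)"
      unfolding has_field_derivative_def by (simp only:)
    moreover have "\<forall>s. \<bar>0 - s\<bar> < e \<longrightarrow> g 0 \<le> g s"
    proof (intro allI impI)
      fix s assume "\<bar>0 - s\<bar> < e"
      then have "dist x y \<le> dist x (c s)" using e(2)[of s] c(2) by (intro near) (auto simp: dist_commute)
      then have "(dist x y)\<^sup>2 \<le> (dist x (c s))\<^sup>2" by (intro power_mono) auto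
      then show "g 0 \<le> g s" by (simp add: g_def c(1) dist_norm power2_norm_eq_inner)
    qed
    ultimately have "- 2 * inner t (x - y) = 0" using e(1) by (intro DERIV_local_min[of g _ 0 e]) auto
    then show ?thesis by simp
  qed
  show ?thesis unfolding normal_to_def
  proof
    fix t assume t: "t \<in> tangent_space R y"
    \<comment> \<open>The tangent space is complex, so real orthogonality to \<i> t also holds; it
      gives the imaginary part of the Hermitian product.\<close>
    then have "\<i> *s t \<in> tangent_space R y" using sub by (simp add: vec.subspace_scale)
    then have "Re (cdot (\<i> *s t) (x - y)) = 0" using real by (simp add: Re_cdot)
    then have "Im (cdot t (x - y)) = 0" by (simp add: cdot_scale_left)
    moreover have "Re (cdot t (x - y)) = 0" using real[OF t] by (simp add: Re_cdot)
    ultimately show "cdot t (x - y) = 0" by (simp add: complex_eq_iff)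
  qed
qed

text \<open>\<open>reach\<close> holds because x' - x differs quadratically from the tangent vector
  D x (f x' - f x); a section through t = D x h is obtained by keeping h and moving the base point.
  The type of the model space is free because for cones it is a product.\<close>

lemma stratum_from_charts:
  fixes R :: "(complex^'n::finite) set"
  assumes sub: "\<And>x. x \<in> R \<Longrightarrow> vec.subspace (tangent_space R x)"
    and loc: "\<And>x. x \<in> R \<Longrightarrow> \<exists>d>0. closed (R \<inter> cball x d)"
    and chart: "\<And>y. y \<in> R \<Longrightarrow> \<exists>d K W (f :: complex^'n \<Rightarrow> 'h::real_normed_vector) D. c11_chart R (tangent_space R) y d K W f D"
    and T: "\<And>x. x \<in> R \<Longrightarrow> T x = tangent_space R x"
  shows "stratum R T"
proof
  fix x assume x: "x \<in> R"
  show "vec.subspace (T x)" using sub T x by simp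
  show "\<exists>d>0. closed (R \<inter> cball x d)" by (rule loc[OF x])
next
  fix y assume y: "y \<in> R"
  obtain d K W and f :: "complex^'n \<Rightarrow> 'h" and D where c: "c11_chart R (tangent_space R) y d K W f D" using chart[OF y] by blast
  show "\<exists>d>0. \<exists>K\<ge>0. \<forall>x\<in>R \<inter> ball y d. \<forall>x'\<in>R \<inter> ball y d. \<forall>v.
       normal_to (T x) v \<longrightarrow> cmod (cdot (x' - x) v) \<le> K * norm v * (norm (x' - x))\<^sup>2"
  proof (intro exI conjI ballI allI impI)
    show "d > 0" "K \<ge> 0" using c by (auto simp: c11_chart_def)
    fix x x' v assume x: "x \<in> R \<inter> ball y d" and x': "x' \<in> R \<inter> ball y d" and n: "normal_to (T x) v"
    have "D x (f x' - f x) \<in> T x" using c x x' T unfolding c11_chart_def by auto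
    then have "cdot (D x (f x' - f x)) v = 0" using n by (simp add: normal_to_def)
    then have "cdot (x' - x) v = cdot (x' - x - D x (f x' - f x)) v" by (simp add: cdot_diff_left)
    also have "cmod \<dots> \<le> norm (x' - x - D x (f x' - f x)) * norm v" by (rule norm_cdot_le)
    also have "\<dots> \<le> (K * (norm (x' - x))\<^sup>2) * norm v"
      using c x x' unfolding c11_chart_def by (intro mult_right_mono) auto
    finally show "cmod (cdot (x' - x) v) \<le> K * norm v * (norm (x' - x))\<^sup>2" by (simp add: mult_ac)
  qed
next
  fix x y d assume "y \<in> R" "(0::real) < d" "\<And>q. q \<in> R \<inter> ball y d \<Longrightarrow> dist x y \<le> dist x q"
  then show "normal_to (T y) (x - y)" using tangent_space_nearest_normal[OF sub, of y d x] T by simp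
next
  fix x t assume x: "x \<in> R" and t: "t \<in> T x"
  obtain d K W and f :: "complex^'n \<Rightarrow> 'h" and D where c: "c11_chart R (tangent_space R) x d K W f D" using chart[OF x] by blast
  have d: "d > 0" "K \<ge> 0" using c by (auto simp: c11_chart_def)
  then obtain h where h: "h \<in> W" "t = D x h" using c x t T unfolding c11_chart_def by force
  have "(K * norm h)-lipschitz_on (R \<inter> ball x d) (\<lambda>y. D y h)"
  proof (rule lipschitz_onI)
    fix y z assume "y \<in> R \<inter> ball x d" "z \<in> R \<inter> ball x d"
    then have "norm (D y h - D z h) \<le> K * norm (y - z) * norm h" using c h unfolding c11_chart_def by blast
    then show "dist (D y h) (D z h) \<le> K * norm h * dist y z" by (simp add: dist_norm mult_ac)
  qed (use d in simp)
  moreover have "D x' h \<in> T x'" if "x' \<in> R \<inter> ball x d" for x' using c that h T unfolding c11_chart_def by auto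
  ultimately show "\<exists>d>0. \<exists>L \<sigma>. L-lipschitz_on (R \<inter> ball x d) \<sigma> \<and> \<sigma> x = t \<and> (\<forall>x'\<in>R \<inter> ball x d. \<sigma> x' \<in> T x')"
    using d h by (intro exI[of _ d] conjI exI[of _ "K * norm h"] exI[of _ "\<lambda>y. D y h"]) auto
qed

text \<open>A holomorphic chart and its inverse give both the tangent spaces and their Lipschitz
  variation. The dimension is recorded since limits in the Grassmannian need it to be
  constant.\<close>

lemma tangent_space_submanifold:
  fixes A :: "(complex^'n::finite) set"
  assumes A: "complex_submanifold d A" and p: "p \<in> A"
  obtains e K W f D where "c11_chart A (tangent_space A) p e K W (f :: complex^'n \<Rightarrow> complex^'n) D" "vec.subspace W"
    "\<And>x. x \<in> A \<inter> ball p e \<Longrightarrow> Vector_Spaces.linear (*s) (*s) (D x)"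
    "\<And>x. x \<in> A \<inter> ball p e \<Longrightarrow> vec.dim (tangent_space A x) = d"
proof -
  obtain U V f g W where UV: "open U" "open V" "p \<in> U" "homeomorphism U V f g"
    "holomorphic_map_on U f" "holomorphic_map_on V g" "vec.subspace W" "vec.dim W = d" "f ` (A \<inter> U) = W \<inter> V"
    using A p unfolding complex_submanifold_def by metis
  have hom: "f ` U = V" "g ` V = U" "\<And>x. x \<in> U \<Longrightarrow> g (f x) = x" "\<And>y. y \<in> V \<Longrightarrow> f (g y) = y"
    using UV(4) by (auto simp: homeomorphism_def)
  obtain r1 K1 Df where Df: "r1 > 0" "K1 \<ge> 0" "ball p r1 \<subseteq> U"
    "\<And>u. u \<in> ball p r1 \<Longrightarrow> (f has_derivative Df u) (at u)"
    "\<And>u u'. u \<in> ball p r1 \<Longrightarrow> u' \<in> ball p r1 \<Longrightarrow> norm (f u' - f u) \<le> K1 * norm (u' - u)"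
    by (rule holomorphic_map_c11[OF UV(1,3,5)]) blast
  have fpV: "f p \<in> V" using hom UV(3) by auto
  obtain r2 K2 Dg where Dg: "r2 > 0" "K2 \<ge> 0" "ball (f p) r2 \<subseteq> V"
    "\<And>u. u \<in> ball (f p) r2 \<Longrightarrow> (g has_derivative Dg u) (at u)" "\<And>u. u \<in> ball (f p) r2 \<Longrightarrow> Vector_Spaces.linear (*s) (*s) (Dg u)"
    "\<And>u u'. u \<in> ball (f p) r2 \<Longrightarrow> u' \<in> ball (f p) r2 \<Longrightarrow> norm (g u' - g u - Dg u (u' - u)) \<le> K2 * (norm (u' - u))\<^sup>2"
    "\<And>u u' h. u \<in> ball (f p) r2 \<Longrightarrow> u' \<in> ball (f p) r2 \<Longrightarrow> norm (Dg u' h - Dg u h) \<le> K2 * norm (u' - u) * norm h"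
    "\<And>u h. u \<in> ball (f p) r2 \<Longrightarrow> norm (Dg u h) \<le> K2 * norm h"
    by (rule holomorphic_map_c11[OF UV(2) fpV UV(6)]) blast
  define e where "e = min r1 (r2 / (K1 + 1))"
  have e: "e > 0" "e \<le> r1" using Df Dg by (auto simp: e_def)
  have fin: "f x \<in> ball (f p) r2" if x: "x \<in> ball p e" for x
  proof -
    have "norm (f x - f p) \<le> K1 * norm (x - p)" using x e by (intro Df(5)) auto
    also have "\<dots> \<le> K1 * (r2 / (K1 + 1))" using x Df(2) by (intro mult_left_mono) (auto simp: e_def dist_norm norm_minus_commute)
    also have "\<dots> < r2" using Df(2) Dg(1) by (simp add: field_simps)
    finally show ?thesis by (simp add: dist_norm norm_minus_commute)
  qed
  have xU: "x \<in> U" if "x \<in> ball p e" for x using that e Df(3) by auto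
  have fW: "f x \<in> W" if "x \<in> A \<inter> ball p e" for x
  proof -
    have "f x \<in> f ` (A \<inter> U)" using that xU by auto
    then show ?thesis unfolding UV(9) by simp
  qed
  have dfx: "(f has_derivative Df x) (at x)" if "x \<in> ball p e" for x using that e by (intro Df(4)) auto
  have dgx: "(g has_derivative Dg (f x)) (at (f x))" if "x \<in> ball p e" for x using Dg(4)[OF fin[OF that]] .
  have DD: "Dg (f x) (Df x v) = v" if x: "x \<in> ball p e" for x v
  proof -
    have "((\<lambda>x. g (f x)) has_derivative (\<lambda>v. Dg (f x) (Df x v))) (at x)" by (rule has_derivative_compose[OF dfx[OF x] dgx[OF x]])
    moreover have "((\<lambda>x. g (f x)) has_derivative (\<lambda>v. v)) (at x)"
      by (rule has_derivative_transform_within_open[OF has_derivative_ident UV(1) xU[OF x]]) (use hom in auto)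
    ultimately show ?thesis using has_derivative_unique by (metis (full_types))
  qed
  have DD': "Df x (Dg (f x) v) = v" if x: "x \<in> ball p e" for x v
  proof -
    have gx: "g (f x) = x" using hom xU[OF x] by simp
    have dfx': "(f has_derivative Df x) (at (g (f x)))" using dfx[OF x] gx by simp
    have "((\<lambda>y. f (g y)) has_derivative (\<lambda>v. Df x (Dg (f x) v))) (at (f x))" by (rule has_derivative_compose[OF dgx[OF x] dfx'])
    moreover have "((\<lambda>y. f (g y)) has_derivative (\<lambda>v. v)) (at (f x))"
      by (rule has_derivative_transform_within_open[OF has_derivative_ident UV(2)]) (use hom xU[OF x] in auto)
    ultimately show ?thesis using has_derivative_unique by (metis (full_types))
  qed
  have Weq: "subspace W" "closed W" using UV(7) by (auto intro: vec_subspace_imp_subspace closed_vec_subspace)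
  have tan: "tangent_space A x = Dg (f x) ` W" if x: "x \<in> A \<inter> ball p e" for x
  proof
    show "Dg (f x) ` W \<subseteq> tangent_space A x"
    proof
      fix v assume "v \<in> Dg (f x) ` W"
      then obtain h where h: "h \<in> W" "v = Dg (f x) h" by blast
      obtain r where r: "r > 0" "ball (f x) r \<subseteq> V" using fin[of x] x Dg(3) UV(2) open_contains_ball by (metis IntD2 subsetD)
      define b where "b = r / (norm h + 1)"
      have b: "b > 0" using r by (simp add: b_def add_nonneg_pos)
      \<comment> \<open>Curves representing tangent vectors have to stay in the set for all times.
        Outside a small interval the parameter is reset to 0, so the curve rests at x there; only
        the germ at 0 matters.\<close>
      define \<psi> where "\<psi> s = (if \<bar>s\<bar> < b then s else 0)" for s :: real
      define c where "c s = g (f x + \<psi> s *\<^sub>R h)" for s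
      have psimem: "f x + \<psi> s *\<^sub>R h \<in> W \<inter> V" for s
      proof -
        have "\<bar>\<psi> s\<bar> < b" using b by (simp add: \<psi>_def)
        then have "norm (\<psi> s *\<^sub>R h) \<le> b * norm h" by (auto intro!: mult_right_mono)
        also have "\<dots> < b * (norm h + 1)" using b by simp
        also have "\<dots> = r" using add_nonneg_pos[OF norm_ge_zero[of h] zero_less_one] less_irrefl by (fastforce simp: b_def)
        finally have "f x + \<psi> s *\<^sub>R h \<in> V" using r(2) by (auto simp: dist_norm)
        moreover have "f x + \<psi> s *\<^sub>R h \<in> W" using fW[OF x] h Weq(1) by (simp add: subspace_add subspace_scale)
        ultimately show ?thesis by simp
      qed
      have cA: "c s \<in> A" for s
      proof -
        obtain y where "y \<in> A \<inter> U" "f x + \<psi> s *\<^sub>R h = f y" using psimem[of s] UV(9) by (metis imageE)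
        then show ?thesis using hom by (simp add: c_def)
      qed
      have xb: "x \<in> ball p e" using x by simp
      have "((\<lambda>s. f x + s *\<^sub>R h) has_derivative (\<lambda>s. s *\<^sub>R h)) (at 0)" by (auto intro!: derivative_eq_intros)
      moreover have "(g has_derivative Dg (f x)) (at (f x + 0 *\<^sub>R h))" using dgx[OF xb] by simp
      ultimately have "((\<lambda>s. g (f x + s *\<^sub>R h)) has_derivative (\<lambda>s. Dg (f x) (s *\<^sub>R h))) (at 0)"
        using has_derivative_compose by blast
      moreover have "(\<lambda>s. Dg (f x) (s *\<^sub>R h)) = (\<lambda>s. s *\<^sub>R v)"
        using clinearD(2)[OF Dg(5)[OF fin[OF xb]]] h by (auto simp: scaleR_vec_eq)
      ultimately have "((\<lambda>s. g (f x + s *\<^sub>R h)) has_vector_derivative v) (at 0)" by (simp add: has_vector_derivative_def)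
      then have "(c has_vector_derivative v) (at 0)"
        by (rule has_vector_derivative_transform_within_open[where S="{-b<..<b}"]) (use b in \<open>auto simp: c_def \<psi>_def\<close>)
      moreover have "c 0 = x" using hom xU[OF xb] by (simp add: c_def \<psi>_def)
      ultimately show "v \<in> tangent_space A x" using cA unfolding tangent_space_def by blast
    qed
    show "tangent_space A x \<subseteq> Dg (f x) ` W"
    proof
      fix v assume "v \<in> tangent_space A x"
      then obtain c where c: "c 0 = x" "\<And>s. c s \<in> A" "(c has_vector_derivative v) (at 0)" by (auto simp: tangent_space_def)
      have xb: "x \<in> ball p e" using x by simp
      have "(f has_derivative Df x) (at (c 0))" using dfx[OF xb] c(1) by simp
      then have "((\<lambda>s. f (c s)) has_derivative (\<lambda>s. Df x (s *\<^sub>R v))) (at 0)"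
        using c(3) unfolding has_vector_derivative_def by (rule has_derivative_compose[rotated])
      moreover have "Df x (s *\<^sub>R v) = s *\<^sub>R Df x v" for s
        using dfx[OF xb] has_derivative_bounded_linear bounded_linear.linear linear_scale by metis
      ultimately have "((\<lambda>s. f (c s)) has_vector_derivative Df x v) (at 0)" by (simp add: has_vector_derivative_def)
      then have lim: "((\<lambda>s. (1 / s) *\<^sub>R (f (c s) - f (c 0))) \<longlongrightarrow> Df x v) (at 0)"
      proof -
        assume "((\<lambda>s. f (c s)) has_vector_derivative Df x v) (at 0)"
        then have "((\<lambda>s. norm (f (c s) - f (c 0) - s *\<^sub>R Df x v) / norm s) \<longlongrightarrow> 0) (at 0)"
          unfolding has_vector_derivative_def has_derivative_at by simp
        then have "((\<lambda>s. norm ((1 / s) *\<^sub>R (f (c s) - f (c 0)) - Df x v)) \<longlongrightarrow> 0) (at 0)"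
        proof (rule Lim_transform_within[where d=1])
          fix s :: real assume "0 < dist s 0"
          then have s: "s \<noteq> 0" by simp
          then have "(1 / s) *\<^sub>R (f (c s) - f (c 0)) - Df x v = (1 / s) *\<^sub>R (f (c s) - f (c 0) - s *\<^sub>R Df x v)"
            by (simp add: scaleR_diff_right)
          then show "norm (f (c s) - f (c 0) - s *\<^sub>R Df x v) / norm s = norm ((1 / s) *\<^sub>R (f (c s) - f (c 0)) - Df x v)"
            by simp
        qed simp
        then show ?thesis by (rule LIM_zero_cancel[OF tendsto_norm_zero_cancel])
      qed
      have "isCont c 0" using c(3) has_vector_derivative_continuous by blast
      then have "\<forall>\<^sub>F s in at 0. c s \<in> ball p e"
        using c(1) xb by (metis continuous_within open_ball topological_tendstoD)
      then have "\<forall>\<^sub>F s in at 0. (1 / s) *\<^sub>R (f (c s) - f (c 0)) \<in> W"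
      proof eventually_elim
        case (elim s)
        have "f (c s) \<in> W" "f (c 0) \<in> W" using fW c elim x by auto
        then show ?case using Weq(1) by (simp add: subspace_diff subspace_scale)
      qed
      \<comment> \<open>Difference quotients of the chart along the curve lie in W, and W is
        closed.\<close>
      then have "Df x v \<in> W" using Lim_in_closed_set[OF Weq(2) _ _ lim] by simp
      then show "v \<in> Dg (f x) ` W" using DD[OF xb, of v] by (metis imageI)
    qed
  qed
  define K where "K = K2 + K2 * K1 + K2 * K1\<^sup>2"
  have K: "K \<ge> 0" "K \<ge> K2" "K \<ge> K2 * K1" "K \<ge> K2 * K1\<^sup>2" using Df(2) Dg(2) by (auto simp: K_def)
  have "c11_chart A (tangent_space A) p e K W f (\<lambda>x. Dg (f x))"
    unfolding c11_chart_def
  proof (intro conjI ballI)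
    show "e > 0" "K \<ge> 0" by fact+
    fix x assume x: "x \<in> A \<inter> ball p e"
    then have xb: "x \<in> ball p e" by simp
    show "tangent_space A x = Dg (f x) ` W" by (rule tan[OF x])
    show "norm (Dg (f x) h) \<le> K * norm h" for h using Dg(8)[OF fin[OF xb], of h] K by (meson mult_right_mono norm_ge_zero order_trans)
    fix x' assume x': "x' \<in> A \<inter> ball p e"
    then have xb': "x' \<in> ball p e" by simp
    show "f x' - f x \<in> W" using fW x x' Weq(1) by (simp add: subspace_diff)
    have ff: "norm (f x' - f x) \<le> K1 * norm (x' - x)" using xb xb' e by (intro Df(5)) auto
    have "norm (x' - x - Dg (f x) (f x' - f x)) \<le> K2 * (norm (f x' - f x))\<^sup>2"
      using Dg(6)[OF fin[OF xb] fin[OF xb']] hom(3) xU[OF xb] xU[OF xb'] by simp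
    also have "\<dots> \<le> K2 * (K1 * norm (x' - x))\<^sup>2" using ff Dg(2) by (intro mult_left_mono power_mono) auto
    also have "\<dots> \<le> K * (norm (x' - x))\<^sup>2" using K(4) by (simp add: power_mult_distrib mult_right_mono flip: mult.assoc)
    finally show "norm (x' - x - Dg (f x) (f x' - f x)) \<le> K * (norm (x' - x))\<^sup>2" .
    show "norm (Dg (f x') h - Dg (f x) h) \<le> K * norm (x' - x) * norm h" for h
    proof -
      have "norm (Dg (f x') h - Dg (f x) h) \<le> K2 * norm (f x' - f x) * norm h" by (rule Dg(7)[OF fin[OF xb] fin[OF xb']])
      also have "\<dots> \<le> K2 * (K1 * norm (x' - x)) * norm h" using ff Dg(2) by (intro mult_right_mono mult_left_mono) auto
      also have "\<dots> \<le> K * norm (x' - x) * norm h" using K(3) by (intro mult_right_mono) (auto simp: mult_right_mono simp flip: mult.assoc)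
      finally show ?thesis .
    qed
  qed
  moreover have "vec.dim (tangent_space A x) = d" if x: "x \<in> A \<inter> ball p e" for x
  proof -
    have "inj_on (Dg (f x)) (vec.span W)" by (rule inj_on_inverseI[where g="Df x"]) (use DD' x in auto)
    then show ?thesis unfolding tan[OF x]
      using vec.dim_image_eq[OF Dg(5)[OF fin]] x UV(8) by simp
  qed
  ultimately show thesis using that[of e K W f "\<lambda>x. Dg (f x)"] UV(7) Dg(5) fin by blast
qed

section \<open>Cones over projective sets\<close>

definition cone :: "'n::finite cproj set \<Rightarrow> (complex^'n) set" where
  "cone S = {v. v \<noteq> 0 \<and> proj v \<in> S}"

lemma line_proj: "v \<noteq> 0 \<Longrightarrow> line (proj v) = vec.span {v}"
  unfolding proj_def by (rule Line_inverse) auto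

lemma span_scale: "c \<noteq> 0 \<Longrightarrow> vec.span {c *s v} = vec.span {v :: complex^'n::finite}"
  unfolding vec.span_singleton by (auto simp: image_iff) (metis divide_inverse_commute mult.assoc nonzero_mult_div_cancel_left times_divide_eq_right mult.commute)

lemma proj_scale: "c \<noteq> 0 \<Longrightarrow> proj (c *s v) = proj v"
  by (simp add: proj_def span_scale)

lemma proj_eq_iff: "v \<noteq> 0 \<Longrightarrow> w \<noteq> 0 \<Longrightarrow> proj v = proj w \<longleftrightarrow> (\<exists>c. c \<noteq> 0 \<and> w = c *s v)"
proof
  assume "v \<noteq> 0" "w \<noteq> 0" "proj v = proj w"
  then have "vec.span {v} = vec.span {w}" by (metis line_proj)
  then have "w \<in> vec.span {v}" by (simp add: vec.span_base)
  then show "\<exists>c. c \<noteq> 0 \<and> w = c *s v" using \<open>w \<noteq> 0\<close> by (auto simp: vec.span_singleton)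
next
  assume "\<exists>c. c \<noteq> 0 \<and> w = c *s v"
  then show "proj v = proj w" by (metis proj_scale)
qed

lemma proj_surj: obtains v where "v \<noteq> 0" "p = proj v"
proof -
  have "line p \<in> {l. \<exists>v. v \<noteq> 0 \<and> l = vec.span {v}}" by (rule cproj.line)
  then obtain v where "v \<noteq> 0" "line p = vec.span {v}" by blast
  then show thesis using that[of v] by (metis line_inverse proj_def)
qed

lemma cone_scale: "c \<noteq> 0 \<Longrightarrow> c *s v \<in> cone S \<longleftrightarrow> v \<in> cone S"
  by (simp add: cone_def proj_scale)

lemma affine_part_cone: "w \<in> affine_part k S \<longleftrightarrow> w $ k = 1 \<and> w \<in> cone S"
  by (auto simp: affine_part_def cone_def)

lemma open_cone: "open U \<Longrightarrow> open (cone U)"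
  by (simp add: open_cproj_def cone_def)

lemma continuous_on_proj: "continuous_on (- {0}) proj"
proof -
  have "openin (top_of_set (- {0})) (- {0} \<inter> proj -` U)" if "open U" for U :: "'a cproj set"
  proof -
    have "- {0} \<inter> proj -` U = cone U" by (auto simp: cone_def)
    then show ?thesis using open_cone[OF that] by (metis inf_le1 open_openin openin_subset_trans top_greatest openin_open_eq open_Compl closed_singleton)
  qed
  then show ?thesis by (simp add: continuous_on_open_gen) (metis continuous_on_open_vimage inf_commute open_Compl closed_singleton openin_open_eq)
qed

lemma closed_cone_insert: "closed F \<Longrightarrow> closed (insert 0 (cone F))"
proof -
  assume "closed F"
  then have "open (cone (- F))" by (intro open_cone) auto
  moreover have "- insert 0 (cone F) = cone (- F)" by (auto simp: cone_def)
  ultimately show ?thesis by (simp add: closed_def)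
qed

abbreviation normalize_at :: "'n::finite \<Rightarrow> complex^'n \<Rightarrow> complex^'n" where
  "normalize_at k v \<equiv> (1 / v $ k) *s v"

lemma normalize_at_affine: "v \<in> cone S \<Longrightarrow> v $ k \<noteq> 0 \<Longrightarrow> normalize_at k v \<in> affine_part k S"
  by (simp add: affine_part_cone cone_scale)

lemma normalize_at_lipschitz:
  fixes v0 :: "complex^'n::finite"
  assumes "v0 $ k \<noteq> 0"
  obtains d K where "d > 0" "K \<ge> 0" "\<And>v. v \<in> ball v0 d \<Longrightarrow> v $ k \<noteq> 0"
    "\<And>v. v \<in> ball v0 d \<Longrightarrow> cmod (v $ k) \<le> K" "\<And>v. v \<in> ball v0 d \<Longrightarrow> norm (normalize_at k v) \<le> K"
    "\<And>v v'. v \<in> ball v0 d \<Longrightarrow> v' \<in> ball v0 d \<Longrightarrow> norm (normalize_at k v' - normalize_at k v) \<le> K * norm (v' - v)"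
proof -
  define c where "c = cmod (v0 $ k) / 2"
  have c: "c > 0" using assms by (simp add: c_def)
  have vk: "cmod (v $ k) \<ge> c" if "v \<in> ball v0 c" for v
  proof -
    have "cmod ((v0 - v) $ k) < c" using that Finite_Cartesian_Product.norm_nth_le[of "v0 - v" k] by (simp add: dist_norm)
    then show ?thesis using norm_triangle_sub[of "v0 $ k" "v $ k"] by (simp add: c_def)
  qed
  define B where "B = norm v0 + c"
  have nv: "norm v \<le> B" if "v \<in> ball v0 c" for v
    using that norm_triangle_sub[of v v0] by (simp add: B_def dist_norm norm_minus_commute)
  have B: "B \<ge> 0" using c by (simp add: B_def)
  define K where "K = B + B / c + (1 / c + B / c\<^sup>2)"
  have K: "K \<ge> 0" "B \<le> K" "B / c \<le> K" "1 / c + B / c\<^sup>2 \<le> K" using B c by (auto simp: K_def)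
  have nrm: "norm (normalize_at k v) \<le> B / c" if "v \<in> ball v0 c" for v
    unfolding norm_vec_scale norm_divide using vk[OF that] nv[OF that] c B by (simp add: frac_le)
  show thesis
  proof (rule that[OF c K(1)])
    fix v assume v: "v \<in> ball v0 c"
    show "v $ k \<noteq> 0" using vk[OF v] c by auto
    show "cmod (v $ k) \<le> K" using Finite_Cartesian_Product.norm_nth_le[of v k] nv[OF v] K by linarith
    show "norm (normalize_at k v) \<le> K" using nrm[OF v] K by linarith
    fix v' assume v': "v' \<in> ball v0 c"
    have k0: "v $ k \<noteq> 0" "v' $ k \<noteq> 0" using vk[OF v] vk[OF v'] c by auto
    have "normalize_at k v' - normalize_at k v = (1 / v' $ k) *s (v' - v) + ((v - v') $ k / (v' $ k * v $ k)) *s v"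
      using k0 by (simp add: vec_eq_iff divide_simps) (simp add: algebra_simps)
    then have "norm (normalize_at k v' - normalize_at k v) \<le> norm ((1 / v' $ k) *s (v' - v)) + norm (((v - v') $ k / (v' $ k * v $ k)) *s v)"
      by (metis norm_triangle_ineq)
    also have "\<dots> \<le> (1 / c) * norm (v' - v) + (norm (v' - v) / (c * c)) * B"
    proof (rule add_mono)
      show "norm ((1 / v' $ k) *s (v' - v)) \<le> (1 / c) * norm (v' - v)"
        unfolding norm_vec_scale norm_divide using vk[OF v'] c by (intro mult_right_mono) (auto simp: frac_le)
      have "cmod ((v - v') $ k) \<le> norm (v' - v)" using Finite_Cartesian_Product.norm_nth_le[of "v - v'" k] by (simp add: norm_minus_commute)
      then have "cmod ((v - v') $ k / (v' $ k * v $ k)) \<le> norm (v' - v) / (c * c)"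
        unfolding norm_divide norm_mult using vk[OF v] vk[OF v'] c by (intro frac_le mult_mono) auto
      then show "norm (((v - v') $ k / (v' $ k * v $ k)) *s v) \<le> (norm (v' - v) / (c * c)) * B"
        unfolding norm_vec_scale using nv[OF v] c by (intro mult_mono) auto
    qed
    also have "\<dots> = (1 / c + B / c\<^sup>2) * norm (v' - v)" by (simp add: algebra_simps power2_eq_square)
    also have "\<dots> \<le> K * norm (v' - v)" using K by (intro mult_right_mono) auto
    finally show "norm (normalize_at k v' - normalize_at k v) \<le> K * norm (v' - v)" .
  qed
qed

text \<open>Normalizing turns a curve in the cone into one in the affine part, and multiplying by a
  scalar function goes back. The scalar factor accounts for the radial term \<alpha> v.\<close>

lemma tangent_space_cone:
  fixes v :: "complex^'n::finite"
  assumes v: "v \<in> cone S" "v $ k \<noteq> 0"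
  shows "tangent_space (cone S) v = {\<alpha> *s v + (v $ k) *s t | \<alpha> t. t \<in> tangent_space (affine_part k S) (normalize_at k v)}"
    (is "_ = ?R")
proof
  let ?w = "normalize_at k v"
  have wv: "(v $ k) *s ?w = v" using v by (simp add: vec_eq_iff)
  show "tangent_space (cone S) v \<subseteq> ?R"
  proof
    fix u assume "u \<in> tangent_space (cone S) v"
    then obtain c where c: "c 0 = v" "\<And>s. c s \<in> cone S" "(c has_vector_derivative u) (at 0)" by (auto simp: tangent_space_def)
    \<comment> \<open>Away from time 0 the curve may leave the chart; a fixed point of the affine
      part is used there.\<close>
    define e where "e s = (if c s $ k = 0 then ?w else normalize_at k (c s))" for s
    have "bounded_linear (\<lambda>v::complex^'n. v $ k)" by (rule bounded_linear_vec_nth)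
    then have ck: "((\<lambda>s. c s $ k) has_vector_derivative u $ k) (at 0)"
      using c(3) by (rule bounded_linear.has_vector_derivative)
    define du where "du = (1 / v $ k) *s u - (u $ k / (v $ k)\<^sup>2) *s v"
    have "isCont (\<lambda>s. c s $ k) 0" using ck has_vector_derivative_continuous by blast
    then have ev: "\<forall>\<^sub>F s in at 0. c s $ k \<noteq> 0" using v(2) c(1) by (metis (mono_tags) continuous_within tendsto_imp_eventually_ne)
    have "((\<lambda>s. 1 / c s $ k) has_vector_derivative - (u $ k) / (v $ k)\<^sup>2) (at 0)"
      using ck v c(1) unfolding has_vector_derivative_def
      by (auto intro!: derivative_eq_intros simp: power2_eq_square divide_simps)
    then have "((\<lambda>s. normalize_at k (c s)) has_vector_derivative
        (1 / c 0 $ k) *s u + (- (u $ k) / (v $ k)\<^sup>2) *s c 0) (at 0)"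
      using c(3) by (rule bounded_bilinear.has_vector_derivative[OF bounded_bilinear_vec_scale])
    then have d: "((\<lambda>s. normalize_at k (c s)) has_vector_derivative du) (at 0)"
      using c(1) by (simp add: du_def vec_eq_iff)
    have "\<forall>\<^sub>F s in at 0. normalize_at k (c s) = e s" by (rule eventually_mono[OF ev]) (simp add: e_def)
    then have "(e has_vector_derivative du) (at 0)"
      unfolding has_vector_derivative_def
      by (rule has_derivative_transform_eventually[OF d[unfolded has_vector_derivative_def]])
        (use v c(1) in \<open>auto simp: e_def\<close>)
    moreover have "e s \<in> affine_part k S" for s using c(2)[of s] v by (auto simp: e_def normalize_at_affine)
    moreover have "e 0 = ?w" using c(1) by (simp add: e_def)
    ultimately have "du \<in> tangent_space (affine_part k S) ?w" unfolding tangent_space_def by blast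
    moreover have "u = (u $ k / v $ k) *s v + (v $ k) *s du"
      using v by (simp add: du_def vec_eq_iff power2_eq_square algebra_simps)
    ultimately show "u \<in> ?R" by blast
  qed
  show "?R \<subseteq> tangent_space (cone S) v"
  proof
    fix u assume "u \<in> ?R"
    then obtain \<alpha> t where u: "u = \<alpha> *s v + (v $ k) *s t" "t \<in> tangent_space (affine_part k S) ?w" by blast
    then obtain c where c: "c 0 = ?w" "\<And>s. c s \<in> affine_part k S" "(c has_vector_derivative t) (at 0)" by (auto simp: tangent_space_def)
    \<comment> \<open>The exponential never vanishes, so the curve stays in the punctured cone for
      all times; its logarithmic derivative at 0 is \<alpha>.\<close>
    define e where "e s = (v $ k * exp (of_real s * \<alpha>)) *s c s" for s
    have "((\<lambda>s. v $ k * exp (of_real s * \<alpha>)) has_vector_derivative v $ k * \<alpha>) (at 0)"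
    proof -
      have "((\<lambda>z. v $ k * exp (z * \<alpha>)) has_field_derivative v $ k * \<alpha>) (at (of_real 0))"
        by (auto intro!: derivative_eq_intros)
      then show ?thesis by (rule has_vector_derivative_real_field)
    qed
    then have "(e has_vector_derivative ((v $ k * exp (of_real 0 * \<alpha>)) *s t + (v $ k * \<alpha>) *s c 0)) (at 0)"
      unfolding e_def using c(3) by (rule bounded_bilinear.has_vector_derivative[OF bounded_bilinear_vec_scale])
    moreover have "(v $ k * exp (of_real 0 * \<alpha>)) *s t + (v $ k * \<alpha>) *s c 0 = u"
      using u v c(1) by (simp add: vec_eq_iff)
    ultimately have "(e has_vector_derivative u) (at 0)" by (simp only:)
    moreover have "e s \<in> cone S" for s using c(2)[of s] v by (simp add: e_def cone_scale affine_part_cone)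
    moreover have "e 0 = v" using c(1) wv v by (simp add: e_def)
    ultimately show "u \<in> tangent_space (cone S) v" unfolding tangent_space_def by blast
  qed
qed

text \<open>Locally v = (v $ k) * normalize_at k v, so the coordinates are those of the normalized
  point together with the scale v $ k. The derivative of the inverse chart is the product
  rule.\<close>

lemma cone_chart:
  fixes v0 :: "complex^'n::finite"
  assumes v0: "v0 \<in> cone S" and k: "v0 $ k \<noteq> 0"
    and chart: "c11_chart (affine_part k S) (tangent_space (affine_part k S)) (normalize_at k v0) d K W (f :: complex^'n \<Rightarrow> 'h::real_normed_vector) D"
  obtains d' K' where "c11_chart (cone S) (tangent_space (cone S)) v0 d' K' (W \<times> (UNIV :: complex set))
    (\<lambda>v. (f (normalize_at k v), v $ k)) (\<lambda>v (h, \<alpha>). \<alpha> *s normalize_at k v + (v $ k) *s D (normalize_at k v) h)"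
proof -
  obtain d1 K1 where d1: "d1 > 0" "K1 \<ge> 0" "\<And>v. v \<in> ball v0 d1 \<Longrightarrow> v $ k \<noteq> 0"
    "\<And>v. v \<in> ball v0 d1 \<Longrightarrow> cmod (v $ k) \<le> K1" "\<And>v. v \<in> ball v0 d1 \<Longrightarrow> norm (normalize_at k v) \<le> K1"
    "\<And>v v'. v \<in> ball v0 d1 \<Longrightarrow> v' \<in> ball v0 d1 \<Longrightarrow> norm (normalize_at k v' - normalize_at k v) \<le> K1 * norm (v' - v)"
    using normalize_at_lipschitz[OF k] by metis
  have dK: "d > 0" "K \<ge> 0" using chart by (auto simp: c11_chart_def)
  let ?A = "affine_part k S"
  let ?n = "normalize_at k"
  define d' where "d' = min d1 (d / (K1 + 1))"
  have d': "d' > 0" "d' \<le> d1" using d1 dK by (auto simp: d'_def)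
  have nin: "?n v \<in> ?A \<inter> ball (?n v0) d" if v: "v \<in> cone S \<inter> ball v0 d'" for v
  proof -
    have "norm (?n v - ?n v0) \<le> K1 * norm (v - v0)" using v d' by (intro d1(6)) auto
    also have "\<dots> \<le> K1 * (d / (K1 + 1))" using v d1(2) by (intro mult_left_mono) (auto simp: d'_def dist_norm norm_minus_commute)
    also have "\<dots> < d" using d1(2) dK(1) by (simp add: field_simps)
    finally show ?thesis using v d' d1(3)[of v] by (auto simp: dist_norm norm_minus_commute intro: normalize_at_affine)
  qed
  define K' where "K' = K1 + K1 * K + K1 * (K * K1\<^sup>2) + (K1 + K1 * (K * K1) + K)"
  have K': "K' \<ge> 0" "K' \<ge> K1 + K1 * K" "K' \<ge> K1 * (K * K1\<^sup>2) + K1" "K' \<ge> K1 + K1 * (K * K1) + K"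
    using d1(2) dK by (auto simp: K'_def)
  have "c11_chart (cone S) (tangent_space (cone S)) v0 d' K' (W \<times> (UNIV :: complex set))
    (\<lambda>v. (f (?n v), v $ k)) (\<lambda>v (h, \<alpha>). \<alpha> *s ?n v + (v $ k) *s D (?n v) h)"
    unfolding c11_chart_def
  proof (intro conjI ballI)
    show "d' > 0" "K' \<ge> 0" by fact+
    fix v assume v: "v \<in> cone S \<inter> ball v0 d'"
    have vk: "v $ k \<noteq> 0" and vd: "v \<in> ball v0 d1" using v d' d1(3)[of v] by auto
    have A: "tangent_space ?A (?n v) = D (?n v) ` W" "\<And>h. h \<in> W \<Longrightarrow> norm (D (?n v) h) \<le> K * norm h"
      using chart nin[OF v] unfolding c11_chart_def by auto
    show "tangent_space (cone S) v = (\<lambda>(h, \<alpha>). \<alpha> *s ?n v + (v $ k) *s D (?n v) h) ` (W \<times> UNIV)"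
    proof -
      have e: "\<alpha> *s v = (\<alpha> * v $ k) *s ?n v" "\<alpha> *s ?n v = (\<alpha> / v $ k) *s v" for \<alpha> using vk by (auto simp: vec_eq_iff)
      have "tangent_space (cone S) v = {\<alpha> *s v + (v $ k) *s t | \<alpha> t. t \<in> D (?n v) ` W}"
        using tangent_space_cone[of v S k] v vk A by simp
      also have "\<dots> = (\<lambda>(h, \<alpha>). \<alpha> *s ?n v + (v $ k) *s D (?n v) h) ` (W \<times> UNIV)"
      proof (intro equalityI subsetI)
        fix u assume "u \<in> {\<alpha> *s v + (v $ k) *s t | \<alpha> t. t \<in> D (?n v) ` W}"
        then obtain \<alpha> h where "u = \<alpha> *s v + (v $ k) *s D (?n v) h" "h \<in> W" by blast
        then show "u \<in> (\<lambda>(h, \<alpha>). \<alpha> *s ?n v + (v $ k) *s D (?n v) h) ` (W \<times> UNIV)"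
          using e(1)[of \<alpha>] by (intro image_eqI[of _ _ "(h, \<alpha> * v $ k)"]) auto
      next
        fix u assume "u \<in> (\<lambda>(h, \<alpha>). \<alpha> *s ?n v + (v $ k) *s D (?n v) h) ` (W \<times> UNIV)"
        then obtain \<alpha> h where u: "u = \<alpha> *s ?n v + (v $ k) *s D (?n v) h" "h \<in> W" by auto
        then show "u \<in> {\<alpha> *s v + (v $ k) *s t | \<alpha> t. t \<in> D (?n v) ` W}" unfolding e(2) by blast
      qed
      finally show ?thesis .
    qed
    show "norm ((\<lambda>(h, \<alpha>). \<alpha> *s ?n v + (v $ k) *s D (?n v) h) x) \<le> K' * norm x" if "x \<in> W \<times> UNIV" for x
    proof -
      obtain h \<alpha> where x: "x = (h, \<alpha>)" "h \<in> W" using \<open>x \<in> _\<close> by auto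
      have "norm (\<alpha> *s ?n v + (v $ k) *s D (?n v) h) \<le> norm (\<alpha> *s ?n v) + norm ((v $ k) *s D (?n v) h)" by (rule norm_triangle_ineq)
      also have "\<dots> = cmod \<alpha> * norm (?n v) + cmod (v $ k) * norm (D (?n v) h)" by (simp only: norm_vec_scale)
      also have "\<dots> \<le> norm x * K1 + K1 * (K * norm x)"
      proof (intro add_mono mult_mono d1)
        show "cmod \<alpha> \<le> norm x" by (metis x(1) norm_snd_le snd_conv)
        have "norm h \<le> norm x" by (metis x(1) norm_fst_le fst_conv)
        then show "norm (D (?n v) h) \<le> K * norm x" using A(2)[OF x(2)] dK by (meson mult_left_mono order_trans)
      qed (use vd d1 in auto)
      also have "\<dots> = (K1 + K1 * K) * norm x" by (simp add: algebra_simps)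
      also have "\<dots> \<le> K' * norm x" using K' by (intro mult_right_mono) auto
      finally show ?thesis using x by simp
    qed
    fix v' assume v': "v' \<in> cone S \<inter> ball v0 d'"
    have vk': "v' $ k \<noteq> 0" and vd': "v' \<in> ball v0 d1" using v' d' d1(3)[of v'] by auto
    have B: "f (?n v') - f (?n v) \<in> W" "norm (?n v' - ?n v - D (?n v) (f (?n v') - f (?n v))) \<le> K * (norm (?n v' - ?n v))\<^sup>2"
      "\<And>h. h \<in> W \<Longrightarrow> norm (D (?n v') h - D (?n v) h) \<le> K * norm (?n v' - ?n v) * norm h"
      using chart nin[OF v] nin[OF v'] unfolding c11_chart_def by auto
    have nn: "norm (?n v' - ?n v) \<le> K1 * norm (v' - v)" by (rule d1(6)[OF vd vd'])
    have vvk: "cmod (v' $ k - v $ k) \<le> norm (v' - v)" using Finite_Cartesian_Product.norm_nth_le[of "v' - v" k] by simp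
    show "(f (?n v'), v' $ k) - (f (?n v), v $ k) \<in> W \<times> UNIV" using B by simp
    have wv: "(v $ k) *s ?n v = v" "(v' $ k) *s ?n v' = v'" using vk vk' by (auto simp: vec_eq_iff)
    have "v' - v - ((v' $ k - v $ k) *s ?n v + (v $ k) *s D (?n v) (f (?n v') - f (?n v)))
      = (v $ k) *s (?n v' - ?n v - D (?n v) (f (?n v') - f (?n v))) + (v' $ k - v $ k) *s (?n v' - ?n v)" (is "?L = _")
    proof -
      have "v' - v = (v' $ k) *s ?n v' - (v $ k) *s ?n v" using wv by simp
      then show ?thesis by (simp add: vec_eq_iff algebra_simps)
    qed
    then have "norm ?L \<le> norm ((v $ k) *s (?n v' - ?n v - D (?n v) (f (?n v') - f (?n v)))) + norm ((v' $ k - v $ k) *s (?n v' - ?n v))"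
      by (metis norm_triangle_ineq)
    also have "\<dots> \<le> K1 * (K * (K1 * norm (v' - v))\<^sup>2) + norm (v' - v) * (K1 * norm (v' - v))"
      unfolding norm_vec_scale
    proof (intro add_mono mult_mono d1 vd vvk nn)
      show "norm (?n v' - ?n v - D (?n v) (f (?n v') - f (?n v))) \<le> K * (K1 * norm (v' - v))\<^sup>2"
        using B(2) nn dK by (meson mult_left_mono norm_ge_zero order_trans power_mono)
    qed (use d1 vd' vd in auto)
    also have "\<dots> = (K1 * (K * K1\<^sup>2) + K1) * (norm (v' - v))\<^sup>2" by (simp add: power2_eq_square algebra_simps)
    also have "\<dots> \<le> K' * (norm (v' - v))\<^sup>2" using K' by (intro mult_right_mono) auto
    finally show "norm (v' - v - (\<lambda>(h, \<alpha>). \<alpha> *s ?n v + (v $ k) *s D (?n v) h) ((f (?n v'), v' $ k) - (f (?n v), v $ k))) \<le> K' * (norm (v' - v))\<^sup>2"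
      by simp
    show "norm ((\<lambda>(h, \<alpha>). \<alpha> *s ?n v' + (v' $ k) *s D (?n v') h) x - (\<lambda>(h, \<alpha>). \<alpha> *s ?n v + (v $ k) *s D (?n v) h) x) \<le> K' * norm (v' - v) * norm x"
      if "x \<in> W \<times> UNIV" for x
    proof -
      obtain h \<alpha> where x: "x = (h, \<alpha>)" "h \<in> W" using \<open>x \<in> _\<close> by auto
      have nx: "cmod \<alpha> \<le> norm x" "norm h \<le> norm x" by (metis x(1) norm_snd_le snd_conv, metis x(1) norm_fst_le fst_conv)
      have "(\<alpha> *s ?n v' + (v' $ k) *s D (?n v') h) - (\<alpha> *s ?n v + (v $ k) *s D (?n v) h)
        = \<alpha> *s (?n v' - ?n v) + (v' $ k) *s (D (?n v') h - D (?n v) h) + (v' $ k - v $ k) *s D (?n v) h"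
        by (simp add: vec_eq_iff algebra_simps)
      also have "norm \<dots> \<le> norm (\<alpha> *s (?n v' - ?n v)) + norm ((v' $ k) *s (D (?n v') h - D (?n v) h)) + norm ((v' $ k - v $ k) *s D (?n v) h)"
        by (meson add_right_mono norm_triangle_ineq order_trans)
      also have "\<dots> \<le> norm x * (K1 * norm (v' - v)) + K1 * (K * (K1 * norm (v' - v)) * norm x) + norm (v' - v) * (K * norm x)"
        unfolding norm_vec_scale
      proof (intro add_mono mult_mono nx nn d1 vd' vvk)
        have "norm (D (?n v') h - D (?n v) h) \<le> K * norm (?n v' - ?n v) * norm h" by (rule B(3)[OF x(2)])
        also have "\<dots> \<le> K * (K1 * norm (v' - v)) * norm x"
          using nn nx dK d1(2) by (intro mult_mono mult_nonneg_nonneg) auto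
        finally show "norm (D (?n v') h - D (?n v) h) \<le> K * (K1 * norm (v' - v)) * norm x" .
        show "norm (D (?n v) h) \<le> K * norm x" using A(2)[OF x(2)] nx(2) dK by (meson mult_left_mono order_trans)
      qed (use d1 vd vd' dK in auto)
      also have "\<dots> = (K1 + K1 * (K * K1) + K) * norm (v' - v) * norm x" by (simp add: algebra_simps)
      also have "\<dots> \<le> K' * norm (v' - v) * norm x" using K' by (intro mult_right_mono) auto
      finally show ?thesis using x by simp
    qed
  qed
  then show thesis using that by blast
qed

section \<open>Uniform Whitney conditions\<close>

definition orthonormal :: "(complex^'n::finite) set \<Rightarrow> bool" where
  "orthonormal B \<longleftrightarrow> (\<forall>b\<in>B. \<forall>c\<in>B. cdot b c = (if b = c then 1 else 0))"

lemma cdot_sum_left: "cdot (\<Sum>i\<in>I. f i) z = (\<Sum>i\<in>I. cdot (f i) z)"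
  by (induction I rule: infinite_finite_induct) (auto simp: cdot_add_left)

lemma orthonormal_independent:
  assumes "finite B" "orthonormal B"
  shows "vec.independent B"
proof -
  have "u b = 0" if b: "b \<in> B" and s: "(\<Sum>v\<in>B. u v *s v) = 0" for u b
  proof -
    have "0 = cdot (\<Sum>v\<in>B. u v *s v) b" using s by simp
    also have "\<dots> = (\<Sum>v\<in>B. u v * cdot v b)" by (simp add: cdot_sum_left cdot_scale_left)
    also have "\<dots> = (\<Sum>v\<in>B. if v = b then u b else 0)"
      by (intro sum.cong) (use assms(2) b in \<open>auto simp: orthonormal_def\<close>)
    also have "\<dots> = u b" using b assms(1) by simp
    finally show "u b = 0" by simp
  qed
  then show ?thesis using assms(1) by (auto simp: vec.dependent_finite)
qed

text \<open>Gram-Schmidt, one vector at a time.\<close>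

lemma orthonormal_subset_exists:
  assumes T: "vec.subspace (T :: (complex^'n::finite) set)" and k: "k \<le> vec.dim T"
  shows "\<exists>B. B \<subseteq> T \<and> finite B \<and> card B = k \<and> orthonormal B"
  using k
proof (induction k)
  case 0
  show ?case by (intro exI[of _ "{}"]) (auto simp: orthonormal_def)
next
  case (Suc k)
  then obtain B where B: "B \<subseteq> T" "finite B" "card B = k" "orthonormal B" by auto
  have "\<not> T \<subseteq> vec.span B"
  proof
    assume "T \<subseteq> vec.span B"
    then have "vec.dim T \<le> card B" using B(2) by (intro vec.dim_le_card) auto
    then show False using B Suc.prems by simp
  qed
  then obtain v where v: "v \<in> T" "v \<notin> vec.span B" by blast
  define r where "r = v - (\<Sum>b\<in>B. cdot v b *s b)"
  have sB: "(\<Sum>b\<in>B. cdot v b *s b) \<in> vec.span B" by (intro vec.span_sum vec.span_scale vec.span_base)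
  have r0: "r \<noteq> 0" using v(2) sB by (auto simp: r_def)
  have "(\<Sum>b\<in>B. cdot v b *s b) \<in> T" using T B(1) by (intro vec.subspace_sum vec.subspace_scale) auto
  then have rT: "r \<in> T" using T v(1) by (simp add: r_def vec.subspace_diff)
  have orth: "cdot r c = 0" if c: "c \<in> B" for c
  proof -
    have "cdot (\<Sum>b\<in>B. cdot v b *s b) c = (\<Sum>b\<in>B. cdot v b * cdot b c)" by (simp add: cdot_sum_left cdot_scale_left)
    also have "\<dots> = (\<Sum>b\<in>B. if b = c then cdot v c else 0)"
      by (intro sum.cong) (use B(4) c in \<open>auto simp: orthonormal_def\<close>)
    also have "\<dots> = cdot v c" using c B(2) by simp
    finally show ?thesis by (simp add: r_def cdot_diff_left)
  qed
  define n where "n = complex_of_real (1 / norm r) *s r"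
  have nT: "n \<in> T" using T rT by (simp add: n_def vec.subspace_scale)
  have "norm n = 1" unfolding n_def norm_vec_scale using r0 by (simp add: norm_divide)
  then have nn: "cdot n n = 1" by (simp add: cdot_self)
  have nb: "cdot n c = 0" "cdot c n = 0" if "c \<in> B" for c
    using orth[OF that] cdot_commute[of c r] by (auto simp: n_def cdot_scale_left cdot_scale_right)
  have nB: "n \<notin> B" using nn nb by auto
  have "orthonormal (insert n B)" unfolding orthonormal_def
    using B(4) nn nb nB by (auto simp: orthonormal_def)
  then show ?case using B nT nB by (intro exI[of _ "insert n B"]) auto
qed

text \<open>Orthonormal frames are bounded, so a subsequence converges. The limit frame is again
  orthonormal, hence spans a space of the same dimension, and its vectors are limits of combinations
  of the frames.\<close>

lemma grassmannian_compact:
  fixes T :: "nat \<Rightarrow> (complex^'n::finite) set"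
  assumes T: "\<And>m. vec.subspace (T m)" "\<And>m. vec.dim (T m) = d"
  obtains r \<tau> where "strict_mono (r :: nat \<Rightarrow> nat)" "grassmann_tendsto (\<lambda>m. T (r m)) \<tau>"
proof -
  have "d \<le> CARD('n)" using dim_subset_UNIV_cart_gen[of "T 0"] T(2)[of 0] by simp
  \<comment> \<open>Frames are stored as square matrices with zero rows outside a d-element index
    set J, because d is a number and not a type.\<close>
  then obtain J :: "'n set" where J: "card J = d" using obtain_subset_with_card_n[of d UNIV] by auto
  have "\<exists>E :: complex^'n^'n. (\<forall>i\<in>J. E $ i \<in> T m) \<and> (\<forall>i\<in>J. \<forall>j\<in>J. cdot (E $ i) (E $ j) = (if i = j then 1 else 0)) \<and> (\<forall>i. norm (E $ i) \<le> 1)" for m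
  proof -
    obtain B where B: "B \<subseteq> T m" "finite B" "card B = d" "orthonormal B"
      using orthonormal_subset_exists[OF T(1)[of m], of d] T(2) by auto
    obtain f where f: "bij_betw f J B" using B(2,3) J finite_same_card_bij[of J B] by auto
    define E :: "complex^'n^'n" where "E = (\<chi> i. if i \<in> J then f i else 0)"
    have fB: "f i \<in> B" if "i \<in> J" for i using f that by (auto simp: bij_betw_def)
    have fe: "f i = f j \<longleftrightarrow> i = j" if "i \<in> J" "j \<in> J" for i j using f that by (auto simp: bij_betw_def inj_on_def)
    have "norm (E $ i) \<le> 1" for i
    proof (cases "i \<in> J")
      case True
      then have "cdot (f i) (f i) = 1" using fB B(4) by (simp add: orthonormal_def)
      then have "(norm (f i))\<^sup>2 = 1" unfolding cdot_self by (metis of_real_eq_1_iff)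
      then have "norm (f i) = 1" by (metis norm_ge_zero one_power2 power2_eq_imp_eq zero_le_one)
      then show ?thesis using True by (simp add: E_def)
    qed (simp add: E_def)
    moreover have "\<forall>i\<in>J. \<forall>j\<in>J. cdot (E $ i) (E $ j) = (if i = j then 1 else 0)"
      using fB B(4) fe by (auto simp: E_def orthonormal_def)
    moreover have "\<forall>i\<in>J. E $ i \<in> T m" using fB B(1) by (auto simp: E_def)
    ultimately show ?thesis by blast
  qed
  then obtain E :: "nat \<Rightarrow> complex^'n^'n" where E: "\<And>m i. i \<in> J \<Longrightarrow> E m $ i \<in> T m"
    "\<And>m i j. i \<in> J \<Longrightarrow> j \<in> J \<Longrightarrow> cdot (E m $ i) (E m $ j) = (if i = j then 1 else 0)" "\<And>m i. norm (E m $ i) \<le> 1" by metis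
  have "norm (E m) \<le> real CARD('n)" for m
  proof -
    have "norm (E m) \<le> (\<Sum>i\<in>UNIV. norm (E m $ i))" unfolding norm_vec_def[of "E m"] by (rule L2_set_le_sum) auto
    also have "\<dots> \<le> (\<Sum>i\<in>(UNIV::'n set). 1)" by (intro sum_mono E)
    finally show ?thesis by simp
  qed
  then have "bounded (range E)" by (auto simp: bounded_iff)
  then obtain L r where r: "strict_mono (r :: nat \<Rightarrow> nat)" "(E \<circ> r) \<longlonglongrightarrow> L"
    using bounded_imp_convergent_subsequence[of E] by blast
  have lim: "(\<lambda>m. E (r m) $ i) \<longlonglongrightarrow> L $ i" for i
    using tendsto_vec_nth[OF r(2), of i] by (simp add: o_def)
  have LL: "cdot (L $ i) (L $ j) = (if i = j then 1 else 0)" if "i \<in> J" "j \<in> J" for i j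
  proof -
    have "(\<lambda>m. cdot (E (r m) $ i) (E (r m) $ j)) \<longlonglongrightarrow> cdot (L $ i) (L $ j)"
      by (intro bounded_bilinear.tendsto[OF bounded_bilinear_cdot] lim)
    then have "(\<lambda>m. if i = j then 1 else 0) \<longlonglongrightarrow> cdot (L $ i) (L $ j)" using E(2)[OF that] by simp
    then show ?thesis by (metis LIMSEQ_const_iff)
  qed
  have inj: "inj_on (\<lambda>i. L $ i) J" using LL by (intro inj_onI) (metis zero_neq_one)
  define B where "B = (\<lambda>i. L $ i) ` J"
  have onB: "orthonormal B" "finite B" "card B = d"
    using LL inj card_image[OF inj] J by (auto simp: B_def orthonormal_def inj_on_def)
  define \<tau> where "\<tau> = vec.span B"
  have dim: "vec.dim \<tau> = d" unfolding \<tau>_def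
    using vec.dim_span vec.dim_eq_card_independent[OF orthonormal_independent[OF onB(2,1)]] onB(3) by simp
  have "\<exists>u. (\<forall>m. u m \<in> T (r m)) \<and> u \<longlonglongrightarrow> v" if v\<tau>: "v \<in> \<tau>" for v
  proof -
    obtain c where "v = (\<Sum>b\<in>B. c b *s b)" using v\<tau> vec.span_finite[OF onB(2)] by (auto simp: \<tau>_def)
    then have v: "v = (\<Sum>i\<in>J. c (L $ i) *s L $ i)" unfolding B_def by (simp add: sum.reindex[OF inj])
    define u where "u m = (\<Sum>i\<in>J. c (L $ i) *s E (r m) $ i)" for m
    have "u m \<in> T (r m)" for m unfolding u_def by (intro vec.subspace_sum vec.subspace_scale T E)
    moreover have "u \<longlonglongrightarrow> v" unfolding u_def v
      by (intro tendsto_sum bounded_bilinear.tendsto[OF bounded_bilinear_vec_scale] tendsto_const lim)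
    ultimately show ?thesis by blast
  qed
  then have "grassmann_tendsto (\<lambda>m. T (r m)) \<tau>"
    unfolding grassmann_tendsto_def using T dim by (auto simp: \<tau>_def)
  then show thesis using that r by blast
qed

text \<open>A sequence of counterexamples has, by compactness of the Grassmannian, a subsequence
  whose tangent spaces converge; this supplies the limit space that the sequential definition
  presupposes.\<close>

lemma whitney_a_uniform:
  fixes R S :: "(complex^'n::finite) set"
  assumes R: "\<And>x. x \<in> R \<Longrightarrow> vec.subspace (tangent_space R x)" "\<And>x. x \<in> R \<Longrightarrow> vec.dim (tangent_space R x) = d"
    and a: "whitney_a R S" and p: "p \<in> S" and w: "w \<in> tangent_space S p" and e: "e > 0"
  obtains \<delta> where "\<delta> > 0" "\<And>x. x \<in> R \<inter> ball p \<delta> \<Longrightarrow> \<exists>t\<in>tangent_space R x. norm (t - w) \<le> e"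
proof (rule ccontr)
  assume "\<not> thesis"
  then have "\<exists>x\<in>R \<inter> ball p (inverse (real (Suc m))). \<forall>t\<in>tangent_space R x. \<not> norm (t - w) \<le> e" for m
    using that[of "inverse (real (Suc m))"] by force
  then obtain x where x: "\<And>m. x m \<in> R" "\<And>m. dist p (x m) < inverse (real (Suc m))" "\<And>m t. t \<in> tangent_space R (x m) \<Longrightarrow> \<not> norm (t - w) \<le> e"
    by (metis IntD1 IntD2 mem_ball)
  have xp: "x \<longlonglongrightarrow> p"
  proof (rule metric_tendsto_imp_tendsto[OF LIMSEQ_inverse_real_of_nat])
    show "\<forall>\<^sub>F m in sequentially. dist (x m) p \<le> dist (inverse (real (Suc m))) 0"
      using x(2) by (auto simp: dist_commute less_imp_le)
  qed
  obtain r \<tau> where r: "strict_mono (r :: nat \<Rightarrow> nat)" "grassmann_tendsto (\<lambda>m. tangent_space R (x (r m))) \<tau>"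
    using grassmannian_compact[of "\<lambda>m. tangent_space R (x m)" d] R x(1) by metis
  have "(\<lambda>m. x (r m)) \<longlonglongrightarrow> p" using LIMSEQ_subseq_LIMSEQ[OF xp r(1)] by (simp add: o_def)
  then have "tangent_space S p \<subseteq> \<tau>"
    using a[unfolded whitney_a_def, THEN spec, THEN spec, THEN spec, of p "\<lambda>m. x (r m)" \<tau>] p x(1) r(2) by simp
  then obtain u where u: "\<And>m. u m \<in> tangent_space R (x (r m))" "u \<longlonglongrightarrow> w"
    using r(2) w unfolding grassmann_tendsto_def by blast
  then obtain m where "dist (u m) w < e" using e by (meson lim_sequentially order_refl)
  then show False using x(3)[OF u(1)[of m]] by (simp add: dist_norm)
qed

text \<open>As for condition (a), with a further subsequence along which the unit secants converge.
  The estimate is scaled back from unit secants to x - y, hence the factor norm (x - y).\<close>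

lemma whitney_b_uniform:
  fixes R S :: "(complex^'n::finite) set"
  assumes R: "\<And>x. x \<in> R \<Longrightarrow> vec.subspace (tangent_space R x)" "\<And>x. x \<in> R \<Longrightarrow> vec.dim (tangent_space R x) = d"
    and b: "whitney_b R S" and disj: "R \<inter> S = {}" and p: "p \<in> S" and e: "e > 0"
  obtains \<delta> where "\<delta> > 0" "\<And>x y. x \<in> R \<inter> ball p \<delta> \<Longrightarrow> y \<in> S \<inter> ball p \<delta> \<Longrightarrow> \<exists>t\<in>tangent_space R x. norm (t - (x - y)) \<le> e * norm (x - y)"
proof (rule ccontr)
  assume "\<not> thesis"
  then have "\<exists>x\<in>R \<inter> ball p (inverse (real (Suc m))). \<exists>y\<in>S \<inter> ball p (inverse (real (Suc m))).
     \<forall>t\<in>tangent_space R x. \<not> norm (t - (x - y)) \<le> e * norm (x - y)" for m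
    using that[of "inverse (real (Suc m))"] by force
  then obtain x y where x: "\<And>m. x m \<in> R" "\<And>m. dist p (x m) < inverse (real (Suc m))"
    and y: "\<And>m. y m \<in> S" "\<And>m. dist p (y m) < inverse (real (Suc m))"
    and no: "\<And>m t. t \<in> tangent_space R (x m) \<Longrightarrow> \<not> norm (t - (x m - y m)) \<le> e * norm (x m - y m)"
    by (metis IntD1 IntD2 mem_ball)
  have conv: "z \<longlonglongrightarrow> p" if "\<And>m. dist p (z m) < inverse (real (Suc m))" for z
  proof (rule metric_tendsto_imp_tendsto[OF LIMSEQ_inverse_real_of_nat])
    show "\<forall>\<^sub>F m in sequentially. dist (z m) p \<le> dist (inverse (real (Suc m))) 0"
      using that by (auto simp: dist_commute less_imp_le)
  qed
  have xney: "x m \<noteq> y m" for m using x(1)[of m] y(1)[of m] disj by auto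
  define u where "u m = complex_of_real (1 / norm (x m - y m)) *s (x m - y m)" for m
  have nu: "norm (u m) = 1" for m using xney[of m] unfolding u_def norm_vec_scale by (simp add: norm_divide)
  have "bounded (range u)" using nu by (auto simp: bounded_iff intro!: exI[of _ 1])
  then obtain l r1 where r1: "strict_mono (r1 :: nat \<Rightarrow> nat)" "(u \<circ> r1) \<longlonglongrightarrow> l"
    using bounded_imp_convergent_subsequence[of u] by blast
  obtain r2 \<tau> where r2: "strict_mono (r2 :: nat \<Rightarrow> nat)" "grassmann_tendsto (\<lambda>m. tangent_space R (x (r1 (r2 m)))) \<tau>"
    using grassmannian_compact[of "\<lambda>m. tangent_space R (x (r1 m))" d] R x(1) by metis
  define r where "r m = r1 (r2 m)" for m
  have r: "strict_mono r" using strict_mono_o[OF r1(1) r2(1)] by (simp add: r_def[abs_def] o_def)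
  have ul: "(\<lambda>m. u (r m)) \<longlonglongrightarrow> l" using LIMSEQ_subseq_LIMSEQ[OF r1(2) r2(1)] by (simp add: o_def r_def)
  have "norm l = 1" using tendsto_norm[OF ul] nu by (simp add: LIMSEQ_const_iff)
  then have l0: "l \<noteq> 0" by auto
  have d1: "vec.dim (vec.span {z}) = 1" if "z \<noteq> 0" for z :: "complex^'n"
    using that vec.dim_span_eq_card_independent[of "{z}"] by (simp add: vec.independent_insert)
  have gl: "grassmann_tendsto (\<lambda>m. vec.span {x (r m) - y (r m)}) (vec.span {l})"
    unfolding grassmann_tendsto_def
  proof (intro conjI allI ballI)
    fix v assume "v \<in> vec.span {l}"
    then obtain c where c: "v = c *s l" by (auto simp: vec.span_singleton)
    show "\<exists>w. (\<forall>m. w m \<in> vec.span {x (r m) - y (r m)}) \<and> w \<longlonglongrightarrow> v"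
    proof (intro exI[of _ "\<lambda>m. c *s u (r m)"] conjI allI)
      show "c *s u (r m) \<in> vec.span {x (r m) - y (r m)}" for m
        unfolding u_def by (intro vec.span_scale vec.span_base) simp
      show "(\<lambda>m. c *s u (r m)) \<longlonglongrightarrow> v" unfolding c
        by (intro bounded_bilinear.tendsto[OF bounded_bilinear_vec_scale] tendsto_const ul)
    qed
  qed (use d1 l0 xney in auto)
  have "(\<lambda>m. x (r m)) \<longlonglongrightarrow> p" "(\<lambda>m. y (r m)) \<longlonglongrightarrow> p"
    using LIMSEQ_subseq_LIMSEQ[OF conv[OF x(2)] r] LIMSEQ_subseq_LIMSEQ[OF conv[OF y(2)] r] by (auto simp: o_def)
  then have "vec.span {l} \<subseteq> \<tau>"
    using b[unfolded whitney_b_def, THEN spec, THEN spec, THEN spec, THEN spec, THEN spec,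
        of p "\<lambda>m. x (r m)" "\<lambda>m. y (r m)" \<tau> "vec.span {l}"] p x(1) y(1) xney r2(2) gl by (simp add: r_def)
  then have "l \<in> \<tau>" using vec.span_base by blast
  then obtain t where t: "\<And>m. t m \<in> tangent_space R (x (r m))" "t \<longlonglongrightarrow> l"
    using r2(2) unfolding grassmann_tendsto_def r_def by blast
  have "(\<lambda>m. norm (t m - u (r m))) \<longlonglongrightarrow> norm (l - l)" by (intro tendsto_intros t ul)
  then obtain m where m: "norm (t m - u (r m)) < e"
    using e order_tendstoD(2)[of "\<lambda>m. norm (t m - u (r m))" "norm (l - l)" sequentially e]
    by (auto simp: eventually_sequentially)
  define n where "n = norm (x (r m) - y (r m))"
  have n: "n > 0" using xney by (simp add: n_def)
  have tT: "complex_of_real n *s t m \<in> tangent_space R (x (r m))" using R(1)[OF x(1)] t(1) by (simp add: vec.subspace_scale)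
  have eq: "complex_of_real n *s t m - (x (r m) - y (r m)) = complex_of_real n *s (t m - u (r m))"
    using n by (simp add: u_def n_def vec_eq_iff algebra_simps)
  have "norm (complex_of_real n *s t m - (x (r m) - y (r m))) \<le> e * n"
    unfolding eq norm_vec_scale using m n by (simp add: mult.commute)
  then show False using no tT unfolding n_def by blast
qed

section \<open>Whitney stratifications of projective varieties\<close>

lemma continuous_on_homogeneous_form: "homogeneous_form d f \<Longrightarrow> continuous_on UNIV f"
  unfolding homogeneous_form_def by (auto intro!: continuous_intros)

lemma closed_algebraic_imp_closed:
  fixes V :: "'n::finite cproj set"
  assumes "closed_algebraic V"
  shows "closed V"
proof -
  obtain F :: "(complex^'n \<Rightarrow> complex) set" where F: "finite F" "\<And>f. f \<in> F \<Longrightarrow> \<exists>d. homogeneous_form d f"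
    "V = {p. \<forall>f\<in>F. \<forall>v\<in>line p. f v = 0}" using assms unfolding closed_algebraic_def by blast
  have "cone (- V) = - {0} - (\<Inter>f\<in>F. \<Inter>c. {v. f (c *s v) = 0})"
  proof (intro equalityI subsetI)
    fix v assume "v \<in> cone (- V)"
    then show "v \<in> - {0} - (\<Inter>f\<in>F. \<Inter>c. {v. f (c *s v) = 0})"
      by (auto simp: cone_def F(3) line_proj vec.span_singleton) blast
  next
    fix v assume "v \<in> - {0} - (\<Inter>f\<in>F. \<Inter>c. {v. f (c *s v) = 0})"
    then show "v \<in> cone (- V)" by (auto simp: cone_def F(3) line_proj vec.span_singleton)
  qed
  moreover have "closed {v. f (c *s v) = 0}" if "f \<in> F" for f c
  proof -
    have "continuous_on UNIV f" using F(2)[OF that] continuous_on_homogeneous_form by blast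
    then have "continuous_on UNIV (\<lambda>v. f (c *s v))"
      by (rule continuous_on_compose2) (auto intro!: linear_continuous_on bounded_bilinear.bounded_linear_right[OF bounded_bilinear_vec_scale])
    then show ?thesis by (intro closed_Collect_eq continuous_on_const) auto
  qed
  ultimately have "open (cone (- V))" by (auto intro!: open_Diff closed_INT)
  then show ?thesis unfolding closed_def open_cproj_def cone_def .
qed

lemma (in stratum) stratum_Int_open:
  assumes "open \<Omega>"
  shows "stratum (R \<inter> \<Omega>) T"
proof
  fix x assume "x \<in> R \<inter> \<Omega>"
  then have x: "x \<in> R" "x \<in> \<Omega>" by auto
  show "vec.subspace (T x)" using subspace_T x by simp
  obtain d0 where d0: "d0 > 0" "cball x d0 \<subseteq> \<Omega>" using assms x open_contains_cball by blast
  obtain d1 where d1: "d1 > 0" "closed (R \<inter> cball x d1)" using loc_closed[OF x(1)] by blast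
  have "R \<inter> \<Omega> \<inter> cball x (min d0 d1) = (R \<inter> cball x d1) \<inter> cball x (min d0 d1)" using d0 by auto
  then show "\<exists>d>0. closed (R \<inter> \<Omega> \<inter> cball x d)" using d0 d1 by (metis closed_Int closed_cball min_less_iff_conj)
next
  fix y assume "y \<in> R \<inter> \<Omega>"
  then obtain d K where "d > 0" "K \<ge> 0" "\<forall>x\<in>R \<inter> ball y d. \<forall>x'\<in>R \<inter> ball y d. \<forall>v.
       normal_to (T x) v \<longrightarrow> cmod (cdot (x' - x) v) \<le> K * norm v * (norm (x' - x))\<^sup>2" using reach[of y] by blast
  then show "\<exists>d>0. \<exists>K\<ge>0. \<forall>x\<in>R \<inter> \<Omega> \<inter> ball y d. \<forall>x'\<in>R \<inter> \<Omega> \<inter> ball y d. \<forall>v.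
       normal_to (T x) v \<longrightarrow> cmod (cdot (x' - x) v) \<le> K * norm v * (norm (x' - x))\<^sup>2"
    by (intro exI[of _ d] exI[of _ K]) auto
next
  fix x y d assume y: "y \<in> R \<inter> \<Omega>" and d: "0 < d" and near: "\<And>q. q \<in> R \<inter> \<Omega> \<inter> ball y d \<Longrightarrow> dist x y \<le> dist x q"
  obtain d0 where d0: "d0 > 0" "ball y d0 \<subseteq> \<Omega>" using assms y open_contains_ball by blast
  show "normal_to (T y) (x - y)"
    by (rule nearest_normal[of y "min d d0"]) (use y d d0 near in auto)
next
  fix x t assume x: "x \<in> R \<inter> \<Omega>" and t: "t \<in> T x"
  then obtain d L \<sigma> where *: "d > 0" "L-lipschitz_on (R \<inter> ball x d) \<sigma>" "\<sigma> x = t" "\<forall>x'\<in>R \<inter> ball x d. \<sigma> x' \<in> T x'"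
    using sections by blast
  have "L-lipschitz_on (R \<inter> \<Omega> \<inter> ball x d) \<sigma>" by (rule lipschitz_on_subset[OF *(2)]) auto
  then show "\<exists>d>0. \<exists>L \<sigma>. L-lipschitz_on (R \<inter> \<Omega> \<inter> ball x d) \<sigma> \<and> \<sigma> x = t \<and> (\<forall>x'\<in>R \<inter> \<Omega> \<inter> ball x d. \<sigma> x' \<in> T x')"
    using * by blast
qed

lemma nonzero_component: "v \<noteq> 0 \<Longrightarrow> \<exists>k. (v :: complex^'n::finite) $ k \<noteq> 0"
  by (auto simp: vec_eq_iff)

locale projective_stratification =
  fixes Y :: "'n::finite cproj set" and \<S> :: "'n cproj set set"
  assumes alg: "closed_algebraic Y" and strat: "whitney_stratification Y \<S>"
begin

lemma finite_strata: "finite \<S>" and strata_nonempty: "S \<in> \<S> \<Longrightarrow> S \<noteq> {}" and strata_union: "\<Union>\<S> = Y"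
  and strata_disj: "S \<in> \<S> \<Longrightarrow> S' \<in> \<S> \<Longrightarrow> S \<noteq> S' \<Longrightarrow> S \<inter> S' = {}"
  using strat by (auto simp: whitney_stratification_def partition_on_def disjoint_def)

lemma closed_frontier: "S \<in> \<S> \<Longrightarrow> closed (closure S - S)"
  using strat unfolding whitney_stratification_def by (auto intro: closed_algebraic_imp_closed)

lemma frontier_condition: "R \<in> \<S> \<Longrightarrow> S \<in> \<S> \<Longrightarrow> S \<inter> closure R \<noteq> {} \<Longrightarrow> S \<subseteq> closure R"
proof -
  assume *: "R \<in> \<S>" "S \<in> \<S>" "S \<inter> closure R \<noteq> {}"
  have "\<forall>R\<in>\<S>. \<forall>S\<in>\<S>. S \<inter> closure R \<noteq> {} \<longrightarrow> S \<subseteq> closure R"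
    using strat unfolding whitney_stratification_def by (elim conjE)
  with * show ?thesis by simp
qed

lemma strata_submanifold: "S \<in> \<S> \<Longrightarrow> \<exists>d. \<forall>k. complex_submanifold d (affine_part k S)"
proof -
  assume S: "S \<in> \<S>"
  have "\<forall>S\<in>\<S>. closed_algebraic (closure S) \<and> closed_algebraic (closure S - S) \<and> (\<exists>d. \<forall>k. complex_submanifold d (affine_part k S))"
    using strat unfolding whitney_stratification_def by (elim conjE)
  with S show ?thesis by simp
qed

lemma strata_whitney: "R \<in> \<S> \<Longrightarrow> S \<in> \<S> \<Longrightarrow> R \<noteq> S \<Longrightarrow> whitney_a (affine_part k R) (affine_part k S) \<and> whitney_b (affine_part k R) (affine_part k S)"
proof -
  assume *: "R \<in> \<S>" "S \<in> \<S>" "R \<noteq> S"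
  have "\<forall>R\<in>\<S>. \<forall>S\<in>\<S>. R \<noteq> S \<longrightarrow> (\<forall>k. whitney_a (affine_part k R) (affine_part k S) \<and> whitney_b (affine_part k R) (affine_part k S))"
    using strat unfolding whitney_stratification_def by (elim conjE)
  with * show ?thesis by simp
qed

lemma affine_tangent:
  assumes "S \<in> \<S>"
  obtains d where "\<And>w k. w \<in> affine_part k S \<Longrightarrow> vec.subspace (tangent_space (affine_part k S) w)"
    "\<And>w k. w \<in> affine_part k S \<Longrightarrow> vec.dim (tangent_space (affine_part k S) w) = d"
proof -
  obtain d where d: "\<And>k. complex_submanifold d (affine_part k S)" using strata_submanifold[OF assms] by blast
  show thesis
  proof (rule that)
    fix w k assume w: "w \<in> affine_part k S"
    obtain e K W f D where c: "c11_chart (affine_part k S) (tangent_space (affine_part k S)) w e K W (f :: complex^'n \<Rightarrow> complex^'n) D" "vec.subspace W"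
      "\<And>x. x \<in> affine_part k S \<inter> ball w e \<Longrightarrow> Vector_Spaces.linear (*s) (*s) (D x)"
      "\<And>x. x \<in> affine_part k S \<inter> ball w e \<Longrightarrow> vec.dim (tangent_space (affine_part k S) x) = d"
      by (rule tangent_space_submanifold[OF d w]) blast
    have we: "w \<in> affine_part k S \<inter> ball w e" using c(1) w by (auto simp: c11_chart_def)
    show "vec.dim (tangent_space (affine_part k S) w) = d" using c(4)[OF we] .
    have "tangent_space (affine_part k S) w = D w ` W" using c(1) we unfolding c11_chart_def by blast
    then show "vec.subspace (tangent_space (affine_part k S) w)" using vec.linear_subspace_image[OF c(3)[OF we] c(2)] by simp
  qed
qed

lemma cone_tangent_subspace:
  assumes S: "S \<in> \<S>" and v: "v \<in> cone S"
  shows "vec.subspace (tangent_space (cone S) v)"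
proof -
  obtain k where k: "v $ k \<noteq> 0" using nonzero_component v by (auto simp: cone_def)
  let ?T = "tangent_space (affine_part k S) (normalize_at k v)"
  have sub: "vec.subspace ?T" using affine_tangent[OF S] normalize_at_affine[OF v k] by metis
  show ?thesis unfolding tangent_space_cone[of v S k, OF v k] vec.subspace_def
  proof (intro conjI ballI allI)
    show "0 \<in> {\<alpha> *s v + (v $ k) *s t |\<alpha> t. t \<in> ?T}" using vec.subspace_0[OF sub] by (intro CollectI exI[of _ 0]) auto
    fix x y assume "x \<in> {\<alpha> *s v + (v $ k) *s t |\<alpha> t. t \<in> ?T}" "y \<in> {\<alpha> *s v + (v $ k) *s t |\<alpha> t. t \<in> ?T}"
    then obtain \<alpha> t \<beta> s where *: "x = \<alpha> *s v + (v $ k) *s t" "y = \<beta> *s v + (v $ k) *s s" "t \<in> ?T" "s \<in> ?T" by blast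
    have "x + y = (\<alpha> + \<beta>) *s v + (v $ k) *s (t + s)" using * by (simp add: vec_eq_iff algebra_simps)
    then show "x + y \<in> {\<alpha> *s v + (v $ k) *s t |\<alpha> t. t \<in> ?T}" using vec.subspace_add[OF sub *(3,4)] by blast
  next
    fix c x assume "x \<in> {\<alpha> *s v + (v $ k) *s t |\<alpha> t. t \<in> ?T}"
    then obtain \<alpha> t where *: "x = \<alpha> *s v + (v $ k) *s t" "t \<in> ?T" by blast
    have "c *s x = (c * \<alpha>) *s v + (v $ k) *s (c *s t)" using * by (simp add: vec_eq_iff algebra_simps)
    then show "c *s x \<in> {\<alpha> *s v + (v $ k) *s t |\<alpha> t. t \<in> ?T}" using vec.subspace_scale[OF sub *(2)] by blast
  qed
qed

lemma cone_locally_closed: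
  assumes S: "S \<in> \<S>" and v: "v \<in> cone S"
  shows "\<exists>d>0. closed (cone S \<inter> cball v d)"
proof -
  have "closed (insert 0 (cone (closure S - S)))" by (rule closed_cone_insert[OF closed_frontier[OF S]])
  then have "open (- insert 0 (cone (closure S - S)))" by (simp add: open_Compl)
  moreover have "v \<in> - insert 0 (cone (closure S - S))" using v by (auto simp: cone_def)
  ultimately obtain d where d: "d > 0" "cball v d \<subseteq> - insert 0 (cone (closure S - S))" using open_contains_cball by blast
  have "cone S \<inter> cball v d = insert 0 (cone (closure S)) \<inter> cball v d"
    using d(2) closure_subset[of S] by (auto simp: cone_def)
  then have "closed (cone S \<inter> cball v d)" by (simp add: closed_cone_insert closed_Int)
  then show ?thesis using d by blast
qed

text \<open>The stratum of v is selected by its projective point, so that a single family of tangent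
  spaces serves all strata at once.\<close>

definition T :: "complex^'n \<Rightarrow> (complex^'n) set" where
  "T v = tangent_space (cone (THE S. S \<in> \<S> \<and> proj v \<in> S)) v"

lemma T_eq: "S \<in> \<S> \<Longrightarrow> v \<in> cone S \<Longrightarrow> T v = tangent_space (cone S) v"
proof -
  assume S: "S \<in> \<S>" "v \<in> cone S"
  then have "(THE S. S \<in> \<S> \<and> proj v \<in> S) = S" using strata_disj by (intro the_equality) (auto simp: cone_def)
  then show ?thesis by (simp add: T_def)
qed

lemma cone_stratum:
  assumes S: "S \<in> \<S>"
  shows "stratum (cone S) T"
proof (rule stratum_from_charts)
  fix y assume y: "y \<in> cone S"
  show "vec.subspace (tangent_space (cone S) y)" by (rule cone_tangent_subspace[OF S y])
  show "\<exists>d>0. closed (cone S \<inter> cball y d)" by (rule cone_locally_closed[OF S y])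
  show "T y = tangent_space (cone S) y" by (rule T_eq[OF S y])
  obtain k where k: "y $ k \<noteq> 0" using nonzero_component y by (auto simp: cone_def)
  obtain d where d: "complex_submanifold d (affine_part k S)" using strata_submanifold[OF S] by blast
  obtain e K W f D where c: "c11_chart (affine_part k S) (tangent_space (affine_part k S)) (normalize_at k y) e K W (f :: complex^'n \<Rightarrow> complex^'n) D"
    using tangent_space_submanifold[OF d normalize_at_affine[OF y k]] by metis
  show "\<exists>d K W (f :: complex^'n \<Rightarrow> (complex^'n) \<times> complex) D. c11_chart (cone S) (tangent_space (cone S)) y d K W f D"
    by (rule cone_chart[OF y k c], (rule exI)+)
qed

text \<open>The cone is locally the product of an affine part and the scale. A tangent vector
  \<alpha> y + (y $ k) t0 is approximated by \<alpha> x + (x $ k) t, with t near t0 from the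
  condition for the affine parts.\<close>

lemma cone_condition_a:
  assumes R: "R \<in> \<S>" and S: "S \<in> \<S>" and ne: "R \<noteq> S" and y: "y \<in> cone S" and w: "w \<in> T y" and e: "e > 0"
  obtains \<delta> where "\<delta> > 0" "\<And>x. x \<in> cone R \<inter> ball y \<delta> \<Longrightarrow> \<exists>t\<in>T x. norm (t - w) \<le> e"
proof -
  obtain k where k: "y $ k \<noteq> 0" using nonzero_component y by (auto simp: cone_def)
  obtain dR where dR: "\<And>w k. w \<in> affine_part k R \<Longrightarrow> vec.subspace (tangent_space (affine_part k R) w)"
    "\<And>w k. w \<in> affine_part k R \<Longrightarrow> vec.dim (tangent_space (affine_part k R) w) = dR" by (rule affine_tangent[OF R]) blast
  obtain \<alpha> t0 where t0: "w = \<alpha> *s y + (y $ k) *s t0" "t0 \<in> tangent_space (affine_part k S) (normalize_at k y)"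
    using w T_eq[OF S y] tangent_space_cone[of y S k, OF y k] by auto
  obtain d1 K where d1: "d1 > 0" "K \<ge> 0" "\<And>v. v \<in> ball y d1 \<Longrightarrow> v $ k \<noteq> 0"
    "\<And>v. v \<in> ball y d1 \<Longrightarrow> cmod (v $ k) \<le> K" "\<And>v. v \<in> ball y d1 \<Longrightarrow> norm (normalize_at k v) \<le> K"
    "\<And>v v'. v \<in> ball y d1 \<Longrightarrow> v' \<in> ball y d1 \<Longrightarrow> norm (normalize_at k v' - normalize_at k v) \<le> K * norm (v' - v)"
    using normalize_at_lipschitz[OF k] by metis
  define e' where "e' = e / (2 * (K + 1))"
  have e': "e' > 0" using e d1 by (simp add: e'_def)
  have Ke: "K * e' \<le> e / 2"
  proof -
    have "K * e' \<le> (K + 1) * e'" using e' by simp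
    also have "K + 1 \<noteq> 0" using d1(2) by linarith
    then have "(K + 1) * e' = e / 2"
      unfolding e'_def times_divide_eq_right mult.commute[of 2] by (rule nonzero_mult_divide_mult_cancel_left)
    finally show ?thesis .
  qed
  obtain \<delta>1 where \<delta>1: "\<delta>1 > 0" "\<And>x. x \<in> affine_part k R \<inter> ball (normalize_at k y) \<delta>1 \<Longrightarrow> \<exists>t\<in>tangent_space (affine_part k R) x. norm (t - t0) \<le> e'"
    using whitney_a_uniform[OF dR conjunct1[OF strata_whitney[OF R S ne]] normalize_at_affine[OF y k] t0(2) e'] by metis
  define B where "B = cmod \<alpha> + norm t0"
  define \<delta> where "\<delta> = Min {d1, \<delta>1 / (K + 1), e / (2 * (B + 1))}"
  have B: "B \<ge> 0" by (simp add: B_def)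
  have \<delta>: "\<delta> > 0" "\<delta> \<le> d1" "\<delta> \<le> \<delta>1 / (K + 1)" "\<delta> \<le> e / (2 * (B + 1))" using d1 \<delta>1 e B by (auto simp: \<delta>_def)
  show thesis
  proof (rule that[OF \<delta>(1)])
    fix x assume x: "x \<in> cone R \<inter> ball y \<delta>"
    have xb: "x \<in> ball y d1" using x \<delta> by auto
    have xk: "x $ k \<noteq> 0" by (rule d1(3)[OF xb])
    have xy: "norm (x - y) < \<delta>" using x by (simp add: dist_norm norm_minus_commute)
    have "norm (normalize_at k x - normalize_at k y) \<le> K * norm (x - y)" using xb d1(1) by (intro d1(6)) auto
    also have "\<dots> \<le> K * (\<delta>1 / (K + 1))" using xy \<delta> d1(2) by (intro mult_left_mono) auto
    also have "\<dots> < \<delta>1" using d1(2) \<delta>1(1) by (simp add: field_simps)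
    finally have "normalize_at k x \<in> affine_part k R \<inter> ball (normalize_at k y) \<delta>1"
      using x xk by (auto simp: dist_norm norm_minus_commute intro: normalize_at_affine)
    then obtain t where t: "t \<in> tangent_space (affine_part k R) (normalize_at k x)" "norm (t - t0) \<le> e'" using \<delta>1(2) by blast
    have "\<alpha> *s x + (x $ k) *s t \<in> T x" using T_eq[OF R] tangent_space_cone[of x R k] x xk t by auto
    moreover have "norm (\<alpha> *s x + (x $ k) *s t - w) \<le> e"
    proof -
      have "\<alpha> *s x + (x $ k) *s t - w = \<alpha> *s (x - y) + (x $ k) *s (t - t0) + ((x - y) $ k) *s t0"
        by (simp add: t0(1) vec_eq_iff algebra_simps)
      also have "norm \<dots> \<le> norm (\<alpha> *s (x - y)) + norm ((x $ k) *s (t - t0)) + norm (((x - y) $ k) *s t0)"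
        by (meson add_right_mono norm_triangle_ineq order_trans)
      also have "\<dots> \<le> cmod \<alpha> * norm (x - y) + K * e' + norm (x - y) * norm t0"
        unfolding norm_vec_scale using d1(4)[OF xb] t(2) d1(2) Finite_Cartesian_Product.norm_nth_le[of "x - y" k]
        by (intro add_mono mult_mono) auto
      also have "\<dots> \<le> B * \<delta> + e / 2" using Ke xy B mult_left_mono[of "norm (x - y)" \<delta> B] by (simp add: B_def algebra_simps)
      also have "B * \<delta> \<le> e / 2"
      proof -
        have "B * \<delta> \<le> (B + 1) * (e / (2 * (B + 1)))" using B \<delta> by (intro mult_mono) auto
        also have "\<dots> = e / 2" using B by (simp add: field_simps)
        finally show ?thesis .
      qed
      finally show ?thesis by simp
    qed
    ultimately show "\<exists>t\<in>T x. norm (t - w) \<le> e" by blast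
  qed
qed

lemma cone_condition_b:
  assumes R: "R \<in> \<S>" and S: "S \<in> \<S>" and ne: "R \<noteq> S" and y: "y \<in> cone S" and e: "e > 0"
  obtains \<delta> where "\<delta> > 0" "\<And>x z. x \<in> cone R \<inter> ball y \<delta> \<Longrightarrow> z \<in> cone S \<inter> ball y \<delta> \<Longrightarrow> \<exists>t\<in>T x. norm (t - (x - z)) \<le> e * norm (x - z)"
proof -
  obtain k where k: "y $ k \<noteq> 0" using nonzero_component y by (auto simp: cone_def)
  obtain dR where dR: "\<And>w k. w \<in> affine_part k R \<Longrightarrow> vec.subspace (tangent_space (affine_part k R) w)"
    "\<And>w k. w \<in> affine_part k R \<Longrightarrow> vec.dim (tangent_space (affine_part k R) w) = dR" by (rule affine_tangent[OF R]) blast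
  obtain d1 K where d1: "d1 > 0" "K \<ge> 0" "\<And>v. v \<in> ball y d1 \<Longrightarrow> v $ k \<noteq> 0"
    "\<And>v. v \<in> ball y d1 \<Longrightarrow> cmod (v $ k) \<le> K" "\<And>v. v \<in> ball y d1 \<Longrightarrow> norm (normalize_at k v) \<le> K"
    "\<And>v v'. v \<in> ball y d1 \<Longrightarrow> v' \<in> ball y d1 \<Longrightarrow> norm (normalize_at k v' - normalize_at k v) \<le> K * norm (v' - v)"
    using normalize_at_lipschitz[OF k] by metis
  define e' where "e' = e / (K * K + 1)"
  have KK: "K * K + 1 > 0" by (smt (verit) zero_le_square)
  have e': "e' > 0" using e KK by (simp add: e'_def)
  have Ke: "K * (e' * K) \<le> e"
  proof -
    have "K * (e' * K) \<le> (K * K + 1) * e'" using e' by (simp add: algebra_simps)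
    also have "\<dots> = e" using KK by (simp add: e'_def)
    finally show ?thesis .
  qed
  have disj: "affine_part k R \<inter> affine_part k S = {}" using strata_disj[OF R S ne] by (auto simp: affine_part_def)
  obtain \<delta>1 where \<delta>1: "\<delta>1 > 0" "\<And>x z. x \<in> affine_part k R \<inter> ball (normalize_at k y) \<delta>1 \<Longrightarrow> z \<in> affine_part k S \<inter> ball (normalize_at k y) \<delta>1
     \<Longrightarrow> \<exists>t\<in>tangent_space (affine_part k R) x. norm (t - (x - z)) \<le> e' * norm (x - z)"
    using whitney_b_uniform[OF dR conjunct2[OF strata_whitney[OF R S ne]] disj normalize_at_affine[OF y k] e'] by metis
  define \<delta> where "\<delta> = min d1 (\<delta>1 / (K + 1))"
  have \<delta>: "\<delta> > 0" "\<delta> \<le> d1" "\<delta> \<le> \<delta>1 / (K + 1)" using d1 \<delta>1 by (auto simp: \<delta>_def)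
  have near: "normalize_at k x \<in> ball (normalize_at k y) \<delta>1" "x $ k \<noteq> 0" if x: "x \<in> ball y \<delta>" for x
  proof -
    have xb: "x \<in> ball y d1" using x \<delta> by auto
    show "x $ k \<noteq> 0" by (rule d1(3)[OF xb])
    have xy: "norm (x - y) < \<delta>" using x by (simp add: dist_norm norm_minus_commute)
    have "norm (normalize_at k x - normalize_at k y) \<le> K * norm (x - y)" using xb d1(1) by (intro d1(6)) auto
    also have "\<dots> \<le> K * (\<delta>1 / (K + 1))" using xy \<delta> d1(2) by (intro mult_left_mono) auto
    also have "\<dots> < \<delta>1" using d1(2) \<delta>1(1) by (simp add: field_simps)
    finally show "normalize_at k x \<in> ball (normalize_at k y) \<delta>1" by (simp add: dist_norm norm_minus_commute)
  qed
  show thesis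
  proof (rule that[OF \<delta>(1)])
    fix x z assume x: "x \<in> cone R \<inter> ball y \<delta>" and z: "z \<in> cone S \<inter> ball y \<delta>"
    have xk: "x $ k \<noteq> 0" and zk: "z $ k \<noteq> 0" using near x z by auto
    have b: "x \<in> ball y d1" "z \<in> ball y d1" using x z \<delta> by auto
    obtain t where t: "t \<in> tangent_space (affine_part k R) (normalize_at k x)"
      "norm (t - (normalize_at k x - normalize_at k z)) \<le> e' * norm (normalize_at k x - normalize_at k z)"
      using \<delta>1(2)[of "normalize_at k x" "normalize_at k z"] near(1) x z xk zk normalize_at_affine by blast
    \<comment> \<open>The secant x - z splits into a radial part, a multiple of x, and z $ k times
      the secant of the normalized points; t approximates the latter, and the radial part is tangent
      to the cone.\<close>
    define t' where "t' = ((x $ k - z $ k) / x $ k) *s x + (x $ k) *s ((z $ k / x $ k) *s t)"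
    have xA: "normalize_at k x \<in> affine_part k R" using x xk by (auto intro: normalize_at_affine)
    have "(z $ k / x $ k) *s t \<in> tangent_space (affine_part k R) (normalize_at k x)"
      using vec.subspace_scale[OF dR(1)[OF xA] t(1)] .
    then have "t' \<in> {\<alpha> *s x + (x $ k) *s t | \<alpha> t. t \<in> tangent_space (affine_part k R) (normalize_at k x)}"
      unfolding t'_def by blast
    then have "t' \<in> T x" using T_eq[OF R] tangent_space_cone[of x R k] x xk by simp
    moreover have "norm (t' - (x - z)) \<le> e * norm (x - z)"
    proof -
      have eq: "t' - (x - z) = (z $ k) *s (t - (normalize_at k x - normalize_at k z))"
        using xk zk by (simp add: t'_def vec_eq_iff field_simps)
      have "norm (t' - (x - z)) = cmod (z $ k) * norm (t - (normalize_at k x - normalize_at k z))"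
        unfolding eq norm_vec_scale ..
      also have "\<dots> \<le> K * (e' * (K * norm (x - z)))"
      proof (intro mult_mono d1 b)
        have "norm (t - (normalize_at k x - normalize_at k z)) \<le> e' * norm (normalize_at k x - normalize_at k z)" by (rule t(2))
        also have "\<dots> \<le> e' * (K * norm (x - z))" using d1(6)[OF b(2,1)] e' by (intro mult_left_mono) auto
        finally show "norm (t - (normalize_at k x - normalize_at k z)) \<le> e' * (K * norm (x - z))" .
      qed (use d1 b in auto)
      also have "\<dots> = (K * (e' * K)) * norm (x - z)" by (simp add: mult_ac)
      also have "\<dots> \<le> e * norm (x - z)" using Ke by (intro mult_right_mono) auto
      finally show ?thesis .
    qed
    ultimately show "\<exists>t\<in>T x. norm (t - (x - z)) \<le> e * norm (x - z)" by blast
  qed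
qed

section \<open>Ordering the strata, and openness of transversality\<close>

lemma closed_Y: "closed Y" by (rule closed_algebraic_imp_closed[OF alg])

lemma strata_antisym:
  assumes R: "R \<in> \<S>" and S: "S \<in> \<S>" and sub: "R \<subseteq> closure S" "S \<subseteq> closure R"
  shows "R = S"
proof (rule ccontr)
  assume "R \<noteq> S"
  then have "R \<inter> S = {}" using strata_disj R S by auto
  then have "R \<subseteq> closure S - S" using sub by auto
  then have "closure R \<subseteq> closure S - S" using closed_frontier[OF S] by (rule closure_minimal)
  then show False using sub(2) strata_nonempty[OF S] by auto
qed

text \<open>The strata are sorted by the number of strata contained in their closures. By the
  frontier condition a stratum meeting the closure of another lies in it, and antisymmetry makes its
  count strictly smaller; so closures of early strata are covered by early strata.\<close>

lemma strata_enumeration: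
  obtains f :: "nat \<Rightarrow> 'n cproj set" and m where "f ` {..<m} = \<S>" "inj_on f {..<m}" "\<And>k. k \<le> m \<Longrightarrow> closed (\<Union>i<k. f i)"
proof -
  define n where "n S = card {R \<in> \<S>. R \<subseteq> closure S}" for S
  have less: "n R < n S" if RS: "R \<in> \<S>" "S \<in> \<S>" "R \<noteq> S" "R \<subseteq> closure S" for R S
  proof -
    have "closure R \<subseteq> closure S" using RS(4) by (rule closure_minimal) simp
    moreover have "\<not> S \<subseteq> closure R" using strata_antisym[OF RS(1,2,4)] RS(3) by blast
    ultimately have "{Q \<in> \<S>. Q \<subseteq> closure R} \<subset> {Q \<in> \<S>. Q \<subseteq> closure S}" using closure_subset[of S] RS(2) by blast
    then show ?thesis unfolding n_def using finite_strata by (intro psubset_card_mono) auto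
  qed
  obtain xs where xs: "set xs = \<S>" "distinct xs" using finite_distinct_list[OF finite_strata] by blast
  define ys where "ys = sort_key n xs"
  have ys: "set ys = \<S>" "distinct ys" "sorted (map n ys)" using xs by (auto simp: ys_def)
  have below: "\<exists>j\<le>i. ys ! j = R" if "i < length ys" "R \<in> \<S>" "R \<inter> closure (ys ! i) \<noteq> {}" for i R
  proof (cases "R = ys ! i")
    case False
    have yi: "ys ! i \<in> \<S>" using that ys nth_mem by blast
    have "n R < n (ys ! i)" using less[OF that(2) yi False] frontier_condition[OF yi that(2,3)] by simp
    have "R \<in> set ys" using that(2) ys(1) by simp
    then obtain j where j: "j < length ys" "ys ! j = R" by (metis in_set_conv_nth)
    have "j \<le> i"
    proof (rule ccontr)
      assume "\<not> j \<le> i"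
      then have "map n ys ! i \<le> map n ys ! j" using ys(3) j by (intro sorted_nth_mono) auto
      then show False using \<open>n R < n (ys ! i)\<close> j that by simp
    qed
    then show ?thesis using j by blast
  qed auto
  show thesis
  proof (rule that[of "\<lambda>i. ys ! i" "length ys"])
    show "(!) ys ` {..<length ys} = \<S>" using ys(1) by (auto simp: set_conv_nth)
    show "inj_on ((!) ys) {..<length ys}" using ys(2) by (simp add: inj_on_nth)
    fix k assume k: "k \<le> length ys"
    have "(\<Union>i<k. ys ! i) = (\<Union>i<k. closure (ys ! i))"
    proof
      show "(\<Union>i<k. ys ! i) \<subseteq> (\<Union>i<k. closure (ys ! i))" using closure_subset by blast
      show "(\<Union>i<k. closure (ys ! i)) \<subseteq> (\<Union>i<k. ys ! i)"
      proof
        fix x assume "x \<in> (\<Union>i<k. closure (ys ! i))"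
        then obtain i where i: "i < k" "x \<in> closure (ys ! i)" by blast
        have "ys ! i \<subseteq> Y" using strata_union ys(1) i k nth_mem[of i ys] by auto
        then have "x \<in> Y" using closure_minimal[OF _ closed_Y] i(2) by blast
        then obtain R where R: "R \<in> \<S>" "x \<in> R" using strata_union by blast
        then obtain j where "j \<le> i" "ys ! j = R" using below[of i R] i k by auto
        then show "x \<in> (\<Union>i<k. ys ! i)" using R i by (auto intro!: bexI[of _ j])
      qed
    qed
    also have "closed \<dots>" by auto
    finally show "closed (\<Union>i<k. ys ! i)" .
  qed
qed

text \<open>Condition (a) handles the other strata, a Lipschitz section the stratum of y itself, and
  finiteness gives a common radius. This is what makes transversality an open condition.\<close>

lemma T_lower_semicontinuous:
  assumes S: "S \<in> \<S>" and y: "y \<in> cone S" and w: "w \<in> T y" and e: "e > 0"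
  obtains d where "d > 0" "\<And>x. x \<in> cone Y \<inter> ball y d \<Longrightarrow> \<exists>t\<in>T x. norm (t - w) \<le> e"
proof -
  have "\<exists>d>0. \<forall>x\<in>cone R \<inter> ball y d. \<exists>t\<in>T x. norm (t - w) \<le> e" if R: "R \<in> \<S>" for R
  proof (cases "R = S")
    case False
    then show ?thesis using cone_condition_a[OF R S False y w e] by metis
  next
    case True
    interpret stratum "cone S" T by (rule cone_stratum[OF S])
    obtain d L \<sigma> where d: "d > 0" "L-lipschitz_on (cone S \<inter> ball y d) \<sigma>" "\<sigma> y = w" "\<forall>x\<in>cone S \<inter> ball y d. \<sigma> x \<in> T x"
      using sections[OF y w] by blast
    have L: "L \<ge> 0" by (rule lipschitz_on_nonneg[OF d(2)])
    have "\<exists>t\<in>T x. norm (t - w) \<le> e" if x: "x \<in> cone S \<inter> ball y (min d (e / (L + 1)))" for x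
    proof -
      have "dist (\<sigma> x) (\<sigma> y) \<le> L * dist x y" using x y d(1) by (intro lipschitz_onD[OF d(2)]) auto
      also have "\<dots> \<le> L * (e / (L + 1))" using x L by (intro mult_left_mono) (auto simp: dist_commute)
      also have "\<dots> \<le> e" using L e by (simp add: divide_simps mult_left_mono)
      finally show ?thesis using d x by (auto simp: dist_norm)
    qed
    then show ?thesis using True d L e by (intro exI[of _ "min d (e / (L + 1))"]) auto
  qed
  then obtain d where d: "\<And>R. R \<in> \<S> \<Longrightarrow> d R > 0" "\<And>R x. R \<in> \<S> \<Longrightarrow> x \<in> cone R \<inter> ball y (d R) \<Longrightarrow> \<exists>t\<in>T x. norm (t - w) \<le> e" by metis
  have ne: "\<S> \<noteq> {}" using S by auto
  show thesis
  proof (rule that[of "Min (d ` \<S>)"])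
    show "Min (d ` \<S>) > 0" using d(1) finite_strata ne by simp
    fix x assume x: "x \<in> cone Y \<inter> ball y (Min (d ` \<S>))"
    then obtain R where R: "R \<in> \<S>" "x \<in> cone R" using strata_union by (auto simp: cone_def)
    moreover have "Min (d ` \<S>) \<le> d R" using finite_strata R by simp
    ultimately show "\<exists>t\<in>T x. norm (t - w) \<le> e" using d(2)[of R x] x by auto
  qed
qed

text \<open>Geometric transversality in a chart is turned into a statement about the linear form: if
  the form vanished on the tangent space of the stratum, it would vanish everywhere.\<close>

lemma hyperplane_transverse:
  assumes S: "S \<in> \<S>" and a: "a \<noteq> 0" and tr: "transverse (hyperplane a) S" and v: "v \<in> cone S" and av: "lform a v = 0"
  obtains t where "t \<in> T v" "lform a t = 1"
proof -
  obtain k where k: "v $ k \<noteq> 0" using nonzero_component v by (auto simp: cone_def)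
  let ?w = "normalize_at k v"
  have mem: "proj x \<in> hyperplane a \<longleftrightarrow> lform a x = 0" if "x \<noteq> 0" for x
  proof -
    have "(\<Sum>i\<in>UNIV. a $ i * (c *s x) $ i) = c * lform a x" for c
      unfolding lform_def[symmetric] by (rule lform_scale)
    then show ?thesis unfolding hyperplane_def using that by (auto simp: line_proj vec.span_singleton intro: exI[of _ 1])
  qed
  have wS: "?w \<in> affine_part k S" by (rule normalize_at_affine[OF v k])
  have w0: "?w \<noteq> 0" using v k by (auto simp: cone_def)
  have wH: "?w \<in> affine_part k (hyperplane a)" using mem[OF w0] av k by (simp add: affine_part_def lform_scale)
  have tH: "lform a u = 0" if u: "u \<in> tangent_space (affine_part k (hyperplane a)) ?w" for u
  proof -
    obtain c where c: "\<And>s. c s \<in> affine_part k (hyperplane a)" "(c has_vector_derivative u) (at 0)" using u by (auto simp: tangent_space_def)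
    have "lform a (c s) = 0" for s
    proof -
      have "c s $ k = 1" using c(1)[of s] by (simp add: affine_part_def)
      then have "c s \<noteq> 0" by auto
      then show ?thesis using c(1)[of s] mem[of "c s"] by (auto simp: affine_part_def)
    qed
    then have "(\<lambda>s. lform a (c s)) = (\<lambda>s. 0)" by auto
    moreover have "((\<lambda>s. lform a (c s)) has_vector_derivative lform a u) (at 0)"
      by (rule bounded_linear.has_vector_derivative[OF bounded_linear_lform c(2)])
    ultimately have "((\<lambda>s::real. 0) has_vector_derivative lform a u) (at 0)" by simp
    then show ?thesis using has_vector_derivative_const vector_derivative_unique_at by blast
  qed
  have "\<exists>t\<in>tangent_space (affine_part k S) ?w. lform a t \<noteq> 0"
  proof (rule ccontr)
    assume "\<not> ?thesis"
    then have z: "lform a t = 0" if "t \<in> tangent_space (affine_part k S) ?w" for t using that by blast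
    have eq: "{u + v | u v. u \<in> tangent_space (affine_part k (hyperplane a)) ?w \<and> v \<in> tangent_space (affine_part k S) ?w} = {u. u $ k = 0}"
      using tr wS wH unfolding transverse_def by blast
    have z2: "lform a u = 0" if "u $ k = 0" for u
    proof -
      have "u \<in> {u + v | u v. u \<in> tangent_space (affine_part k (hyperplane a)) ?w \<and> v \<in> tangent_space (affine_part k S) ?w}"
        unfolding eq using that by simp
      then show ?thesis using tH z by (auto simp: lform_add)
    qed
    have wk: "?w $ k = 1" using k by simp
    have "lform a u = 0" for u
    proof -
      \<comment> \<open>The chart only sees vectors with u $ k = 0; the missing direction is that of
        the point itself, on which the form vanishes because the point lies on the
        hyperplane.\<close>
      have "lform a (u - (u $ k) *s ?w) = 0" using wk k by (intro z2) simp
      moreover have "lform a ?w = 0" using av by (simp add: lform_scale)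
      ultimately show ?thesis by (simp add: lform_diff lform_scale)
    qed
    then have "cdot u (\<chi> i. cnj (a $ i)) = 0" for u by (simp add: lform_cdot)
    then have "cdot (\<chi> i. cnj (a $ i)) (\<chi> i. cnj (a $ i)) = 0" by blast
    then have "(\<chi> i. cnj (a $ i)) = 0" by (simp add: cdot_self)
    then show False using a by (simp add: vec_eq_iff)
  qed
  then obtain t where t: "t \<in> tangent_space (affine_part k S) ?w" "lform a t \<noteq> 0" by blast
  have "0 *s v + (v $ k) *s t \<in> tangent_space (cone S) v" unfolding tangent_space_cone[of v S k, OF v k] using t by blast
  then have tT: "(v $ k) *s t \<in> T v" using T_eq[OF S v] by simp
  have "(1 / (v $ k * lform a t)) *s ((v $ k) *s t) \<in> T v"
    using tT cone_tangent_subspace[OF S v] T_eq[OF S v] by (simp only: vec.subspace_scale)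
  moreover have "lform a ((1 / (v $ k * lform a t)) *s ((v $ k) *s t)) = 1" using t k by (simp add: lform_scale)
  ultimately show thesis using that by blast
qed

text \<open>Requiring the property on a whole ball makes the region open in the ambient space,
  including points off the cone. Omitting the apex keeps it different from the whole space.\<close>

definition good_region :: "complex^'n \<Rightarrow> (complex^'n) set" where
  "good_region a = {v. v \<noteq> 0 \<and> (\<exists>d>0. \<forall>x\<in>cone Y \<inter> ball v d. \<exists>t\<in>T x. lform a t = 1)}"

lemma good_region_open: "open (good_region a)"
  unfolding open_contains_ball
proof
  fix v assume "v \<in> good_region a"
  then obtain d where d: "v \<noteq> 0" "d > 0" "\<forall>x\<in>cone Y \<inter> ball v d. \<exists>t\<in>T x. lform a t = 1" by (auto simp: good_region_def)
  show "\<exists>e>0. ball v e \<subseteq> good_region a"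
  proof (intro exI[of _ "min (d/2) (norm v)"] conjI subsetI)
    show "min (d/2) (norm v) > 0" using d by simp
    fix w assume w: "w \<in> ball v (min (d/2) (norm v))"
    have "w \<noteq> 0" using w by (auto simp: dist_norm)
    moreover have "ball w (d/2) \<subseteq> ball v d"
    proof
      fix x assume "x \<in> ball w (d/2)"
      then show "x \<in> ball v d" using w dist_triangle[of v x w] by simp
    qed
    ultimately show "w \<in> good_region a" unfolding good_region_def using d by (auto intro!: exI[of _ "d/2"])
  qed
qed

text \<open>Nearby tangent spaces contain vectors within e of w, and norm a * e < 1 keeps the form
  non-zero on them; scaling restores the value 1.\<close>

lemma good_region_contains:
  assumes a: "a \<noteq> 0" and tr: "transverse_to_strata (hyperplane a) \<S>" and v: "v \<in> cone Y" and av: "lform a v = 0"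
  shows "v \<in> good_region a"
proof -
  obtain S where S: "S \<in> \<S>" "v \<in> cone S" using v strata_union by (auto simp: cone_def)
  obtain w where w: "w \<in> T v" "lform a w = 1"
    using hyperplane_transverse[OF S(1) a _ S(2) av] tr S(1) by (auto simp: transverse_to_strata_def)
  define e where "e = 1 / (2 * (norm a + 1))"
  have na: "norm a + 1 > 0" using norm_ge_zero[of a] by linarith
  have e: "e > 0" "norm a * e < 1"
  proof -
    show "e > 0" using na by (simp add: e_def)
    then have "norm a * e \<le> (norm a + 1) * e" by simp
    also have "\<dots> = 1 / 2" using na by (simp add: e_def)
    finally show "norm a * e < 1" by simp
  qed
  obtain d where d: "d > 0" "\<And>x. x \<in> cone Y \<inter> ball v d \<Longrightarrow> \<exists>t\<in>T x. norm (t - w) \<le> e"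
    using T_lower_semicontinuous[OF S w(1) e(1)] by metis
  have "\<exists>t\<in>T x. lform a t = 1" if x: "x \<in> cone Y \<inter> ball v d" for x
  proof -
    obtain t where t: "t \<in> T x" "norm (t - w) \<le> e" using d(2)[OF x] by blast
    have "cmod (lform a t - 1) \<le> norm a * norm (t - w)" using norm_lform_le[of a "t - w"] w by (simp add: lform_diff)
    also have "\<dots> \<le> norm a * e" using t by (intro mult_left_mono) auto
    also have "\<dots> < 1" by (rule e(2))
    finally have l0: "lform a t \<noteq> 0" by auto
    obtain R where R: "R \<in> \<S>" "x \<in> cone R" using x strata_union by (auto simp: cone_def)
    have "(1 / lform a t) *s t \<in> T x" using t(1) cone_tangent_subspace[OF R] T_eq[OF R] by (simp only: vec.subspace_scale)
    moreover have "lform a ((1 / lform a t) *s t) = 1" using l0 by (simp add: lform_scale)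
    ultimately show ?thesis by blast
  qed
  then show ?thesis using v d unfolding good_region_def by (auto simp: cone_def)
qed

lemma controlled_field:
  obtains \<eta> where "\<And>v. v \<in> cone Y \<inter> good_region a \<Longrightarrow> \<eta> v \<in> T v \<and> lform a (\<eta> v) = 1"
    "continuous_on (cone Y \<inter> good_region a) \<eta>"
    "\<And>S v. S \<in> \<S> \<Longrightarrow> v \<in> cone S \<inter> good_region a \<Longrightarrow> \<exists>d>0. \<exists>L. L-lipschitz_on (cone S \<inter> ball v d) \<eta>"
    "\<And>S y. S \<in> \<S> \<Longrightarrow> y \<in> cone S \<inter> good_region a \<Longrightarrow> \<exists>d>0. \<exists>C\<ge>0. \<forall>x\<in>cone Y \<inter> ball y d. \<forall>q\<in>cone S \<inter> ball y d.
       normal_to (T q) (x - q) \<longrightarrow> cmod (cdot (\<eta> x) (x - q)) \<le> C * (norm (x - q))\<^sup>2"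
proof -
  define \<Omega> where "\<Omega> = good_region a"
  obtain f :: "nat \<Rightarrow> 'n cproj set" and m where f: "f ` {..<m} = \<S>" "inj_on f {..<m}" "\<And>k. k \<le> m \<Longrightarrow> closed (\<Union>i<k. f i)"
    using strata_enumeration by metis
  have fS: "f i \<in> \<S>" if "i < m" for i using f(1) that by auto
  have fne: "f i \<noteq> f j" if "i < j" "j < m" for i j
    using f(2) that inj_on_eq_iff[of f "{..<m}" i j] by auto
  define R where "R i = cone (f i) \<inter> \<Omega>" for i
  interpret W: whitney_family \<Omega> T a R m
  proof (rule whitney_family.intro)
    show "open \<Omega>" unfolding \<Omega>_def by (rule good_region_open)
    show "\<Omega> \<noteq> UNIV" unfolding \<Omega>_def good_region_def by blast
    show "stratum (R i) T" if "i < m" for i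
      unfolding R_def using stratum.stratum_Int_open[OF cone_stratum[OF fS[OF that]]] by (simp add: \<Omega>_def good_region_open)
    show "R i \<subseteq> \<Omega>" for i by (auto simp: R_def)
    show "R i \<inter> R j = {}" if "i < j" "j < m" for i j
      using strata_disj[OF fS fS fne[OF that]] that by (auto simp: R_def cone_def)
    show "closedin (top_of_set \<Omega>) (\<Union>i<k. R i)" if "k \<le> m" for k
    proof -
      have "(\<Union>i<k. R i) = \<Omega> \<inter> insert 0 (cone (\<Union>i<k. f i))"
        by (auto simp: R_def cone_def \<Omega>_def good_region_def)
      then show ?thesis using closed_cone_insert[OF f(3)[OF that]] by (auto simp: closedin_closed)
    qed
    show "\<exists>t\<in>T x. lform a t = 1" if "i < m" "x \<in> R i" for i x
    proof -
      have "x \<in> cone Y" "x \<in> good_region a" using that fS strata_union by (auto simp: R_def cone_def \<Omega>_def)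
      then show ?thesis unfolding good_region_def by auto
    qed
    show "\<exists>d>0. \<forall>x\<in>R j \<inter> ball y d. \<exists>t\<in>T x. norm (t - w) \<le> e"
      if ij: "i < j" "j < m" and y: "y \<in> R i" and w: "w \<in> T y" and e: "e > 0" for i j y w e
    proof -
      have ne: "f j \<noteq> f i" using fne[OF ij] by simp
      have im: "i < m" using ij by simp
      have yc: "y \<in> cone (f i)" using y by (simp add: R_def)
      obtain d where "d > 0" "\<And>x. x \<in> cone (f j) \<inter> ball y d \<Longrightarrow> \<exists>t\<in>T x. norm (t - w) \<le> e"
        using cone_condition_a[OF fS[OF ij(2)] fS[OF im] ne yc w e] by metis
      then show ?thesis by (auto simp: R_def)
    qed
    show "\<exists>d>0. \<forall>x\<in>R j \<inter> ball y d. \<forall>y'\<in>R i \<inter> ball y d. \<exists>t\<in>T x. norm (t - (x - y')) \<le> e * norm (x - y')"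
      if ij: "i < j" "j < m" and y: "y \<in> R i" and e: "e > 0" for i j y e
    proof -
      have ne: "f j \<noteq> f i" using fne[OF ij] by simp
      have im: "i < m" using ij by simp
      have yc: "y \<in> cone (f i)" using y by (simp add: R_def)
      obtain d where "d > 0" "\<And>x z. x \<in> cone (f j) \<inter> ball y d \<Longrightarrow> z \<in> cone (f i) \<inter> ball y d \<Longrightarrow> \<exists>t\<in>T x. norm (t - (x - z)) \<le> e * norm (x - z)"
        using cone_condition_b[OF fS[OF ij(2)] fS[OF im] ne yc e] by metis
      then show ?thesis by (auto simp: R_def)
    qed
  qed
  obtain \<eta> where g: "W.good_field m \<eta>" using W.controlled_field_exists[of m] by auto
  have Ym: "W.Y m = cone Y \<inter> \<Omega>"
    using f(1) strata_union by (fastforce simp: W.Y_def R_def cone_def)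
  have shrink: "\<exists>d'>0. d' \<le> d \<and> ball v d' \<subseteq> \<Omega>" if v: "v \<in> \<Omega>" and dpos: "d > 0" for v and d :: real
  proof -
    obtain d0 where "d0 > 0" "ball v d0 \<subseteq> \<Omega>" using v good_region_open[of a] unfolding \<Omega>_def open_contains_ball by blast
    then show ?thesis using dpos by (intro exI[of _ "min d d0"]) auto
  qed
  show thesis
  proof (rule that[of \<eta>])
    show "continuous_on (cone Y \<inter> good_region a) \<eta>" using g Ym by (simp add: W.good_field_def \<Omega>_def)
    show "\<eta> v \<in> T v \<and> lform a (\<eta> v) = 1" if "v \<in> cone Y \<inter> good_region a" for v
    proof -
      have "v \<in> W.Y m" using that Ym by (simp add: \<Omega>_def)
      then show ?thesis using g by (auto simp: W.good_field_def W.Y_def)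
    qed
    fix S y assume S: "S \<in> \<S>" and y: "y \<in> cone S \<inter> good_region a"
    obtain i where i: "i < m" "S = f i" using f(1) S by auto
    have yR: "y \<in> R i" using y i by (simp add: R_def \<Omega>_def)
    have y\<Omega>: "y \<in> \<Omega>" using y by (simp add: \<Omega>_def)
    have "\<exists>d>0. \<exists>L. L-lipschitz_on (R i \<inter> ball y d) \<eta>" using g i yR by (simp add: W.good_field_def)
    then obtain d L where d: "d > 0" "L-lipschitz_on (R i \<inter> ball y d) \<eta>" by blast
    obtain d' where d': "d' > 0" "d' \<le> d" "ball y d' \<subseteq> \<Omega>" using shrink[OF y\<Omega> d(1)] by blast
    have "L-lipschitz_on (cone S \<inter> ball y d') \<eta>" by (rule lipschitz_on_subset[OF d(2)]) (use d' i in \<open>auto simp: R_def\<close>)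
    then show "\<exists>d>0. \<exists>L. L-lipschitz_on (cone S \<inter> ball y d) \<eta>" using d' by blast
    have "\<exists>d>0. \<exists>C\<ge>0. \<forall>x\<in>W.Y m \<inter> ball y d. \<forall>q\<in>R i \<inter> ball y d. normal_to (T q) (x - q) \<longrightarrow>
        cmod (cdot (\<eta> x) (x - q)) \<le> C * (norm (x - q))\<^sup>2" using g i yR unfolding W.good_field_def by blast
    then obtain d C where d: "d > 0" "C \<ge> 0" "\<forall>x\<in>W.Y m \<inter> ball y d. \<forall>q\<in>R i \<inter> ball y d. normal_to (T q) (x - q) \<longrightarrow>
        cmod (cdot (\<eta> x) (x - q)) \<le> C * (norm (x - q))\<^sup>2" by blast
    obtain d' where d': "d' > 0" "d' \<le> d" "ball y d' \<subseteq> \<Omega>" using shrink[OF y\<Omega> d(1)] by blast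
    have "cone Y \<inter> ball y d' \<subseteq> W.Y m \<inter> ball y d" "cone S \<inter> ball y d' \<subseteq> R i \<inter> ball y d"
      using d' Ym i by (auto simp: R_def)
    then show "\<exists>d>0. \<exists>C\<ge>0. \<forall>x\<in>cone Y \<inter> ball y d. \<forall>q\<in>cone S \<inter> ball y d.
       normal_to (T q) (x - q) \<longrightarrow> cmod (cdot (\<eta> x) (x - q)) \<le> C * (norm (x - q))\<^sup>2"
      using d d'(1) by (intro exI[of _ d'] exI[of _ C] conjI ballI) blast+
  qed
qed

end

section \<open>Bounded Lipschitz maps\<close>

text \<open>Boundedness is included so that the notion is stable under bilinear products and, away
  from 0, under inversion.\<close>

definition lip_bdd :: "'a::metric_space set \<Rightarrow> ('a \<Rightarrow> 'b::real_normed_vector) \<Rightarrow> bool" where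
  "lip_bdd X f \<longleftrightarrow> (\<exists>L. L-lipschitz_on X f) \<and> (\<exists>M. \<forall>x\<in>X. norm (f x) \<le> M)"

lemma lip_bddD:
  assumes "lip_bdd X f"
  obtains L M where "L \<ge> 0" "M \<ge> 0" "\<And>x y. x \<in> X \<Longrightarrow> y \<in> X \<Longrightarrow> norm (f x - f y) \<le> L * dist x y" "\<And>x. x \<in> X \<Longrightarrow> norm (f x) \<le> M"
proof -
  obtain L M where *: "L-lipschitz_on X f" "\<And>x. x \<in> X \<Longrightarrow> norm (f x) \<le> M" using assms by (auto simp: lip_bdd_def)
  show thesis
    by (rule that[of L "max 0 M"]) (use * lipschitz_on_nonneg[OF *(1)] lipschitz_onD[OF *(1)] in \<open>auto simp: dist_norm le_max_iff_disj\<close>)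
qed

lemma lip_bddI:
  assumes "\<And>x y. x \<in> X \<Longrightarrow> y \<in> X \<Longrightarrow> norm (f x - f y) \<le> L * dist x y" "\<And>x. x \<in> X \<Longrightarrow> norm (f x) \<le> M"
  shows "lip_bdd X f"
proof -
  have "(max 0 L)-lipschitz_on X f"
  proof (rule lipschitz_onI)
    fix x y assume "x \<in> X" "y \<in> X"
    then have "norm (f x - f y) \<le> L * dist x y" by (rule assms(1))
    also have "\<dots> \<le> max 0 L * dist x y" by (intro mult_right_mono) auto
    finally show "dist (f x) (f y) \<le> max 0 L * dist x y" by (simp add: dist_norm)
  qed auto
  then show ?thesis using assms(2) unfolding lip_bdd_def by blast
qed

lemma lip_bdd_const: "lip_bdd X (\<lambda>_. c)"
  by (rule lip_bddI[of _ _ 0 "norm c"]) auto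

lemma lip_bdd_subset: "lip_bdd X f \<Longrightarrow> Y \<subseteq> X \<Longrightarrow> lip_bdd Y f"
  unfolding lip_bdd_def by (meson lipschitz_on_subset subsetD)

lemma lip_bdd_cong: "lip_bdd X f \<Longrightarrow> (\<And>x. x \<in> X \<Longrightarrow> f x = g x) \<Longrightarrow> lip_bdd X g"
  unfolding lip_bdd_def by (metis lipschitz_on_transform)

lemma lip_bdd_add:
  assumes "lip_bdd X f" "lip_bdd X g"
  shows "lip_bdd X (\<lambda>x. f x + g x)"
proof -
  obtain L1 M1 where 1: "L1 \<ge> 0" "M1 \<ge> 0" "\<And>x y. x \<in> X \<Longrightarrow> y \<in> X \<Longrightarrow> norm (f x - f y) \<le> L1 * dist x y" "\<And>x. x \<in> X \<Longrightarrow> norm (f x) \<le> M1"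
    by (rule lip_bddD[OF assms(1)]) blast
  obtain L2 M2 where 2: "L2 \<ge> 0" "M2 \<ge> 0" "\<And>x y. x \<in> X \<Longrightarrow> y \<in> X \<Longrightarrow> norm (g x - g y) \<le> L2 * dist x y" "\<And>x. x \<in> X \<Longrightarrow> norm (g x) \<le> M2"
    by (rule lip_bddD[OF assms(2)]) blast
  show ?thesis
  proof (rule lip_bddI[of _ _ "L1 + L2" "M1 + M2"])
    fix x y assume xy: "x \<in> X" "y \<in> X"
    have "f x + g x - (f y + g y) = (f x - f y) + (g x - g y)" by simp
    then have "norm (f x + g x - (f y + g y)) \<le> norm (f x - f y) + norm (g x - g y)" by (metis norm_triangle_ineq)
    then show "norm (f x + g x - (f y + g y)) \<le> (L1 + L2) * dist x y" using 1(3)[OF xy] 2(3)[OF xy] by (simp add: algebra_simps)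
  next
    fix x assume "x \<in> X"
    then show "norm (f x + g x) \<le> M1 + M2" using 1(4)[of x] 2(4)[of x] norm_triangle_ineq[of "f x" "g x"] by linarith
  qed
qed

lemma lip_bdd_bilinear:
  assumes bil: "bounded_bilinear b" and "lip_bdd X f" "lip_bdd X g"
  shows "lip_bdd X (\<lambda>x. b (f x) (g x))"
proof -
  obtain L1 M1 where 1: "L1 \<ge> 0" "M1 \<ge> 0" "\<And>x y. x \<in> X \<Longrightarrow> y \<in> X \<Longrightarrow> norm (f x - f y) \<le> L1 * dist x y" "\<And>x. x \<in> X \<Longrightarrow> norm (f x) \<le> M1"
    by (rule lip_bddD[OF assms(2)]) blast
  obtain L2 M2 where 2: "L2 \<ge> 0" "M2 \<ge> 0" "\<And>x y. x \<in> X \<Longrightarrow> y \<in> X \<Longrightarrow> norm (g x - g y) \<le> L2 * dist x y" "\<And>x. x \<in> X \<Longrightarrow> norm (g x) \<le> M2"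
    by (rule lip_bddD[OF assms(3)]) blast
  obtain K where K: "K \<ge> 0" "\<And>u v. norm (b u v) \<le> norm u * norm v * K" using bounded_bilinear.nonneg_bounded[OF bil] by blast
  show ?thesis
  proof (rule lip_bddI[of _ _ "L1 * M2 * K + M1 * L2 * K" "M1 * M2 * K"])
    fix x y assume xy: "x \<in> X" "y \<in> X"
    have "b (f x) (g x) - b (f y) (g y) = b (f x - f y) (g x) + b (f y) (g x - g y)"
      by (simp add: bounded_bilinear.diff_left[OF bil] bounded_bilinear.diff_right[OF bil])
    then have "norm (b (f x) (g x) - b (f y) (g y)) \<le> norm (b (f x - f y) (g x)) + norm (b (f y) (g x - g y))"
      by (metis norm_triangle_ineq)
    also have "\<dots> \<le> norm (f x - f y) * norm (g x) * K + norm (f y) * norm (g x - g y) * K" by (intro add_mono K)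
    also have "\<dots> \<le> (L1 * dist x y) * M2 * K + M1 * (L2 * dist x y) * K"
      using 1 2 K xy by (intro add_mono mult_mono mult_nonneg_nonneg) auto
    finally show "norm (b (f x) (g x) - b (f y) (g y)) \<le> (L1 * M2 * K + M1 * L2 * K) * dist x y" by (simp add: algebra_simps)
  next
    fix x assume x: "x \<in> X"
    have "norm (b (f x) (g x)) \<le> norm (f x) * norm (g x) * K" by (rule K)
    also have "\<dots> \<le> M1 * M2 * K" using 1 2 K x by (intro mult_mono mult_nonneg_nonneg) auto
    finally show "norm (b (f x) (g x)) \<le> M1 * M2 * K" .
  qed
qed

lemma lip_bdd_inverse:
  fixes f :: "'a::metric_space \<Rightarrow> complex"
  assumes "lip_bdd X f" and c: "c > 0" "\<And>x. x \<in> X \<Longrightarrow> cmod (f x) \<ge> c"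
  shows "lip_bdd X (\<lambda>x. 1 / f x)"
proof -
  obtain L M where L: "L \<ge> 0" "M \<ge> 0" "\<And>x y. x \<in> X \<Longrightarrow> y \<in> X \<Longrightarrow> norm (f x - f y) \<le> L * dist x y" "\<And>x. x \<in> X \<Longrightarrow> norm (f x) \<le> M"
    by (rule lip_bddD[OF assms(1)]) blast
  show ?thesis
  proof (rule lip_bddI[of _ _ "L / (c * c)" "1 / c"])
    fix x y assume xy: "x \<in> X" "y \<in> X"
    have f0: "f x \<noteq> 0" "f y \<noteq> 0" using c xy by force+
    have "1 / f x - 1 / f y = (f y - f x) / (f x * f y)" using f0 by (simp add: field_simps)
    then have "norm (1 / f x - 1 / f y) = norm (f x - f y) / (cmod (f x) * cmod (f y))" by (simp add: norm_divide norm_mult norm_minus_commute)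
    also have "\<dots> \<le> (L * dist x y) / (c * c)" using L(3)[OF xy] L(1) c xy by (intro frac_le mult_mono) auto
    finally show "norm (1 / f x - 1 / f y) \<le> L / (c * c) * dist x y" by simp
  next
    fix x assume "x \<in> X"
    then show "norm (1 / f x) \<le> 1 / c" using c by (simp add: norm_divide frac_le)
  qed
qed

lemma lip_bdd_compose:
  assumes f: "lip_bdd X f" and g: "\<And>u v. norm (g u - g v) \<le> K * norm (u - v)" and K: "K \<ge> 0"
  shows "lip_bdd X (\<lambda>x. g (f x))"
proof -
  obtain L M where L: "L \<ge> 0" "M \<ge> 0" "\<And>x y. x \<in> X \<Longrightarrow> y \<in> X \<Longrightarrow> norm (f x - f y) \<le> L * dist x y" "\<And>x. x \<in> X \<Longrightarrow> norm (f x) \<le> M"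
    by (rule lip_bddD[OF f]) blast
  show ?thesis
  proof (rule lip_bddI[of _ _ "K * L" "norm (g 0) + K * M"])
    fix x y assume xy: "x \<in> X" "y \<in> X"
    have "norm (g (f x) - g (f y)) \<le> K * norm (f x - f y)" by (rule g)
    also have "\<dots> \<le> K * (L * dist x y)" using L(3)[OF xy] K by (intro mult_left_mono) auto
    finally show "norm (g (f x) - g (f y)) \<le> K * L * dist x y" by simp
  next
    fix x assume x: "x \<in> X"
    have "norm (g (f x)) \<le> norm (g 0) + norm (g (f x) - g 0)" by (rule norm_triangle_sub)
    also have "norm (g (f x) - g 0) \<le> K * norm (f x)" using g[of "f x" 0] by simp
    also have "\<dots> \<le> K * M" using L(4)[OF x] K by (intro mult_left_mono) auto
    finally show "norm (g (f x)) \<le> norm (g 0) + K * M" by simp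
  qed
qed

lemma lip_bdd_linear:
  assumes "lip_bdd X f" and g: "bounded_linear g"
  shows "lip_bdd X (\<lambda>x. g (f x))"
proof -
  obtain K where K: "K \<ge> 0" "\<And>u. norm (g u) \<le> norm u * K" using bounded_linear.nonneg_bounded[OF g] by blast
  show ?thesis
    by (rule lip_bdd_compose[OF assms(1), of g K])
      (use K in \<open>auto simp: mult.commute simp flip: linear_diff[OF bounded_linear.linear[OF g]]\<close>)
qed

lemma lip_bdd_id: "bounded X \<Longrightarrow> lip_bdd X (\<lambda>x. x)"
  unfolding bounded_iff by (elim exE, rule lip_bddI[of _ _ 1]) (auto simp: dist_norm)

lemma lip_bdd_Pair:
  assumes "lip_bdd X f" "lip_bdd X g"
  shows "lip_bdd X (\<lambda>x. (f x, g x))"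
proof -
  have "lip_bdd X (\<lambda>x. (f x, 0) + (0, g x))"
    by (intro lip_bdd_add lip_bdd_linear[OF assms(1), of "\<lambda>u. (u, 0)"] lip_bdd_linear[OF assms(2), of "\<lambda>u. (0, u)"]
        bounded_linear_Pair bounded_linear_ident bounded_linear_zero)
  then show ?thesis by simp
qed

lemma lip_bdd_pull_fst:
  fixes f :: "'a::metric_space \<Rightarrow> 'b::real_normed_vector" and Z :: "'c::metric_space set"
  assumes "lip_bdd X f"
  shows "lip_bdd (X \<times> Z) (\<lambda>e. f (fst e))"
proof -
  obtain L M where L: "L \<ge> 0" "M \<ge> 0" "\<And>x y. x \<in> X \<Longrightarrow> y \<in> X \<Longrightarrow> norm (f x - f y) \<le> L * dist x y" "\<And>x. x \<in> X \<Longrightarrow> norm (f x) \<le> M"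
    by (rule lip_bddD[OF assms(1)]) blast
  show ?thesis
  proof (rule lip_bddI[of _ _ L M])
    fix x y :: "'a \<times> 'c" assume xy: "x \<in> X \<times> Z" "y \<in> X \<times> Z"
    have "norm (f (fst x) - f (fst y)) \<le> L * dist (fst x) (fst y)" using xy by (intro L) auto
    also have "\<dots> \<le> L * dist x y" using L(1) by (intro mult_left_mono dist_fst_le) auto
    finally show "norm (f (fst x) - f (fst y)) \<le> L * dist x y" .
  qed (use L in auto)
qed

lemma infdist_product:
  fixes R :: "'a::metric_space set" and z :: "'b::metric_space"
  assumes "q \<in> R" "dist x q = infdist x R"
  shows "dist (x, z) (q, z) = infdist (x, z) (R \<times> UNIV)"
proof (rule antisym)
  have "dist x q \<le> dist (x, z) p" if p: "p \<in> R \<times> UNIV" for p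
  proof -
    have "dist x q \<le> dist x (fst p)" using assms(2) infdist_le[of "fst p" R x] p by auto
    also have "\<dots> \<le> dist (x, z) p" using dist_fst_le[of "(x, z)" p] by simp
    finally show ?thesis .
  qed
  moreover have "dist (x, z) (q, z) = dist x q" by (simp add: dist_Pair_Pair)
  moreover have "R \<times> UNIV \<noteq> {}" using assms(1) by auto
  ultimately show "dist (x, z) (q, z) \<le> infdist (x, z) (R \<times> UNIV)"
    unfolding infdist_notempty[OF \<open>R \<times> UNIV \<noteq> {}\<close>] by (intro cINF_greatest) auto
qed (use assms in \<open>auto intro: infdist_le\<close>)

lemma norm_le_of_derivative_bound:
  fixes f :: "real \<Rightarrow> 'e::real_normed_vector"
  assumes "\<And>t. t \<in> {0..1} \<Longrightarrow> (f has_vector_derivative f' t) (at t within {0..1})" "\<And>t. t \<in> {0..1} \<Longrightarrow> norm (f' t) \<le> B"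
    and "t \<in> {0..1}"
  shows "norm (f t - f 0) \<le> B * t"
proof -
  have "norm (f t - f 0) \<le> B * norm (t - 0)"
  proof (rule differentiable_bound[of "{0..1}" f "\<lambda>t h. h *\<^sub>R f' t"])
    show "onorm (\<lambda>h. h *\<^sub>R f' x) \<le> B" if "x \<in> {0..1}" for x
      by (rule onorm_le) (use assms(2)[OF that] in \<open>simp add: mult.commute[of B] mult_left_mono\<close>)
  qed (use assms in \<open>auto simp: has_vector_derivative_def\<close>)
  then show ?thesis using assms(3) by simp
qed

section \<open>Local trivialization of the pencil\<close>

context projective_stratification
begin

lemma closed_cone_Y: "closed (insert 0 (cone Y))" by (rule closed_cone_insert[OF closed_Y])

lemma cone_Y_strata: "v \<in> cone Y \<Longrightarrow> \<exists>S\<in>\<S>. v \<in> cone S"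
  using strata_union by (auto simp: cone_def)

lemma cone_strata_Y: "S \<in> \<S> \<Longrightarrow> v \<in> cone S \<Longrightarrow> v \<in> cone Y"
  using strata_union by (auto simp: cone_def)

text \<open>The controlled field lives on the open good region only. Cutting it off gives a bounded
  field on the closed cone, apex included, that keeps the value 1 of the form near those unit
  vectors on which the form is small. Multiplication by a real factor between 0 and 1 preserves
  control.\<close>

lemma cutoff_field:
  assumes a: "a \<noteq> 0" and tr: "transverse_to_strata (hyperplane a) \<S>"
  obtains \<zeta> d r M where "d > 0" "d \<le> 1/2" "r > 0" "M > 0" "continuous_on (insert 0 (cone Y)) \<zeta>"
    "\<And>v. v \<in> insert 0 (cone Y) \<Longrightarrow> norm (\<zeta> v) \<le> M" "\<And>v. norm v \<ge> 2 \<Longrightarrow> \<zeta> v = 0"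
    "\<And>v. v \<in> cone Y \<Longrightarrow> \<zeta> v \<in> T v" "\<exists>e>0. \<forall>v\<in>ball 0 e. \<zeta> v = 0"
    "\<And>v w. v \<in> cone Y \<Longrightarrow> norm v = 1 \<Longrightarrow> cmod (lform a v) \<le> r \<Longrightarrow> w \<in> cone Y \<Longrightarrow> dist v w \<le> d \<Longrightarrow> lform a (\<zeta> w) = 1"
    "\<And>S v. S \<in> \<S> \<Longrightarrow> v \<in> cone S \<Longrightarrow> \<exists>e>0. lip_bdd (cone S \<inter> ball v e) \<zeta>"
    "\<And>S y. S \<in> \<S> \<Longrightarrow> y \<in> cone S \<Longrightarrow> \<exists>e>0. \<exists>C\<ge>0. \<forall>x\<in>cone Y \<inter> ball y e. \<forall>q\<in>cone S \<inter> ball y e.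
       normal_to (T q) (x - q) \<longrightarrow> cmod (cdot (\<zeta> x) (x - q)) \<le> C * (norm (x - q))\<^sup>2"
proof -
  let ?\<Omega> = "good_region a"
  let ?F = "insert 0 (cone Y)"
  obtain \<eta> where \<eta>: "\<And>v. v \<in> cone Y \<inter> ?\<Omega> \<Longrightarrow> \<eta> v \<in> T v \<and> lform a (\<eta> v) = 1"
    "continuous_on (cone Y \<inter> ?\<Omega>) \<eta>"
    "\<And>S v. S \<in> \<S> \<Longrightarrow> v \<in> cone S \<inter> ?\<Omega> \<Longrightarrow> \<exists>d>0. \<exists>L. L-lipschitz_on (cone S \<inter> ball v d) \<eta>"
    "\<And>S y. S \<in> \<S> \<Longrightarrow> y \<in> cone S \<inter> ?\<Omega> \<Longrightarrow> \<exists>d>0. \<exists>C\<ge>0. \<forall>x\<in>cone Y \<inter> ball y d. \<forall>q\<in>cone S \<inter> ball y d.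
       normal_to (T q) (x - q) \<longrightarrow> cmod (cdot (\<eta> x) (x - q)) \<le> C * (norm (x - q))\<^sup>2"
    by (rule controlled_field[of a]) blast
  \<comment> \<open>The points where the field has to vanish: those outside the good region, among
    them the apex, and those of norm at least 2.\<close>
  define N where "N = - ?\<Omega> \<union> - ball 0 2"
  have N: "closed N" "0 \<in> N" using good_region_open[of a] by (auto simp: N_def good_region_def)
  have Nne: "N \<noteq> {}" using N by auto
  define K0 where "K0 = ?F \<inter> sphere 0 1 \<inter> {v. lform a v = 0}"
  have clA: "closed {v. lform a v = 0}"
    by (intro closed_Collect_eq continuous_on_const linear_continuous_on bounded_linear_lform)
  have "compact K0" unfolding K0_def using closed_cone_Y clA
    by (intro closed_Int_compact compact_Int_closed) (auto simp: closed_Int)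
  moreover have "K0 \<inter> N = {}"
    using good_region_contains[OF a tr] by (auto simp: K0_def N_def)
  ultimately obtain d0 where d0: "d0 > 0" "\<And>x y. x \<in> K0 \<Longrightarrow> y \<in> N \<Longrightarrow> d0 \<le> dist x y"
    using separate_compact_closed[OF _ N(1)] by metis
  \<comment> \<open>Four thresholds for the distance to N: unit vectors of the cone in the kernel of
    the form have distance at least 4 * d, those with a small value more than 3 * d, moving by d
    leaves at least 2 * d, where the cutoff is 1, and up to d the field is 0.\<close>
  define d where "d = min (1/2) (d0 / 4)"
  have d: "d > 0" "d \<le> 1/2" "4 * d \<le> d0" using d0 by (auto simp: d_def)
  have K0N: "infdist x N \<ge> 4 * d" if "x \<in> K0" for x
    unfolding infdist_notempty[OF Nne] using d0(2)[OF that] d Nne by (intro cINF_greatest) (auto intro: order_trans)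
  \<comment> \<open>On this compact set the form has no zero, hence a lower bound r; so a unit
    vector of the cone with value at most r in modulus is farther than 3 * d from N.\<close>
  define C where "C = ?F \<inter> sphere 0 1 \<inter> {v. infdist v N \<le> 3 * d}"
  have "closed {v. infdist v N \<le> 3 * d}" by (intro closed_Collect_le continuous_intros)
  then have "compact C" unfolding C_def using closed_cone_Y
    by (intro compact_Int_closed closed_Int_compact) auto
  have Apos: "lform a v \<noteq> 0" if "v \<in> C" for v
    using K0N[of v] that d(1) by (auto simp: C_def K0_def)
  have "\<exists>r>0. \<forall>v\<in>C. cmod (lform a v) > r"
  proof (cases "C = {}")
    case False
    have "continuous_on C (\<lambda>v. cmod (lform a v))" by (intro continuous_intros linear_continuous_on bounded_linear_lform)
    then obtain v0 where v0: "v0 \<in> C" "\<And>v. v \<in> C \<Longrightarrow> cmod (lform a v0) \<le> cmod (lform a v)"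
      using continuous_attains_inf[OF \<open>compact C\<close> False] by metis
    have p: "cmod (lform a v0) > 0" using Apos[OF v0(1)] by simp
    show ?thesis
    proof (intro exI[of _ "cmod (lform a v0) / 2"] conjI ballI)
      fix v assume "v \<in> C"
      then show "cmod (lform a v0) / 2 < cmod (lform a v)" using v0(2)[of v] p by linarith
    qed (use p in simp)
  qed (auto intro: exI[of _ 1])
  then obtain r where r: "r > 0" "\<And>v. v \<in> C \<Longrightarrow> cmod (lform a v) > r" by blast
  define \<kappa> where "\<kappa> v = max 0 (min 1 (infdist v N / d - 1))" for v
  have \<kappa>1: "\<kappa> v = 1" if "infdist v N \<ge> 2 * d" for v
    using that d by (simp add: \<kappa>_def field_simps)
  have \<kappa>0: "\<kappa> v = 0" if "infdist v N \<le> d" for v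
    using that d by (simp add: \<kappa>_def field_simps)
  have \<kappa>01: "0 \<le> \<kappa> v" "\<kappa> v \<le> 1" for v by (auto simp: \<kappa>_def)
  have \<kappa>lip: "\<bar>\<kappa> v - \<kappa> w\<bar> \<le> (1/d) * dist v w" for v w
  proof -
    have "\<bar>infdist v N - infdist w N\<bar> \<le> dist v w"
      using infdist_triangle[of v N w] infdist_triangle[of w N v] by (auto simp: abs_le_iff dist_commute)
    then have "\<bar>infdist v N / d - infdist w N / d\<bar> \<le> dist v w / d"
      using d(1) divide_right_mono[of _ "dist v w" d] by (simp add: abs_divide flip: diff_divide_distrib)
    then show ?thesis by (auto simp: \<kappa>_def)
  qed
  have \<kappa>cont: "continuous_on UNIV \<kappa>" unfolding \<kappa>_def using d(1) by (intro continuous_intros) auto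
  define \<zeta> where "\<zeta> v = (if infdist v N > d then \<kappa> v *\<^sub>R \<eta> v else 0)" for v
  have dN: "infdist v N > d \<Longrightarrow> v \<in> ?\<Omega> \<and> norm v < 2" for v
    using d by (cases "v \<in> N") (auto simp: N_def)
  have \<zeta>\<Omega>: "\<zeta> v = \<kappa> v *\<^sub>R \<eta> v" if "v \<in> ?\<Omega>" for v
    using \<kappa>0[of v] by (auto simp: \<zeta>_def not_less)
  define F1 where "F1 = ?F \<inter> {v. infdist v N \<ge> d}"
  define F2 where "F2 = ?F \<inter> {v. infdist v N \<le> d}"
  have cl12: "closed F1" "closed F2" unfolding F1_def F2_def
    using closed_cone_Y by (auto intro!: closed_Int closed_Collect_le continuous_intros)
  have F1\<Omega>: "v \<in> cone Y \<inter> ?\<Omega> \<and> norm v < 2" if "v \<in> F1" for v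
  proof -
    have "v \<notin> N" using that d(1) by (auto simp: F1_def)
    then show ?thesis using that by (auto simp: F1_def N_def good_region_def)
  qed
  have \<zeta>F1: "continuous_on F1 \<zeta>"
  proof (rule continuous_on_eq)
    show "continuous_on F1 (\<lambda>v. \<kappa> v *\<^sub>R \<eta> v)"
      using F1\<Omega> by (intro continuous_on_scaleR continuous_on_subset[OF \<kappa>cont] continuous_on_subset[OF \<eta>(2)]) auto
    show "\<kappa> v *\<^sub>R \<eta> v = \<zeta> v" if "v \<in> F1" for v using \<zeta>\<Omega> F1\<Omega>[OF that] by simp
  qed
  have \<zeta>F2: "continuous_on F2 \<zeta>"
    by (rule continuous_on_eq[of _ "\<lambda>_. 0"]) (auto simp: F2_def \<zeta>_def)
  have "continuous_on (F1 \<union> F2) \<zeta>" by (rule continuous_on_closed_Un[OF cl12 \<zeta>F1 \<zeta>F2])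
  moreover have "F1 \<union> F2 = ?F" by (auto simp: F1_def F2_def)
  ultimately have cont\<zeta>: "continuous_on ?F \<zeta>" by simp
  have "compact F1" using cl12 F1\<Omega> by (auto simp: compact_eq_bounded_closed bounded_iff intro!: exI[of _ 2] less_imp_le)
  then have "bounded (\<zeta> ` F1)" using \<zeta>F1 by (intro compact_imp_bounded compact_continuous_image)
  then obtain M where M: "M > 0" "\<And>v. v \<in> F1 \<Longrightarrow> norm (\<zeta> v) \<le> M" unfolding bounded_pos by blast
  have Mb: "norm (\<zeta> v) \<le> M" if "v \<in> ?F" for v
    using M that by (cases "infdist v N \<ge> d") (auto simp: F1_def \<zeta>_def)
  have farN: "\<exists>e>0. \<forall>x\<in>ball y e. \<zeta> x = 0" if "y \<in> N" for y
  proof (intro exI[of _ d] conjI ballI d(1))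
    fix x assume "x \<in> ball y d"
    then have "infdist x N < d" using infdist_le[OF that, of x] by (simp add: dist_commute)
    then show "\<zeta> x = 0" by (simp add: \<zeta>_def)
  qed
  show thesis
  proof (rule that[of d r M \<zeta>])
    show "\<zeta> v = 0" if "norm v \<ge> 2" for v
    proof -
      have "v \<in> N" using that by (simp add: N_def)
      then show ?thesis using d(1) by (simp add: \<zeta>_def)
    qed
    show "\<zeta> v \<in> T v" if v: "v \<in> cone Y" for v
    proof -
      obtain S where S: "S \<in> \<S>" "v \<in> cone S" using cone_Y_strata[OF v] by blast
      have sub: "vec.subspace (T v)" using cone_tangent_subspace[OF S] T_eq[OF S] by simp
      show ?thesis
      proof (cases "infdist v N > d")
        case True
        then have "\<eta> v \<in> T v" using \<eta>(1)[of v] v dN by simp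
        then show ?thesis using True sub by (simp add: \<zeta>_def scaleR_vec_eq vec.subspace_scale)
      qed (use sub in \<open>simp add: \<zeta>_def vec.subspace_0\<close>)
    qed
    show "\<exists>e>0. \<forall>v\<in>ball 0 e. \<zeta> v = 0" by (rule farN[OF N(2)])
    show "lform a (\<zeta> w) = 1" if v: "v \<in> cone Y" "norm v = 1" "cmod (lform a v) \<le> r" and w: "w \<in> cone Y" "dist v w \<le> d" for v w
    proof -
      have "v \<notin> C" using r(2)[of v] v(3) by auto
      then have "infdist v N > 3 * d" using v by (auto simp: C_def)
      then have w2: "infdist w N \<ge> 2 * d" using infdist_triangle[of v N w] w(2) by simp
      then have "w \<in> ?\<Omega>" using dN[of w] d(1) by simp
      then show ?thesis using \<kappa>1[OF w2] \<zeta>\<Omega>[of w] \<eta>(1)[of w] w by simp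
    qed
    fix S y assume S: "S \<in> \<S>" and y: "y \<in> cone S"
    show "\<exists>e>0. lip_bdd (cone S \<inter> ball y e) \<zeta>"
    proof (cases "y \<in> ?\<Omega>")
      case True
      obtain e L where e: "e > 0" "L-lipschitz_on (cone S \<inter> ball y e) \<eta>" using \<eta>(3)[OF S, of y] y True by blast
      obtain e' where e': "e' > 0" "ball y e' \<subseteq> ?\<Omega>" using True good_region_open open_contains_ball by blast
      define X where "X = cone S \<inter> ball y (min e e')"
      have "lip_bdd X \<eta>"
      proof (rule lip_bddI[of _ _ L "norm (\<eta> y) + L * e"])
        fix u v assume "u \<in> X" "v \<in> X"
        then show "norm (\<eta> u - \<eta> v) \<le> L * dist u v" using lipschitz_onD[OF e(2)] by (auto simp: X_def dist_norm)
      next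
        fix u assume u: "u \<in> X"
        have "norm (\<eta> u) \<le> norm (\<eta> y) + norm (\<eta> u - \<eta> y)" by (rule norm_triangle_sub)
        also have "norm (\<eta> u - \<eta> y) \<le> L * dist u y" using lipschitz_onD[OF e(2), of u y] u y e(1) by (auto simp: X_def dist_norm)
        also have "\<dots> \<le> L * e" using u lipschitz_on_nonneg[OF e(2)] by (intro mult_left_mono) (auto simp: X_def dist_commute)
        finally show "norm (\<eta> u) \<le> norm (\<eta> y) + L * e" by simp
      qed
      moreover have "lip_bdd X \<kappa>" by (rule lip_bddI[of _ _ "1/d" 1]) (use \<kappa>lip \<kappa>01 in auto)
      ultimately have "lip_bdd X (\<lambda>v. \<kappa> v *\<^sub>R \<eta> v)" by (intro lip_bdd_bilinear[OF bounded_bilinear_scaleR])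
      then have "lip_bdd X \<zeta>" by (rule lip_bdd_cong) (use \<zeta>\<Omega> e' in \<open>auto simp: X_def subset_iff\<close>)
      then show ?thesis unfolding X_def using e(1) e'(1) by (intro exI[of _ "min e e'"]) auto
    next
      case False
      then obtain e where "e > 0" "\<forall>x\<in>ball y e. \<zeta> x = 0" using farN[of y] by (auto simp: N_def)
      then show ?thesis by (intro exI[of _ e] conjI lip_bdd_cong[OF lip_bdd_const[of _ 0]]) auto
    qed
    show "\<exists>e>0. \<exists>C\<ge>0. \<forall>x\<in>cone Y \<inter> ball y e. \<forall>q\<in>cone S \<inter> ball y e.
       normal_to (T q) (x - q) \<longrightarrow> cmod (cdot (\<zeta> x) (x - q)) \<le> C * (norm (x - q))\<^sup>2"
    proof (cases "y \<in> ?\<Omega>")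
      case True
      obtain e C where e: "e > 0" "C \<ge> 0" "\<forall>x\<in>cone Y \<inter> ball y e. \<forall>q\<in>cone S \<inter> ball y e.
       normal_to (T q) (x - q) \<longrightarrow> cmod (cdot (\<eta> x) (x - q)) \<le> C * (norm (x - q))\<^sup>2" using \<eta>(4)[OF S, of y] y True by blast
      obtain e' where e': "e' > 0" "ball y e' \<subseteq> ?\<Omega>" using True good_region_open open_contains_ball by blast
      have "cmod (cdot (\<zeta> x) (x - q)) \<le> C * (norm (x - q))\<^sup>2"
        if x: "x \<in> cone Y \<inter> ball y (min e e')" and q: "q \<in> cone S \<inter> ball y (min e e')" and n: "normal_to (T q) (x - q)" for x q
      proof -
        have "cmod (cdot (\<eta> x) (x - q)) \<le> C * (norm (x - q))\<^sup>2" using e(3) x q n by auto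
        moreover have "x \<in> ?\<Omega>" using x e' by auto
        then have "cmod (cdot (\<zeta> x) (x - q)) = \<kappa> x * cmod (cdot (\<eta> x) (x - q))"
          using \<kappa>01[of x] by (simp add: \<zeta>\<Omega> cdot_scaleR_left norm_mult)
        then have "cmod (cdot (\<zeta> x) (x - q)) \<le> 1 * cmod (cdot (\<eta> x) (x - q))"
          using \<kappa>01[of x] by (metis mult_right_mono norm_ge_zero)
        ultimately show ?thesis by simp
      qed
      then show ?thesis using e e' by (intro exI[of _ "min e e'"] conjI exI[of _ C]) auto
    next
      case False
      then obtain e where "e > 0" "\<forall>x\<in>ball y e. \<zeta> x = 0" using farN[of y] by (auto simp: N_def)
      then show ?thesis by (intro exI[of _ e] conjI exI[of _ 0]) auto
    qed
  qed (use d r M Mb cont\<zeta> in auto)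
qed

end

text \<open>A 1-Lipschitz retraction onto the disc, which lets the field below be defined and
  bounded for all parameters.\<close>

definition clamp_disc :: "real \<Rightarrow> complex \<Rightarrow> complex" where
  "clamp_disc r z = closest_point (cball 0 r) z"

lemma clamp_disc_props:
  assumes "r \<ge> 0"
  shows "cmod (clamp_disc r z) \<le> r" "cmod z \<le> r \<Longrightarrow> clamp_disc r z = z" "norm (clamp_disc r z - clamp_disc r w) \<le> 1 * norm (z - w)"
    "continuous_on UNIV (clamp_disc r)"
proof -
  have ne: "cball (0::complex) r \<noteq> {}" using assms by auto
  have "clamp_disc r z \<in> cball 0 r" unfolding clamp_disc_def by (rule closest_point_in_set) (use ne in auto)
  then show "cmod (clamp_disc r z) \<le> r" by simp
  show "cmod z \<le> r \<Longrightarrow> clamp_disc r z = z" unfolding clamp_disc_def by (rule closest_point_self) auto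
  show "norm (clamp_disc r z - clamp_disc r w) \<le> 1 * norm (z - w)"
    unfolding clamp_disc_def using closest_point_lipschitz[OF convex_cball closed_cball ne, of z w] by (simp add: dist_norm)
  show "continuous_on UNIV (clamp_disc r)"
    unfolding clamp_disc_def[abs_def] by (rule continuous_on_closest_point) (use ne in auto)
qed

context projective_stratification
begin

text \<open>\<open>z\<close> is the parameter of the hyperplane of the form \<open>a + z b\<close>; \<open>Tr v z z'\<close> carries \<open>v\<close> from the hyperplane with
  parameter \<open>z\<close> to the one with parameter \<open>z'\<close>. The field \<open>\<zeta>\<close> raises the value of \<open>a\<close> at unit speed, so the time-one
  flow of \<open>- (z' - z) b(v) / (1 + z b(\<zeta>)) \<zeta>\<close> does this; it vanishes on the axis.\<close>

lemma local_slicing: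
  fixes a b :: "complex^'n"
  assumes a: "a \<noteq> 0" and tr: "transverse_to_strata (hyperplane a) \<S>"
  defines "E \<equiv> \<lambda>\<rho>. {(v, z, z'). v \<in> cone Y \<and> norm v = 1 \<and> lform a v + z * lform b v = 0 \<and> cmod z \<le> \<rho> \<and> cmod z' \<le> \<rho>}"
  obtains \<rho> Tr where "\<rho> > 0" "continuous_on (E \<rho>) (\<lambda>(v, z, z'). Tr v z z')"
    "\<And>v z z' S. (v, z, z') \<in> E \<rho> \<Longrightarrow> S \<in> \<S> \<Longrightarrow> v \<in> cone S \<Longrightarrow> Tr v z z' \<in> cone S"
    "\<And>v z z'. (v, z, z') \<in> E \<rho> \<Longrightarrow> lform a (Tr v z z') + z' * lform b (Tr v z z') = 0"
    "\<And>v z. (v, z, z) \<in> E \<rho> \<Longrightarrow> Tr v z z = v"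
    "\<And>v z z'. (v, z, z') \<in> E \<rho> \<Longrightarrow> lform b v = 0 \<Longrightarrow> Tr v z z' = v"
proof -
  let ?F = "insert 0 (cone Y)"
  obtain \<zeta> d r M where d: "d > 0" "d \<le> 1/2" and r: "r > 0" and M: "M > 0" and cont\<zeta>: "continuous_on ?F \<zeta>"
    and \<zeta>M: "\<And>v. v \<in> ?F \<Longrightarrow> norm (\<zeta> v) \<le> M" and \<zeta>2: "\<And>v. norm v \<ge> 2 \<Longrightarrow> \<zeta> v = 0"
    and \<zeta>T: "\<And>v. v \<in> cone Y \<Longrightarrow> \<zeta> v \<in> T v" and \<zeta>0: "\<exists>e>0. \<forall>v\<in>ball 0 e. \<zeta> v = 0"
    and \<zeta>1: "\<And>v w. v \<in> cone Y \<Longrightarrow> norm v = 1 \<Longrightarrow> cmod (lform a v) \<le> r \<Longrightarrow> w \<in> cone Y \<Longrightarrow> dist v w \<le> d \<Longrightarrow> lform a (\<zeta> w) = 1"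
    and \<zeta>lip: "\<And>S v. S \<in> \<S> \<Longrightarrow> v \<in> cone S \<Longrightarrow> \<exists>e>0. lip_bdd (cone S \<inter> ball v e) \<zeta>"
    and \<zeta>ctl: "\<And>S y. S \<in> \<S> \<Longrightarrow> y \<in> cone S \<Longrightarrow> \<exists>e>0. \<exists>C\<ge>0. \<forall>x\<in>cone Y \<inter> ball y e. \<forall>q\<in>cone S \<inter> ball y e.
       normal_to (T q) (x - q) \<longrightarrow> cmod (cdot (\<zeta> x) (x - q)) \<le> C * (norm (x - q))\<^sup>2"
    by (rule cutoff_field[OF a tr]) blast
  define B where "B = norm b + 1"
  have B: "B > 0" "norm b \<le> B" using norm_ge_zero[of b] by (auto simp: B_def add_nonneg_pos)
  \<comment> \<open>The first bound makes |a(v)| = |z b(v)| at most r on unit vectors; the second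
    keeps the denominators above 1/2 and the speed below d.\<close>
  define \<rho> where "\<rho> = min (r / B) (d / (16 * (B * (M + 1))))"
  have BM: "B * (M + 1) > 0" using B M by simp
  have \<rho>: "\<rho> > 0" "\<rho> * B \<le> r" "16 * (\<rho> * (B * (M + 1))) \<le> d"
  proof -
    show "\<rho> > 0" using r d B BM by (simp add: \<rho>_def)
    have "\<rho> \<le> r / B" by (simp add: \<rho>_def)
    then show "\<rho> * B \<le> r" using B by (simp add: field_simps)
    have "\<rho> \<le> d / (16 * (B * (M + 1)))" by (simp add: \<rho>_def)
    then have "\<rho> * (16 * (B * (M + 1))) \<le> d" using BM by (subst (asm) pos_le_divide_eq) linarith+
    then show "16 * (\<rho> * (B * (M + 1))) \<le> d" by linarith
  qed
  have BMM: "\<rho> * (B * M) \<le> \<rho> * (B * (M + 1))" using \<rho>(1) B by simp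
  have lb: "cmod (lform b v) \<le> B * norm v" for v
    using norm_lform_le[of b v] mult_right_mono[OF B(2) norm_ge_zero[of v]] by linarith
  define den where "den v z = 1 + clamp_disc \<rho> z * lform b (\<zeta> v)" for v z
  have small: "cmod (clamp_disc \<rho> z * lform b (\<zeta> v)) \<le> 1/2" if "v \<in> ?F" for v z
  proof -
    have "cmod (lform b (\<zeta> v)) \<le> B * M"
      using lb[of "\<zeta> v"] mult_left_mono[OF \<zeta>M[OF that], of B] B(1) by linarith
    then have "cmod (clamp_disc \<rho> z * lform b (\<zeta> v)) \<le> \<rho> * (B * M)"
      unfolding norm_mult using clamp_disc_props(1)[of \<rho> z] \<rho>(1) by (intro mult_mono) auto
    also have "\<dots> \<le> 1/2" using BMM \<rho>(3) d(2) by linarith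
    finally show ?thesis .
  qed
  have den2: "cmod (den v z) \<ge> 1/2" if "v \<in> ?F" for v z
    using small[OF that, of z] norm_triangle_ineq2[of 1 "- (clamp_disc \<rho> z * lform b (\<zeta> v))"] by (simp add: den_def)
  \<comment> \<open>Both clamps are inactive along the solutions that are used, where |z| \<le>
    \<rho> and |c| = |z' - z| \<le> 2 * \<rho>.\<close>
  define g where "g v z c = (- (clamp_disc (2 * \<rho>) c * lform b v) * (1 / den v z)) *s \<zeta> v" for v z c
  have gd: "norm (g v z c) \<le> d" if v: "v \<in> ?F" for v z c
  proof (cases "norm v \<ge> 2")
    case True then show ?thesis using \<zeta>2 d by (simp add: g_def)
  next
    case False
    have "norm (g v z c) = cmod (clamp_disc (2 * \<rho>) c) * cmod (lform b v) * (1 / cmod (den v z)) * norm (\<zeta> v)"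
      by (simp add: g_def norm_vec_scale norm_mult norm_divide)
    also have "\<dots> \<le> (2 * \<rho>) * (B * 2) * 2 * M"
    proof (intro mult_mono)
      show "cmod (clamp_disc (2 * \<rho>) c) \<le> 2 * \<rho>" using \<rho> by (intro clamp_disc_props) auto
      show "cmod (lform b v) \<le> B * 2" using lb[of v] mult_left_mono[of "norm v" 2 B] False B by linarith
      show "1 / cmod (den v z) \<le> 2" using den2[OF v, of z] by (simp add: divide_le_eq)
    qed (use \<zeta>M[OF v] \<rho> B in auto)
    also have "\<dots> = 8 * (\<rho> * (B * M))" by simp
    also have "\<dots> \<le> d" using BMM \<rho> B M mult_nonneg_nonneg[of \<rho> "B * M"] by (smt (verit) mult_pos_pos)
    finally show ?thesis .
  qed
  define F where "F = ?F \<times> (UNIV :: (complex \<times> complex) set)"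
  \<comment> \<open>The parameter z and its velocity c = z' - z are made part of the state. The
    field becomes autonomous, and continuity of the flow in the initial point is joint continuity in
    v, z and z'.\<close>
  define G :: "(complex^'n) \<times> complex \<times> complex \<Rightarrow> (complex^'n) \<times> complex \<times> complex" where
    "G e = (g (fst e) (fst (snd e)) (snd (snd e)), clamp_disc (2 * \<rho>) (snd (snd e)), 0)" for e
  \<comment> \<open>The apex becomes a stratum of its own, which closes up the cone; the field
    vanishes near it.\<close>
  define \<R> where "\<R> = (\<lambda>R. R \<times> (UNIV :: (complex \<times> complex) set)) ` insert {0} (cone ` \<S>)"
  have \<R>cases: "(\<exists>S\<in>\<S>. R = cone S \<times> UNIV) \<or> R = {0} \<times> UNIV" if "R \<in> \<R>" for R using that by (auto simp: \<R>_def)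
  have clc: "continuous_on X (\<lambda>e. clamp_disc s (f e))" if "continuous_on X f" "s \<ge> 0" for X f s
    by (rule continuous_on_compose2[OF clamp_disc_props(4)[OF that(2)] that(1)]) auto
  have bl: "continuous_on X (\<lambda>e. lform b (f e))" if "continuous_on X f" for X f
    by (rule bounded_linear.continuous_on[OF bounded_linear_lform that])
  have cG: "continuous_on F G"
  proof -
    have z: "continuous_on F (\<lambda>e. \<zeta> (fst e))" by (rule continuous_on_compose2[OF cont\<zeta>]) (auto intro!: continuous_intros simp: F_def)
    have dn: "continuous_on F (\<lambda>e. den (fst e) (fst (snd e)))" unfolding den_def
      by (intro continuous_intros clc bl z) (use \<rho> in auto)
    have dn0: "den (fst e) (fst (snd e)) \<noteq> 0" if "e \<in> F" for e
      using den2[of "fst e" "fst (snd e)"] that by (auto simp: F_def)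
    show ?thesis unfolding G_def g_def
      by (intro continuous_on_Pair bounded_bilinear.continuous_on[OF bounded_bilinear_vec_scale] continuous_intros clc bl z dn)
        (use dn0 \<rho> in auto)
  qed
  have fx: "g 0 z c = 0" for z c using \<zeta>0 by (auto simp: g_def)
  interpret SF: stratified_field F G \<R> "d + 2 * \<rho>"
  proof (rule stratified_field.intro)
    show "closed F" unfolding F_def using closed_cone_Y by (intro closed_Times) auto
    show "continuous_on F G" by (rule cG)
    show "norm (G e) \<le> d + 2 * \<rho>" if e: "e \<in> F" for e
    proof -
      have "norm (G e) \<le> norm (g (fst e) (fst (snd e)) (snd (snd e))) + norm (clamp_disc (2 * \<rho>) (snd (snd e)), 0 :: complex)"
        unfolding G_def by (rule norm_Pair_le)
      also have "\<dots> \<le> d + 2 * \<rho>" using gd[of "fst e"] e clamp_disc_props(1)[of "2 * \<rho>" "snd (snd e)"] \<rho> by (intro add_mono) (auto simp: F_def norm_Pair)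
      finally show ?thesis .
    qed
    show "\<Union>\<R> = F"
      using strata_union by (auto simp: \<R>_def F_def cone_def)
    show "disjoint \<R>"
      using strata_disj by (auto simp: \<R>_def disjoint_def cone_def)
    show "viable F G" unfolding viable_def
    proof (intro ballI allI impI)
      fix x and e :: real assume x: "x \<in> F" and e: "e > 0"
      obtain v z c where xv: "x = (v, z, c)" by (cases x)
      show "\<exists>h y. 0 < h \<and> h < e \<and> y \<in> F \<and> norm (y - x - h *\<^sub>R G x) \<le> e * h"
      proof (cases "v = 0")
        case True
        then show ?thesis using e xv fx
          by (intro exI[of _ "e/2"] exI[of _ "(0, z + (e/2) *\<^sub>R clamp_disc (2 * \<rho>) c, c)"]) (auto simp: F_def G_def)
      next
        case False
        then have vY: "v \<in> cone Y" using x xv by (auto simp: F_def)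
        obtain S where S: "S \<in> \<S>" "v \<in> cone S" using cone_Y_strata[OF vY] by blast
        have "g v z c \<in> T v" unfolding g_def
          using cone_tangent_subspace[OF S] T_eq[OF S] \<zeta>T[OF vY] by (simp only: vec.subspace_scale)
        \<comment> \<open>Tangency is all that viability asks: a curve in the stratum with this
          velocity supplies the points of F near an Euler step.\<close>
        then obtain \<gamma> where \<gamma>: "\<gamma> 0 = v" "\<And>s. \<gamma> s \<in> cone S" "(\<gamma> has_vector_derivative g v z c) (at 0)"
          using T_eq[OF S] by (auto simp: tangent_space_def)
        obtain k where k: "k > 0" "\<And>s. \<bar>s\<bar> < k \<Longrightarrow> norm (\<gamma> s - v - s *\<^sub>R g v z c) \<le> e * \<bar>s\<bar>"
          using \<gamma>(3) e unfolding has_vector_derivative_def has_derivative_at_alt \<gamma>(1) by (auto simp: \<gamma>(1))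
        define h where "h = min (e/2) (k/2)"
        have h: "h > 0" "h < e" "h < k" using e k by (auto simp: h_def)
        have "norm (\<gamma> h - v - h *\<^sub>R g v z c) \<le> e * h" using k(2)[of h] h by simp
        moreover have "\<gamma> h \<in> cone Y" using cone_strata_Y[OF S(1) \<gamma>(2)] .
        ultimately show ?thesis using h xv
          by (intro exI[of _ h] exI[of _ "(\<gamma> h, z + h *\<^sub>R clamp_disc (2 * \<rho>) c, c)"]) (auto simp: F_def G_def norm_Pair)
      qed
    qed
    show "\<exists>d>0. \<exists>C. \<forall>y\<in>F \<inter> ball x d. \<exists>q\<in>R. dist y q = infdist y R \<and> \<bar>inner (y - q) (G y)\<bar> \<le> C * (dist y q)\<^sup>2"
      if R: "R \<in> \<R>" and x: "x \<in> R" for R x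
      using \<R>cases[OF R]
    proof
      assume R0: "R = {0} \<times> UNIV"
      obtain e where e: "e > 0" "\<forall>v\<in>ball 0 e. \<zeta> v = 0" using \<zeta>0 by blast
      have x0: "fst x = 0" using x R0 by auto
      show ?thesis
      proof (rule exI[of _ e], rule conjI, rule e(1), rule exI[of _ 0], rule ballI)
        fix y assume y: "y \<in> F \<inter> ball x e"
        obtain v w where yv: "y = (v, w)" by (cases y)
        have "dist 0 v < e" using y dist_fst_le[of x y] x0 yv by simp
        then have "g v (fst w) (snd w) = 0" using e by (simp add: g_def)
        then have "inner (y - (0, w)) (G y) = 0" by (simp add: yv G_def inner_Pair)
        moreover have "dist y (0, w) = infdist y R" unfolding yv R0 by (rule infdist_product) auto
        ultimately show "\<exists>q\<in>R. dist y q = infdist y R \<and> \<bar>inner (y - q) (G y)\<bar> \<le> 0 * (dist y q)\<^sup>2"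
          using R0 by (intro bexI[of _ "(0, w)"]) auto
      qed
    next
      assume "\<exists>S\<in>\<S>. R = cone S \<times> UNIV"
      then obtain S where S: "S \<in> \<S>" "R = cone S \<times> UNIV" by blast
      interpret CS: stratum "cone S" T by (rule cone_stratum[OF S(1)])
      have xS: "fst x \<in> cone S" using x S by auto
      obtain e C where e: "e > 0" "C \<ge> 0" "\<And>v q. v \<in> cone Y \<inter> ball (fst x) e \<Longrightarrow> q \<in> cone S \<inter> ball (fst x) e \<Longrightarrow>
       normal_to (T q) (v - q) \<Longrightarrow> cmod (cdot (\<zeta> v) (v - q)) \<le> C * (norm (v - q))\<^sup>2" using \<zeta>ctl[OF S(1) xS] by blast
      have "\<exists>k>0. k \<le> e \<and> (\<forall>v\<in>ball (fst x) k. \<exists>q\<in>cone S \<inter> ball (fst x) e. normal_to (T q) (v - q) \<and> dist v q = infdist v (cone S))"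
        using CS.foot_exists[OF xS e(1)] by metis
      then obtain k where k: "k > 0" "k \<le> e" "\<And>v. v \<in> ball (fst x) k \<Longrightarrow>
        \<exists>q\<in>cone S \<inter> ball (fst x) e. normal_to (T q) (v - q) \<and> dist v q = infdist v (cone S)"
        by blast
      define L where "L = (2 * \<rho>) * (B * (norm (fst x) + e)) * 2 * C"
      have "\<forall>y\<in>F \<inter> ball x k. \<exists>q\<in>R. dist y q = infdist y R \<and> \<bar>inner (y - q) (G y)\<bar> \<le> L * (dist y q)\<^sup>2"
      proof
        fix y assume y: "y \<in> F \<inter> ball x k"
        obtain v w where yv: "y = (v, w)" by (cases y)
        have vk: "v \<in> ball (fst x) k" using y dist_fst_le[of x y] yv by simp
        obtain q where q: "q \<in> cone S \<inter> ball (fst x) e" "normal_to (T q) (v - q)" "dist v q = infdist v (cone S)" using k(3)[OF vk] by blast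
        have vF: "v \<in> ?F" using y yv by (auto simp: F_def)
        have est: "cmod (cdot (\<zeta> v) (v - q)) \<le> C * (norm (v - q))\<^sup>2"
        proof (cases "v = 0")
          case True
          obtain e0 where "e0 > 0" "\<forall>v\<in>ball 0 e0. \<zeta> v = 0" using \<zeta>0 by blast
          then have "\<zeta> v = 0" using True by simp
          then show ?thesis using e by simp
        next
          case False
          then show ?thesis using vF vk k q by (intro e(3)) auto
        qed
        have nv: "norm v \<le> norm (fst x) + e" using vk k(2) norm_triangle_sub[of v "fst x"] by (simp add: dist_norm norm_minus_commute)
        have "\<bar>inner (y - (q, w)) (G y)\<bar> = \<bar>inner (g v (fst w) (snd w)) (v - q)\<bar>"
          by (simp add: yv G_def inner_Pair inner_commute)
        also have "\<dots> \<le> cmod (cdot (g v (fst w) (snd w)) (v - q))" by (rule abs_inner_le_cdot)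
        also have "\<dots> = cmod (clamp_disc (2 * \<rho>) (snd w)) * cmod (lform b v) * (1 / cmod (den v (fst w))) * cmod (cdot (\<zeta> v) (v - q))"
          unfolding g_def cdot_scale_left norm_mult norm_divide norm_minus_cancel norm_one by simp
        also have "\<dots> \<le> (2 * \<rho>) * (B * (norm (fst x) + e)) * 2 * (C * (norm (v - q))\<^sup>2)"
        proof (intro mult_mono est)
          show "cmod (clamp_disc (2 * \<rho>) (snd w)) \<le> 2 * \<rho>" using \<rho> by (intro clamp_disc_props) auto
          show "cmod (lform b v) \<le> B * (norm (fst x) + e)" using lb[of v] mult_left_mono[OF nv, of B] B by linarith
          show "1 / cmod (den v (fst w)) \<le> 2" using den2[OF vF, of "fst w"] by (simp add: divide_le_eq)
        qed (use \<rho> B e in auto)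
        also have "\<dots> = L * (dist y (q, w))\<^sup>2" by (simp add: L_def yv dist_Pair_Pair dist_norm)
        finally have "\<bar>inner (y - (q, w)) (G y)\<bar> \<le> L * (dist y (q, w))\<^sup>2" .
        moreover have "dist y (q, w) = infdist y R" unfolding yv S(2) using q by (intro infdist_product) auto
        ultimately show "\<exists>q\<in>R. dist y q = infdist y R \<and> \<bar>inner (y - q) (G y)\<bar> \<le> L * (dist y q)\<^sup>2"
          using q S(2) by (intro bexI[of _ "(q, w)"]) auto
      qed
      then show ?thesis using k(1) by blast
    qed
    show "\<exists>d>0. \<exists>L. L-lipschitz_on (R \<inter> ball x d) G" if R: "R \<in> \<R>" and x: "x \<in> R" for R x
    proof -
      have "\<exists>e>0. \<exists>Q. R = Q \<times> UNIV \<and> Q \<subseteq> ?F \<and> lip_bdd (Q \<inter> ball (fst x) e) \<zeta>"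
        using \<R>cases[OF R]
      proof
        assume R0: "R = {0} \<times> UNIV"
        then show ?thesis by (intro exI[of _ 1] conjI exI[of _ "{0}"] lip_bddI[of _ _ 0 "norm (\<zeta> 0)"]) auto
      next
        assume "\<exists>S\<in>\<S>. R = cone S \<times> UNIV"
        then obtain S where S: "S \<in> \<S>" "R = cone S \<times> UNIV" by blast
        then have "fst x \<in> cone S" using x by auto
        then obtain e where "e > 0" "lip_bdd (cone S \<inter> ball (fst x) e) \<zeta>" using \<zeta>lip[OF S(1)] by blast
        moreover have "cone S \<subseteq> ?F" using cone_strata_Y[OF S(1)] by blast
        ultimately show ?thesis using S(2) by blast
      qed
      then obtain e Q where e: "e > 0" "R = Q \<times> UNIV" "Q \<subseteq> ?F" "lip_bdd (Q \<inter> ball (fst x) e) \<zeta>" by blast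
      define X where "X = R \<inter> ball x e"
      have XF: "X \<subseteq> F" using e by (auto simp: X_def F_def)
      have "X \<subseteq> (Q \<inter> ball (fst x) e) \<times> UNIV"
      proof
        fix y assume "y \<in> X"
        then show "y \<in> (Q \<inter> ball (fst x) e) \<times> UNIV" using e(2) dist_fst_le[of x y] by (cases y) (auto simp: X_def)
      qed
      then have l\<zeta>: "lip_bdd X (\<lambda>e. \<zeta> (fst e))" using lip_bdd_pull_fst[OF e(4)] by (rule lip_bdd_subset[rotated])
      have bX: "lip_bdd X (\<lambda>e. e)" by (rule lip_bdd_id) (auto simp: X_def bounded_Int)
      have lv: "lip_bdd X fst" by (rule lip_bdd_linear[OF bX bounded_linear_fst])
      have ls: "lip_bdd X snd" by (rule lip_bdd_linear[OF bX bounded_linear_snd])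
      have lz: "lip_bdd X (\<lambda>e. fst (snd e))" by (rule lip_bdd_linear[OF ls bounded_linear_fst])
      have lc: "lip_bdd X (\<lambda>e. snd (snd e))" by (rule lip_bdd_linear[OF ls bounded_linear_snd])
      have lcz: "lip_bdd X (\<lambda>e. clamp_disc \<rho> (fst (snd e)))" by (rule lip_bdd_compose[OF lz clamp_disc_props(3)]) (use \<rho> in auto)
      have lcc: "lip_bdd X (\<lambda>e. clamp_disc (2 * \<rho>) (snd (snd e)))" by (rule lip_bdd_compose[OF lc clamp_disc_props(3)]) (use \<rho> in auto)
      have lden: "lip_bdd X (\<lambda>e. den (fst e) (fst (snd e)))" unfolding den_def
        by (intro lip_bdd_add lip_bdd_const lip_bdd_bilinear[OF bounded_bilinear_mult] lcz lip_bdd_linear[OF l\<zeta> bounded_linear_lform])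
      have lid: "lip_bdd X (\<lambda>e. 1 / den (fst e) (fst (snd e)))"
      proof (rule lip_bdd_inverse[OF lden, of "1/2"])
        show "1/2 \<le> cmod (den (fst e) (fst (snd e)))" if "e \<in> X" for e using den2[of "fst e"] that XF by (auto simp: F_def)
      qed simp
      have lneg: "lip_bdd X (\<lambda>e. - (clamp_disc (2 * \<rho>) (snd (snd e)) * lform b (fst e)))"
        by (rule lip_bdd_linear[OF lip_bdd_bilinear[OF bounded_bilinear_mult lcc lip_bdd_linear[OF lv bounded_linear_lform]]])
          (rule bounded_linear_minus[OF bounded_linear_ident])
      have "lip_bdd X G" unfolding G_def g_def
        by (intro lip_bdd_Pair lcc lip_bdd_const lip_bdd_bilinear[OF bounded_bilinear_vec_scale] l\<zeta>
            lip_bdd_bilinear[OF bounded_bilinear_mult] lneg lid)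
      then show ?thesis using e(1) unfolding lip_bdd_def X_def by blast
    qed
  qed
  obtain \<Phi> where \<Phi>: "\<And>x. x \<in> F \<Longrightarrow> SF.solution (\<Phi> x)" "\<And>x. x \<in> F \<Longrightarrow> \<Phi> x 0 = x"
    "\<And>t. t \<in> {0..1} \<Longrightarrow> continuous_on F (\<lambda>x. \<Phi> x t)" using SF.flow_exists by metis
  define Tr where "Tr v z z' = fst (\<Phi> (v, z, z' - z) 1)" for v z z'
  have EF: "(v, z, z' - z) \<in> F" if "(v, z, z') \<in> E \<rho>" for v z z' using that by (auto simp: E_def F_def)
  \<comment> \<open>If g vanishes at v for all parameters, the curve that keeps v and only moves z
    is a solution, hence the one chosen, by uniqueness. This covers z' = z as well as points of the
    axis.\<close>
  have const: "Tr v z z' = v" if vE: "(v, z, z') \<in> E \<rho>" and s: "\<And>t. g v t (z' - z) = 0" for v z z'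
  proof -
    have c: "cmod (z' - z) \<le> 2 * \<rho>" using vE norm_triangle_ineq4[of z' z] by (auto simp: E_def)
    have cl: "clamp_disc (2 * \<rho>) (z' - z) = z' - z" using c \<rho> by (intro clamp_disc_props) auto
    have vF: "v \<in> ?F" using vE by (auto simp: E_def)
    have "SF.solution (\<lambda>t. (v, z + t *\<^sub>R (z' - z), z' - z))" unfolding SF.solution_def
    proof (intro ballI conjI)
      fix t :: real
      show "(v, z + t *\<^sub>R (z' - z), z' - z) \<in> F" using vF by (simp add: F_def)
      have "((\<lambda>t. (v, z + t *\<^sub>R (z' - z), z' - z)) has_derivative (\<lambda>h. (0, h *\<^sub>R (z' - z), 0))) (at t within {0..1})"
        by (auto intro!: derivative_eq_intros)
      moreover have "(\<lambda>h. (0, h *\<^sub>R (z' - z), 0)) = (\<lambda>h. h *\<^sub>R G (v, z + t *\<^sub>R (z' - z), z' - z))"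
        using s cl by (auto simp: G_def)
      ultimately show "((\<lambda>t. (v, z + t *\<^sub>R (z' - z), z' - z)) has_vector_derivative G (v, z + t *\<^sub>R (z' - z), z' - z)) (at t within {0..1})"
        unfolding has_vector_derivative_def by simp
    qed
    then have "\<Phi> (v, z, z' - z) 1 = (v, z + 1 *\<^sub>R (z' - z), z' - z)"
      using SF.solution_unique[OF \<Phi>(1)[OF EF[OF vE]], of "\<lambda>t. (v, z + t *\<^sub>R (z' - z), z' - z)" 1] \<Phi>(2)[OF EF[OF vE]] by simp
    then show ?thesis by (simp add: Tr_def)
  qed
  show thesis
  proof (rule that[of \<rho> Tr])
    show "\<rho> > 0" by (rule \<rho>)
    have "continuous_on (E \<rho>) (\<lambda>p. \<Phi> (fst p, fst (snd p), snd (snd p) - fst (snd p)) 1)"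
      by (rule continuous_on_compose2[OF \<Phi>(3)]) (auto intro!: continuous_intros EF)
    then show "continuous_on (E \<rho>) (\<lambda>(v, z, z'). Tr v z z')"
      unfolding Tr_def case_prod_beta by (intro continuous_on_fst)
    fix v z assume "(v, z, z) \<in> E \<rho>"
    then show "Tr v z z = v" by (rule const) (use \<rho> clamp_disc_props(2)[of "2 * \<rho>" 0] in \<open>simp add: g_def\<close>)
  next
    fix v z z' assume vE: "(v, z, z') \<in> E \<rho>"
    show "Tr v z z' = v" if "lform b v = 0" by (rule const[OF vE]) (simp add: g_def that)
    define \<phi> where "\<phi> = \<Phi> (v, z, z' - z)"
    have sol: "SF.solution \<phi>" "\<phi> 0 = (v, z, z' - z)" using \<Phi>(1,2)[OF EF[OF vE]] by (auto simp: \<phi>_def)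
    have der: "(\<phi> has_vector_derivative G (\<phi> t)) (at t within {0..1})" "\<phi> t \<in> F" if "t \<in> {0..1}" for t
      using sol(1) that by (auto simp: SF.solution_def)
    show "Tr v z z' \<in> cone S" if S: "S \<in> \<S>" "v \<in> cone S" for S
    proof -
      have "\<phi> 1 \<in> cone S \<times> UNIV"
        by (rule SF.solution_in_stratum[OF sol(1), of _ 0]) (use S sol(2) in \<open>auto simp: \<R>_def\<close>)
      then show ?thesis by (auto simp: Tr_def \<phi>_def mem_Times_iff)
    qed
    have vY: "v \<in> cone Y" and v1: "norm v = 1" and L0: "lform a v + z * lform b v = 0" and zz: "cmod z \<le> \<rho>" "cmod z' \<le> \<rho>"
      using vE by (auto simp: E_def)
    obtain S where S: "S \<in> \<S>" "v \<in> cone S" using cone_Y_strata[OF vY] by blast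
    have inS: "fst (\<phi> t) \<in> cone S" if "t \<in> {0..1}" for t
    proof -
      have "\<phi> t \<in> cone S \<times> UNIV"
        by (rule SF.solution_in_stratum[OF sol(1), of _ 0]) (use S sol(2) that in \<open>auto simp: \<R>_def\<close>)
      then show ?thesis by (simp add: mem_Times_iff)
    qed
    have c: "cmod (z' - z) \<le> 2 * \<rho>" using zz norm_triangle_ineq4[of z' z] by simp
    have cl: "clamp_disc (2 * \<rho>) (z' - z) = z' - z" using c \<rho> by (intro clamp_disc_props) auto
    have dsnd: "((\<lambda>t. snd (snd (\<phi> t))) has_vector_derivative 0) (at t within {0..1})" if "t \<in> {0..1}" for t
      using bounded_linear.has_vector_derivative[OF bounded_linear_snd bounded_linear.has_vector_derivative[OF bounded_linear_snd der(1)[OF that]]]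
      by (simp add: G_def)
    have c_const: "snd (snd (\<phi> t)) = z' - z" if "t \<in> {0..1}" for t
      using norm_le_of_derivative_bound[of "\<lambda>t. snd (snd (\<phi> t))" "\<lambda>_. 0" 0 t] dsnd that sol(2) by simp
    have dz: "((\<lambda>t. fst (snd (\<phi> t))) has_vector_derivative z' - z) (at t within {0..1})" if "t \<in> {0..1}" for t
      using bounded_linear.has_vector_derivative[OF bounded_linear_fst bounded_linear.has_vector_derivative[OF bounded_linear_snd der(1)[OF that]]]
      by (simp add: G_def c_const[OF that] cl)
    have z_eq: "fst (snd (\<phi> t)) = z + t *\<^sub>R (z' - z)" if t: "t \<in> {0..1}" for t
    proof -
      have "((\<lambda>t. fst (snd (\<phi> t)) - t *\<^sub>R (z' - z)) has_vector_derivative 0) (at s within {0..1})" if "s \<in> {0..1}" for s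
      proof -
        have "((\<lambda>t. t *\<^sub>R (z' - z)) has_vector_derivative z' - z) (at s within {0..1})"
          unfolding has_vector_derivative_def by (auto intro!: derivative_eq_intros)
        from has_vector_derivative_diff[OF dz[OF that] this] show ?thesis by simp
      qed
      then show ?thesis
        using norm_le_of_derivative_bound[of "\<lambda>t. fst (snd (\<phi> t)) - t *\<^sub>R (z' - z)" "\<lambda>_. 0" 0 t] t sol(2) by (simp add: diff_eq_eq)
    qed
    have z_bd: "cmod (fst (snd (\<phi> t))) \<le> \<rho>" if t: "t \<in> {0..1}" for t
    proof -
      have "z + t *\<^sub>R (z' - z) = (1 - t) *\<^sub>R z + t *\<^sub>R z'" by (simp add: algebra_simps)
      also have "\<dots> \<in> cball 0 \<rho>" by (rule convexD_alt[OF convex_cball]) (use zz t in auto)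
      finally show ?thesis using z_eq[OF t] by simp
    qed
    have dv: "((\<lambda>t. fst (\<phi> t)) has_vector_derivative g (fst (\<phi> t)) (fst (snd (\<phi> t))) (z' - z)) (at t within {0..1})" if "t \<in> {0..1}" for t
      using bounded_linear.has_vector_derivative[OF bounded_linear_fst der(1)[OF that]]
      by (simp add: G_def c_const[OF that])
    \<comment> \<open>Speed at most d over unit time keeps the solution in the region where the form
      takes the value 1 on \<zeta>.\<close>
    have near: "dist v (fst (\<phi> t)) \<le> d" if t: "t \<in> {0..1}" for t
    proof -
      have "norm (fst (\<phi> t) - fst (\<phi> 0)) \<le> d * t"
        by (rule norm_le_of_derivative_bound[OF dv _ t]) (use der(2) in \<open>auto intro!: gd simp: F_def mem_Times_iff\<close>)
      also have "\<dots> \<le> d" using t d by (simp add: mult_left_le)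
      finally show ?thesis using sol(2) by (simp add: dist_norm norm_minus_commute)
    qed
    have "cmod (lform a v) \<le> r"
    proof -
      have "lform a v = - (z * lform b v)" using L0 by (simp add: eq_neg_iff_add_eq_0)
      then have "cmod (lform a v) = cmod z * cmod (lform b v)" by (simp add: norm_mult)
      also have "\<dots> \<le> \<rho> * B" using zz(1) lb[of v] v1 \<rho> by (intro mult_mono) auto
      finally show ?thesis using \<rho> by simp
    qed
    then have a1: "lform a (\<zeta> (fst (\<phi> t))) = 1" if t: "t \<in> {0..1}" for t
      using \<zeta>1[OF vY v1 _ cone_strata_Y[OF S(1) inS[OF t]] near[OF t]] by simp
    \<comment> \<open>Its derivative is m * (1 + z b(\<zeta>)) + (z' - z) b(v), where g = m \<zeta>
      and a(\<zeta>) = 1; the denominator in g is chosen to make this vanish.\<close>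
    define Lz where "Lz t = lform a (fst (\<phi> t)) + fst (snd (\<phi> t)) * lform b (fst (\<phi> t))" for t
    have "(Lz has_vector_derivative 0) (at t within {0..1})" if t: "t \<in> {0..1}" for t
    proof -
      let ?v = "fst (\<phi> t)" and ?z = "fst (snd (\<phi> t))"
      let ?g = "g ?v ?z (z' - z)"
      have "(Lz has_vector_derivative lform a ?g + (?z * lform b ?g + (z' - z) * lform b ?v)) (at t within {0..1})"
        unfolding Lz_def
        by (intro has_vector_derivative_add bounded_linear.has_vector_derivative[OF bounded_linear_lform dv[OF t]]
            has_vector_derivative_mult[OF dz[OF t]] )
      moreover have "lform a ?g + (?z * lform b ?g + (z' - z) * lform b ?v) = 0"
      proof -
        have clz: "clamp_disc \<rho> ?z = ?z" using z_bd[OF t] \<rho> by (intro clamp_disc_props) auto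
        have vF: "?v \<in> ?F" using cone_strata_Y[OF S(1) inS[OF t]] by simp
        have d0: "den ?v ?z \<noteq> 0" using den2[OF vF, of ?z] by auto
        define m where "m = - ((z' - z) * lform b ?v) * (1 / den ?v ?z)"
        have ge: "?g = m *s \<zeta> ?v" by (simp add: g_def cl m_def)
        have "lform a ?g + ?z * lform b ?g = m * (1 + ?z * lform b (\<zeta> ?v))"
          unfolding ge by (simp add: lform_scale a1[OF t] algebra_simps)
        also have "1 + ?z * lform b (\<zeta> ?v) = den ?v ?z" by (simp add: den_def clz)
        finally have "lform a ?g + ?z * lform b ?g = - ((z' - z) * lform b ?v)" using d0 by (simp add: m_def)
        then show ?thesis by (simp add: algebra_simps)
      qed
      ultimately show ?thesis by simp
    qed
    then have "norm (Lz 1 - Lz 0) \<le> 0 * 1" by (intro norm_le_of_derivative_bound[of Lz "\<lambda>_. 0"]) auto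
    moreover have "Lz 0 = 0" using L0 sol(2) by (simp add: Lz_def)
    moreover have "Lz 1 = lform a (Tr v z z') + z' * lform b (Tr v z z')"
      using z_eq[of 1] by (simp add: Lz_def Tr_def \<phi>_def)
    ultimately show "lform a (Tr v z z') + z' * lform b (Tr v z z') = 0" by simp
  qed
qed

end

section \<open>From the affine parameter z to points of the projective line of the pencil\<close>

lemma proj_in_hyperplane: "v \<noteq> 0 \<Longrightarrow> proj v \<in> hyperplane a \<longleftrightarrow> lform a v = 0"
  unfolding hyperplane_def lform_def[symmetric] by (auto simp: line_proj vec.span_singleton lform_scale)

lemma lform_comb: "lform (s *s a + t *s b) v = s * lform a v + t * lform b v"
  by (simp add: lform_def sum.distrib sum_distrib_left algebra_simps)

lemma proj_in_pencil:
  assumes "v \<noteq> 0" "s \<noteq> 0"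
  shows "proj v \<in> pencil a b (proj s) \<longleftrightarrow> s $ 1 * lform a v + s $ 2 * lform b v = 0"
proof -
  have "proj v \<in> pencil a b (proj s) \<longleftrightarrow> (\<forall>c. c * (s $ 1 * lform a v + s $ 2 * lform b v) = 0)"
    by (simp add: pencil_def line_proj vec.span_singleton assms proj_in_hyperplane lform_comb algebra_simps)
  then show ?thesis by (metis mult_1 mult_zero_right)
qed

lemma pencil_proj:
  fixes a b :: "complex^'n::finite"
  assumes s: "s \<noteq> 0"
  shows "pencil a b (proj s) = hyperplane (s $ 1 *s a + s $ 2 *s b)"
proof (rule Set.set_eqI)
  fix p :: "'n cproj"
  obtain v where v: "v \<noteq> 0" "p = proj v" by (rule proj_surj)
  show "p \<in> pencil a b (proj s) \<longleftrightarrow> p \<in> hyperplane (s $ 1 *s a + s $ 2 *s b)"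
    unfolding v(2) by (simp add: proj_in_pencil[OF v(1) s] proj_in_hyperplane[OF v(1)] lform_comb)
qed

lemma axis_in_pencil: "pencil_axis a b \<subseteq> pencil a b \<mu>"
proof
  fix p assume p: "p \<in> pencil_axis a b"
  obtain v where v: "v \<noteq> 0" "p = proj v" by (rule proj_surj)
  obtain s where s: "s \<noteq> 0" "\<mu> = proj s" by (rule proj_surj)
  show "p \<in> pencil a b \<mu>" using p unfolding v(2) s(2) proj_in_pencil[OF v(1) s(1)]
    by (simp add: pencil_axis_def proj_in_hyperplane[OF v(1)])
qed

text \<open>The universal property of the quotient topology, on open subsets.\<close>

lemma continuous_on_cproj:
  fixes f :: "'n::finite cproj \<Rightarrow> 'b::topological_space"
  assumes "open U" "continuous_on (cone U) (\<lambda>v. f (proj v))"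
  shows "continuous_on U f"
  unfolding continuous_on_open_vimage[OF assms(1)]
proof (intro allI impI)
  fix B :: "'b set" assume B: "open B"
  have "open ((\<lambda>v. f (proj v)) -` B \<inter> cone U)"
    using assms(2) B unfolding continuous_on_open_vimage[OF open_cone[OF assms(1)]] by blast
  moreover have "(\<lambda>v. f (proj v)) -` B \<inter> cone U = {v. v \<noteq> 0 \<and> proj v \<in> f -` B \<inter> U}" by (auto simp: cone_def)
  ultimately show "open (f -` B \<inter> U)" by (simp add: open_cproj_def)
qed

lemma vec2_eq_iff: "(v :: complex^2) = w \<longleftrightarrow> v $ 1 = w $ 1 \<and> v $ 2 = w $ 2"
  by (simp add: vec_eq_iff forall_2)

context projective_stratification
begin

text \<open>The generators of the pencil are replaced by a', the form of the given member, and a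
  complementary b', so that the member has affine parameter 0 and \<open>local_slicing\<close>
  applies. Scaling by the norm extends the transport from unit vectors to the cone.\<close>

lemma pencil_slicing:
  fixes a b :: "complex^'n"
  assumes ab: "a \<noteq> b" "vec.independent {a, b}" and tr: "transverse_to_strata (pencil a b \<mu>1) \<S>"
  defines "E \<equiv> \<lambda>U. {(v, \<mu>, \<mu>'). v \<in> cone (Y \<inter> pencil a b \<mu>) \<and> \<mu> \<in> U \<and> \<mu>' \<in> U}"
  obtains U Tr where "open U" "\<mu>1 \<in> U" "continuous_on (E U) (\<lambda>(v, \<mu>, \<mu>'). Tr v \<mu> \<mu>')"
    "\<And>v \<mu> \<mu>' S. (v, \<mu>, \<mu>') \<in> E U \<Longrightarrow> S \<in> \<S> \<Longrightarrow> v \<in> cone S \<Longrightarrow> Tr v \<mu> \<mu>' \<in> cone S"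
    "\<And>v \<mu> \<mu>'. (v, \<mu>, \<mu>') \<in> E U \<Longrightarrow> proj (Tr v \<mu> \<mu>') \<in> pencil a b \<mu>'"
    "\<And>v \<mu>. (v, \<mu>, \<mu>) \<in> E U \<Longrightarrow> Tr v \<mu> \<mu> = v"
    "\<And>v \<mu> \<mu>'. (v, \<mu>, \<mu>') \<in> E U \<Longrightarrow> proj v \<in> pencil_axis a b \<Longrightarrow> Tr v \<mu> \<mu>' = v"
proof -
  obtain s where s: "s \<noteq> 0" "\<mu>1 = proj s" by (rule proj_surj)
  define N where "N = s $ 1 * cnj (s $ 1) + s $ 2 * cnj (s $ 2)"
  have "N = of_real ((cmod (s $ 1))\<^sup>2 + (cmod (s $ 2))\<^sup>2)"
    unfolding N_def of_real_add of_real_power complex_norm_square[symmetric] by simp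
  moreover have "(cmod (s $ 1))\<^sup>2 + (cmod (s $ 2))\<^sup>2 \<noteq> 0" using s(1) by (auto simp: vec2_eq_iff sum_power2_eq_zero_iff)
  ultimately have N: "N \<noteq> 0" by (metis of_real_eq_0_iff)
  define a' where "a' = s $ 1 *s a + s $ 2 *s b"
  \<comment> \<open>Its coefficients form the vector Hermitian-orthogonal to s. Accordingly \<alpha>
    and \<beta> below are, up to the factor N, the coordinates of a parameter vector in this
    orthogonal basis, and their quotient is the affine parameter.\<close>
  define b' where "b' = (- cnj (s $ 2)) *s a + cnj (s $ 1) *s b"
  have a'0: "a' \<noteq> 0"
  proof
    assume "a' = 0"
    then have "(\<Sum>v\<in>{a, b}. (if v = a then s $ 1 else s $ 2) *s v) = 0" using ab(1) by (simp add: a'_def)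
    then have "(if v = a then s $ 1 else s $ 2) = 0" if "v \<in> {a, b}" for v
      using vec.independentD[OF ab(2), of "{a, b}" "\<lambda>v. if v = a then s $ 1 else s $ 2"] that by auto
    from this[of a] this[of b] show False using ab(1) s(1) by (auto simp: vec2_eq_iff)
  qed
  have tr': "transverse_to_strata (hyperplane a') \<S>" using tr by (simp add: s(2) pencil_proj[OF s(1)] a'_def)
  let ?E = "\<lambda>\<rho>. {(v, z, z'). v \<in> cone Y \<and> norm v = 1 \<and> lform a' v + z * lform b' v = 0 \<and> cmod z \<le> \<rho> \<and> cmod z' \<le> \<rho>}"
  obtain \<rho> Tr where \<rho>: "\<rho> > 0"
    and Tr: "continuous_on (?E \<rho>) (\<lambda>(v, z, z'). Tr v z z')"
    "\<And>v z z' S. (v, z, z') \<in> ?E \<rho> \<Longrightarrow> S \<in> \<S> \<Longrightarrow> v \<in> cone S \<Longrightarrow> Tr v z z' \<in> cone S"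
    "\<And>v z z'. (v, z, z') \<in> ?E \<rho> \<Longrightarrow> lform a' (Tr v z z') + z' * lform b' (Tr v z z') = 0"
    "\<And>v z. (v, z, z) \<in> ?E \<rho> \<Longrightarrow> Tr v z z = v"
    "\<And>v z z'. (v, z, z') \<in> ?E \<rho> \<Longrightarrow> lform b' v = 0 \<Longrightarrow> Tr v z z' = v"
    by (rule local_slicing[OF a'0 tr', of b']) (rule that)
  define \<alpha> where "\<alpha> w = w $ 1 * cnj (s $ 1) + w $ 2 * cnj (s $ 2)" for w :: "complex^2"
  define \<beta> where "\<beta> w = w $ 2 * s $ 1 - w $ 1 * s $ 2" for w :: "complex^2"
  have sc: "\<alpha> (c *s w) = c * \<alpha> w" "\<beta> (c *s w) = c * \<beta> w" for c w by (auto simp: \<alpha>_def \<beta>_def algebra_simps)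
  \<comment> \<open>The representative is arbitrary; it enters only through a quotient and a
    non-vanishing condition that are invariant under scaling.\<close>
  define rep where "rep \<mu> = (SOME w. w \<noteq> 0 \<and> proj w = \<mu>)" for \<mu> :: "2 cproj"
  have rep: "rep \<mu> \<noteq> 0" "proj (rep \<mu>) = \<mu>" for \<mu>
    using someI_ex[of "\<lambda>w. w \<noteq> 0 \<and> proj w = \<mu>"] proj_surj[of \<mu>] by (auto simp: rep_def)
  define \<zeta> where "\<zeta> \<mu> = \<beta> (rep \<mu>) / \<alpha> (rep \<mu>)" for \<mu>
  define U where "U = {\<mu>. \<alpha> (rep \<mu>) \<noteq> 0 \<and> cmod (\<zeta> \<mu>) < \<rho>}"
  have rp: "\<exists>c. c \<noteq> 0 \<and> rep (proj w) = c *s w" if "w \<noteq> 0" for w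
    using proj_eq_iff[OF that rep(1)] rep(2) by metis
  have \<zeta>p: "\<zeta> (proj w) = \<beta> w / \<alpha> w" "\<alpha> (rep (proj w)) = 0 \<longleftrightarrow> \<alpha> w = 0" if "w \<noteq> 0" for w
    using rp[OF that] by (auto simp: \<zeta>_def sc)
  have coneU: "cone U = {w. \<alpha> w \<noteq> 0 \<and> cmod (\<beta> w) < \<rho> * cmod (\<alpha> w)}"
  proof (rule Set.set_eqI)
    fix w
    show "w \<in> cone U \<longleftrightarrow> w \<in> {w. \<alpha> w \<noteq> 0 \<and> cmod (\<beta> w) < \<rho> * cmod (\<alpha> w)}"
    proof (cases "w = 0")
      case True then show ?thesis by (simp add: cone_def \<alpha>_def)
    next
      case False then show ?thesis by (auto simp: cone_def U_def \<zeta>p norm_divide pos_divide_less_eq)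
    qed
  qed
  have cont: "continuous_on UNIV \<alpha>" "continuous_on UNIV \<beta>" unfolding \<alpha>_def[abs_def] \<beta>_def[abs_def] by (intro continuous_intros)+
  have "open {w. \<alpha> w \<noteq> 0 \<and> cmod (\<beta> w) < \<rho> * cmod (\<alpha> w)}"
    by (intro open_Collect_conj open_Collect_neq open_Collect_less continuous_intros cont)
  then have oU: "open U" using coneU by (simp add: open_cproj_def cone_def)
  have "continuous_on (cone U) (\<lambda>w. \<beta> w / \<alpha> w)"
    unfolding coneU by (intro continuous_intros continuous_on_subset[OF cont(1)] continuous_on_subset[OF cont(2)]) auto
  then have c\<zeta>: "continuous_on U \<zeta>"
    by (intro continuous_on_cproj[OF oU]) (auto simp: \<zeta>p cone_def cong: continuous_on_cong_simp)
  have eq: "proj v \<in> pencil a b \<mu> \<longleftrightarrow> lform a' v + \<zeta> \<mu> * lform b' v = 0" if v: "v \<noteq> 0" and \<mu>: "\<mu> \<in> U" for v \<mu>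
  proof -
    let ?w = "rep \<mu>"
    have al: "\<alpha> ?w \<noteq> 0" using \<mu> by (simp add: U_def)
    have 1: "\<alpha> ?w * s $ 1 - \<beta> ?w * cnj (s $ 2) = N * ?w $ 1" "\<alpha> ?w * s $ 2 + \<beta> ?w * cnj (s $ 1) = N * ?w $ 2"
      by (auto simp: \<alpha>_def \<beta>_def N_def algebra_simps)
    have "\<alpha> ?w * (lform a' v + \<zeta> \<mu> * lform b' v) = \<alpha> ?w * lform a' v + \<beta> ?w * lform b' v"
      using al by (simp add: \<zeta>_def algebra_simps)
    also have "\<dots> = (\<alpha> ?w * s $ 1 - \<beta> ?w * cnj (s $ 2)) * lform a v + (\<alpha> ?w * s $ 2 + \<beta> ?w * cnj (s $ 1)) * lform b v"
      unfolding a'_def b'_def lform_comb by (simp add: algebra_simps)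
    also have "\<dots> = N * (?w $ 1 * lform a v + ?w $ 2 * lform b v)" unfolding 1 by (simp add: algebra_simps)
    finally have "lform a' v + \<zeta> \<mu> * lform b' v = 0 \<longleftrightarrow> ?w $ 1 * lform a v + ?w $ 2 * lform b v = 0"
      using al N by (metis mult_eq_0_iff)
    then show ?thesis using proj_in_pencil[OF v rep(1), of a b \<mu>] by (simp add: rep(2))
  qed
  \<comment> \<open>The transport is computed on the unit vector and the original length
    restored.\<close>
  define T' where "T' v \<mu> \<mu>' = norm v *\<^sub>R Tr ((1 / norm v) *\<^sub>R v) (\<zeta> \<mu>) (\<zeta> \<mu>')" for v \<mu> \<mu>'
  have scR: "r *\<^sub>R v \<in> cone S \<longleftrightarrow> v \<in> cone S" if "r > 0" for r v and S :: "'n cproj set" using that by (simp add: scaleR_vec_eq cone_scale)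
  have EE: "((1 / norm v) *\<^sub>R v, \<zeta> \<mu>, \<zeta> \<mu>') \<in> ?E \<rho>" if e: "(v, \<mu>, \<mu>') \<in> E U" for v \<mu> \<mu>'
  proof -
    have v: "v \<noteq> 0" "v \<in> cone Y" "proj v \<in> pencil a b \<mu>" and U: "\<mu> \<in> U" "\<mu>' \<in> U" using e by (auto simp: E_def cone_def)
    have "lform a' v + \<zeta> \<mu> * lform b' v = 0" using eq[OF v(1) U(1)] v(3) by simp
    then have "of_real (1 / norm v) * (lform a' v + \<zeta> \<mu> * lform b' v) = 0" by simp
    then have "lform a' ((1 / norm v) *\<^sub>R v) + \<zeta> \<mu> * lform b' ((1 / norm v) *\<^sub>R v) = 0" unfolding lform_scaleR by (simp add: algebra_simps)
    moreover have "(1 / norm v) *\<^sub>R v \<in> cone Y" using v by (subst scR) auto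
    ultimately show ?thesis using v(1) U by (auto simp: U_def)
  qed
  have E0: "v \<noteq> 0 \<and> v \<in> cone Y" if "(v, \<mu>, \<mu>') \<in> E U" for v \<mu> \<mu>' using that by (auto simp: E_def cone_def)
  show thesis
  proof (rule that[of U T'])
    show "open U" by (rule oU)
    have "\<beta> s = 0" "\<alpha> s = N" by (auto simp: \<alpha>_def \<beta>_def N_def)
    then have "s \<in> cone U" using N \<rho> by (simp add: coneU)
    then show "\<mu>1 \<in> U" by (simp add: cone_def s(2))
    have c1: "continuous_on (E U) fst" "continuous_on (E U) (\<lambda>e. fst (snd e))" "continuous_on (E U) (\<lambda>e. snd (snd e))"
      by (intro continuous_intros)+
    have c2: "continuous_on (E U) (\<lambda>e. ((1 / norm (fst e)) *\<^sub>R fst e, \<zeta> (fst (snd e)), \<zeta> (snd (snd e))))"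
      by (intro continuous_on_Pair continuous_on_scaleR continuous_on_divide continuous_on_const continuous_on_norm c1
          continuous_on_compose2[OF c\<zeta> c1(2)] continuous_on_compose2[OF c\<zeta> c1(3)]) (use E0 in \<open>auto simp: E_def cone_def\<close>)
    have "continuous_on (E U) (\<lambda>e. norm (fst e) *\<^sub>R (\<lambda>(v, z, z'). Tr v z z') ((1 / norm (fst e)) *\<^sub>R fst e, \<zeta> (fst (snd e)), \<zeta> (snd (snd e))))"
      by (intro continuous_on_scaleR continuous_on_norm c1 continuous_on_compose2[OF Tr(1) c2]) (use EE in auto)
    then show "continuous_on (E U) (\<lambda>(v, \<mu>, \<mu>'). T' v \<mu> \<mu>')" by (simp add: T'_def case_prod_beta)
  next
    fix v \<mu> \<mu>' S assume e: "(v, \<mu>, \<mu>') \<in> E U" and S: "S \<in> \<S>" "v \<in> cone S"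
    have "(1 / norm v) *\<^sub>R v \<in> cone S" using E0[OF e] S(2) by (subst scR) auto
    then show "T' v \<mu> \<mu>' \<in> cone S" unfolding T'_def using E0[OF e] Tr(2)[OF EE[OF e] S(1)] by (subst scR) auto
  next
    fix v \<mu> \<mu>' assume e: "(v, \<mu>, \<mu>') \<in> E U"
    let ?t = "Tr ((1 / norm v) *\<^sub>R v) (\<zeta> \<mu>) (\<zeta> \<mu>')"
    obtain S where S: "S \<in> \<S>" "v \<in> cone S" using cone_Y_strata E0[OF e] by blast
    have "(1 / norm v) *\<^sub>R v \<in> cone S" using E0[OF e] S(2) by (subst scR) auto
    then have "?t \<in> cone S" by (rule Tr(2)[OF EE[OF e] S(1)])
    then have t0: "?t \<noteq> 0" by (simp add: cone_def)
    have "proj ?t \<in> pencil a b \<mu>'" using eq[OF t0, of \<mu>'] Tr(3)[OF EE[OF e]] e by (auto simp: E_def)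
    then show "proj (T' v \<mu> \<mu>') \<in> pencil a b \<mu>'" using E0[OF e] by (simp add: T'_def scaleR_vec_eq proj_scale)
    assume "proj v \<in> pencil_axis a b"
    then have "lform a v = 0" "lform b v = 0" using E0[OF e] by (auto simp: pencil_axis_def proj_in_hyperplane)
    then have "lform b' ((1 / norm v) *\<^sub>R v) = 0" unfolding b'_def lform_comb lform_scaleR by simp
    then show "T' v \<mu> \<mu>' = v" unfolding T'_def using Tr(5)[OF EE[OF e]] E0[OF e] by simp
  next
    fix v \<mu> assume e: "(v, \<mu>, \<mu>) \<in> E U"
    show "T' v \<mu> \<mu> = v" unfolding T'_def using Tr(4)[OF EE[OF e]] E0[OF e] by simp
  qed
qed

end

section \<open>Transport over paths of parameters\<close>

text \<open>A local substitute for a trivialization: continuous transport between nearby fibres, the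
  identity on the diagonal and at rest on A. Transports need not compose to transports.\<close>

definition slice :: "('m::topological_space \<Rightarrow> 'v::topological_space set) \<Rightarrow> 'v set \<Rightarrow> 'm set \<Rightarrow> ('v \<Rightarrow> 'm \<Rightarrow> 'm \<Rightarrow> 'v) \<Rightarrow> bool" where
  "slice fib A U T \<longleftrightarrow> open U \<and>
    continuous_on {(v, \<mu>, \<mu>'). v \<in> fib \<mu> \<and> \<mu> \<in> U \<and> \<mu>' \<in> U} (\<lambda>(v, \<mu>, \<mu>'). T v \<mu> \<mu>') \<and>
    (\<forall>\<mu>\<in>U. \<forall>\<mu>'\<in>U. \<forall>v\<in>fib \<mu>. T v \<mu> \<mu>' \<in> fib \<mu>' \<and> T v \<mu> \<mu> = v \<and> (v \<in> A \<longrightarrow> T v \<mu> \<mu>' = v))"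

locale local_slices =
  fixes fib :: "'m::topological_space \<Rightarrow> 'v::topological_space set" and A :: "'v set" and B :: "'m set"
  assumes slices: "\<mu>1 \<in> B \<Longrightarrow> \<exists>U T. \<mu>1 \<in> U \<and> slice fib A U T"
begin

text \<open>The time reached depends on the point, which allows one ball of points to move while the
  others wait. The last clause also fixes points whose path of parameters is constant; it later
  identifies the ends of the homotopy.\<close>

definition transported :: "'q::metric_space set \<Rightarrow> ('q \<times> real \<Rightarrow> 'm) \<Rightarrow> ('q \<Rightarrow> 'v) \<Rightarrow> ('q \<Rightarrow> real) \<Rightarrow> bool" where
  "transported Q \<gamma> g a \<longleftrightarrow> continuous_on Q a \<and> a ` Q \<subseteq> {0..1} \<and>
     (\<exists>g'. continuous_on Q g' \<and> (\<forall>x\<in>Q. g' x \<in> fib (\<gamma> (x, a x)) \<and>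
        (g x \<in> A \<or> (\<forall>t\<in>{0..1}. \<gamma> (x, t) = \<gamma> (x, 0)) \<longrightarrow> g' x = g x)))"

text \<open>Only the points near the centre of one ball of a finite cover move during a step: the time is a function
  of the point, which is raised successively ball by ball.\<close>

lemma transported_step:
  assumes t: "transported Q \<gamma> g a" and \<gamma>: "continuous_on (Q \<times> {0..1}) \<gamma>"
    and a': "continuous_on Q a'" "a' ` Q \<subseteq> {0..1}"
    and S: "slice fib A U T"
    and C: "closed C" "closed D" "C \<union> D = UNIV"
    and CU: "\<And>x. x \<in> Q \<inter> C \<Longrightarrow> \<gamma> (x, a x) \<in> U \<and> \<gamma> (x, a' x) \<in> U" and Da: "\<And>x. x \<in> Q \<inter> D \<Longrightarrow> a' x = a x"
  shows "transported Q \<gamma> g a'"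
proof -
  have U: "open U" "continuous_on {(v, \<mu>, \<mu>'). v \<in> fib \<mu> \<and> \<mu> \<in> U \<and> \<mu>' \<in> U} (\<lambda>(v, \<mu>, \<mu>'). T v \<mu> \<mu>')"
    "\<forall>\<mu>\<in>U. \<forall>\<mu>'\<in>U. \<forall>v\<in>fib \<mu>. T v \<mu> \<mu>' \<in> fib \<mu>' \<and> T v \<mu> \<mu> = v \<and> (v \<in> A \<longrightarrow> T v \<mu> \<mu>' = v)"
    using S unfolding slice_def by blast+
  obtain g' where g': "continuous_on Q g'" "\<And>x. x \<in> Q \<Longrightarrow> g' x \<in> fib (\<gamma> (x, a x))"
    "\<And>x. x \<in> Q \<Longrightarrow> g x \<in> A \<or> (\<forall>t\<in>{0..1}. \<gamma> (x, t) = \<gamma> (x, 0)) \<Longrightarrow> g' x = g x"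
    and a: "continuous_on Q a" "a ` Q \<subseteq> {0..1}" using t unfolding transported_def by blast
  let ?t = "\<lambda>x. T (g' x) (\<gamma> (x, a x)) (\<gamma> (x, a' x))"
  define k where "k x = (if x \<in> C then ?t x else g' x)" for x
  have cg: "continuous_on (Q \<inter> C) (\<lambda>x. \<gamma> (x, c x))" if "continuous_on Q c" "c ` Q \<subseteq> {0..1}" for c
    by (rule continuous_on_compose2[OF \<gamma>]) (use that in \<open>auto intro!: continuous_intros elim: continuous_on_subset\<close>)
  have "continuous_on (Q \<inter> C) (\<lambda>x. (\<lambda>(v, \<mu>, \<mu>'). T v \<mu> \<mu>') (g' x, \<gamma> (x, a x), \<gamma> (x, a' x)))"
    by (rule continuous_on_compose2[OF U(2)])
      (use CU g'(2) in \<open>auto intro!: continuous_on_Pair cg a a' continuous_on_subset[OF g'(1)]\<close>)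
  then have ct: "continuous_on (Q \<inter> C) ?t" by simp
  have "continuous_on (Q \<inter> C \<union> Q \<inter> D) (\<lambda>x. if x \<in> C then ?t x else g' x)"
  proof (rule continuous_on_cases_local[OF _ _ ct])
    have Q: "Q \<inter> C \<union> Q \<inter> D = Q" using C(3) by blast
    show "closedin (top_of_set (Q \<inter> C \<union> Q \<inter> D)) (Q \<inter> C)" "closedin (top_of_set (Q \<inter> C \<union> Q \<inter> D)) (Q \<inter> D)"
      unfolding Q using C by (auto simp: closedin_closed_Int)
    show "continuous_on (Q \<inter> D) g'" by (rule continuous_on_subset[OF g'(1)]) auto
    fix x assume "x \<in> Q \<inter> C \<and> x \<notin> C \<or> x \<in> Q \<inter> D \<and> x \<in> C"
    then show "?t x = g' x" using CU[of x] Da[of x] U(3) g'(2)[of x] by auto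
  qed
  moreover have "Q \<inter> C \<union> Q \<inter> D = Q" using C(3) by blast
  ultimately have "continuous_on Q k" unfolding k_def[abs_def] by simp
  moreover have "k x \<in> fib (\<gamma> (x, a' x)) \<and> (g x \<in> A \<or> (\<forall>t\<in>{0..1}. \<gamma> (x, t) = \<gamma> (x, 0)) \<longrightarrow> k x = g x)" if x: "x \<in> Q" for x
  proof (cases "x \<in> C")
    case False
    then have "x \<in> D" using C(3) by blast
    then show ?thesis using False x g'(2,3)[OF x] Da[of x] by (auto simp: k_def)
  next
    case True
    note u = CU[of x] g'(2)[OF x]
    have "?t x \<in> fib (\<gamma> (x, a' x))" using u U(3) True x by blast
    moreover have "?t x = g x" if h: "g x \<in> A \<or> (\<forall>t\<in>{0..1}. \<gamma> (x, t) = \<gamma> (x, 0))"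
    proof -
      have e: "g' x = g x" by (rule g'(3)[OF x h])
      show ?thesis using h
      proof
        assume "g x \<in> A" then show ?thesis using u U(3) True x e by (metis IntI)
      next
        assume "\<forall>t\<in>{0..1}. \<gamma> (x, t) = \<gamma> (x, 0)"
        then have "\<gamma> (x, a x) = \<gamma> (x, a' x)" using a(2) a'(2) x by (metis imageI subsetD)
        then show ?thesis using u U(3) True x e by (metis IntI)
      qed
    qed
    ultimately show ?thesis using True by (simp add: k_def)
  qed
  ultimately show ?thesis unfolding transported_def using a' by blast
qed

lemma transport:
  fixes Q :: "'q::metric_space set" and \<gamma> :: "'q \<times> real \<Rightarrow> 'm"
  assumes Q: "compact Q" and \<gamma>: "continuous_on (Q \<times> {0..1}) \<gamma>" "\<gamma> ` (Q \<times> {0..1}) \<subseteq> B"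
    and g: "continuous_on Q g" "\<And>x. x \<in> Q \<Longrightarrow> g x \<in> fib (\<gamma> (x, 0))"
  obtains g' where "continuous_on Q g'" "\<And>x. x \<in> Q \<Longrightarrow> g' x \<in> fib (\<gamma> (x, 1))"
    "\<And>x. x \<in> Q \<Longrightarrow> g x \<in> A \<Longrightarrow> g' x = g x"
    "\<And>x. x \<in> Q \<Longrightarrow> \<forall>t\<in>{0..1}. \<gamma> (x, t) = \<gamma> (x, 0) \<Longrightarrow> g' x = g x"
proof -
  let ?K = "Q \<times> {0..1::real}"
  define G where "G = {V. open V \<and> (\<exists>U T. slice fib A U T \<and> \<gamma> ` (V \<inter> ?K) \<subseteq> U)}"
  have "?K \<subseteq> \<Union>G"
  proof
    fix y assume y: "y \<in> ?K"
    then have "\<gamma> y \<in> B" using \<gamma>(2) by blast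
    then obtain U T where U: "slice fib A U T" "\<gamma> y \<in> U" using slices by blast
    then obtain V where "open V" "V \<inter> ?K = \<gamma> -` U \<inter> ?K"
      using \<gamma>(1) unfolding continuous_on_open_invariant slice_def by (metis Int_commute)
    then have "V \<in> G" "y \<in> V" using U y by (auto simp: G_def)
    then show "y \<in> \<Union>G" by blast
  qed
  moreover have "compact ?K" by (intro compact_Times Q) auto
  ultimately obtain e where e: "e > 0" "\<And>y. y \<in> ?K \<Longrightarrow> \<exists>V\<in>G. ball y e \<subseteq> V"
    using Heine_Borel_lemma[of ?K G] unfolding G_def by blast
  \<comment> \<open>e is a Lebesgue number: a ball of radius e / 2 in Q times a time interval of
    length 1 / n is mapped into the domain of one slice.\<close>
  obtain n :: nat where n: "n > 0" "1 / real n < e / 2" using e(1) by (metis half_gt_zero nat_approx_posE zero_less_Suc)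
  obtain F where F: "finite F" "F \<subseteq> Q" "Q \<subseteq> (\<Union>c\<in>F. ball c (e/4))"
    using compactE_image[OF Q, of Q "\<lambda>c. ball c (e/4)"] e(1) by (metis UN_I centre_in_ball open_ball subsetI zero_less_divide_iff zero_less_numeral)
  \<comment> \<open>Equal to 1 within e / 4 of c, where the finite cover is to be completed, and to
    0 beyond e / 2, where points must not move.\<close>
  define \<beta> where "\<beta> c x = max 0 (min 1 (2 - dist x c * (4 / e)))" for c x :: 'q
  have \<beta>: "0 \<le> \<beta> c x" "\<beta> c x \<le> 1" "dist x c \<ge> e / 2 \<Longrightarrow> \<beta> c x = 0" "dist x c \<le> e / 4 \<Longrightarrow> \<beta> c x = 1" for c x
    using e(1) by (auto simp: \<beta>_def field_simps)
  have slab: "transported Q \<gamma> g (\<lambda>_. real (Suc k) / n)" if k: "k < n" and t: "transported Q \<gamma> g (\<lambda>_. real k / n)" for k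
  proof -
    have k01: "0 \<le> real k / n" "real k / n \<le> 1" "real (Suc k) / n \<le> 1" "real (Suc k) / n = real k / n + 1 / n" using k by (auto simp: field_simps)
    have st: "\<exists>a. transported Q \<gamma> g a \<and> (\<forall>x. real k / n \<le> a x \<and> a x \<le> real (Suc k) / n \<and> (\<forall>c\<in>F'. dist x c \<le> e / 4 \<longrightarrow> a x = real (Suc k) / n))"
      if "F' \<subseteq> F" for F'
      using finite_subset[OF that F(1)] that
    proof (induction F' rule: finite_induct)
      case empty
      show ?case by (rule exI[of _ "\<lambda>_. real k / n"]) (use t k01 in auto)
    next
      case (insert c F')
      then obtain a where a: "transported Q \<gamma> g a" "\<And>x. real k / n \<le> a x" "\<And>x. a x \<le> real (Suc k) / n"
        "\<And>x c. c \<in> F' \<Longrightarrow> dist x c \<le> e / 4 \<Longrightarrow> a x = real (Suc k) / n" by blast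
      \<comment> \<open>The maximum never lowers points that earlier balls have already raised to
        the top of the slab.\<close>
      define a' where "a' x = max (a x) (real k / n + \<beta> c x / n)" for x
      have a'b: "real k / n \<le> a' x" "a' x \<le> real (Suc k) / n" "a x \<le> a' x" for x
        using a(2,3)[of x] \<beta>[of c x] n k01 by (auto simp: a'_def divide_right_mono)
      have "(c, real k / n) \<in> ?K" using insert.prems F(2) k01 by auto
      then obtain V where "V \<in> G" "ball (c, real k / n) e \<subseteq> V" using e(2) by blast
      then obtain U T where V: "ball (c, real k / n) e \<subseteq> V" "slice fib A U T" "\<gamma> ` (V \<inter> ?K) \<subseteq> U" unfolding G_def by blast
      have inU: "\<gamma> (x, s) \<in> U" if "x \<in> Q" "dist x c \<le> e / 2" "real k / n \<le> s" "s \<le> real (Suc k) / n" for x s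
      proof -
        have "dist (c, real k / n) (x, s) \<le> dist c x + dist (real k / n) s"
          unfolding dist_Pair_Pair by (rule sqrt_sum_squares_le_sum) auto
        also have "\<dots> < e" using that n k01 by (simp add: dist_commute dist_real_def)
        finally have "(x, s) \<in> V" using V(1) by auto
        moreover have "0 \<le> s" "s \<le> 1" using that(3,4) k01(1,3) by linarith+
        ultimately have "(x, s) \<in> V \<inter> ?K" using that(1) by auto
        then show ?thesis using V(3) by blast
      qed
      have "transported Q \<gamma> g a'"
      proof (rule transported_step[OF a(1) \<gamma>(1), where C = "cball c (e/2)" and D = "- ball c (e/2)"])
        have "continuous_on Q a" using a(1) by (simp add: transported_def)
        then show "continuous_on Q a'" unfolding a'_def[abs_def] \<beta>_def using n(1) e(1) by (intro continuous_intros) auto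
        show "a' ` Q \<subseteq> {0..1}" using order_trans[OF k01(1) a'b(1)] order_trans[OF a'b(2) k01(3)] by auto
        show "slice fib A U T" by (rule V(2))
        show "\<gamma> (x, a x) \<in> U \<and> \<gamma> (x, a' x) \<in> U" if "x \<in> Q \<inter> cball c (e / 2)" for x
          using that a a'b by (auto intro!: inU simp: dist_commute)
        show "a' x = a x" if "x \<in> Q \<inter> - ball c (e / 2)" for x
          using that \<beta>(3)[of x c] a(2)[of x] by (auto simp: a'_def dist_commute)
      qed auto
      moreover have "a' x = real (Suc k) / n" if "c' \<in> insert c F'" "dist x c' \<le> e / 4" for x c'
      proof (cases "c' \<in> F'")
        case True then show ?thesis using a(4) that a'b[of x] by (metis antisym)
      next
        case False then show ?thesis using that \<beta>(4)[of x c] a(3)[of x] k01(4) by (auto simp: a'_def)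
      qed
      ultimately show ?case using a'b by blast
    qed
    obtain a where a: "transported Q \<gamma> g a"
      "\<forall>x. real k / n \<le> a x \<and> a x \<le> real (Suc k) / n \<and> (\<forall>c\<in>F. dist x c \<le> e / 4 \<longrightarrow> a x = real (Suc k) / n)"
      using st[OF order_refl] by (elim exE conjE) (rule that)
    have "a x = real (Suc k) / n" if xQ: "x \<in> Q" for x
    proof -
      obtain c where "c \<in> F" "x \<in> ball c (e/4)" using F(3) xQ by blast
      then have "c \<in> F" "dist x c \<le> e / 4" by (auto simp: dist_commute)
      then show ?thesis using a(2) by blast
    qed
    then show ?thesis using a(1) unfolding transported_def by (auto cong: continuous_on_cong)
  qed
  have "k \<le> n \<Longrightarrow> transported Q \<gamma> g (\<lambda>_. real k / n)" for k
  proof (induction k)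
    case 0
    show ?case unfolding transported_def using g by auto
  next
    case (Suc k)
    then show ?case by (intro slab) auto
  qed
  from this[of n] have "transported Q \<gamma> g (\<lambda>_. 1)" using n by simp
  then show thesis unfolding transported_def using that by blast
qed

end

text \<open>X is a union of strata, so a transport that preserves strata of Y restricts to
  X.\<close>

lemma (in projective_stratification) pencil_local_slices:
  fixes a b :: "complex^'n"
  assumes ab: "a \<noteq> b" "vec.independent {a, b}"
    and X: "\<T> \<subseteq> \<S>" "X = Y - \<Union>\<T>" and \<Lambda>: "\<forall>\<mu>. \<not> transverse_to_strata (pencil a b \<mu>) \<S> \<longrightarrow> \<mu> \<in> \<Lambda>"
  shows "local_slices (\<lambda>\<mu>. cone (X \<inter> pencil a b \<mu>)) (cone (pencil_axis a b)) (- \<Lambda>)"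
proof
  fix \<mu>1 assume "\<mu>1 \<in> - \<Lambda>"
  then have tr: "transverse_to_strata (pencil a b \<mu>1) \<S>" using \<Lambda> by blast
  let ?E = "\<lambda>U. {(v, \<mu>, \<mu>'). v \<in> cone (Y \<inter> pencil a b \<mu>) \<and> \<mu> \<in> U \<and> \<mu>' \<in> U}"
  obtain U Tr where U: "open U" "\<mu>1 \<in> U" and T: "continuous_on (?E U) (\<lambda>(v, \<mu>, \<mu>'). Tr v \<mu> \<mu>')"
    "\<And>v \<mu> \<mu>' S. (v, \<mu>, \<mu>') \<in> ?E U \<Longrightarrow> S \<in> \<S> \<Longrightarrow> v \<in> cone S \<Longrightarrow> Tr v \<mu> \<mu>' \<in> cone S"
    "\<And>v \<mu> \<mu>'. (v, \<mu>, \<mu>') \<in> ?E U \<Longrightarrow> proj (Tr v \<mu> \<mu>') \<in> pencil a b \<mu>'"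
    "\<And>v \<mu>. (v, \<mu>, \<mu>) \<in> ?E U \<Longrightarrow> Tr v \<mu> \<mu> = v"
    "\<And>v \<mu> \<mu>'. (v, \<mu>, \<mu>') \<in> ?E U \<Longrightarrow> proj v \<in> pencil_axis a b \<Longrightarrow> Tr v \<mu> \<mu>' = v"
    by (rule pencil_slicing[OF ab tr]) (rule that)
  have sub: "cone (X \<inter> pencil a b \<mu>) \<subseteq> cone (Y \<inter> pencil a b \<mu>)" for \<mu> using X(2) by (auto simp: cone_def)
  have "Tr v \<mu> \<mu>' \<in> cone (X \<inter> pencil a b \<mu>')" if v: "v \<in> cone (X \<inter> pencil a b \<mu>)" and \<mu>: "\<mu> \<in> U" "\<mu>' \<in> U" for v \<mu> \<mu>'
  proof -
    have e: "(v, \<mu>, \<mu>') \<in> ?E U" using v \<mu> sub by auto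
    obtain S where S: "S \<in> \<S>" "v \<in> cone S" using v X(2) cone_Y_strata by (auto simp: cone_def)
    have "S \<subseteq> X"
    proof
      fix p assume p: "p \<in> S"
      have "R = S" if "R \<in> \<T>" "p \<in> R" for R using strata_disj[of R S] that p S X(1) by blast
      moreover have "S \<notin> \<T>" using S(2) v X(2) by (auto simp: cone_def)
      ultimately show "p \<in> X" using p S(1) X(2) strata_union by blast
    qed
    then show ?thesis using T(2)[OF e S] T(3)[OF e] by (auto simp: cone_def)
  qed
  moreover have "continuous_on {(v, \<mu>, \<mu>'). v \<in> cone (X \<inter> pencil a b \<mu>) \<and> \<mu> \<in> U \<and> \<mu>' \<in> U} (\<lambda>(v, \<mu>, \<mu>'). Tr v \<mu> \<mu>')"
    by (rule continuous_on_subset[OF T(1)]) (use sub in auto)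
  moreover have "Tr v \<mu> \<mu> = v" "v \<in> cone (pencil_axis a b) \<Longrightarrow> Tr v \<mu> \<mu>' = v"
    if "v \<in> cone (X \<inter> pencil a b \<mu>)" "\<mu> \<in> U" "\<mu>' \<in> U" for v \<mu> \<mu>'
    using T(4)[of v \<mu>] T(5)[of v \<mu> \<mu>'] that sub by (auto simp: cone_def)
  ultimately have "slice (\<lambda>\<mu>. cone (X \<inter> pencil a b \<mu>)) (cone (pencil_axis a b)) U Tr"
    using U(1) unfolding slice_def by blast
  then show "\<exists>U T. \<mu>1 \<in> U \<and> slice (\<lambda>\<mu>. cone (X \<inter> pencil a b \<mu>)) (cone (pencil_axis a b)) U T" using U(2) by blast
qed

section \<open>Lifting cells to the cone\<close>

text \<open>Transport in the tautological line bundle is homotopy lifting.\<close>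

lemma line_slices: "local_slices (\<lambda>\<mu> :: 'n::finite cproj. cone {\<mu>}) {} UNIV"
proof
  fix \<mu>1 :: "'n cproj"
  obtain w where w: "w \<noteq> 0" "\<mu>1 = proj w" by (rule proj_surj)
  define l where "l = lform (\<chi> i. cnj (w $ i))"
  have lw: "l w \<noteq> 0"
  proof -
    have "l w = (\<Sum>i\<in>UNIV. of_real ((cmod (w $ i))\<^sup>2))"
      unfolding l_def lform_def complex_norm_square by (simp add: mult.commute)
    moreover have "(\<Sum>i\<in>UNIV. (cmod (w $ i))\<^sup>2) \<noteq> 0" using w(1) by (auto simp: sum_nonneg_eq_0_iff vec_eq_iff)
    ultimately show ?thesis by (metis of_real_sum of_real_eq_0_iff)
  qed
  have ls: "l (c *s v) = c * l v" for c v by (simp add: l_def lform_scale)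
  define rep where "rep \<mu> = (SOME v. v \<noteq> 0 \<and> proj v = \<mu>)" for \<mu> :: "'n cproj"
  have rep: "rep \<mu> \<noteq> 0" "proj (rep \<mu>) = \<mu>" for \<mu>
    using someI_ex[of "\<lambda>v. v \<noteq> 0 \<and> proj v = \<mu>"] proj_surj[of \<mu>] by (auto simp: rep_def)
  \<comment> \<open>The section of the line bundle on which l takes the value 1; transport keeps the
    value of l.\<close>
  define \<sigma> where "\<sigma> \<mu> = (1 / l (rep \<mu>)) *s rep \<mu>" for \<mu>
  define U where "U = {\<mu>. l (rep \<mu>) \<noteq> 0}"
  have rp: "\<exists>c. c \<noteq> 0 \<and> rep (proj v) = c *s v" if "v \<noteq> 0" for v
    using proj_eq_iff[OF that rep(1)] rep(2) by metis
  have \<sigma>p: "\<sigma> (proj v) = (1 / l v) *s v" "proj v \<in> U \<longleftrightarrow> l v \<noteq> 0" if "v \<noteq> 0" for v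
    using rp[OF that] by (auto simp: \<sigma>_def U_def ls)
  have l0: "l 0 = 0" using ls[of 0 0] by simp
  have coneU: "cone U = {v. l v \<noteq> 0}"
  proof -
    have "v \<noteq> 0" if "l v \<noteq> 0" for v using that l0 by auto
    then show ?thesis by (auto simp: cone_def \<sigma>p)
  qed
  have cl: "continuous_on S l" for S unfolding l_def by (rule linear_continuous_on[OF bounded_linear_lform])
  have "open {v. l v \<noteq> 0}" by (intro open_Collect_neq cl continuous_intros)
  then have oU: "open U" using coneU by (simp add: open_cproj_def cone_def)
  have "continuous_on (cone U) (\<lambda>v. (1 / l v) *s v)"
    unfolding coneU by (intro bounded_bilinear.continuous_on[OF bounded_bilinear_vec_scale] continuous_intros cl) auto
  then have c\<sigma>: "continuous_on U \<sigma>"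
    by (intro continuous_on_cproj[OF oU]) (auto simp: \<sigma>p cone_def cong: continuous_on_cong_simp)
  have "slice (\<lambda>\<mu>. cone {\<mu>}) {} U (\<lambda>v \<mu> \<mu>'. l v *s \<sigma> \<mu>')"
    unfolding slice_def case_prod_beta
  proof (intro conjI oU ballI)
    show "continuous_on {x. fst x \<in> cone {fst (snd x)} \<and> fst (snd x) \<in> U \<and> snd (snd x) \<in> U} (\<lambda>x. l (fst x) *s \<sigma> (snd (snd x)))"
      by (intro bounded_bilinear.continuous_on[OF bounded_bilinear_vec_scale] continuous_on_compose2[OF c\<sigma>] continuous_on_compose2[OF cl[of UNIV]])
        (auto intro!: continuous_intros)
    fix \<mu> \<mu>' v assume "\<mu> \<in> U" "\<mu>' \<in> U" and v: "v \<in> cone {\<mu>}"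
    then have v0: "v \<noteq> 0" "\<mu> = proj v" "l v \<noteq> 0" using \<sigma>p(2)[of v] by (auto simp: cone_def)
    show "l v *s \<sigma> \<mu> = v" unfolding v0(2) using v0 by (simp add: \<sigma>p vec_eq_iff)
    have m: "l (rep \<mu>') \<noteq> 0" using \<open>\<mu>' \<in> U\<close> by (simp add: U_def)
    have "l v *s \<sigma> \<mu>' = (l v / l (rep \<mu>')) *s rep \<mu>'" by (simp add: \<sigma>_def)
    moreover have "(l v / l (rep \<mu>')) *s rep \<mu>' \<in> cone {\<mu>'}" using v0 m rep[of \<mu>'] by (subst cone_scale) (auto simp: cone_def)
    ultimately show "l v *s \<sigma> \<mu>' \<in> cone {\<mu>'}" by simp
  qed simp
  moreover have "\<mu>1 \<in> U" using lw \<sigma>p(2)[OF w(1)] w(2) by simp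
  ultimately show "\<exists>U T. \<mu>1 \<in> U \<and> slice (\<lambda>\<mu>. cone {\<mu>}) {} U T" by blast
qed

lemma lift_homotopy:
  fixes Q :: "'q::metric_space set" and H :: "'q \<times> real \<Rightarrow> 'n::finite cproj"
  assumes "compact Q" "continuous_on (Q \<times> {0..1}) H" "continuous_on Q g" "\<And>x. x \<in> Q \<Longrightarrow> g x \<noteq> 0 \<and> proj (g x) = H (x, 0)"
  obtains g' where "continuous_on Q g'" "\<And>x. x \<in> Q \<Longrightarrow> g' x \<noteq> 0 \<and> proj (g' x) = H (x, 1)"
proof -
  interpret L: local_slices "\<lambda>\<mu> :: 'n cproj. cone {\<mu>}" "{}" UNIV by (rule line_slices)
  obtain g' where g': "continuous_on Q g'" "\<And>x. x \<in> Q \<Longrightarrow> g' x \<in> cone {H (x, 1)}"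
    by (rule L.transport[OF assms(1,2) _ assms(3)]) (use assms(4) in \<open>auto simp: cone_def\<close>)
  then show thesis using that by (auto simp: cone_def)
qed

text \<open>Coordinates outside 1..q are frozen at 0, so the cube is a product of compact sets in
  the full function space.\<close>

lemma cube_eq: "cube q = Pi\<^sub>E UNIV (\<lambda>i. if i \<in> {1..q} then {0..1} else {0})"
  by (auto simp: cube_def PiE_def Pi_def split: if_splits)

lemma compact_cube: "compact (cube q)"
proof -
  have "compactin (product_topology (\<lambda>_. euclidean :: real topology) UNIV) (cube q)"
    unfolding cube_eq compactin_PiE by auto
  then show ?thesis by (simp add: euclidean_product_topology)
qed

text \<open>Scaling contracts the cube to the origin; the lift starts from the constant map there
  and follows the scaling back.\<close>

lemma lift_cube:
  fixes f :: "(nat \<Rightarrow> real) \<Rightarrow> 'n::finite cproj"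
  assumes "continuous_on (cube q) f"
  obtains g where "continuous_on (cube q) g" "\<And>x. x \<in> cube q \<Longrightarrow> g x \<noteq> 0 \<and> proj (g x) = f x"
proof -
  obtain v where v: "v \<noteq> 0" "f (\<lambda>_. 0) = proj v" by (rule proj_surj)
  have sc: "(\<lambda>i. t * x i) \<in> cube q" if "x \<in> cube q" "t \<in> {0..1}" for x and t :: real
    using that by (auto simp: cube_def mult_le_one)
  have "continuous_on (cube q \<times> {0..1}) (\<lambda>y i. snd y * fst y i)"
    by (intro continuous_on_coordinatewise_then_product continuous_on_mult continuous_on_snd continuous_on_id
        continuous_on_compose2[OF continuous_on_product_coordinates continuous_on_fst[OF continuous_on_id]]) simp
  then have "continuous_on (cube q \<times> {0..1}) (\<lambda>y. f (\<lambda>i. snd y * fst y i))"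
    by (rule continuous_on_compose2[OF assms]) (use sc in auto)
  then show thesis
    by (rule lift_homotopy[OF compact_cube, where g = "\<lambda>_. v"]) (use v that in auto)
qed

text \<open>The deformation parameter runs over \<open>[0, 3]\<close>. Starting at \<open>\<Theta> (f x) (1 - u)\<close>, at \<open>f x\<close>, or at
  \<open>\<Theta>' (f x) (u - 2)\<close> on the three unit intervals, a point is transported along the rest of \<open>\<omega>\<close>, along an intermediate
  loop of the homotopy, or along the rest of \<open>\<omega>'\<close>, respectively. At \<open>u = 0\<close> and \<open>u = 3\<close> nothing is left to transport.\<close>

lemma (in projective_stratification) monodromy_homotopy:
  fixes a b :: "complex^'n" and f :: "(nat \<Rightarrow> real) \<Rightarrow> 'n cproj" and \<Theta> \<Theta>' :: "'n cproj \<Rightarrow> real \<Rightarrow> 'n cproj"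
  assumes ab: "a \<noteq> b" "vec.independent {a, b}"
    and X: "\<T> \<subseteq> \<S>" "X = Y - \<Union>\<T>" and \<Lambda>: "\<forall>\<mu>. \<not> transverse_to_strata (pencil a b \<mu>) \<S> \<longrightarrow> \<mu> \<in> \<Lambda>"
    and f: "continuous_on (cube q) f" "f ` cube q \<subseteq> LX" and LX: "LX = pencil a b \<mu>0 \<inter> X"
    and \<omega>: "homotopic_paths (UNIV - \<Lambda>) \<omega> \<omega>'" "\<omega> 0 = \<mu>0" "\<omega> 1 = \<mu>0"
    and \<Theta>: "continuous_on (LX \<times> {0..1}) (\<lambda>(x, t). \<Theta> x t)"
      "\<And>x t. x \<in> LX \<Longrightarrow> t \<in> {0..1} \<Longrightarrow> \<Theta> x t \<in> X \<inter> pencil a b (\<omega> t)" "\<And>x. x \<in> LX \<Longrightarrow> \<Theta> x 0 = x"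
      "\<And>x t. x \<in> pencil_axis a b \<inter> X \<Longrightarrow> t \<in> {0..1} \<Longrightarrow> \<Theta> x t = x"
    and \<Theta>': "continuous_on (LX \<times> {0..1}) (\<lambda>(x, t). \<Theta>' x t)"
      "\<And>x t. x \<in> LX \<Longrightarrow> t \<in> {0..1} \<Longrightarrow> \<Theta>' x t \<in> X \<inter> pencil a b (\<omega>' t)" "\<And>x. x \<in> LX \<Longrightarrow> \<Theta>' x 0 = x"
      "\<And>x t. x \<in> pencil_axis a b \<inter> X \<Longrightarrow> t \<in> {0..1} \<Longrightarrow> \<Theta>' x t = x"
  obtains G :: "real \<times> (nat \<Rightarrow> real) \<Rightarrow> 'n cproj" where "continuous_on ({0..1} \<times> cube q) G" "G ` ({0..1} \<times> cube q) \<subseteq> LX"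
    "\<And>x. x \<in> cube q \<Longrightarrow> G (0, x) = \<Theta> (f x) 1" "\<And>x. x \<in> cube q \<Longrightarrow> G (1, x) = \<Theta>' (f x) 1"
    "\<And>x t. x \<in> cube q \<Longrightarrow> t \<in> {0..1} \<Longrightarrow> f x \<in> pencil_axis a b \<Longrightarrow> G (t, x) = f x"
proof -
  interpret LS: local_slices "\<lambda>\<mu>. cone (X \<inter> pencil a b \<mu>)" "cone (pencil_axis a b)" "- \<Lambda>"
    by (rule pencil_local_slices[OF ab X \<Lambda>])
  obtain W where W: "continuous_on ({0..1} \<times> {0..1}) W" "W \<in> ({0..1} \<times> {0..1}) \<rightarrow> UNIV - \<Lambda>"
    "\<And>t. t \<in> {0..1} \<Longrightarrow> W (0, t) = \<omega> t" "\<And>t. t \<in> {0..1} \<Longrightarrow> W (1, t) = \<omega>' t"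
    "\<And>s. s \<in> {0..1::real} \<Longrightarrow> W (s, 0) = \<mu>0" "\<And>s. s \<in> {0..1} \<Longrightarrow> W (s, 1) = \<mu>0"
    using \<omega> unfolding homotopic_paths by (auto simp: pathstart_def pathfinish_def)
  have fLX: "f x \<in> LX" if "x \<in> cube q" for x using f(2) that by blast
  define Q where "Q = cube q \<times> {0..3::real}"
  have cQ: "compact Q" unfolding Q_def by (intro compact_Times compact_cube) auto
  \<comment> \<open>The maxima make both formulas equal to f x for u in [1, 2], so they can be
    joined at the midpoint 3/2.\<close>
  define K where "K y = (if snd y \<le> 3/2 then \<Theta> (f (fst y)) (max 0 (1 - snd y)) else \<Theta>' (f (fst y)) (max 0 (snd y - 2)))" for y :: "(nat \<Rightarrow> real) \<times> real"
  have cK: "continuous_on Q K" unfolding K_def[abs_def]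
  proof (rule continuous_on_cases_le)
    have 1: "continuous_on {x \<in> Q. snd x \<le> 3/2} (\<lambda>y. (f (fst y), max 0 (1 - snd y)))"
      by (intro continuous_on_Pair continuous_on_compose2[OF f(1)] continuous_intros) (auto simp: Q_def)
    show "continuous_on {x \<in> Q. snd x \<le> 3/2} (\<lambda>y. \<Theta> (f (fst y)) (max 0 (1 - snd y)))"
      using continuous_on_compose2[OF \<Theta>(1) 1, unfolded case_prod_conv] fLX by (fastforce simp: Q_def)
    have 2: "continuous_on {x \<in> Q. 3/2 \<le> snd x} (\<lambda>y. (f (fst y), max 0 (snd y - 2)))"
      by (intro continuous_on_Pair continuous_on_compose2[OF f(1)] continuous_intros) (auto simp: Q_def)
    show "continuous_on {x \<in> Q. 3/2 \<le> snd x} (\<lambda>y. \<Theta>' (f (fst y)) (max 0 (snd y - 2)))"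
      using continuous_on_compose2[OF \<Theta>'(1) 2, unfolded case_prod_conv] fLX by (fastforce simp: Q_def)
    show "continuous_on Q snd" by (intro continuous_intros)
  qed (use \<Theta>(3) \<Theta>'(3) fLX in \<open>auto simp: Q_def\<close>)
  obtain g0 where g0: "continuous_on (cube q) g0" "\<And>x. x \<in> cube q \<Longrightarrow> g0 x \<noteq> 0 \<and> proj (g0 x) = f x"
    using lift_cube[OF f(1)] by blast
  \<comment> \<open>A lift of K is found by moving u away from 3/2, where K is f and g0 is a
    lift.\<close>
  obtain g where g: "continuous_on Q g" "\<And>y. y \<in> Q \<Longrightarrow> g y \<noteq> 0 \<and> proj (g y) = K y"
  proof (rule lift_homotopy[OF cQ, where g = "\<lambda>y. g0 (fst y)" and H = "\<lambda>(y, t). K (fst y, 3/2 + t * (snd y - 3/2))"])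
    have "3/2 + t * (u - 3/2) \<in> {0..3}" if "u \<in> {0..3}" "t \<in> {0..1}" for t u :: real
    proof -
      have "3/2 + t * (u - 3/2) = (1 - t) *\<^sub>R (3/2) + t *\<^sub>R u" by (simp add: field_simps)
      also have "\<dots> \<in> {0..3}" by (rule convexD_alt) (use that in \<open>auto simp: convex_real_interval\<close>)
      finally show ?thesis .
    qed
    then show "continuous_on (Q \<times> {0..1}) (\<lambda>(y, t). K (fst y, 3/2 + t * (snd y - 3/2)))"
      unfolding case_prod_beta by (intro continuous_on_compose2[OF cK] continuous_intros) (auto simp: Q_def)
    show "continuous_on Q (\<lambda>y. g0 (fst y))"
      by (intro continuous_on_compose2[OF g0(1)] continuous_intros) (auto simp: Q_def)
    show "g0 (fst y) \<noteq> 0 \<and> proj (g0 (fst y)) = (case (y, 0) of (y, t) \<Rightarrow> K (fst y, 3/2 + t * (snd y - 3/2)))" if "y \<in> Q" for y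
      using g0(2)[of "fst y"] \<Theta>(3)[OF fLX[of "fst y"]] that by (auto simp: K_def Q_def)
  qed (use that in auto)
  \<comment> \<open>The time on the loop that the given isotopy has already covered. In \<gamma> the
    remaining time is run through, over the loop of index u - 1 clipped to [0, 1]; so the transport
    always ends over \<mu>0.\<close>
  define \<sigma> where "\<sigma> u = max 0 (max (1 - u) (u - 2))" for u :: real
  define \<gamma> where "\<gamma> = (\<lambda>(y :: (nat \<Rightarrow> real) \<times> real, t). W (min 1 (max 0 (snd y - 1)), \<sigma> (snd y) + t * (1 - \<sigma> (snd y))))"
  have \<sigma>: "\<sigma> u \<in> {0..1}" "\<sigma> u + t * (1 - \<sigma> u) \<in> {0..1}" if "u \<in> {0..3}" "t \<in> {0..1}" for u t
  proof -
    show 1: "\<sigma> u \<in> {0..1}" using that by (auto simp: \<sigma>_def)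
    have "0 \<le> t * (1 - \<sigma> u)" using 1 that by simp
    moreover have "t * (1 - \<sigma> u) \<le> 1 * (1 - \<sigma> u)" using 1 that by (intro mult_right_mono) auto
    ultimately show "\<sigma> u + t * (1 - \<sigma> u) \<in> {0..1}" using 1 by auto
  qed
  have mem: "(min 1 (max 0 (snd y - 1)), \<sigma> (snd y) + t * (1 - \<sigma> (snd y))) \<in> {0..1} \<times> {0..1}" if "y \<in> Q" "t \<in> {0..1}" for y t
    using \<sigma>(2)[of "snd y" t] that by (auto simp: Q_def)
  have KX: "K y \<in> X \<inter> pencil a b (\<gamma> (y, 0))" if y: "y \<in> Q" for y
  proof -
    obtain x u where xu: "y = (x, u)" "x \<in> cube q" "u \<in> {0..3}" using y by (auto simp: Q_def)
    consider "u \<le> 1" | "1 \<le> u" "u \<le> 2" | "2 \<le> u" by linarith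
    then show ?thesis
    proof cases
      case 1
      then have "K y = \<Theta> (f x) (1 - u)" "\<gamma> (y, 0) = \<omega> (1 - u)" using xu W(3)[of "1 - u"] by (auto simp: K_def \<gamma>_def \<sigma>_def max_def)
      then show ?thesis using \<Theta>(2)[OF fLX[OF xu(2)], of "1 - u"] 1 xu by auto
    next
      case 2
      then have "K y = f x" "\<gamma> (y, 0) = \<mu>0" using xu W(5)[of "u - 1"] \<Theta>(3) \<Theta>'(3) fLX by (auto simp: K_def \<gamma>_def \<sigma>_def max_def)
      then show ?thesis using fLX[OF xu(2)] LX by auto
    next
      case 3
      then have "K y = \<Theta>' (f x) (u - 2)" "\<gamma> (y, 0) = \<omega>' (u - 2)" using xu W(4)[of "u - 2"] by (auto simp: K_def \<gamma>_def \<sigma>_def max_def)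
      then show ?thesis using \<Theta>'(2)[OF fLX[OF xu(2)], of "u - 2"] 3 xu by auto
    qed
  qed
  obtain g' where g': "continuous_on Q g'" "\<And>y. y \<in> Q \<Longrightarrow> g' y \<in> cone (X \<inter> pencil a b (\<gamma> (y, 1)))"
    "\<And>y. y \<in> Q \<Longrightarrow> g y \<in> cone (pencil_axis a b) \<Longrightarrow> g' y = g y"
    "\<And>y. y \<in> Q \<Longrightarrow> \<forall>t\<in>{0..1}. \<gamma> (y, t) = \<gamma> (y, 0) \<Longrightarrow> g' y = g y"
  proof (rule LS.transport[OF cQ _ _ g(1), of \<gamma>])
    show "continuous_on (Q \<times> {0..1}) \<gamma>" unfolding \<gamma>_def case_prod_beta \<sigma>_def
      by (intro continuous_on_compose2[OF W(1)] continuous_intros) (use mem in \<open>auto simp: \<sigma>_def\<close>)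
    show "\<gamma> ` (Q \<times> {0..1}) \<subseteq> - \<Lambda>" using W(2) mem by (fastforce simp: \<gamma>_def)
    show "g y \<in> cone (X \<inter> pencil a b (\<gamma> (y, 0)))" if "y \<in> Q" for y using g(2)[OF that] KX[OF that] by (simp add: cone_def)
  qed (rule that)
  have \<gamma>1: "\<gamma> (y, 1) = \<mu>0" for y using W(6) by (simp add: \<gamma>_def)
  have pg: "proj (g' y) \<in> LX" if "y \<in> Q" for y using g'(2)[OF that] by (auto simp: \<gamma>1 LX cone_def)
  have inQ: "(x, 3 * t) \<in> Q" if "x \<in> cube q" "t \<in> {0..1}" for x t using that by (auto simp: Q_def)
  show thesis
  proof (rule that[of "\<lambda>(t, x). proj (g' (x, 3 * t))"])
    have "continuous_on ({0..1} \<times> cube q) (\<lambda>y. g' (snd y, 3 * fst y))"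
      by (intro continuous_on_compose2[OF g'(1)] continuous_on_Pair continuous_on_snd continuous_on_id
          continuous_on_mult continuous_on_const continuous_on_fst) (auto intro!: inQ)
    then show "continuous_on ({0..1} \<times> cube q) (\<lambda>(t, x). proj (g' (x, 3 * t)))"
      unfolding case_prod_beta by (rule continuous_on_compose2[OF continuous_on_proj]) (use g'(2) inQ in \<open>fastforce simp: cone_def\<close>)
    show "(\<lambda>(t, x). proj (g' (x, 3 * t))) ` ({0..1} \<times> cube q) \<subseteq> LX" using pg inQ by auto
    fix x assume x: "x \<in> cube q"
    \<comment> \<open>At u = 0, and likewise at u = 3, \<sigma> is 1, the remaining path is constant
      and nothing moves.\<close>
    have "g' (x, 0) = g (x, 0)" by (rule g'(4)) (use x in \<open>auto simp: Q_def \<gamma>_def \<sigma>_def\<close>)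
    then show "(case (0, x) of (t, x) \<Rightarrow> proj (g' (x, 3 * t))) = \<Theta> (f x) 1" using g(2)[of "(x, 0)"] x by (simp add: Q_def K_def)
    have "g' (x, 3) = g (x, 3)" by (rule g'(4)) (use x in \<open>auto simp: Q_def \<gamma>_def \<sigma>_def\<close>)
    then show "(case (1, x) of (t, x) \<Rightarrow> proj (g' (x, 3 * t))) = \<Theta>' (f x) 1" using g(2)[of "(x, 3)"] x by (simp add: Q_def K_def)
    fix t :: real assume t: "t \<in> {0..1}" and fx: "f x \<in> pencil_axis a b"
    have "f x \<in> pencil_axis a b \<inter> X" using fx fLX[OF x] LX by auto
    then have "K (x, 3 * t) = f x" using t \<Theta>(4) \<Theta>'(4) by (auto simp: K_def)
    then have p: "g (x, 3 * t) \<noteq> 0" "proj (g (x, 3 * t)) = f x" using g(2)[OF inQ[OF x t]] by auto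
    then have "g' (x, 3 * t) = g (x, 3 * t)" using fx by (intro g'(3) inQ x t) (simp add: cone_def)
    then show "(case (t, x) of (t, x) \<Rightarrow> proj (g' (x, 3 * t))) = f x" using p by simp
  qed
qed

section \<open>Cells and their homotopies\<close>

lemma cube_upd: "x \<in> cube q \<Longrightarrow> i \<in> {1..q} \<Longrightarrow> 0 \<le> v \<Longrightarrow> v \<le> 1 \<Longrightarrow> x(i := v) \<in> cube q"
  by (auto simp: cube_def)

lemma cube_nth: "x \<in> cube q \<Longrightarrow> i \<in> {1..q} \<Longrightarrow> 0 \<le> x i \<and> x i \<le> 1"
  by (auto simp: cube_def)

lemma continuous_on_upd:
  fixes v :: "'s::topological_space \<Rightarrow> 'b::topological_space"
  assumes "continuous_on S f" "continuous_on S v"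
  shows "continuous_on S (\<lambda>y. (f y)(i := v y))"
proof (rule continuous_on_coordinatewise_then_product)
  fix j
  have "continuous_on S (\<lambda>y. f y j)" by (rule continuous_on_compose2[OF continuous_on_product_coordinates assms(1)]) simp
  then show "continuous_on S (\<lambda>y. ((f y)(i := v y)) j)" using assms(2) by (cases "j = i") auto
qed

lemma cube_half:
  assumes "x \<in> cube q" "i \<in> {1..q}"
  shows "x i \<le> 1/2 \<Longrightarrow> x(i := 2 * x i) \<in> cube q" "x i \<le> 1/2 \<Longrightarrow> x(i := 1 - 2 * x i) \<in> cube q"
    "\<not> x i \<le> 1/2 \<Longrightarrow> x(i := 2 * x i - 1) \<in> cube q"
  using cube_nth[OF assms] by (auto intro!: cube_upd[OF assms])

lemma rel_cellsD:
  assumes "f \<in> rel_cells q A B p" "x \<in> cube q"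
  shows "f x \<in> A" "x q = 0 \<Longrightarrow> f x \<in> B" "x q = 1 \<Longrightarrow> f x = p" "i \<in> {1..<q} \<Longrightarrow> x i = 0 \<or> x i = 1 \<Longrightarrow> f x = p"
  using assms unfolding rel_cells_def by blast+

lemma cellsD:
  assumes "f \<in> cells q A p" "x \<in> cube q"
  shows "f x \<in> A" "i \<in> {1..q} \<Longrightarrow> x i = 0 \<or> x i = 1 \<Longrightarrow> f x = p"
  using assms unfolding cells_def by blast+

text \<open>Common to both operations on cells, which differ in the coordinate i and in the
  substitutions; S carries the homotopy parameter.\<close>

lemma continuous_on_glue:
  fixes H K :: "'s::topological_space \<times> (nat \<Rightarrow> real) \<Rightarrow> 'a::topological_space"
  assumes i: "i \<in> {1..q}" and H: "continuous_on (S \<times> cube q) H" and K: "continuous_on (S \<times> cube q) K"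
    and c: "continuous_on UNIV \<phi>" "continuous_on UNIV \<psi>"
    and \<phi>: "\<And>u. 0 \<le> u \<Longrightarrow> u \<le> 1/2 \<Longrightarrow> \<phi> u \<in> {0..1}" and \<psi>: "\<And>u. 1/2 \<le> u \<Longrightarrow> u \<le> 1 \<Longrightarrow> \<psi> u \<in> {0..1}"
    and e: "\<And>s x. s \<in> S \<Longrightarrow> x \<in> cube q \<Longrightarrow> H (s, x(i := \<phi> (1/2))) = K (s, x(i := \<psi> (1/2)))"
  shows "continuous_on (S \<times> cube q) (\<lambda>(s, x). if x i \<le> 1/2 then H (s, x(i := \<phi> (x i))) else K (s, x(i := \<psi> (x i))))"
  unfolding case_prod_beta
proof (rule continuous_on_cases_le)
  have ci: "continuous_on T (\<lambda>y. snd y i)" for T :: "('s \<times> (nat \<Rightarrow> real)) set"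
    by (rule continuous_on_compose2[OF continuous_on_product_coordinates continuous_on_snd[OF continuous_on_id]]) simp
  show "continuous_on (S \<times> cube q) (\<lambda>y. snd y i)" by (rule ci)
  have u: "continuous_on T (\<lambda>y. (fst y, (snd y)(i := \<theta> (snd y i))))" if "continuous_on UNIV \<theta>" for T :: "('s \<times> (nat \<Rightarrow> real)) set" and \<theta>
    by (intro continuous_on_Pair continuous_on_upd continuous_on_fst continuous_on_snd continuous_on_id continuous_on_compose2[OF that ci]) auto
  show "continuous_on {y \<in> S \<times> cube q. snd y i \<le> 1/2} (\<lambda>y. H (fst y, (snd y)(i := \<phi> (snd y i))))"
  proof (rule continuous_on_compose2[OF H u[OF c(1)]])
    show "(\<lambda>y. (fst y, (snd y)(i := \<phi> (snd y i)))) ` {y \<in> S \<times> cube q. snd y i \<le> 1/2} \<subseteq> S \<times> cube q"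
      using cube_nth[OF _ i] cube_upd[OF _ i] \<phi> by fastforce
  qed
  show "continuous_on {y \<in> S \<times> cube q. 1/2 \<le> snd y i} (\<lambda>y. K (fst y, (snd y)(i := \<psi> (snd y i))))"
  proof (rule continuous_on_compose2[OF K u[OF c(2)]])
    show "(\<lambda>y. (fst y, (snd y)(i := \<psi> (snd y i)))) ` {y \<in> S \<times> cube q. 1/2 \<le> snd y i} \<subseteq> S \<times> cube q"
      using cube_nth[OF _ i] cube_upd[OF _ i] \<psi> by fastforce
  qed
  show "H (fst y, (snd y)(i := \<phi> (snd y i))) = K (fst y, (snd y)(i := \<psi> (snd y i)))" if "y \<in> S \<times> cube q" "snd y i = 1/2" for y
    unfolding that(2) using e[of "fst y" "snd y"] that(1) by auto
qed

lemma continuous_on_perp: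
  assumes "q \<ge> 1" "continuous_on (S \<times> cube q) (\<lambda>(s, x). H s x)" "continuous_on (S \<times> cube q) (\<lambda>(s, x). K s x)"
    "\<And>s x. s \<in> S \<Longrightarrow> x \<in> cube q \<Longrightarrow> x q = 0 \<Longrightarrow> H s x = K s x"
  shows "continuous_on (S \<times> cube q) (\<lambda>(s, x). perp q (H s) (K s) x)"
proof -
  have "H s (x(q := 0)) = K s (x(q := 0))" if "s \<in> S" "x \<in> cube q" for s x
    using that assms(1) by (intro assms(4) cube_upd) auto
  then have "continuous_on (S \<times> cube q) (\<lambda>(s, x). if x q \<le> 1/2 then H s (x(q := 1 - 2 * x q)) else K s (x(q := 2 * x q - 1)))"
    using continuous_on_glue[OF _ assms(2,3), of q "\<lambda>u. 1 - 2 * u" "\<lambda>u. 2 * u - 1", unfolded case_prod_conv] assms(1)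
    by (simp add: continuous_intros)
  then show ?thesis by (simp only: perp_def)
qed

lemma continuous_on_concat1:
  assumes "q \<ge> 1" "continuous_on (S \<times> cube q) (\<lambda>(s, x). H s x)" "continuous_on (S \<times> cube q) (\<lambda>(s, x). K s x)"
    "\<And>s x. s \<in> S \<Longrightarrow> x \<in> cube q \<Longrightarrow> H s (x(1 := 1)) = K s (x(1 := 0))"
  shows "continuous_on (S \<times> cube q) (\<lambda>(s, x). concat1 (H s) (K s) x)"
proof -
  have "continuous_on (S \<times> cube q) (\<lambda>(s, x). if x 1 \<le> 1/2 then H s (x(1 := 2 * x 1)) else K s (x(1 := 2 * x 1 - 1)))"
    using continuous_on_glue[OF _ assms(2,3), of 1 "\<lambda>u. 2 * u" "\<lambda>u. 2 * u - 1", unfolded case_prod_conv] assms(1,4)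
    by (simp add: continuous_intros)
  then show ?thesis by (simp only: concat1_def)
qed

text \<open>A single cell is a family over a one-point space, so continuity of the operations is
  proved for families only.\<close>

lemma continuous_on_cell_family: "continuous_on C f \<Longrightarrow> continuous_on ({0::real} \<times> C) (\<lambda>(s, x). f x)"
  unfolding case_prod_beta by (rule continuous_on_compose2[where g = f]) (auto intro: continuous_intros)

lemma continuous_on_cell_familyD: "continuous_on ({0::real} \<times> C) (\<lambda>(s, x). H s x) \<Longrightarrow> continuous_on C (H 0)"
proof -
  assume "continuous_on ({0::real} \<times> C) (\<lambda>(s, x). H s x)"
  moreover have "continuous_on C (\<lambda>x. (0::real, x))" by (intro continuous_on_Pair continuous_on_const continuous_on_id)
  ultimately have "continuous_on C (\<lambda>x. case (0, x) of (s, x) \<Rightarrow> H s x)" by (rule continuous_on_compose2) auto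
  then show ?thesis by simp
qed

text \<open>The faces x q = 0 and x q = 1 of the result come from the faces x q = 1 of f and g,
  which go to p; the faces x q = 0 meet in the middle, where f and g agree.\<close>

lemma perp_in_cells:
  assumes q: "q \<ge> 1" and f: "f \<in> rel_cells q A B p" and g: "g \<in> rel_cells q A B p"
    and e: "\<And>x. x \<in> cube q \<Longrightarrow> x q = 0 \<Longrightarrow> f x = g x"
  shows "perp q f g \<in> cells q A p"
proof -
  have "continuous_on ({0::real} \<times> cube q) (\<lambda>(s, x). perp q f g x)"
    using f g e by (intro continuous_on_perp q continuous_on_cell_family) (auto simp: rel_cells_def)
  then have c: "continuous_on (cube q) (perp q f g)" using continuous_on_cell_familyD[of "cube q" "\<lambda>_. perp q f g"] by simp
  have q': "q \<in> {1..q}" using q by simp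
  note up = cube_half(2)[OF _ q'] and dn = cube_half(3)[OF _ q']
  have "perp q f g x \<in> A" if "x \<in> cube q" for x
    using rel_cellsD(1)[OF f up[OF that]] rel_cellsD(1)[OF g dn[OF that]] by (auto simp: perp_def)
  moreover have "perp q f g x = p" if x: "x \<in> cube q" and i: "i \<in> {1..q}" "x i = 0 \<or> x i = 1" for x i
  proof (cases "i = q")
    case True
    then show ?thesis using rel_cellsD(3)[OF f up[OF x]] rel_cellsD(3)[OF g dn[OF x]] i by (auto simp: perp_def)
  next
    case False
    then have "i \<in> {1..<q}" "(x(q := u)) i = 0 \<or> (x(q := u)) i = 1" for u using i by auto
    then show ?thesis using rel_cellsD(4)[OF f up[OF x], of i] rel_cellsD(4)[OF g dn[OF x], of i] unfolding perp_def by presburger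
  qed
  ultimately show ?thesis using c unfolding cells_def by blast
qed

lemma concat1_in_rel_cells:
  assumes q: "q \<ge> 2" and f: "f \<in> rel_cells q A B p" and g: "g \<in> rel_cells q A B p"
  shows "concat1 f g \<in> rel_cells q A B p"
proof -
  have 1: "(1::nat) \<in> {1..<q}" "(1::nat) \<in> {1..q}" "q \<noteq> 1" using q by auto
  have face: "k (x(1 := u)) = p" if "k \<in> rel_cells q A B p" "x \<in> cube q" "u = 0 \<or> u = 1" for k x u
  proof -
    have "x(1 := u) \<in> cube q" using that 1 by (intro cube_upd) auto
    moreover have "(x(1 := u)) 1 = 0 \<or> (x(1 := u)) 1 = 1" using that(3) by simp
    ultimately show ?thesis using that(1) 1(1) unfolding rel_cells_def by blast
  qed
  have "continuous_on ({0::real} \<times> cube q) (\<lambda>(s, x). concat1 f g x)"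
    using f g q face[OF f] face[OF g] by (intro continuous_on_concat1 continuous_on_cell_family) (auto simp: rel_cells_def)
  then have c: "continuous_on (cube q) (concat1 f g)" using continuous_on_cell_familyD[of "cube q" "\<lambda>_. concat1 f g"] by simp
  note up = cube_half(1)[OF _ 1(2)] and dn = cube_half(3)[OF _ 1(2)]
  have "concat1 f g x \<in> A" if "x \<in> cube q" for x
    using rel_cellsD(1)[OF f up[OF that]] rel_cellsD(1)[OF g dn[OF that]] by (auto simp: concat1_def)
  moreover have "concat1 f g x \<in> B" if "x \<in> cube q" "x q = 0" for x
    using rel_cellsD(2)[OF f up[OF that(1)]] rel_cellsD(2)[OF g dn[OF that(1)]] that(2) 1(3) by (auto simp: concat1_def)
  moreover have "concat1 f g x = p" if "x \<in> cube q" "x q = 1" for x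
    using rel_cellsD(3)[OF f up[OF that(1)]] rel_cellsD(3)[OF g dn[OF that(1)]] that(2) 1(3) by (auto simp: concat1_def)
  moreover have "concat1 f g x = p" if x: "x \<in> cube q" and i: "i \<in> {1..<q}" "x i = 0 \<or> x i = 1" for x i
  proof (cases "i = 1")
    case True
    then show ?thesis using face[OF f x] face[OF g x] i by (auto simp: concat1_def)
  next
    case False
    then have "(x(1 := u)) i = 0 \<or> (x(1 := u)) i = 1" for u using i by simp
    then show ?thesis using rel_cellsD(4)[OF f up[OF x] i(1)] rel_cellsD(4)[OF g dn[OF x] i(1)] unfolding concat1_def by presburger
  qed
  ultimately show ?thesis using c unfolding rel_cells_def by blast
qed

lemma concat1_in_cells:
  assumes q: "q \<ge> 1" and f: "f \<in> cells q A p" and g: "g \<in> cells q A p"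
  shows "concat1 f g \<in> cells q A p"
proof -
  have 1: "(1::nat) \<in> {1..q}" using q by auto
  have face: "k (x(1 := u)) = p" if "k \<in> cells q A p" "x \<in> cube q" "u = 0 \<or> u = 1" for k x u
  proof -
    have "x(1 := u) \<in> cube q" using that 1 by (intro cube_upd) auto
    moreover have "(x(1 := u)) 1 = 0 \<or> (x(1 := u)) 1 = 1" using that(3) by simp
    ultimately show ?thesis using that(1) 1 unfolding cells_def by blast
  qed
  have "continuous_on ({0::real} \<times> cube q) (\<lambda>(s, x). concat1 f g x)"
    using f g q face[OF f] face[OF g] by (intro continuous_on_concat1 continuous_on_cell_family) (auto simp: cells_def)
  then have c: "continuous_on (cube q) (concat1 f g)" using continuous_on_cell_familyD[of "cube q" "\<lambda>_. concat1 f g"] by simp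
  note up = cube_half(1)[OF _ 1] and dn = cube_half(3)[OF _ 1]
  have "concat1 f g x \<in> A" if "x \<in> cube q" for x
    using cellsD(1)[OF f up[OF that]] cellsD(1)[OF g dn[OF that]] by (auto simp: concat1_def)
  moreover have "concat1 f g x = p" if x: "x \<in> cube q" and i: "i \<in> {1..q}" "x i = 0 \<or> x i = 1" for x i
  proof (cases "i = 1")
    case True
    then show ?thesis using face[OF f x] face[OF g x] i by (auto simp: concat1_def)
  next
    case False
    then have "(x(1 := u)) i = 0 \<or> (x(1 := u)) i = 1" for u using i by simp
    then show ?thesis using cellsD(2)[OF f up[OF x] i(1)] cellsD(2)[OF g dn[OF x] i(1)] unfolding concat1_def by presburger
  qed
  ultimately show ?thesis using c unfolding cells_def by blast
qed

lemma homotopic_cells_iff: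
  assumes "\<And>h k. (\<And>x. x \<in> C \<Longrightarrow> h x = k x) \<Longrightarrow> P h = P k" "\<And>h. P h \<Longrightarrow> h ` C \<subseteq> A"
  shows "homotopic_with_canon P C A f g \<longleftrightarrow>
    (\<exists>H. continuous_on ({0..1::real} \<times> C) (\<lambda>(t, x). H t x) \<and> (\<forall>x\<in>C. H 0 x = f x) \<and> (\<forall>x\<in>C. H 1 x = g x) \<and> (\<forall>t\<in>{0..1}. P (H t)))"
    (is "_ \<longleftrightarrow> ?R")
proof -
  have "homotopic_with_canon P C A f g \<longleftrightarrow> (\<exists>h. continuous_on ({0..1::real} \<times> C) h \<and> h \<in> ({0..1} \<times> C) \<rightarrow> A \<and>
     (\<forall>x\<in>C. h (0, x) = f x) \<and> (\<forall>x\<in>C. h (1, x) = g x) \<and> (\<forall>t\<in>{0..1}. P (\<lambda>x. h (t, x))))"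
  proof -
    have "homotopic_with_canon P C A f g \<longleftrightarrow> (\<exists>h. continuous_map (prod_topology (top_of_set {0..1::real}) (top_of_set C)) (top_of_set A) h \<and>
       (\<forall>x\<in>topspace (top_of_set C). h (0, x) = f x) \<and> (\<forall>x\<in>topspace (top_of_set C). h (1, x) = g x) \<and> (\<forall>t\<in>{0..1}. P (\<lambda>x. h (t, x))))"
      by (rule homotopic_with, rule assms(1)) simp
    then show ?thesis by (simp add: conj_assoc)
  qed
  also have "\<dots> \<longleftrightarrow> ?R"
  proof (intro iffI; elim exE conjE)
    fix h assume "continuous_on ({0..1} \<times> C) h" "\<forall>x\<in>C. h (0, x) = f x" "\<forall>x\<in>C. h (1, x) = g x" "\<forall>t\<in>{0..1::real}. P (\<lambda>x. h (t, x))"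
    then show ?R by (intro exI[of _ "\<lambda>t x. h (t, x)"]) auto
  next
    fix H assume "continuous_on ({0..1} \<times> C) (\<lambda>(t :: real, x). H t x)" "\<forall>x\<in>C. H 0 x = f x" "\<forall>x\<in>C. H 1 x = g x" "\<forall>t\<in>{0..1}. P (H t)"
    then show "\<exists>h. continuous_on ({0..1::real} \<times> C) h \<and> h \<in> ({0..1} \<times> C) \<rightarrow> A \<and>
     (\<forall>x\<in>C. h (0, x) = f x) \<and> (\<forall>x\<in>C. h (1, x) = g x) \<and> (\<forall>t\<in>{0..1}. P (\<lambda>x. h (t, x)))"
      using assms(2) by (intro exI[of _ "\<lambda>(t, x). H t x"]) fastforce
  qed
  finally show ?thesis .
qed

abbreviation rel_homotopic where
  "rel_homotopic q A B p \<equiv> homotopic_with_canon (\<lambda>k. k \<in> rel_cells q A B p) (cube q) A"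

abbreviation abs_homotopic where
  "abs_homotopic q A p \<equiv> homotopic_with_canon (\<lambda>k. k \<in> cells q A p) (cube q) A"

lemma rel_homotopic_iff:
  "rel_homotopic q A B p f g \<longleftrightarrow>
    (\<exists>H. continuous_on ({0..1::real} \<times> cube q) (\<lambda>(t, x). H t x) \<and> (\<forall>x\<in>cube q. H 0 x = f x) \<and> (\<forall>x\<in>cube q. H 1 x = g x) \<and> (\<forall>t\<in>{0..1}. H t \<in> rel_cells q A B p))"
  by (rule homotopic_cells_iff) (auto simp: rel_cells_def cong: continuous_on_cong_simp)

lemma abs_homotopic_iff:
  "abs_homotopic q A p f g \<longleftrightarrow>
    (\<exists>H. continuous_on ({0..1::real} \<times> cube q) (\<lambda>(t, x). H t x) \<and> (\<forall>x\<in>cube q. H 0 x = f x) \<and> (\<forall>x\<in>cube q. H 1 x = g x) \<and> (\<forall>t\<in>{0..1}. H t \<in> cells q A p))"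
  by (rule homotopic_cells_iff) (auto simp: cells_def cong: continuous_on_cong_simp)

lemma abs_class_eq: "abs_homotopic q A p f g \<Longrightarrow> abs_class q A p f = abs_class q A p g"
  unfolding abs_class_def by (auto intro: homotopic_with_trans dest: homotopic_with_symD)

lemma rel_class_eq: "rel_homotopic q A B p f g \<Longrightarrow> rel_class q A B p f = rel_class q A B p g"
  unfolding rel_class_def by (auto intro: homotopic_with_trans dest: homotopic_with_symD)

lemma cells_self: "f \<in> cells q A p \<Longrightarrow> f \<in> abs_class q A p f"
  by (auto simp: abs_class_def cells_def)

lemma rel_cells_self: "f \<in> rel_cells q A B p \<Longrightarrow> f \<in> rel_class q A B p f"
  by (auto simp: rel_class_def rel_cells_def)

text \<open>Agreement on the face x q = 0 is asked at every time, so that the two halves can be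
  joined throughout the homotopy.\<close>

lemma perp_homotopic:
  assumes q: "q \<ge> 1" and H: "continuous_on ({0..1} \<times> cube q) (\<lambda>(t, x). H t x)" "\<And>t. t \<in> {0..1} \<Longrightarrow> H t \<in> rel_cells q A B p"
    and K: "continuous_on ({0..1} \<times> cube q) (\<lambda>(t, x). K t x)" "\<And>t. t \<in> {0..1} \<Longrightarrow> K t \<in> rel_cells q A B p"
    and e: "\<And>t x. t \<in> {0..1::real} \<Longrightarrow> x \<in> cube q \<Longrightarrow> x q = 0 \<Longrightarrow> H t x = K t x"
  shows "abs_homotopic q A p (perp q (H 0) (K 0)) (perp q (H 1) (K 1))"
  unfolding abs_homotopic_iff
  by (intro exI[of _ "\<lambda>t. perp q (H t) (K t)"] conjI ballI continuous_on_perp q H K perp_in_cells[where B = B] e) auto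

section \<open>The variation operator\<close>

lemma UN_const2: "a \<in> \<alpha> \<Longrightarrow> b \<in> \<beta> \<Longrightarrow> (\<And>x y. x \<in> \<alpha> \<Longrightarrow> y \<in> \<beta> \<Longrightarrow> F x y = c) \<Longrightarrow> (\<Union>x\<in>\<alpha>. \<Union>y\<in>\<beta>. F x y) = c"
  by blast

locale variation_data =
  fixes q :: nat and A B :: "'a::topological_space set" and p :: 'a
  assumes q: "q \<ge> 1" and BA: "B \<subseteq> A" and pB: "p \<in> B"
begin

text \<open>All that well-definedness and additivity use of a geometric monodromy.\<close>

definition fixing :: "('a \<Rightarrow> 'a) \<Rightarrow> bool" where
  "fixing h \<longleftrightarrow> continuous_on A h \<and> h ` A \<subseteq> A \<and> (\<forall>x\<in>B. h x = x)"

lemma comp_rel_cells: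
  assumes h: "fixing h" and f: "f \<in> rel_cells q A B p"
  shows "h \<circ> f \<in> rel_cells q A B p"
proof -
  have "continuous_on (cube q) (h \<circ> f)" using h f
    by (intro continuous_on_compose) (auto simp: fixing_def rel_cells_def intro: continuous_on_subset)
  then show ?thesis using h f pB BA unfolding fixing_def rel_cells_def by (auto simp: image_subset_iff)
qed

lemma comp_eq_face: "fixing h \<Longrightarrow> f \<in> rel_cells q A B p \<Longrightarrow> x \<in> cube q \<Longrightarrow> x q = 0 \<Longrightarrow> f x = (h \<circ> f) x"
  by (metis comp_apply fixing_def rel_cellsD(2))

lemma perp_comp_cells: "fixing h \<Longrightarrow> f \<in> rel_cells q A B p \<Longrightarrow> perp q f (h \<circ> f) \<in> cells q A p"
  using perp_in_cells[OF q, of f A B p "h \<circ> f"] comp_rel_cells comp_eq_face by blast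

lemma perp_cong_cube:
  assumes "\<And>x. x \<in> cube q \<Longrightarrow> f x = f' x" "\<And>x. x \<in> cube q \<Longrightarrow> g x = g' x" "x \<in> cube q"
  shows "perp q f g x = perp q f' g' x"
  using assms cube_half[OF assms(3), of q] q by (auto simp: perp_def)

lemma abs_homotopic_cong:
  assumes "abs_homotopic q A p f g" "\<And>x. x \<in> cube q \<Longrightarrow> f x = f' x" "\<And>x. x \<in> cube q \<Longrightarrow> g x = g' x"
  shows "abs_homotopic q A p f' g'"
proof -
  obtain H where H: "continuous_on ({0..1::real} \<times> cube q) (\<lambda>(t, x). H t x)" "\<forall>x\<in>cube q. H 0 x = f x" "\<forall>x\<in>cube q. H 1 x = g x"
    "\<forall>t\<in>{0..1}. H t \<in> cells q A p" using assms(1) unfolding abs_homotopic_iff by blast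
  then show ?thesis unfolding abs_homotopic_iff using assms(2,3) by (intro exI[of _ H]) auto
qed

text \<open>A homotopy of relative cells is composed with h; both agree on the face x q = 0, which
  lies in B at every time because the homotopy runs through relative cells.\<close>

lemma variation_cong:
  assumes h: "fixing h" and fg: "rel_homotopic q A B p f g"
  shows "abs_class q A p (perp q f (h \<circ> f)) = abs_class q A p (perp q g (h \<circ> g))"
proof -
  obtain H where H: "continuous_on ({0..1::real} \<times> cube q) (\<lambda>(t, x). H t x)" "\<forall>x\<in>cube q. H 0 x = f x" "\<forall>x\<in>cube q. H 1 x = g x"
    "\<And>t. t \<in> {0..1} \<Longrightarrow> H t \<in> rel_cells q A B p" using fg unfolding rel_homotopic_iff by blast
  have "continuous_on ({0..1::real} \<times> cube q) (\<lambda>y. h ((\<lambda>(t, x). H t x) y))"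
    by (rule continuous_on_compose2[of A h, OF _ H(1)]) (use h rel_cellsD(1)[OF H(4)] in \<open>auto simp: fixing_def\<close>)
  then have "continuous_on ({0..1::real} \<times> cube q) (\<lambda>(t, x). (h \<circ> H t) x)" by (simp add: case_prod_beta)
  then have "abs_homotopic q A p (perp q (H 0) (h \<circ> H 0)) (perp q (H 1) (h \<circ> H 1))"
    using H(1) by (intro perp_homotopic[where B = B] q H(4) comp_rel_cells comp_eq_face h) auto
  then have "abs_homotopic q A p (perp q f (h \<circ> f)) (perp q g (h \<circ> g))"
    by (rule abs_homotopic_cong) (use H(2,3) in \<open>auto intro!: perp_cong_cube\<close>)
  then show ?thesis by (rule abs_class_eq)
qed

lemma rel_class_eqD: "f \<in> rel_cells q A B p \<Longrightarrow> g \<in> rel_cells q A B p \<Longrightarrow> rel_class q A B p f = rel_class q A B p g \<Longrightarrow> rel_homotopic q A B p f g"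
  using rel_cells_self unfolding rel_class_def by blast

lemma is_variation_ex1:
  assumes h: "fixing h"
  shows "\<exists>!V. is_variation q A B p h V"
proof -
  let ?C = "rel_class q A B p ` rel_cells q A B p"
  let ?v = "\<lambda>f. abs_class q A p (perp q f (h \<circ> f))"
  \<comment> \<open>A representative is chosen in each class; outside the carrier the value is
    undefined by restriction, which is what makes V unique as a function.\<close>
  define V where "V = restrict (\<lambda>c. ?v (SOME f. f \<in> rel_cells q A B p \<and> rel_class q A B p f = c)) ?C"
  have V: "V (rel_class q A B p f) = ?v f" if f: "f \<in> rel_cells q A B p" for f
  proof -
    let ?g = "SOME g. g \<in> rel_cells q A B p \<and> rel_class q A B p g = rel_class q A B p f"
    have "?g \<in> rel_cells q A B p \<and> rel_class q A B p ?g = rel_class q A B p f" by (rule someI[of _ f]) (use f in simp)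
    then have "rel_homotopic q A B p ?g f" using rel_class_eqD f by blast
    then have "?v ?g = ?v f" by (rule variation_cong[OF h])
    then show ?thesis using f by (simp add: V_def)
  qed
  show ?thesis
  proof (rule ex1I[of _ V])
    show "is_variation q A B p h V" unfolding is_variation_def rel_homotopy_group_def homotopy_group_def
      using V perp_comp_cells[OF h] by (auto simp: PiE_def extensional_def V_def)
    fix V' assume V': "is_variation q A B p h V'"
    show "V' = V"
    proof (rule extensionalityI[of _ ?C])
      show "V' \<in> extensional ?C" using V' by (simp add: is_variation_def rel_homotopy_group_def PiE_def)
      show "V' c = V c" if "c \<in> ?C" for c using that V V' by (auto simp: is_variation_def)
    qed (simp add: V_def)
  qed
qed

text \<open>A homotopy from h \<circ> f to h' \<circ> f that rests where f takes values in B runs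
  through relative cells and always agrees with f on the face x q = 0; so it can be joined to the
  constant homotopy of f.\<close>

lemma is_variation_change:
  assumes V: "is_variation q A B p h V" and h: "fixing h" and h': "fixing h'"
    and G: "\<And>f. f \<in> rel_cells q A B p \<Longrightarrow> \<exists>G. continuous_on ({0..1::real} \<times> cube q) (\<lambda>(t, x). G t x) \<and>
      (\<forall>t\<in>{0..1}. \<forall>x\<in>cube q. G t x \<in> A \<and> (f x \<in> B \<longrightarrow> G t x = f x)) \<and> (\<forall>x\<in>cube q. G 0 x = h (f x) \<and> G 1 x = h' (f x))"
  shows "is_variation q A B p h' V"
proof -
  have "abs_class q A p (perp q f (h \<circ> f)) = abs_class q A p (perp q f (h' \<circ> f))" if f: "f \<in> rel_cells q A B p" for f
  proof -
    obtain G where G: "continuous_on ({0..1::real} \<times> cube q) (\<lambda>(t, x). G t x)"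
      "\<And>t x. t \<in> {0..1} \<Longrightarrow> x \<in> cube q \<Longrightarrow> G t x \<in> A" "\<And>t x. t \<in> {0..1} \<Longrightarrow> x \<in> cube q \<Longrightarrow> f x \<in> B \<Longrightarrow> G t x = f x"
      "\<And>x. x \<in> cube q \<Longrightarrow> G 0 x = h (f x)" "\<And>x. x \<in> cube q \<Longrightarrow> G 1 x = h' (f x)"
      using G[OF f] by metis
    have "G t \<in> rel_cells q A B p" if t: "t \<in> {0..1}" for t
    proof -
      have "continuous_on (cube q) (\<lambda>x. (\<lambda>(t, x). G t x) (t, x))"
        by (rule continuous_on_compose2[OF G(1)]) (use t in \<open>auto intro!: continuous_on_Pair continuous_on_const continuous_on_id\<close>)
      then have "continuous_on (cube q) (G t)" by simp
      moreover have "f x = p \<Longrightarrow> G t x = p" if "x \<in> cube q" for x using G(3)[OF t that] pB by simp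
      ultimately show ?thesis using f G(2,3)[OF t] unfolding rel_cells_def by auto
    qed
    moreover have "continuous_on ({0..1::real} \<times> cube q) (\<lambda>(t, x). f x)"
      unfolding case_prod_beta using f
      by (intro continuous_on_compose2[of "cube q" f, OF _ continuous_on_snd[OF continuous_on_id]]) (auto simp: rel_cells_def)
    ultimately have "abs_homotopic q A p (perp q f (G 0)) (perp q f (G 1))"
      using perp_homotopic[OF q, of "\<lambda>_. f" A B p G] f G rel_cellsD(2)[OF f] by simp
    then have "abs_homotopic q A p (perp q f (h \<circ> f)) (perp q f (h' \<circ> f))"
      by (rule abs_homotopic_cong) (auto intro!: perp_cong_cube simp: G(4,5))
    then show ?thesis by (rule abs_class_eq)
  qed
  then show ?thesis using V perp_comp_cells[OF h'] unfolding is_variation_def by auto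
qed

section \<open>Additivity of the variation\<close>

lemma rel_concat1_homotopic:
  assumes "q \<ge> 2" "rel_homotopic q A B p f f'" "rel_homotopic q A B p g g'"
  shows "rel_homotopic q A B p (concat1 f g) (concat1 f' g')"
proof -
  have 1: "(1::nat) \<in> {1..<q}" "(1::nat) \<in> {1..q}" using assms(1) by auto
  obtain H K where H: "continuous_on ({0..1::real} \<times> cube q) (\<lambda>(t, x). H t x)" "\<forall>x\<in>cube q. H 0 x = f x" "\<forall>x\<in>cube q. H 1 x = f' x"
    "\<And>t. t \<in> {0..1} \<Longrightarrow> H t \<in> rel_cells q A B p"
    and K: "continuous_on ({0..1::real} \<times> cube q) (\<lambda>(t, x). K t x)" "\<forall>x\<in>cube q. K 0 x = g x" "\<forall>x\<in>cube q. K 1 x = g' x"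
    "\<And>t. t \<in> {0..1} \<Longrightarrow> K t \<in> rel_cells q A B p" using assms(2,3) unfolding rel_homotopic_iff by blast
  have "continuous_on ({0..1::real} \<times> cube q) (\<lambda>(t, x). concat1 (H t) (K t) x)"
  proof (rule continuous_on_concat1[OF q H(1) K(1)])
    fix t :: real and x assume "t \<in> {0..1}" "x \<in> cube q"
    then have "H t (x(1 := 1)) = p" "K t (x(1 := 0)) = p"
      using rel_cellsD(4)[OF H(4) cube_upd[OF _ 1(2)] 1(1), of t x 1] rel_cellsD(4)[OF K(4) cube_upd[OF _ 1(2)] 1(1), of t x 0] by auto
    then show "H t (x(1 := 1)) = K t (x(1 := 0))" by simp
  qed
  then show ?thesis unfolding rel_homotopic_iff
    using H K assms(1) cube_half(1,3)[OF _ 1(2)]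
    by (intro exI[of _ "\<lambda>t. concat1 (H t) (K t)"] conjI ballI concat1_in_rel_cells) (auto simp: concat1_def)
qed

lemma abs_concat1_homotopic:
  assumes "abs_homotopic q A p f f'" "abs_homotopic q A p g g'"
  shows "abs_homotopic q A p (concat1 f g) (concat1 f' g')"
proof -
  have 1: "(1::nat) \<in> {1..q}" using q by auto
  obtain H K where H: "continuous_on ({0..1::real} \<times> cube q) (\<lambda>(t, x). H t x)" "\<forall>x\<in>cube q. H 0 x = f x" "\<forall>x\<in>cube q. H 1 x = f' x"
    "\<And>t. t \<in> {0..1} \<Longrightarrow> H t \<in> cells q A p"
    and K: "continuous_on ({0..1::real} \<times> cube q) (\<lambda>(t, x). K t x)" "\<forall>x\<in>cube q. K 0 x = g x" "\<forall>x\<in>cube q. K 1 x = g' x"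
    "\<And>t. t \<in> {0..1} \<Longrightarrow> K t \<in> cells q A p" using assms unfolding abs_homotopic_iff by blast
  have "continuous_on ({0..1::real} \<times> cube q) (\<lambda>(t, x). concat1 (H t) (K t) x)"
  proof (rule continuous_on_concat1[OF q H(1) K(1)])
    fix t :: real and x assume "t \<in> {0..1}" "x \<in> cube q"
    then have "H t (x(1 := 1)) = p" "K t (x(1 := 0)) = p"
      using cellsD(2)[OF H(4) cube_upd[OF _ 1] 1, of t x 1] cellsD(2)[OF K(4) cube_upd[OF _ 1] 1, of t x 0] by auto
    then show "H t (x(1 := 1)) = K t (x(1 := 0))" by simp
  qed
  then show ?thesis unfolding abs_homotopic_iff
    using H K q cube_half(1,3)[OF _ 1]
    by (intro exI[of _ "\<lambda>t. concat1 (H t) (K t)"] conjI ballI concat1_in_cells) (auto simp: concat1_def)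
qed

text \<open>The product is a union over all pairs of representatives; concatenation respects
  homotopy, so all members of the union coincide.\<close>

lemma rel_mult:
  assumes "q \<ge> 2" "f \<in> rel_cells q A B p" "g \<in> rel_cells q A B p"
  shows "rel_class q A B p f \<otimes>\<^bsub>rel_homotopy_group q A B p\<^esub> rel_class q A B p g = rel_class q A B p (concat1 f g)"
proof -
  have "rel_class q A B p (concat1 f' g') = rel_class q A B p (concat1 f g)" if "f' \<in> rel_class q A B p f" "g' \<in> rel_class q A B p g" for f' g'
    using rel_class_eq[OF rel_concat1_homotopic[OF assms(1)], of f f' g g'] that unfolding rel_class_def by simp
  then show ?thesis using rel_cells_self[OF assms(2)] rel_cells_self[OF assms(3)] unfolding rel_homotopy_group_def monoid.simps by (intro UN_const2)
qed

lemma abs_mult: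
  assumes "f \<in> cells q A p" "g \<in> cells q A p"
  shows "abs_class q A p f \<otimes>\<^bsub>homotopy_group q A p\<^esub> abs_class q A p g = abs_class q A p (concat1 f g)"
proof -
  have "abs_class q A p (concat1 f' g') = abs_class q A p (concat1 f g)" if "f' \<in> abs_class q A p f" "g' \<in> abs_class q A p g" for f' g'
    using abs_class_eq[OF abs_concat1_homotopic, of f f' g g'] that unfolding abs_class_def by simp
  then show ?thesis using cells_self[OF assms(1)] cells_self[OF assms(2)] unfolding homotopy_group_def monoid.simps by (intro UN_const2)
qed

text \<open>The two operations act on the coordinates q and 1, which are distinct for q \<ge> 2, so
  they commute on the nose. This is why additivity begins at q = 2.\<close>

lemma perp_concat1:
  "q \<ge> 2 \<Longrightarrow> perp q (concat1 f g) (h \<circ> concat1 f g) = concat1 (perp q f (h \<circ> f)) (perp q g (h \<circ> g))"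
  by (rule ext) (simp add: perp_def concat1_def fun_upd_twist)

lemma variation_hom:
  assumes q2: "q \<ge> 2" and h: "fixing h" and V: "is_variation q A B p h V"
  shows "V \<in> hom (rel_homotopy_group q A B p) (homotopy_group q A p)"
proof (rule homI)
  have c: "carrier (rel_homotopy_group q A B p) = rel_class q A B p ` rel_cells q A B p" by (simp add: rel_homotopy_group_def)
  show "V x \<in> carrier (homotopy_group q A p)" if "x \<in> carrier (rel_homotopy_group q A B p)" for x
    using V that by (auto simp: is_variation_def)
  have v: "V (rel_class q A B p f) = abs_class q A p (perp q f (h \<circ> f))" if "f \<in> rel_cells q A B p" for f
    using V that by (simp add: is_variation_def)
  fix x y assume "x \<in> carrier (rel_homotopy_group q A B p)" "y \<in> carrier (rel_homotopy_group q A B p)"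
  then obtain f g where fg: "f \<in> rel_cells q A B p" "x = rel_class q A B p f" "g \<in> rel_cells q A B p" "y = rel_class q A B p g"
    unfolding c by blast
  show "V (x \<otimes>\<^bsub>rel_homotopy_group q A B p\<^esub> y) = V x \<otimes>\<^bsub>homotopy_group q A p\<^esub> V y"
    unfolding fg(2,4) rel_mult[OF q2 fg(1,3)] v[OF fg(1)] v[OF fg(3)] v[OF concat1_in_rel_cells[OF q2 fg(1,3)]] perp_concat1[OF q2]
    by (rule abs_mult[symmetric]) (use perp_comp_cells[OF h] fg in auto)
qed

end

section \<open>Application to geometric monodromies\<close>

lemma monodromy_isotopy:
  fixes a b :: "complex^'n::finite"
  assumes h: "geometric_monodromy a b X K \<omega> h" and \<omega>: "loop_around \<mu>0 \<nu> D \<gamma> \<Gamma> \<omega>"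
    and A: "A = pencil a b \<mu>0 \<inter> X" and B: "B = pencil_axis a b \<inter> X"
  obtains \<Theta> where "continuous_on (A \<times> {0..1}) (\<lambda>(x, t). \<Theta> x t)"
    "\<And>x t. x \<in> A \<Longrightarrow> t \<in> {0..1} \<Longrightarrow> \<Theta> x t \<in> X \<inter> pencil a b (\<omega> t)" "\<And>x. x \<in> A \<Longrightarrow> \<Theta> x 0 = x"
    "\<And>x t. x \<in> B \<Longrightarrow> t \<in> {0..1} \<Longrightarrow> \<Theta> x t = x" "\<And>x. x \<in> A \<Longrightarrow> h x = \<Theta> x 1"
    "\<omega> 0 = \<mu>0" "\<omega> 1 = \<mu>0" "continuous_on A h" "h ` A \<subseteq> A" "\<forall>x\<in>B. h x = x"
proof -
  have w: "\<omega> 0 = \<mu>0" "\<omega> 1 = \<mu>0" using \<omega> by (auto simp: loop_around_def)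
  obtain \<Theta> :: "'n cproj \<Rightarrow> real \<Rightarrow> 'n cproj" where \<Theta>: "continuous_on (A \<times> {0..1}) (\<lambda>(x, t). \<Theta> x t)" "\<forall>x\<in>A. \<Theta> x 0 = x"
    "\<forall>t\<in>{0..1}. \<exists>g. homeomorphism A (over a b X {\<omega> t}) (\<lambda>x. \<Theta> x t) g"
    "\<forall>x\<in>B. \<forall>t\<in>{0..1}. \<Theta> x t = x" "\<forall>x\<in>A. h x = \<Theta> x 1"
    using h unfolding geometric_monodromy_def Let_def w A B by blast
  \<comment> \<open>The homeomorphism is used through its image, which places the isotopy in the
    member of the pencil over \<open>\<omega> t\<close>.\<close>
  have th: "\<Theta> x t \<in> X \<inter> pencil a b (\<omega> t)" if "x \<in> A" "t \<in> {0..1}" for x t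
    using \<Theta>(3) that unfolding homeomorphism_def over_def by blast
  have "continuous_on A (\<lambda>x. (x, 1::real))" by (intro continuous_intros)
  then have "continuous_on A (\<lambda>x. (\<lambda>(x, t). \<Theta> x t) (x, 1))" by (rule continuous_on_compose2[OF \<Theta>(1)]) auto
  then have "continuous_on A h" using \<Theta>(5) by (simp cong: continuous_on_cong)
  moreover have "h ` A \<subseteq> A" using th[of _ 1] \<Theta>(5) w A by auto
  moreover have "\<forall>x\<in>B. h x = x" using \<Theta>(4,5) axis_in_pencil[of a b \<mu>0] by (auto simp: A B)
  ultimately show thesis using \<Theta> th w by (intro that[of \<Theta>]) auto
qed

theorem lemma4p1:
  fixes n :: nat
    and Y Z X L M :: "'n::finite cproj set"
    and \<S> :: "'n cproj set set"
    and a b :: "complex^'n"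
    and \<mu>\<^sub>0 \<nu> :: "2 cproj"
    and \<Lambda> :: "2 cproj set"
    and D \<Gamma> :: "2 cproj \<Rightarrow> 2 cproj set"
    and \<gamma> :: "2 cproj \<Rightarrow> 2 cproj"
    and \<omega> :: "real \<Rightarrow> 2 cproj"
    and h :: "'n cproj \<Rightarrow> 'n cproj"
    and p :: "'n cproj"
    and q :: nat
  assumes "CARD('n) = n + 1" and "n \<ge> 2"
    and "closed_algebraic Y" and "Y \<noteq> {}"
    and "closed_algebraic Z" and "Z \<subset> Y" and "X = Y - Z"
    and "whitney_stratification Y \<S>" and "\<exists>\<T>\<subseteq>\<S>. Z = \<Union>\<T>"
    and "a \<noteq> b" and "vec.independent {a, b}"
    and "L = pencil a b \<mu>\<^sub>0" and "transverse_to_strata L \<S>"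
    and "M = pencil_axis a b" and "transverse_to_strata M \<S>"
    and "finite \<Lambda>" and "\<mu>\<^sub>0 \<notin> \<Lambda>"
    and "\<forall>\<mu>. \<not> transverse_to_strata (pencil a b \<mu>) \<S> \<longrightarrow> \<mu> \<in> \<Lambda>"
    and "p \<in> M \<inter> X"
    and "\<nu> \<in> \<Lambda>"
    and "loop_system \<Lambda> \<mu>\<^sub>0 D \<gamma> \<Gamma>"
    and "loop_around \<mu>\<^sub>0 \<nu> (D \<nu>) (\<gamma> \<nu>) (\<Gamma> \<nu>) \<omega>"
    and "geometric_monodromy a b X (\<Gamma> \<nu> \<union> D \<nu>) \<omega> h"
    and "q \<ge> 1"
  shows "(\<exists>!V. is_variation q (L \<inter> X) (M \<inter> X) p h V) \<and>
    (\<forall>V. is_variation q (L \<inter> X) (M \<inter> X) p h V \<longrightarrow>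
       (\<forall>D' \<gamma>' \<Gamma>' \<omega>' h'.
          loop_system \<Lambda> \<mu>\<^sub>0 D' \<gamma>' \<Gamma>' \<and>
          loop_around \<mu>\<^sub>0 \<nu> (D' \<nu>) (\<gamma>' \<nu>) (\<Gamma>' \<nu>) \<omega>' \<and>
          homotopic_paths (UNIV - \<Lambda>) \<omega> \<omega>' \<and>
          geometric_monodromy a b X (\<Gamma>' \<nu> \<union> D' \<nu>) \<omega>' h' \<longrightarrow>
          is_variation q (L \<inter> X) (M \<inter> X) p h' V) \<and>
       (q \<ge> 2 \<longrightarrow>
          V \<in> hom (rel_homotopy_group q (L \<inter> X) (M \<inter> X) p) (homotopy_group q (L \<inter> X) p)))"
proof -
  obtain \<T> where T: "\<T> \<subseteq> \<S>" "Z = \<Union>\<T>" using assms by blast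
  interpret PS: projective_stratification Y \<S> using assms by (simp add: projective_stratification_def)
  have Xe: "X = Y - \<Union>\<T>" using assms(7) T(2) by simp
  let ?A = "L \<inter> X" and ?B = "M \<inter> X"
  have A: "?A = pencil a b \<mu>\<^sub>0 \<inter> X" and B: "?B = pencil_axis a b \<inter> X" using assms by simp_all
  have BA: "?B \<subseteq> ?A" unfolding A B using axis_in_pencil by blast
  interpret VD: variation_data q ?A ?B p using assms BA by (intro variation_data.intro) auto
  obtain \<Theta> where \<Theta>: "continuous_on (?A \<times> {0..1}) (\<lambda>(x, t). \<Theta> x t)"
    "\<And>x t. x \<in> ?A \<Longrightarrow> t \<in> {0..1} \<Longrightarrow> \<Theta> x t \<in> X \<inter> pencil a b (\<omega> t)" "\<And>x. x \<in> ?A \<Longrightarrow> \<Theta> x 0 = x"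
    "\<And>x t. x \<in> ?B \<Longrightarrow> t \<in> {0..1} \<Longrightarrow> \<Theta> x t = x" "\<And>x. x \<in> ?A \<Longrightarrow> h x = \<Theta> x 1"
    "\<omega> 0 = \<mu>\<^sub>0" "\<omega> 1 = \<mu>\<^sub>0" "continuous_on ?A h" "h ` ?A \<subseteq> ?A" "\<forall>x\<in>?B. h x = x"
    by (rule monodromy_isotopy[OF assms(23,22) A B]) (rule that)
  have h: "VD.fixing h" using \<Theta> by (simp add: VD.fixing_def)
  show ?thesis
  proof (intro conjI allI impI; (elim conjE)?)
    show "\<exists>!V. is_variation q ?A ?B p h V" by (rule VD.is_variation_ex1[OF h])
    fix V assume V: "is_variation q ?A ?B p h V"
    show "V \<in> hom (rel_homotopy_group q ?A ?B p) (homotopy_group q ?A p)" if "2 \<le> q"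
      using VD.variation_hom[OF that h V] .
    fix D' \<gamma>' \<Gamma>' \<omega>' h'
    assume \<omega>': "loop_around \<mu>\<^sub>0 \<nu> (D' \<nu>) (\<gamma>' \<nu>) (\<Gamma>' \<nu>) \<omega>'" and hp: "homotopic_paths (UNIV - \<Lambda>) \<omega> \<omega>'"
      and h': "geometric_monodromy a b X (\<Gamma>' \<nu> \<union> D' \<nu>) \<omega>' h'"
    obtain \<Theta>' where \<Theta>': "continuous_on (?A \<times> {0..1}) (\<lambda>(x, t). \<Theta>' x t)"
      "\<And>x t. x \<in> ?A \<Longrightarrow> t \<in> {0..1} \<Longrightarrow> \<Theta>' x t \<in> X \<inter> pencil a b (\<omega>' t)" "\<And>x. x \<in> ?A \<Longrightarrow> \<Theta>' x 0 = x"
      "\<And>x t. x \<in> ?B \<Longrightarrow> t \<in> {0..1} \<Longrightarrow> \<Theta>' x t = x" "\<And>x. x \<in> ?A \<Longrightarrow> h' x = \<Theta>' x 1"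
      "\<omega>' 0 = \<mu>\<^sub>0" "\<omega>' 1 = \<mu>\<^sub>0" "continuous_on ?A h'" "h' ` ?A \<subseteq> ?A" "\<forall>x\<in>?B. h' x = x"
      by (rule monodromy_isotopy[OF h' \<omega>' A B]) (rule that)
    show "is_variation q ?A ?B p h' V"
    proof (rule VD.is_variation_change[OF V h])
      show "VD.fixing h'" using \<Theta>' by (simp add: VD.fixing_def)
      \<comment> \<open>The comparison is made cell by cell: a cell lifts to the cone because its
        domain is a cube.\<close>
      fix f assume f: "f \<in> rel_cells q ?A ?B p"
      have fc: "continuous_on (cube q) f" and fA: "f ` cube q \<subseteq> ?A" using f by (auto simp: rel_cells_def)
      obtain G :: "real \<times> (nat \<Rightarrow> real) \<Rightarrow> 'n cproj" where G: "continuous_on ({0..1} \<times> cube q) G" "G ` ({0..1} \<times> cube q) \<subseteq> ?A"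
        "\<And>x. x \<in> cube q \<Longrightarrow> G (0, x) = \<Theta> (f x) 1" "\<And>x. x \<in> cube q \<Longrightarrow> G (1, x) = \<Theta>' (f x) 1"
        "\<And>x t. x \<in> cube q \<Longrightarrow> t \<in> {0..1} \<Longrightarrow> f x \<in> pencil_axis a b \<Longrightarrow> G (t, x) = f x"
        by (rule PS.monodromy_homotopy[OF \<open>a \<noteq> b\<close> \<open>vec.independent {a, b}\<close> T(1) Xe assms(18) fc fA A hp
              \<Theta>(6,7) \<Theta>(1-3) \<Theta>(4)[unfolded B] \<Theta>'(1-3) \<Theta>'(4)[unfolded B]]) (assumption | rule that)+
      show "\<exists>G. continuous_on ({0..1::real} \<times> cube q) (\<lambda>(t, x). G t x) \<and>
          (\<forall>t\<in>{0..1}. \<forall>x\<in>cube q. G t x \<in> ?A \<and> (f x \<in> ?B \<longrightarrow> G t x = f x)) \<and> (\<forall>x\<in>cube q. G 0 x = h (f x) \<and> G 1 x = h' (f x))"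
      proof (intro exI[of _ "\<lambda>t x. G (t, x)"] conjI ballI impI)
        show "continuous_on ({0..1} \<times> cube q) (\<lambda>(t, x). G (t, x))" using G(1) by simp
        fix x assume x: "x \<in> cube q"
        show "G (0, x) = h (f x)" "G (1, x) = h' (f x)" using x fA G(3,4) \<Theta>(5) \<Theta>'(5) by (simp_all add: image_subset_iff)
        fix t :: real assume t: "t \<in> {0..1}"
        show "G (t, x) \<in> ?A" using G(2) x t by blast
        show "G (t, x) = f x" if "f x \<in> ?B" using G(5)[OF x t] that B by blast
      qed
    qed
  qed
qed

end
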